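(* Let $u\in\mathfrak S^f(S_1^+)$ with $|f(x,t)|\le M\|(x,t)\|^{\ell-2}$ in $S_1^+$, $\ell\ge2$. For any $\kappa\in(0,\ell)$ define the Weiss energy functional $$W_u^\kappa(r):=\frac1{r^{2\kappa+2}}\int_{S_r^+}\Big(|t||\nabla u|^2-\frac\kappa2u^2\Big)G=\frac1{r^{2\kappa}}\Big(I_u(r)-\frac\kappa2H_u(r)\Big),\qquad0<r<1.$$ Then for any $0<\sigma<\ell-\kappa$ there exists $C>0$, depending only on $\sigma,\ell,M$ and $n$, such that $$\frac d{dr}W_u^\kappa(r)\ge-C\,r^{2\sigma-1}\qquad\text{for a.e. }r\in(0,1).$$ In particular, the function $r\mapsto W_u^\kappa(r)+C\,r^{2\sigma}$ is monotonically nondecreasing for $r\in(0,1)$ (for such a suitable constant $C$).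
   Context: Notation: $n\ge 2$; $x=(x',x_n)\in\mathbb R^n$; $\mathbb R^{n-1}$ is identified with $\{x_n=0\}$; $\mathbb R^n_+=\{x_n>0\}$; $\|(x,t)\|=(|x|^2+|t|)^{1/2}$; $S_r^+=\mathbb R^n_+\times(-r^2,0]$, $S_r'=\mathbb R^{n-1}\times(-r^2,0]$. $G(x,t)=(-4\pi t)^{-n/2}e^{|x|^2/(4t)}$ for $t<0$, $G=0$ for $t\ge0$. $H_u(r)=\frac1{r^2}\int_{S_r^+}u^2G\,dx\,dt$, $I_u(r)=\frac1{r^2}\int_{S_r^+}|t||\nabla u|^2G\,dx\,dt$. Function classes: $W^{2,1}_2(E)$: $u\in L_2(E)$ with $\partial_x^\alpha\partial_t^ju\in L_2(E)$, $|\alpha|+2j\le2$. $H^{\alpha,\alpha/2}(E)$, $0<\alpha<1$: bounded functions, $\alpha$-Hölder in $x$ and $\alpha/2$-Hölder in $t$. Class $\mathfrak S^f(S_1^+)$, $f\in L_\infty(S_1^+)$: $u\in W^{2,1}_2(S_1^+)\cap L_\infty(S_1^+)$, $\nabla u\in H^{\alpha,\alpha/2}(S_1^+\cup S_1')$ for some $0<\alpha<1$, $u$ has bounded support, $\Delta u-\partial_tu=f$ in $S_1^+$; $u\ge0$, $-\partial_{x_n}u\ge0$, $u\,\partial_{x_n}u=0$ on $S_1'$; $(0,0)\in\Gamma_*(u):=\partial_{S_1'}\{(x',t)\in S_1'\mid u(x',0,t)=\partial_{x_n}u(x',0,t)=0\}$ (boundary in the relative topology of $S_1'$). *)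

theory Defs
  imports "HOL-Analysis.Analysis"
begin

(* The space R^n (n \<ge> 2) is 'a \<times> real with 'a of dimension n - 1: a point x = (x', x_n)
   is literally a pair, with the Euclidean norm of the product. Points of space-time are
   pairs (x, t). The variable x' ranges over R^(n-1), so n = DIM('a) + 1. *)

type_synonym 'a spacetime = "('a \<times> real) \<times> real"

definition closed_half_space :: "('a \<times> real) set" where
  "closed_half_space = {x. 0 \<le> snd x}"

definition half_cyl :: "real \<Rightarrow> ('a::euclidean_space) spacetime set" where
  "half_cyl r = {(x, t). 0 < snd x \<and> - (r\<^sup>2) < t \<and> t \<le> 0}"

definition thin_cyl :: "real \<Rightarrow> ('a::euclidean_space) spacetime set" where
  "thin_cyl r = {(x, t). snd x = 0 \<and> - (r\<^sup>2) < t \<and> t \<le> 0}"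

definition par_norm :: "('a::euclidean_space) spacetime \<Rightarrow> real" where
  "par_norm z = sqrt ((norm (fst z))\<^sup>2 + \<bar>snd z\<bar>)"

definition heat_kernel :: "('a::euclidean_space) spacetime \<Rightarrow> real" where
  "heat_kernel = (\<lambda>(x, t).
     if t < 0 then (- 4 * pi * t) powr (- real DIM('a \<times> real) / 2) * exp ((norm x)\<^sup>2 / (4 * t))
     else 0)"

definition L2_on :: "'b::euclidean_space set \<Rightarrow> ('b \<Rightarrow> real) \<Rightarrow> bool" where
  "L2_on E v \<longleftrightarrow> v \<in> borel_measurable (lebesgue_on E) \<and> integrable (lebesgue_on E) (\<lambda>z. (v z)\<^sup>2)"

definition Linf_on :: "'b::euclidean_space set \<Rightarrow> ('b \<Rightarrow> real) \<Rightarrow> bool" where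
  "Linf_on E v \<longleftrightarrow>
     v \<in> borel_measurable (lebesgue_on E) \<and> (\<exists>B. AE z in lebesgue_on E. \<bar>v z\<bar> \<le> B)"

primrec C_k :: "nat \<Rightarrow> ('b::euclidean_space \<Rightarrow> real) \<Rightarrow> bool" where
  "C_k 0 g \<longleftrightarrow> continuous_on UNIV g"
| "C_k (Suc k) g \<longleftrightarrow>
     (\<forall>z. g differentiable (at z)) \<and>
     (\<forall>b\<in>Basis. C_k k (\<lambda>z. frechet_derivative g (at z) b))"

definition test_function :: "'b::euclidean_space set \<Rightarrow> ('b \<Rightarrow> real) \<Rightarrow> bool" where
  "test_function U \<phi> \<longleftrightarrow>
     (\<forall>k. C_k k \<phi>) \<and> compact (closure {z. \<phi> z \<noteq> 0}) \<and> closure {z. \<phi> z \<noteq> 0} \<subseteq> U"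

definition locally_integrable_on :: "'b::euclidean_space set \<Rightarrow> ('b \<Rightarrow> real) \<Rightarrow> bool" where
  "locally_integrable_on U v \<longleftrightarrow> (\<forall>K. compact K \<and> K \<subseteq> U \<longrightarrow> set_integrable lebesgue K v)"

(* w is the weak (distributional) derivative of v in direction b on the open set U. *)
definition weak_deriv ::
  "'b::euclidean_space set \<Rightarrow> 'b \<Rightarrow> ('b \<Rightarrow> real) \<Rightarrow> ('b \<Rightarrow> real) \<Rightarrow> bool" where
  "weak_deriv U b v w \<longleftrightarrow>
     locally_integrable_on U v \<and> locally_integrable_on U w \<and>
     (\<forall>\<phi>. test_function U \<phi> \<longrightarrow>
        (LINT z:U|lebesgue. v z * frechet_derivative \<phi> (at z) b)
          = - (LINT z:U|lebesgue. w z * \<phi> z))"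

(* Derivatives are taken in the interior of E; half_cyl r contains its top t = 0, a null set. *)
definition W21_2 :: "('b::euclidean_space \<times> real) set \<Rightarrow> ('b \<times> real \<Rightarrow> real) \<Rightarrow> bool" where
  "W21_2 E u \<longleftrightarrow>
     L2_on E u \<and>
     (\<exists>w. L2_on E w \<and> weak_deriv (interior E) (0, 1) u w) \<and>
     (\<forall>b\<in>Basis. \<exists>v. L2_on E v \<and> weak_deriv (interior E) (b, 0) u v \<and>
        (\<forall>c\<in>Basis. \<exists>w. L2_on E w \<and> weak_deriv (interior E) (c, 0) v w))"

(* The equation \<Delta>u - \<partial>\<^sub>t u = f almost everywhere, with weak derivatives. *)
definition heat_equation_on ::
  "('b::euclidean_space \<times> real) set \<Rightarrow> ('b \<times> real \<Rightarrow> real) \<Rightarrow> ('b \<times> real \<Rightarrow> real) \<Rightarrow> bool" where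
  "heat_equation_on E u f \<longleftrightarrow>
     (\<exists>ut d2. weak_deriv (interior E) (0, 1) u ut \<and>
        (\<forall>b\<in>Basis. \<exists>v. weak_deriv (interior E) (b, 0) u v \<and>
                        weak_deriv (interior E) (b, 0) v (d2 b)) \<and>
        (AE z in lebesgue_on E. (\<Sum>b\<in>Basis. d2 b z) - ut z = f z))"

definition par_holder ::
  "real \<Rightarrow> ('b::real_normed_vector \<times> real) set \<Rightarrow> ('b \<times> real \<Rightarrow> 'c::real_normed_vector) \<Rightarrow> bool"
  where
  "par_holder \<alpha> E g \<longleftrightarrow>
     bounded (g ` E) \<and>
     (\<exists>K. (\<forall>x y t. (x, t) \<in> E \<and> (y, t) \<in> E \<longrightarrow> norm (g (x, t) - g (y, t)) \<le> K * norm (x - y) powr \<alpha>) \<and>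
          (\<forall>x s t. (x, s) \<in> E \<and> (x, t) \<in> E \<longrightarrow> norm (g (x, s) - g (x, t)) \<le> K * \<bar>s - t\<bar> powr (\<alpha> / 2)))"

(* The spatial gradient at z = (x, t), as a classical derivative relative to the closed half-space;
   on x_n = 0 this is the one-sided gradient. *)
definition grad_x :: "('a::euclidean_space spacetime \<Rightarrow> real) \<Rightarrow> 'a spacetime \<Rightarrow> 'a \<times> real" where
  "grad_x u z =
     (\<Sum>b\<in>Basis. frechet_derivative (\<lambda>y. u (y, snd z)) (at (fst z) within closed_half_space) b *\<^sub>R b)"

definition d_n :: "('a::euclidean_space spacetime \<Rightarrow> real) \<Rightarrow> 'a spacetime \<Rightarrow> real" where
  "d_n u z = snd (grad_x u z)"

definition extended_free_boundary :: "('a::euclidean_space spacetime \<Rightarrow> real) \<Rightarrow> 'a spacetime set" where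
  "extended_free_boundary u =
     top_of_set (thin_cyl 1) frontier_of {z \<in> thin_cyl 1. u z = 0 \<and> d_n u z = 0}"

(* An element u of the Sobolev class with Hoelder continuous gradient has a representative that is
   continuous on S_1^+ \<union> S_1' and continuously differentiable in x up to x_n = 0. The values of u
   and its normal derivative on S_1' refer to that representative, hence the continuity and
   differentiability clauses. *)
definition signorini_class ::
  "('a::euclidean_space spacetime \<Rightarrow> real) \<Rightarrow> ('a spacetime \<Rightarrow> real) \<Rightarrow> bool" where
  "signorini_class f u \<longleftrightarrow>
     Linf_on (half_cyl 1) f \<and>
     W21_2 (half_cyl 1) u \<and> Linf_on (half_cyl 1) u \<and>
     continuous_on (half_cyl 1 \<union> thin_cyl 1) u \<and>
     (\<forall>(x, t) \<in> half_cyl 1 \<union> thin_cyl 1.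
        (\<lambda>y. u (y, t)) differentiable (at x within closed_half_space)) \<and>
     (\<exists>\<alpha>. 0 < \<alpha> \<and> \<alpha> < 1 \<and> par_holder \<alpha> (half_cyl 1 \<union> thin_cyl 1) (grad_x u)) \<and>
     bounded {z \<in> half_cyl 1 \<union> thin_cyl 1. u z \<noteq> 0} \<and>
     heat_equation_on (half_cyl 1) u f \<and>
     (\<forall>z \<in> thin_cyl 1. 0 \<le> u z \<and> 0 \<le> - d_n u z \<and> u z * d_n u z = 0) \<and>
     (0, 0) \<in> extended_free_boundary u"

definition H_fun :: "('a::euclidean_space spacetime \<Rightarrow> real) \<Rightarrow> real \<Rightarrow> real" where
  "H_fun u r = 1 / r\<^sup>2 * (LINT z:half_cyl r|lebesgue. (u z)\<^sup>2 * heat_kernel z)"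

definition I_fun :: "('a::euclidean_space spacetime \<Rightarrow> real) \<Rightarrow> real \<Rightarrow> real" where
  "I_fun u r =
     1 / r\<^sup>2 * (LINT z:half_cyl r|lebesgue. \<bar>snd z\<bar> * (norm (grad_x u z))\<^sup>2 * heat_kernel z)"

definition weiss :: "real \<Rightarrow> ('a::euclidean_space spacetime \<Rightarrow> real) \<Rightarrow> real \<Rightarrow> real" where
  "weiss \<kappa> u r =
     1 / r powr (2 * \<kappa> + 2) *
       (LINT z:half_cyl r|lebesgue.
          (\<bar>snd z\<bar> * (norm (grad_x u z))\<^sup>2 - \<kappa> / 2 * (u z)\<^sup>2) * heat_kernel z)"

end

theory Submission
  imports Defs "HOL-Probability.Distributions"
begin

text \<open>
  For \<open>t < 0\<close> let \<open>E(t)\<close> be \<open>(- t)\<close> to the power \<open>- \<kappa>\<close> times the integral of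
  \<open>(|t| |\<nabla>u|\<^sup>2 - (\<kappa>/2) u\<^sup>2) G\<close> over the time slice. The Weiss energy at radius \<open>r\<close> is the average
  of \<open>E(- r\<^sup>2 s)\<close> over \<open>0 < s < 1\<close> with weight \<open>s\<close> to the power \<open>\<kappa>\<close>, so it suffices to bound the
  increase of \<open>E\<close> in time.

  Let \<open>v(x, t)\<close> be \<open>u(\<lambda> x, t - h)\<close> times \<open>\<lambda>\<close> to the power \<open>- \<kappa>\<close>, with \<open>\<lambda>\<^sup>2 = (t - h) / t\<close>. Then
  \<open>E(t - h)\<close> is the energy of \<open>v\<close> at time \<open>t\<close>, and convexity of the Dirichlet integral bounds
  \<open>E(t - h) - E(t)\<close> from below by a term linear in \<open>v - u\<close>, up to a multiple of \<open>(v - u)\<^sup>2\<close>, which is of second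
  order in \<open>h\<close>. Testing the equation with \<open>(v - u) G\<close> leaves on the thin space only
  \<open>(v - u) \<partial>\<^sub>n u = v \<partial>\<^sub>n u \<le> 0\<close>, which has the good sign, so that no trace of \<open>\<partial>\<^sub>t u\<close> on the thin space is
  needed. The difference quotients \<open>(v - u) / h\<close> converge weakly to \<open>Z / (- 2t)\<close> with
  \<open>Z = x \<cdot> \<nabla>u + 2t \<partial>\<^sub>t u - \<kappa> u\<close>, and the lower bound becomes a weighted integral of
  \<open>Z (Z + 2t f) \<ge> - t\<^sup>2 f\<^sup>2\<close>. The growth bound on \<open>f\<close> and the Gaussian moments bound the integral of \<open>f\<^sup>2 G\<close>
  over a time slice by a power of \<open>- t\<close>.
\<close>

section \<open>Smooth functions and mollification\<close>

text \<open>The time derivative of \<open>u\<close>, represented by \<open>w\<close>, is known only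
  in L2 of space-time, so the equation cannot be tested on a single time slice. All estimates are
  therefore integrated over slabs a \<le> t \<le> b. Values of E at single times are recovered from
  the continuity of E: 1/h times the integral of E(t - h) - E(t) over [a, b] telescopes and tends to
  E(a) - E(b).

  The shift goes backward because convexity bounds E(t - h) - E(t) from below, that is, the increase
  of E from above. Moreover \<lambda> \<ge> 1 then, so the spatial support of v does not grow.

  The quotient (v - u) / h is split. Its dilation part is bounded and converges pointwise, since the
  gradient is continuous up to the thin space; its time part is merely bounded in L2 and converges
  weakly. This suffices because the quotient enters linearly, apart from a quadratic remainder that
  carries a factor h. The function multiplying it contains \<open>w\<close> and \<open>f\<close> and
  lies only in L2, which is why weak convergence is needed against all of L2. Monotonicity in r is
  obtained first, and the derivative bound is read off from it.\<close>

lemma C_k_imp_continuous: "C_k k f \<Longrightarrow> continuous_on UNIV f"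
  by (cases k) (auto intro!: differentiable_imp_continuous_on simp: differentiable_on_def)

lemma C_k_SucD: "C_k (Suc k) f \<Longrightarrow> C_k k f"
proof (induction k arbitrary: f)
  case 0
  then show ?case using C_k_imp_continuous[OF 0] by simp
next
  case (Suc k)
  show ?case
    unfolding C_k.simps(2)[of k]
  proof (intro conjI ballI)
    show "\<forall>z. f differentiable at z" using Suc.prems by simp
    fix b :: 'a assume "b \<in> Basis"
    then have "C_k (Suc k) (\<lambda>z. frechet_derivative f (at z) b)" using Suc.prems by auto
    then show "C_k k (\<lambda>z. frechet_derivative f (at z) b)" by (rule Suc.IH)
  qed
qed

text \<open>\<open>C_k\<close> is stated through \<open>frechet_derivative\<close>; uniqueness of
  the derivative lets the inductions below work with explicit formulas instead.\<close>

lemma C_k_SucI: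
  assumes "\<And>z. (f has_derivative f' z) (at z)" "\<And>b. b \<in> Basis \<Longrightarrow> C_k k (\<lambda>z. f' z b)"
  shows "C_k (Suc k) f"
proof -
  have "f' z = frechet_derivative f (at z)" for z
    using assms(1) by (rule frechet_derivative_at)
  then show ?thesis using assms by (auto simp: differentiable_def)
qed

lemma C_k_Suc_has_derivative:
  "C_k (Suc k) f \<Longrightarrow> (f has_derivative frechet_derivative f (at z)) (at z)"
  by (simp add: frechet_derivative_works)

lemma C_k_const: "C_k k (\<lambda>_. c)"
proof (induction k arbitrary: c)
  case (Suc k)
  show ?case by (rule C_k_SucI[where f'="\<lambda>_ _. 0"]) (auto intro: Suc)
qed simp

lemma C_k_inner: "C_k k (\<lambda>z. z \<bullet> c)"
proof (cases k)
  case (Suc k)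
  show ?thesis unfolding Suc
    by (rule C_k_SucI[where f'="\<lambda>_ v. v \<bullet> c"]) (auto intro!: C_k_const derivative_eq_intros)
qed (auto intro!: continuous_intros)

lemma C_k_add: "C_k k f \<Longrightarrow> C_k k g \<Longrightarrow> C_k k (\<lambda>z. f z + g z)"
proof (induction k arbitrary: f g)
  case (Suc k)
  show ?case
    by (rule C_k_SucI[where f'="\<lambda>z v. frechet_derivative f (at z) v + frechet_derivative g (at z) v"])
       (use Suc in \<open>auto intro!: derivative_eq_intros C_k_Suc_has_derivative\<close>)
qed (auto intro!: continuous_intros)

lemma C_k_mult: "C_k k f \<Longrightarrow> C_k k g \<Longrightarrow> C_k k (\<lambda>z. f z * g z)"
proof (induction k arbitrary: f g)
  case (Suc k)
  show ?case
  proof (rule C_k_SucI[where f'="\<lambda>z v. f z * frechet_derivative g (at z) v + frechet_derivative f (at z) v * g z"])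
    show "((\<lambda>z. f z * g z) has_derivative
      (\<lambda>v. f z * frechet_derivative g (at z) v + frechet_derivative f (at z) v * g z)) (at z)" for z
      by (intro has_derivative_mult C_k_Suc_has_derivative[OF Suc.prems(1)]
          C_k_Suc_has_derivative[OF Suc.prems(2)])
    fix b :: 'a assume "b \<in> Basis"
    then show "C_k k (\<lambda>z. f z * frechet_derivative g (at z) b + frechet_derivative f (at z) b * g z)"
      using Suc.prems C_k_SucD[OF Suc.prems(1)] C_k_SucD[OF Suc.prems(2)]
      by (intro C_k_add Suc.IH) (auto simp del: C_k.simps(2) simp: C_k.simps(2)[of k])
  qed
qed (auto intro!: continuous_intros)

text \<open>The classical function exp(-1/s), divided by s^j. The powers are included because the
  family indexed by \<open>j\<close> is closed under differentiation up to linear combinations, so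
  that one induction proves all of its members smooth.\<close>

definition flat :: "nat \<Rightarrow> real \<Rightarrow> real" where
  "flat j s = (if s > 0 then exp (- 1 / s) / s ^ j else 0)"

lemma flat_nonneg: "0 \<le> flat j s"
  by (simp add: flat_def)

text \<open>With m = j + 2 and y = 1/s, the bound exp(y/m) \<ge> y/m raised to the power m gives
  exp(-1/s) \<le> m^m s^m. The two powers beyond \<open>j\<close> leave s^2, which makes the
  derivative at 0 vanish.\<close>

lemma flat_le: "flat j s \<le> real (j + 2) ^ (j + 2) * s\<^sup>2"
proof (cases "s > 0")
  case True
  let ?m = "j + 2"
  have "exp (- 1 / s) = 1 / exp (1 / s / real ?m) ^ ?m"
  proof -
    have "exp (1 / s / real ?m) ^ ?m = exp (real ?m * (1 / s / real ?m))"
      by (rule exp_of_nat_mult[symmetric])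
    also have "real ?m * (1 / s / real ?m) = 1 / s" by simp
    finally show ?thesis by (simp add: exp_minus inverse_eq_divide)
  qed
  also have "\<dots> \<le> 1 / (1 / s / real ?m) ^ ?m"
  proof (rule divide_left_mono)
    have "1 / s / real ?m \<le> exp (1 / s / real ?m)"
      using exp_ge_add_one_self[of "1 / s / real ?m"] by linarith
    then show "(1 / s / real ?m) ^ ?m \<le> exp (1 / s / real ?m) ^ ?m"
      using True by (intro power_mono) auto
  qed (use True in auto)
  also have "\<dots> = real ?m ^ ?m * s\<^sup>2 * s ^ j"
    using True by (simp add: power_divide power_add power2_eq_square power_mult_distrib)
  finally show ?thesis using True by (simp add: flat_def divide_le_eq)
qed (simp add: flat_def)

lemma flat_has_derivative:
  "(flat j has_real_derivative (flat (j + 2) s - real j * flat (j + 1) s)) (at s)"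
proof -
  consider "s > 0" | "s < 0" | "s = 0" by linarith
  then show ?thesis
  proof cases
    case 1
    have "((\<lambda>s. exp (- 1 / s) / s ^ j) has_real_derivative (flat (j + 2) s - real j * flat (j + 1) s)) (at s)"
      using 1
      by (auto intro!: derivative_eq_intros simp: flat_def power2_eq_square divide_simps)
         (cases j; simp add: algebra_simps)
    then show ?thesis
      by (rule has_field_derivative_transform_within_open[where S="{0<..}"]) (use 1 in \<open>auto simp: flat_def\<close>)
  next
    case 2
    have "((\<lambda>s. 0) has_real_derivative (flat (j + 2) s - real j * flat (j + 1) s)) (at s)"
      using 2 by (auto intro!: derivative_eq_intros simp: flat_def)
    then show ?thesis
      by (rule has_field_derivative_transform_within_open[where S="{..<0}"]) (use 2 in \<open>auto simp: flat_def\<close>)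
  next
    case 3
    define c where "c = real (j + 2) ^ (j + 2)"
    have "((\<lambda>h. flat j h / h) \<longlongrightarrow> 0) (at 0)"
    proof (rule Lim_null_comparison[where g="\<lambda>h. c * \<bar>h\<bar>"])
      show "((\<lambda>h. c * \<bar>h\<bar>) \<longlongrightarrow> 0) (at (0::real))" by (auto intro!: tendsto_eq_intros)
      have "norm (flat j h / h) \<le> c * \<bar>h\<bar>" if "h \<noteq> 0" for h
      proof -
        have "flat j h \<le> c * \<bar>h\<bar> * \<bar>h\<bar>"
          using flat_le[of j h] by (simp add: c_def power2_eq_square mult.assoc)
        then show ?thesis using that flat_nonneg[of j h] by (simp add: abs_div divide_le_eq)
      qed
      then show "\<forall>\<^sub>F h in at 0. norm (flat j h / h) \<le> c * \<bar>h\<bar>"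
        by (auto simp: eventually_at_filter)
    qed
    then show ?thesis using 3 by (simp add: has_field_derivative_iff flat_def)
  qed
qed

text \<open>The induction on \<open>k\<close> has to treat all \<open>j\<close> at once: the chain
  rule turns \<open>flat j\<close> into a combination of \<open>flat (j + 2)\<close> and
  \<open>flat (j + 1)\<close>, times a linear factor.\<close>

lemma C_k_flat: "C_k k (\<lambda>z::'b::euclidean_space. flat j (1 - a * (z \<bullet> z)))"
proof (induction k arbitrary: j)
  case 0
  have "isCont (flat j) s" for s
    using flat_has_derivative by (rule DERIV_isCont)
  then have "continuous_on UNIV (flat j)" by (simp add: continuous_at_imp_continuous_on)
  then show ?case
    by (auto intro!: continuous_on_compose2[of UNIV "flat j"] continuous_intros)
next
  case (Suc k)
  define D where "D s = flat (j + 2) s - real j * flat (j + 1) s" for s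
  show ?case
  proof (rule C_k_SucI[where f'="\<lambda>z v. D (1 - a * (z \<bullet> z)) * ((- 2 * a) * (z \<bullet> v))"])
    fix z :: 'b
    have "((\<lambda>z. 1 - a * (z \<bullet> z)) has_derivative (\<lambda>v. (- 2 * a) * (z \<bullet> v))) (at z)"
      by (auto intro!: derivative_eq_intros simp: inner_commute)
    then show "((\<lambda>z. flat j (1 - a * (z \<bullet> z))) has_derivative
      (\<lambda>v. D (1 - a * (z \<bullet> z)) * ((- 2 * a) * (z \<bullet> v)))) (at z)"
      using flat_has_derivative[of j "1 - a * (z \<bullet> z)", folded D_def]
      by (auto dest: has_derivative_compose simp: has_field_derivative_def)
  next
    fix b :: 'b
    show "C_k k (\<lambda>z. D (1 - a * (z \<bullet> z)) * ((- 2 * a) * (z \<bullet> b)))"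
    proof -
      have eq: "D s = flat (j + 2) s + (- real j) * flat (j + 1) s" for s by (simp add: D_def)
      show ?thesis unfolding eq by (intro C_k_mult C_k_add C_k_const C_k_inner Suc.IH)
    qed
  qed
qed

lemma integrable_compact_support:
  fixes F :: "'b::euclidean_space \<Rightarrow> real"
  assumes "continuous_on UNIV F" "compact K" "\<And>z. z \<notin> K \<Longrightarrow> F z = 0"
  shows "integrable lborel F"
proof -
  have "integrable lborel (\<lambda>x. indicator K x *\<^sub>R F x)"
    using assms by (intro borel_integrable_compact continuous_on_subset[OF assms(1)]) auto
  also have "(\<lambda>x. indicator K x *\<^sub>R F x) = F"
    using assms(3) by (auto simp: indicator_def fun_eq_iff)
  finally show ?thesis .
qed

lemma mollifier_exists:
  fixes e :: real
  assumes "e > 0"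
  obtains \<rho> :: "'b::euclidean_space \<Rightarrow> real" where
    "\<And>k. C_k k \<rho>" "\<And>z. 0 \<le> \<rho> z" "\<And>z. e \<le> norm z \<Longrightarrow> \<rho> z = 0"
    "integrable lborel \<rho>" "integral\<^sup>L lborel \<rho> = 1"
proof -
  define g where "g z = flat 0 (1 - (1 / e\<^sup>2) * (z \<bullet> z))" for z :: 'b
  have Ck: "C_k k g" for k unfolding g_def by (rule C_k_flat)
  have cont: "continuous_on UNIV g" using Ck by (rule C_k_imp_continuous)
  have nn: "0 \<le> g z" for z by (simp add: g_def flat_nonneg)
  have z0: "g z = 0" if "e \<le> norm z" for z
  proof -
    have "e\<^sup>2 \<le> z \<bullet> z" using power_mono[OF that, of 2] assms by (simp add: power2_norm_eq_inner)
    then show ?thesis using assms by (simp add: g_def flat_def)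
  qed
  have int: "integrable lborel g"
    by (rule integrable_compact_support[OF cont, where K="cball 0 e"]) (auto intro!: z0)
  \<comment> \<open>If the integral were 0, the continuous nonnegative \<open>g\<close> would vanish
    on a closed set of full measure, that is everywhere, while its value at 0 is exp(-1).\<close>
  have "integral\<^sup>L lborel g \<noteq> 0"
  proof
    assume "integral\<^sup>L lborel g = 0"
    then have "AE z in lborel. g z = 0"
      using integral_nonneg_eq_0_iff_AE[OF int] nn by simp
    then have "AE z in lebesgue. z \<in> {z. g z = 0}"
      by (auto intro: AE_completion)
    moreover have "closed {z. g z = 0}"
      using continuous_closed_vimage[of "{0}" g] cont
      by (auto simp: vimage_def continuous_on_eq_continuous_at)
    ultimately have "0 \<in> {z. g z = 0}"
      using mem_closed_if_AE_lebesgue by blast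
    then show False by (simp add: g_def flat_def)
  qed
  moreover have "integral\<^sup>L lborel g \<ge> 0" using nn by (simp add: integral_nonneg_AE)
  ultimately have pos: "integral\<^sup>L lborel g > 0" by simp
  define c where "c = 1 / integral\<^sup>L lborel g"
  show thesis
  proof
    show "C_k k (\<lambda>z. c * g z)" for k by (intro C_k_mult C_k_const Ck)
    show "0 \<le> c * g z" for z using nn pos by (simp add: c_def)
    show "e \<le> norm z \<Longrightarrow> c * g z = 0" for z using z0 by simp
    show "integrable lborel (\<lambda>z. c * g z)" using int by simp
    show "integral\<^sup>L lborel (\<lambda>z. c * g z) = 1" using pos by (simp add: c_def)
  qed
qed

section \<open>Affine changes of variable and derivatives along lines\<close>

lemma lborel_integral_affine:
  fixes F :: "'b::euclidean_space \<Rightarrow> real"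
  assumes "F \<in> borel_measurable borel" "c \<noteq> 0"
  shows "integral\<^sup>L lborel F = \<bar>c\<bar> ^ DIM('b) * (LINT x|lborel. F (t + c *\<^sub>R x))"
proof -
  have "integral\<^sup>L lborel F
      = integral\<^sup>L (density (distr lborel borel (\<lambda>x. t + c *\<^sub>R x)) (\<lambda>_. ennreal (\<bar>c\<bar> ^ DIM('b)))) F"
    using lborel_affine[OF assms(2), of t] by simp
  also have "\<dots> = \<bar>c\<bar> ^ DIM('b) * (LINT x|lborel. F (t + c *\<^sub>R x))"
    using assms by (simp add: integral_density integral_distr)
  finally show ?thesis .
qed

lemma lborel_integrable_affine:
  fixes F :: "'b::euclidean_space \<Rightarrow> real"
  assumes "integrable lborel F" "c \<noteq> 0"
  shows "integrable lborel (\<lambda>x. F (t + c *\<^sub>R x))"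
proof -
  have m: "F \<in> borel_measurable borel" using assms(1) by auto
  have "integrable (density (distr lborel borel (\<lambda>x. t + c *\<^sub>R x)) (\<lambda>_. ennreal (\<bar>c\<bar> ^ DIM('b)))) F"
    using assms(1) lborel_affine[OF assms(2), of t] by simp
  then have "integrable (distr lborel borel (\<lambda>x. t + c *\<^sub>R x)) (\<lambda>x. \<bar>c\<bar> ^ DIM('b) *\<^sub>R F x)"
    using m by (subst (asm) integrable_density) auto
  then have "integrable lborel (\<lambda>x. \<bar>c\<bar> ^ DIM('b) *\<^sub>R F (t + c *\<^sub>R x))"
    using m by (subst (asm) integrable_distr_eq) auto
  then show ?thesis using assms(2) by simp
qed

lemma lborel_integral_translate:
  fixes F :: "'b::euclidean_space \<Rightarrow> real"
  assumes "F \<in> borel_measurable borel"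
  shows "(LINT x|lborel. F (t + x)) = integral\<^sup>L lborel F"
  using lborel_integral_affine[OF assms, of 1 t] by simp

lemma lborel_integral_reflect:
  fixes F :: "'b::euclidean_space \<Rightarrow> real"
  assumes "F \<in> borel_measurable borel"
  shows "(LINT x|lborel. F (t - x)) = integral\<^sup>L lborel F"
  using lborel_integral_affine[OF assms, of "-1" t] by simp

text \<open>Derivatives along \<open>b\<close> are required at parameter 0 only, but for every base
  point; moving the base point along the line gives them at all parameters. This form suits
  functions that are differentiable in a single direction, such as time averages of continuous
  functions.\<close>

lemma directional_derivative_shift:
  fixes \<Phi> :: "'b::real_normed_vector \<Rightarrow> real"
  assumes "\<And>z. ((\<lambda>s. \<Phi> (z + s *\<^sub>R b)) has_real_derivative d\<Phi> z) (at 0)"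
  shows "((\<lambda>s. \<Phi> (z + s *\<^sub>R b)) has_real_derivative d\<Phi> (z + s0 *\<^sub>R b)) (at s0)"
proof -
  have "((\<lambda>s. \<Phi> ((z + s0 *\<^sub>R b) + s *\<^sub>R b)) has_real_derivative d\<Phi> (z + s0 *\<^sub>R b)) (at 0)"
    by (rule assms)
  moreover have "(\<lambda>s. \<Phi> ((z + s0 *\<^sub>R b) + s *\<^sub>R b)) = (\<lambda>s. \<Phi> (z + (s + s0) *\<^sub>R b))"
    by (simp add: algebra_simps)
  ultimately show ?thesis
    using DERIV_shift[of "\<lambda>s. \<Phi> (z + s *\<^sub>R b)" "d\<Phi> (z + s0 *\<^sub>R b)" 0 s0] by simp
qed

lemma directional_derivative_bound:
  fixes \<Phi> :: "'b::real_normed_vector \<Rightarrow> real"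
  assumes "\<And>z. ((\<lambda>s. \<Phi> (z + s *\<^sub>R b)) has_real_derivative d\<Phi> z) (at 0)" "\<And>z. \<bar>d\<Phi> z\<bar> \<le> B"
  shows "\<bar>\<Phi> (z + s *\<^sub>R b) - \<Phi> z\<bar> \<le> B * \<bar>s\<bar>"
  using field_differentiable_bound[of UNIV "\<lambda>s. \<Phi> (z + s *\<^sub>R b)" "\<lambda>s. d\<Phi> (z + s *\<^sub>R b)" B s 0]
    directional_derivative_shift[OF assms(1)] assms(2) by simp

lemma directional_derivative_zero_outside:
  fixes \<Phi> :: "'b::real_normed_vector \<Rightarrow> real"
  assumes "closed K" "\<And>z. z \<notin> K \<Longrightarrow> \<Phi> z = 0"
    and d: "((\<lambda>s. \<Phi> (z + s *\<^sub>R b)) has_real_derivative d) (at 0)" and "z \<notin> K"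
  shows "d = 0"
proof -
  have o: "open ((\<lambda>s. z + s *\<^sub>R b) -` (- K))"
    using assms(1) by (intro open_vimage continuous_intros) auto
  have "((\<lambda>s::real. 0::real) has_real_derivative 0) (at 0)" by simp
  then have "((\<lambda>s. \<Phi> (z + s *\<^sub>R b)) has_real_derivative 0) (at 0)"
    by (rule has_field_derivative_transform_within_open[OF _ o]) (use assms in auto)
  then show ?thesis using d DERIV_unique by blast
qed

lemma compact_support_bounded:
  fixes F :: "'b::euclidean_space \<Rightarrow> real"
  assumes "continuous_on UNIV F" "compact K" "\<And>z. z \<notin> K \<Longrightarrow> F z = 0"
  obtains B where "B > 0" "\<And>z. \<bar>F z\<bar> \<le> B"
proof -
  have "bounded (F ` K)"
    using assms by (intro compact_imp_bounded compact_continuous_image continuous_on_subset[OF assms(1)]) auto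
  then obtain B where "B > 0" "\<And>z. z \<in> K \<Longrightarrow> \<bar>F z\<bar> \<le> B"
    unfolding bounded_pos by auto
  then show thesis using assms(3) that[of B] by (metis abs_zero less_imp_le)
qed

lemma compact_neighbourhood:
  fixes K :: "'b::euclidean_space set"
  assumes "compact K"
  shows "compact {z. \<exists>x\<in>K. dist x z \<le> d}"
proof -
  have "{z. \<exists>x\<in>K. dist x z \<le> d} = {x + y |x y. x \<in> K \<and> y \<in> cball 0 d}"
  proof (intro set_eqI iffI)
    fix z assume "z \<in> {z. \<exists>x\<in>K. dist x z \<le> d}"
    then obtain x where "x \<in> K" "dist x z \<le> d" by auto
    then have "x + (z - x) \<in> {x + y |x y. x \<in> K \<and> y \<in> cball 0 d}"
      by (intro CollectI exI[of _ x] exI[of _ "z - x"]) (simp add: dist_norm norm_minus_commute)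
    then show "z \<in> {x + y |x y. x \<in> K \<and> y \<in> cball 0 d}" by simp
  next
    fix z assume "z \<in> {x + y |x y. x \<in> K \<and> y \<in> cball 0 d}"
    then obtain x y where "x \<in> K" "norm y \<le> d" "z = x + y" by auto
    then show "z \<in> {z. \<exists>x\<in>K. dist x z \<le> d}"
      by (auto simp: dist_norm intro!: bexI[of _ x])
  qed
  then show ?thesis by (simp only: compact_sums[OF assms compact_cball])
qed

text \<open>By translation invariance every difference quotient along \<open>b\<close> has integral
  0. The quotients converge to \<open>d\<Phi>\<close> and are dominated on a compact neighbourhood
  of the support, so the limit has integral 0 as well.\<close>

lemma integral_directional_derivative_zero:
  fixes \<Phi> :: "'b::euclidean_space \<Rightarrow> real"
  assumes c: "continuous_on UNIV \<Phi>" "continuous_on UNIV d\<Phi>"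
    and K: "compact K" "\<And>z. z \<notin> K \<Longrightarrow> \<Phi> z = 0"
    and d: "\<And>z. ((\<lambda>s. \<Phi> (z + s *\<^sub>R b)) has_real_derivative d\<Phi> z) (at 0)"
  shows "integral\<^sup>L lborel d\<Phi> = 0"
proof -
  have d0: "d\<Phi> z = 0" if "z \<notin> K" for z
    using directional_derivative_zero_outside[OF _ K(2) d that] K(1) compact_imp_closed by blast
  obtain B where B: "B > 0" "\<And>z. \<bar>d\<Phi> z\<bar> \<le> B"
    using compact_support_bounded[OF c(2) K(1) d0] by blast
  \<comment> \<open>All steps satisfy \<open>s n \<le> 1\<close>, so a quotient can be nonzero only
    within distance \<open>norm b\<close> of \<open>K\<close>.\<close>
  define L where "L = {z. \<exists>x\<in>K. dist x z \<le> norm b}"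
  have L: "compact L" unfolding L_def by (rule compact_neighbourhood[OF K(1)])
  define s where "s n = 1 / real (Suc n)" for n
  have s: "0 < s n" "s n \<le> 1" for n by (auto simp: s_def)
  have s0: "s \<longlonglongrightarrow> 0" unfolding s_def by (rule lim_1_over_n[THEN LIMSEQ_Suc])
  define Q where "Q n z = (\<Phi> (z + s n *\<^sub>R b) - \<Phi> z) / s n" for n z
  have [measurable]: "\<Phi> \<in> borel_measurable borel" "d\<Phi> \<in> borel_measurable borel"
    using c by (auto intro: borel_measurable_continuous_onI)
  have "(\<lambda>n. integral\<^sup>L lborel (Q n)) \<longlonglongrightarrow> integral\<^sup>L lborel d\<Phi>"
  proof (rule integral_dominated_convergence)
    show "integrable lborel (\<lambda>z. indicator L z *\<^sub>R B)"
      using L by (intro borel_integrable_compact) auto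
    have "(\<lambda>n. Q n z) \<longlonglongrightarrow> d\<Phi> z" for z
    proof -
      have "((\<lambda>h. (\<Phi> (z + h *\<^sub>R b) - \<Phi> z) / h) \<longlongrightarrow> d\<Phi> z) (at 0)"
        using d[of z] by (simp add: has_field_derivative_iff)
      moreover have "filterlim s (at 0) sequentially"
        using s0 s(1) by (auto simp: filterlim_at less_imp_neq[symmetric] eventually_sequentially)
      ultimately show ?thesis unfolding Q_def by (rule filterlim_compose)
    qed
    then show "AE z in lborel. (\<lambda>n. Q n z) \<longlonglongrightarrow> d\<Phi> z" by simp
    have "\<bar>Q n z\<bar> \<le> indicator L z *\<^sub>R B" for n z
    proof (cases "z \<in> L")
      case True
      then show ?thesis using directional_derivative_bound[OF d B(2), of z "s n"] s[of n]
        by (simp add: Q_def divide_le_eq abs_div)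
    next
      case False
      have "z \<notin> K" using False by (auto simp: L_def)
      moreover have "z + s n *\<^sub>R b \<notin> K"
      proof
        assume "z + s n *\<^sub>R b \<in> K"
        moreover have "dist (z + s n *\<^sub>R b) z \<le> norm b"
          using s[of n] mult_right_mono[of "s n" 1 "norm b"] by (simp add: dist_norm)
        ultimately show False using False by (auto simp: L_def)
      qed
      ultimately show ?thesis using K(2) False by (simp add: Q_def)
    qed
    then show "AE z in lborel. norm (Q n z) \<le> indicator L z *\<^sub>R B" for n by simp
    show "Q n \<in> borel_measurable lborel" for n unfolding Q_def by measurable
  qed measurable
  moreover have "integral\<^sup>L lborel (Q n) = 0" for n
  proof -
    have i: "integrable lborel \<Phi>" by (rule integrable_compact_support[OF c(1) K])
    have "integrable lborel (\<lambda>z. \<Phi> (z + s n *\<^sub>R b))"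
      using lborel_integrable_affine[OF i, of 1 "s n *\<^sub>R b"] by (simp add: add.commute)
    then show ?thesis using i lborel_integral_translate[of \<Phi> "s n *\<^sub>R b"]
      by (simp add: Q_def[abs_def] add.commute)
  qed
  ultimately show ?thesis using LIMSEQ_unique[of "\<lambda>_. 0" 0] by simp
qed

section \<open>Convolution with a smooth kernel\<close>

definition convolve :: "('b::euclidean_space \<Rightarrow> real) \<Rightarrow> ('b \<Rightarrow> real) \<Rightarrow> 'b \<Rightarrow> real" where
  "convolve \<phi> \<rho> z = (LINT y|lborel. \<phi> y * \<rho> (z - y))"

lemma lborel_integral_eq_cbox:
  fixes F :: "'b::euclidean_space \<Rightarrow> real"
  assumes "continuous_on UNIV F" "\<And>z. z \<notin> cbox a b \<Longrightarrow> F z = 0"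
  shows "integral\<^sup>L lborel F = integral (cbox a b) F"
proof -
  have "integral\<^sup>L lborel F = integral UNIV F"
    using integral_lborel[OF integrable_compact_support[OF assms(1) compact_cbox assms(2)]] by simp
  also have "integral UNIV F = integral UNIV (\<lambda>x. if x \<in> cbox a b then F x else 0)"
    using assms(2) by (intro arg_cong[where f="integral UNIV"]) auto
  also have "\<dots> = integral (cbox a b) F"
    by (rule Henstock_Kurzweil_Integration.integral_restrict_UNIV)
  finally show ?thesis .
qed

text \<open>The derivative falls on the kernel, so continuity of \<open>\<phi>\<close> is enough.
  Restricting the integral to a box that contains the support of \<open>\<phi>\<close> makes the
  Leibniz rule applicable, with derivatives in the space of bounded linear maps.\<close>

lemma convolve_has_derivative:
  fixes \<phi> \<rho> :: "'b::euclidean_space \<Rightarrow> real"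
  assumes \<phi>: "continuous_on UNIV \<phi>" "compact K" "\<And>z. z \<notin> K \<Longrightarrow> \<phi> z = 0" and \<rho>: "C_k 1 \<rho>"
  shows "(convolve \<phi> \<rho> has_derivative (\<lambda>v. convolve \<phi> (\<lambda>z. frechet_derivative \<rho> (at z) v) z)) (at z)"
proof -
  obtain a where a: "K \<subseteq> cbox (-a) a"
    using bounded_subset_cbox_symmetric[OF compact_imp_bounded[OF \<phi>(2)]] by blast
  then have out: "\<phi> z = 0" if "z \<notin> cbox (-a) a" for z using \<phi>(3) that by blast
  define D where "D z = frechet_derivative \<rho> (at z)" for z
  have D: "(\<rho> has_derivative D z) (at z)" for z
    using \<rho> by (simp add: D_def frechet_derivative_works)
  have lin: "bounded_linear (D z)" for z using D by (rule has_derivative_bounded_linear)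
  have contD: "continuous_on UNIV (\<lambda>z. D z v)" for v
  proof -
    have "continuous_on UNIV (\<lambda>z. \<Sum>i\<in>Basis. (v \<bullet> i) * D z i)"
      using \<rho> by (auto intro!: continuous_intros simp: D_def)
    moreover have "D z v = (\<Sum>i\<in>Basis. (v \<bullet> i) * D z i)" for z
    proof -
      have "D z v = D z (\<Sum>i\<in>Basis. (v \<bullet> i) *\<^sub>R i)" by (simp add: euclidean_representation)
      also have "\<dots> = (\<Sum>i\<in>Basis. (v \<bullet> i) * D z i)"
        using bounded_linear.linear[OF lin] by (simp add: linear_sum linear_cmul)
      finally show ?thesis .
    qed
    ultimately show ?thesis by simp
  qed
  have cont\<rho>: "continuous_on UNIV \<rho>" using \<rho> by (rule C_k_imp_continuous)
  define fx where "fx z y = \<phi> y *\<^sub>R Blinfun (D (z - y))" for z y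
  have fx: "blinfun_apply (fx z y) v = \<phi> y * D (z - y) v" for z y v
    by (simp add: fx_def scaleR_blinfun.rep_eq bounded_linear_Blinfun_apply[OF lin])
  have contfx: "continuous_on UNIV (\<lambda>(z, y). fx z y)"
  proof (rule continuous_on_blinfun_componentwise)
    fix i :: 'b
    have "continuous_on UNIV (\<lambda>x. \<phi> (snd x) * D (fst x - snd x) i)"
      by (intro continuous_intros continuous_on_compose2[OF \<phi>(1)] continuous_on_compose2[OF contD]) auto
    then show "continuous_on UNIV (\<lambda>x. blinfun_apply (case x of (z, y) \<Rightarrow> fx z y) i)"
      by (simp add: case_prod_unfold fx)
  qed
  have cint: "continuous_on UNIV (\<lambda>y. \<phi> y * \<rho> (z - y))" for z
    by (intro continuous_intros \<phi>(1) continuous_on_compose2[OF cont\<rho>]) auto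
  have "((\<lambda>z. integral (cbox (-a) a) (\<lambda>y. \<phi> y * \<rho> (z - y))) has_derivative
     integral (cbox (-a) a) (fx z)) (at z within UNIV)"
  proof (rule leibniz_rule)
    fix z y
    have "((\<lambda>x. \<rho> (x - y)) has_derivative D (z - y)) (at z)"
      by (rule has_derivative_compose[where f="\<lambda>x. x - y", OF _ D, simplified])
         (auto intro!: derivative_eq_intros)
    then show "((\<lambda>x. \<phi> y * \<rho> (x - y)) has_derivative blinfun_apply (fx z y)) (at z within UNIV)"
      unfolding fx[abs_def] by (auto intro!: derivative_eq_intros simp: fx)
  next
    show "(\<lambda>y. \<phi> y * \<rho> (z - y)) integrable_on cbox (- a) a" for z
      by (rule integrable_continuous[OF continuous_on_subset[OF cint]]) auto
    show "continuous_on (UNIV \<times> cbox (- a) a) (\<lambda>(x, t). fx x t)"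
      by (rule continuous_on_subset[OF contfx]) auto
  qed auto
  moreover have "(\<lambda>z. integral (cbox (-a) a) (\<lambda>y. \<phi> y * \<rho> (z - y))) = convolve \<phi> \<rho>"
    unfolding convolve_def fun_eq_iff
    by (auto intro!: lborel_integral_eq_cbox[symmetric] cint simp: out)
  moreover have "blinfun_apply (integral (cbox (-a) a) (fx z)) v = convolve \<phi> (\<lambda>z. D z v) z" for v
  proof -
    have "continuous_on UNIV (fx z)"
      using continuous_on_compose2[OF contfx continuous_on_Pair[OF continuous_on_const[where c=z] continuous_on_id[of UNIV]]] by simp
    then have "fx z integrable_on cbox (-a) a"
      by (intro integrable_continuous) (auto intro: continuous_on_subset)
    then have "blinfun_apply (integral (cbox (-a) a) (fx z)) v
        = integral (cbox (-a) a) (\<lambda>y. \<phi> y * D (z - y) v)"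
      by (subst blinfun_apply_integral) (auto simp: fx)
    also have "\<dots> = convolve \<phi> (\<lambda>z. D z v) z"
      unfolding convolve_def
      by (intro lborel_integral_eq_cbox[symmetric] continuous_intros \<phi>(1) continuous_on_compose2[OF contD])
         (auto simp: out)
    finally show ?thesis .
  qed
  ultimately have "(convolve \<phi> \<rho> has_derivative (\<lambda>v. convolve \<phi> (\<lambda>z. D z v) z)) (at z)"
    by (metis (no_types, lifting) ext)
  then show ?thesis by (simp add: D_def)
qed

lemma continuous_convolve:
  fixes \<phi> \<rho> :: "'b::euclidean_space \<Rightarrow> real"
  assumes \<phi>: "continuous_on UNIV \<phi>" "compact K" "\<And>z. z \<notin> K \<Longrightarrow> \<phi> z = 0" and \<rho>: "C_k 1 \<rho>"
  shows "continuous_on UNIV (convolve \<phi> \<rho>)"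
  by (intro continuous_at_imp_continuous_on ballI has_derivative_continuous[OF convolve_has_derivative[OF assms]])

lemma C_k_convolve:
  fixes \<phi> \<rho> :: "'b::euclidean_space \<Rightarrow> real"
  assumes \<phi>: "continuous_on UNIV \<phi>" "compact K" "\<And>z. z \<notin> K \<Longrightarrow> \<phi> z = 0" and \<rho>: "\<And>k. C_k k \<rho>"
  shows "C_k k (convolve \<phi> \<rho>)"
  using \<rho>
proof (induction k arbitrary: \<rho>)
  case 0
  then show ?case using continuous_convolve[OF \<phi> 0] by simp
next
  case (Suc k)
  show ?case
  proof (rule C_k_SucI)
    show "(convolve \<phi> \<rho> has_derivative (\<lambda>v. convolve \<phi> (\<lambda>z. frechet_derivative \<rho> (at z) v) z)) (at z)" for z
      by (rule convolve_has_derivative[OF \<phi> Suc.prems])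
    fix b :: 'b assume b: "b \<in> Basis"
    have "C_k k (\<lambda>z. frechet_derivative \<rho> (at z) b)" for k
      using Suc.prems[of "Suc k"] b by simp
    then show "C_k k (convolve \<phi> (\<lambda>z. frechet_derivative \<rho> (at z) b))" by (rule Suc.IH)
  qed
qed

text \<open>The function y \<mapsto> \<phi>(y) \<rho>(z - y) has compact support, so its derivative
  along \<open>b\<close> integrates to 0; this moves the derivative from the kernel to
  \<open>\<phi>\<close>.\<close>

lemma convolve_directional_derivative:
  fixes \<phi> \<rho> :: "'b::euclidean_space \<Rightarrow> real"
  assumes \<phi>: "continuous_on UNIV \<phi>" "compact K" "\<And>z. z \<notin> K \<Longrightarrow> \<phi> z = 0" and \<rho>: "C_k 1 \<rho>"
    and b: "b \<in> Basis" and d\<phi>: "continuous_on UNIV d\<phi>"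
      "\<And>z. ((\<lambda>s. \<phi> (z + s *\<^sub>R b)) has_real_derivative d\<phi> z) (at 0)"
  shows "convolve \<phi> (\<lambda>z. frechet_derivative \<rho> (at z) b) z = convolve d\<phi> \<rho> z"
proof -
  define D where "D z = frechet_derivative \<rho> (at z)" for z
  have D: "(\<rho> has_derivative D z) (at z)" for z
    using \<rho> by (simp add: D_def frechet_derivative_works)
  have contD: "continuous_on UNIV (\<lambda>z. D z b)" using \<rho> b by (simp add: D_def)
  have cont\<rho>: "continuous_on UNIV \<rho>" using \<rho> by (rule C_k_imp_continuous)
  have d0: "d\<phi> z = 0" if "z \<notin> K" for z
    using directional_derivative_zero_outside[OF _ \<phi>(3) d\<phi>(2) that] \<phi>(2) compact_imp_closed by blast
  have c1: "continuous_on UNIV (\<lambda>y. d\<phi> y * \<rho> (z - y))"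
    by (intro continuous_intros d\<phi>(1) continuous_on_compose2[OF cont\<rho>]) auto
  have c2: "continuous_on UNIV (\<lambda>y. \<phi> y * D (z - y) b)"
    by (intro continuous_intros \<phi>(1) continuous_on_compose2[OF contD]) auto
  have "(LINT y|lborel. d\<phi> y * \<rho> (z - y) - \<phi> y * D (z - y) b) = 0"
  proof (rule integral_directional_derivative_zero[where \<Phi>="\<lambda>y. \<phi> y * \<rho> (z - y)" and K=K and b=b])
    show "continuous_on UNIV (\<lambda>y. \<phi> y * \<rho> (z - y))"
      by (intro continuous_intros \<phi>(1) continuous_on_compose2[OF cont\<rho>]) auto
    show "continuous_on UNIV (\<lambda>y. d\<phi> y * \<rho> (z - y) - \<phi> y * D (z - y) b)"
      by (intro continuous_intros c1 c2)
    fix y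
    have lin: "linear (D (z - y))" using D has_derivative_linear by blast
    have "((\<lambda>s. \<rho> (z - (y + s *\<^sub>R b))) has_derivative (\<lambda>s. D (z - y) (- (s *\<^sub>R b)))) (at 0)"
      by (rule has_derivative_compose[where f="\<lambda>s. z - (y + s *\<^sub>R b)" and s=UNIV, simplified])
         (auto intro!: derivative_eq_intros D)
    then have "((\<lambda>s. \<rho> (z - (y + s *\<^sub>R b))) has_real_derivative (- D (z - y) b)) (at 0)"
      by (rule has_derivative_imp_has_field_derivative) (simp add: linear_neg[OF lin] linear_cmul[OF lin])
    from DERIV_mult[OF d\<phi>(2)[of y] this]
    show "((\<lambda>s. \<phi> (y + s *\<^sub>R b) * \<rho> (z - (y + s *\<^sub>R b))) has_real_derivative
      d\<phi> y * \<rho> (z - y) - \<phi> y * D (z - y) b) (at 0)" by (simp add: algebra_simps)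
  qed (use \<phi> in auto)
  moreover have "integrable lborel (\<lambda>y. d\<phi> y * \<rho> (z - y))"
    by (rule integrable_compact_support[OF c1 \<phi>(2)]) (simp add: d0)
  moreover have "integrable lborel (\<lambda>y. \<phi> y * D (z - y) b)"
    by (rule integrable_compact_support[OF c2 \<phi>(2)]) (simp add: \<phi>(3))
  ultimately show ?thesis by (simp add: convolve_def D_def)
qed

lemma compact_support_uniformly_continuous:
  fixes F :: "'b::euclidean_space \<Rightarrow> real"
  assumes F: "continuous_on UNIV F" "compact K" "\<And>z. z \<notin> K \<Longrightarrow> F z = 0" and "e > 0"
  obtains d where "d > 0" "\<And>x y. dist x y < d \<Longrightarrow> \<bar>F x - F y\<bar> < e"
proof -
  define L where "L = {z. \<exists>x\<in>K. dist x z \<le> 1}"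
  have L: "compact L" unfolding L_def by (rule compact_neighbourhood[OF F(2)])
  have "uniformly_continuous_on L F"
    using L by (intro compact_uniformly_continuous continuous_on_subset[OF F(1)]) auto
  then obtain d where d: "d > 0" "\<And>x y. x \<in> L \<Longrightarrow> y \<in> L \<Longrightarrow> dist x y < d \<Longrightarrow> \<bar>F x - F y\<bar> < e"
    using \<open>e > 0\<close> unfolding uniformly_continuous_on_def dist_real_def by metis
  have "\<bar>F x - F y\<bar> < e" if xy: "dist x y < min d 1" for x y
  proof (cases "x \<in> K \<or> y \<in> K")
    case True
    have "x \<in> L \<and> y \<in> L"
      using True xy unfolding L_def by (auto simp: dist_commute intro: bexI[of _ x] bexI[of _ y])
    then show ?thesis using d xy by auto
  qed (use F(3) \<open>e > 0\<close> in auto)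
  then show thesis using that[of "min d 1"] d(1) by auto
qed

lemma convolve_close:
  fixes \<phi> \<rho> :: "'b::euclidean_space \<Rightarrow> real"
  assumes \<phi>: "continuous_on UNIV \<phi>" "compact K" "\<And>z. z \<notin> K \<Longrightarrow> \<phi> z = 0"
    and \<rho>: "continuous_on UNIV \<rho>" "\<And>z. 0 \<le> \<rho> z" "\<And>z. d \<le> norm z \<Longrightarrow> \<rho> z = 0"
      "integrable lborel \<rho>" "integral\<^sup>L lborel \<rho> = 1"
    and e: "\<And>x y. dist x y < d \<Longrightarrow> \<bar>\<phi> x - \<phi> y\<bar> \<le> e"
  shows "\<bar>convolve \<phi> \<rho> z - \<phi> z\<bar> \<le> e"
proof -
  have [measurable]: "\<phi> \<in> borel_measurable borel" "\<rho> \<in> borel_measurable borel"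
    using \<phi>(1) \<rho>(1) by (auto intro: borel_measurable_continuous_onI)
  have *: "convolve \<phi> \<rho> z = (LINT y|lborel. \<phi> (z - y) * \<rho> y)"
    unfolding convolve_def using lborel_integral_reflect[of "\<lambda>y. \<phi> y * \<rho> (z - y)" z] by simp
  have c: "continuous_on UNIV (\<lambda>y. \<phi> (z - y) * \<rho> y)"
    by (intro continuous_intros \<rho>(1) continuous_on_compose2[OF \<phi>(1)]) auto
  have i: "integrable lborel (\<lambda>y. \<phi> (z - y) * \<rho> y)"
    by (rule integrable_compact_support[OF c, of "cball 0 d"]) (auto simp: \<rho>(3))
  have "convolve \<phi> \<rho> z - \<phi> z = (LINT y|lborel. (\<phi> (z - y) - \<phi> z) * \<rho> y)"
    using i \<rho>(4,5) by (simp add: * left_diff_distrib)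
  also have "\<bar>\<dots>\<bar> \<le> (LINT y|lborel. e * \<rho> y)"
  proof (rule integral_abs_bound[THEN order_trans], rule integral_mono)
    show "integrable lborel (\<lambda>y. \<bar>(\<phi> (z - y) - \<phi> z) * \<rho> y\<bar>)"
      using i \<rho>(4) by (simp add: left_diff_distrib)
    show "\<bar>(\<phi> (z - y) - \<phi> z) * \<rho> y\<bar> \<le> e * \<rho> y" for y
    proof (cases "norm y < d")
      case True
      then have "\<bar>\<phi> (z - y) - \<phi> z\<bar> \<le> e" by (intro e) (simp add: dist_norm)
      then show ?thesis using \<rho>(2)[of y] by (simp add: abs_mult mult_right_mono)
    qed (simp add: \<rho>(3))
  qed (use \<rho>(4) in auto)
  finally show ?thesis using \<rho>(5) by simp
qed

text \<open>This extends weak formulations from smooth test functions to continuous ones that have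
  continuous derivatives in certain directions only. One sequence of mollifications serves all these
  directions at once, hence the quantification over \<open>b\<close> and \<open>d\<phi>\<close>
  inside the conclusion. The supports stay in one compact \<open>K'\<close> because the mollifier
  radii are at most \<open>d\<close>, and the closed \<open>d\<close>-neighbourhood of
  \<open>K\<close> lies in \<open>U\<close>.\<close>

lemma smooth_approx:
  fixes \<phi> :: "'b::euclidean_space \<Rightarrow> real"
  assumes \<phi>: "continuous_on UNIV \<phi>" "compact K" "\<And>z. z \<notin> K \<Longrightarrow> \<phi> z = 0"
    and U: "open U" "K \<subseteq> U"
  obtains \<Phi> K' where "compact K'" "K' \<subseteq> U" "\<And>n. test_function U (\<Phi> n)"
    "\<And>n z. z \<notin> K' \<Longrightarrow> \<Phi> n z = 0"
    "uniform_limit UNIV \<Phi> \<phi> sequentially"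
    "\<And>b d\<phi>. b \<in> Basis \<Longrightarrow> continuous_on UNIV d\<phi> \<Longrightarrow>
       (\<And>z. ((\<lambda>s. \<phi> (z + s *\<^sub>R b)) has_real_derivative d\<phi> z) (at 0)) \<Longrightarrow>
       uniform_limit UNIV (\<lambda>n z. frechet_derivative (\<Phi> n) (at z) b) d\<phi> sequentially"
proof -
  obtain d where d: "d > 0" "(\<Union>x\<in>K. cball x d) \<subseteq> U"
    using compact_subset_open_imp_cball_epsilon_subset[OF \<phi>(2) U] by blast
  define K' where "K' = {z. \<exists>x\<in>K. dist x z \<le> d}"
  have K': "compact K'" unfolding K'_def by (rule compact_neighbourhood[OF \<phi>(2)])
  have K'U: "K' \<subseteq> U" proof
    fix z assume "z \<in> K'"
    then obtain x where "x \<in> K" "z \<in> cball x d" by (auto simp: K'_def)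
    then show "z \<in> U" using d(2) by blast
  qed
  define e where "e n = d / real (Suc n)" for n
  have e: "0 < e n" "e n \<le> d" for n using d(1) by (auto simp: e_def field_simps)
  have e0: "e \<longlonglongrightarrow> 0"
    unfolding e_def using tendsto_mult_right_zero[OF lim_1_over_n[THEN LIMSEQ_Suc], of d] by simp
  define mol :: "nat \<Rightarrow> ('b \<Rightarrow> real) \<Rightarrow> bool" where
    "mol n \<rho> \<longleftrightarrow> (\<forall>k. C_k k \<rho>) \<and> (\<forall>z. 0 \<le> \<rho> z) \<and> (\<forall>z. e n \<le> norm z \<longrightarrow> \<rho> z = 0) \<and>
      integrable lborel \<rho> \<and> integral\<^sup>L lborel \<rho> = 1" for n \<rho>
  have "\<exists>\<rho>. mol n \<rho>" for n
  proof (rule mollifier_exists[OF e(1)[of n]])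
    fix \<rho> :: "'b \<Rightarrow> real" assume "\<And>k. C_k k \<rho>" "\<And>z. 0 \<le> \<rho> z" "\<And>z. e n \<le> norm z \<Longrightarrow> \<rho> z = 0"
      "integrable lborel \<rho>" "integral\<^sup>L lborel \<rho> = 1"
    then show ?thesis unfolding mol_def by (intro exI[of _ \<rho>] conjI) simp_all
  qed
  then obtain \<rho> where "\<And>n. mol n (\<rho> n)" using choice[of mol] by blast
  then have \<rho>: "\<And>n k. C_k k (\<rho> n)" "\<And>n z. 0 \<le> \<rho> n z"
      "\<And>n z. e n \<le> norm z \<Longrightarrow> \<rho> n z = 0" "\<And>n. integrable lborel (\<rho> n)" "\<And>n. integral\<^sup>L lborel (\<rho> n) = 1"
    unfolding mol_def by auto
  define \<Phi> where "\<Phi> n = convolve \<phi> (\<rho> n)" for n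
  have lim: "uniform_limit UNIV (\<lambda>n. convolve F (\<rho> n)) F sequentially"
    if F: "continuous_on UNIV F" "\<And>z. z \<notin> K \<Longrightarrow> F z = 0" for F
  proof (rule uniform_limitI)
    fix r :: real assume "r > 0"
    then have r2: "r / 2 > 0" by simp
    obtain \<delta> where \<delta>: "\<delta> > 0" "\<And>x y. dist x y < \<delta> \<Longrightarrow> \<bar>F x - F y\<bar> < r / 2"
      using compact_support_uniformly_continuous[OF F(1) \<phi>(2) F(2) r2] by metis
    have "\<forall>\<^sub>F n in sequentially. e n < \<delta>" using order_tendstoD(2)[OF e0 \<delta>(1)] .
    then show "\<forall>\<^sub>F n in sequentially. \<forall>x\<in>UNIV. dist (convolve F (\<rho> n) x) (F x) < r"
    proof eventually_elim
      case (elim n)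
      have c: "\<bar>F x - F y\<bar> \<le> r / 2" if "dist x y < e n" for x y
        using \<delta>(2)[of x y] that elim by linarith
      have "\<bar>convolve F (\<rho> n) x - F x\<bar> \<le> r / 2" for x
        by (rule convolve_close[where K=K and d="e n", OF F(1) \<phi>(2) _ C_k_imp_continuous[OF \<rho>(1)]
              \<rho>(2) _ \<rho>(4,5)]; erule F(2) \<rho>(3) c)
      from le_less_trans[OF this] r2 have "\<bar>convolve F (\<rho> n) x - F x\<bar> < r" for x
        by (simp add: \<open>r > 0\<close>)
      then show ?case by (simp add: dist_real_def)
    qed
  qed
  have out: "\<Phi> n z = 0" if z: "z \<notin> K'" for n z
  proof -
    have "\<phi> y * \<rho> n (z - y) = 0" for y
    proof (cases "y \<in> K")
      case True
      then have "\<not> dist y z \<le> d" using z by (auto simp: K'_def)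
      then have "d \<le> norm (z - y)" using norm_minus_commute[of y z] by (simp add: dist_norm)
      then show ?thesis using \<rho>(3)[of n "z - y"] e(2)[of n] by simp
    qed (simp add: \<phi>(3))
    note * = this
    show ?thesis unfolding \<Phi>_def convolve_def * by simp
  qed
  show thesis
  proof
    show "compact K'" "K' \<subseteq> U" by fact+
    show "\<Phi> n z = 0" if "z \<notin> K'" for n z by (rule out[OF that])
    show "test_function U (\<Phi> n)" for n
    proof -
      have "closure {z. \<Phi> n z \<noteq> 0} \<subseteq> K'"
        using out K' by (intro closure_minimal compact_imp_closed) auto
      moreover from this have "compact (closure {z. \<Phi> n z \<noteq> 0})"
        using compact_Int_closed[OF K' closed_closure, of "{z. \<Phi> n z \<noteq> 0}"] by (simp add: Int_absorb1)
      ultimately show ?thesis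
        unfolding test_function_def using K'U C_k_convolve[OF \<phi> \<rho>(1)] by (auto simp: \<Phi>_def)
    qed
    show "uniform_limit UNIV \<Phi> \<phi> sequentially" unfolding \<Phi>_def by (rule lim[OF \<phi>(1,3)])
    fix b d\<phi> assume b: "b \<in> (Basis::'b set)" and d\<phi>: "continuous_on UNIV d\<phi>"
      "\<And>z. ((\<lambda>s. \<phi> (z + s *\<^sub>R b)) has_real_derivative d\<phi> z) (at 0)"
    have d0: "d\<phi> z = 0" if "z \<notin> K" for z
      using directional_derivative_zero_outside[OF _ \<phi>(3) d\<phi>(2) that] \<phi>(2) compact_imp_closed by blast
    have "frechet_derivative (\<Phi> n) (at z) b = convolve d\<phi> (\<rho> n) z" for n z
    proof -
      have "frechet_derivative (\<Phi> n) (at z) b = convolve \<phi> (\<lambda>z. frechet_derivative (\<rho> n) (at z) b) z"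
        unfolding \<Phi>_def by (simp add: frechet_derivative_at[OF convolve_has_derivative[OF \<phi> \<rho>(1)], symmetric])
      also have "\<dots> = convolve d\<phi> (\<rho> n) z"
        by (rule convolve_directional_derivative[OF \<phi> \<rho>(1) b d\<phi>])
      finally show ?thesis .
    qed
    then show "uniform_limit UNIV (\<lambda>n z. frechet_derivative (\<Phi> n) (at z) b) d\<phi> sequentially"
      using lim[OF d\<phi>(1) d0] by simp
  qed
qed

section \<open>The Signorini problem on the parabolic cylinder\<close>

definition space_cyl :: "'a::euclidean_space spacetime set" where
  "space_cyl = {z. 0 \<le> snd (fst z) \<and> - 1 < snd z \<and> snd z \<le> 0}"

definition open_cyl :: "'a::euclidean_space spacetime set" where
  "open_cyl = {z. 0 < snd (fst z) \<and> - 1 < snd z \<and> snd z < 0}"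

lemma open_open_cyl: "open open_cyl"
  unfolding open_cyl_def by (intro open_Collect_conj open_Collect_less continuous_intros)

lemma open_cyl_borel [measurable]: "open_cyl \<in> sets borel"
  by (intro borel_open open_open_cyl)

lemma open_cyl_subset: "open_cyl \<subseteq> space_cyl"
  by (auto simp: open_cyl_def space_cyl_def)

lemma half_thin_eq: "half_cyl 1 \<union> thin_cyl 1 = space_cyl"
  by (auto simp: half_cyl_def thin_cyl_def space_cyl_def)

lemma interior_half_cyl: "interior (half_cyl 1) = (open_cyl :: 'a::euclidean_space spacetime set)"
proof (rule interior_unique)
  show "(open_cyl :: 'a spacetime set) \<subseteq> half_cyl 1" by (auto simp: open_cyl_def half_cyl_def)
  show "open (open_cyl :: 'a spacetime set)" by (rule open_open_cyl)
  fix T :: "'a spacetime set" assume T: "T \<subseteq> half_cyl 1" "open T"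
  show "T \<subseteq> open_cyl"
  proof
    fix z assume "z \<in> T"
    then obtain e where e: "e > 0" "ball z e \<subseteq> T" using T(2) openE by blast
    have "(fst z, snd z + e / 2) \<in> ball z e"
      using e(1) by (simp add: dist_prod_def dist_real_def)
    then have "(fst z, snd z + e / 2) \<in> half_cyl 1" using e T by blast
    then have "snd z < 0" using e(1) by (simp add: half_cyl_def)
    moreover have "z \<in> half_cyl 1" using \<open>z \<in> T\<close> T by blast
    ultimately show "z \<in> open_cyl" by (auto simp: open_cyl_def half_cyl_def)
  qed
qed

lemma negligible_half_open_cyl: "negligible (half_cyl 1 - (open_cyl :: 'a::euclidean_space spacetime set))"
proof (rule negligible_subset)
  have "(0, 1) \<in> (Basis :: 'a spacetime set)" by (simp add: Basis_prod_def)
  then show "negligible {z :: 'a spacetime. z \<bullet> (0, 1) = 0}" by (intro negligible_standard_hyperplane)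
  show "half_cyl 1 - open_cyl \<subseteq> {z :: 'a spacetime. z \<bullet> (0, 1) = 0}"
    by (auto simp: half_cyl_def open_cyl_def)
qed

lemma half_cyl_lebesgue: "half_cyl 1 \<in> sets (lebesgue :: 'a::euclidean_space spacetime measure)"
proof -
  have "half_cyl 1 = (open_cyl :: 'a spacetime set) \<union> (half_cyl 1 - open_cyl)"
    by (auto simp: half_cyl_def open_cyl_def)
  moreover have "half_cyl 1 - open_cyl \<in> sets (lebesgue :: 'a spacetime measure)"
    using negligible_half_open_cyl by (rule negligible_imp_sets)
  moreover have "open_cyl \<in> sets (lebesgue :: 'a spacetime measure)"
    using open_cyl_borel by simp
  ultimately show ?thesis by (metis sets.Un)
qed

lemma continuous_on_extend_zero:
  assumes "open U" "closed K" "K \<subseteq> U" "continuous_on U F" "\<And>z. z \<notin> K \<Longrightarrow> F z = 0"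
  shows "continuous_on UNIV F"
proof -
  have "continuous_on (- K) F"
    by (rule continuous_on_cong[THEN iffD1, OF refl _ continuous_on_const[of _ 0]]) (simp add: assms(5))
  then have "continuous_on (U \<union> (- K)) F"
    using assms by (intro continuous_on_open_Un) auto
  moreover have "U \<union> (- K) = UNIV" using assms(3) by auto
  ultimately show ?thesis by simp
qed

lemma integrable_mult_compact_support:
  fixes k :: "'b::euclidean_space \<Rightarrow> real"
  assumes K: "compact K" and k: "integrable lborel (\<lambda>z. indicator K z * k z)"
    and H: "continuous_on UNIV H" "\<And>z. z \<notin> K \<Longrightarrow> H z = 0"
  shows "integrable lborel (\<lambda>z. k z * H z)"
proof -
  obtain B where B: "B > 0" "\<And>z. \<bar>H z\<bar> \<le> B"
    using compact_support_bounded[OF H(1) K H(2)] by blast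
  have [measurable]: "H \<in> borel_measurable borel" using H(1) by (rule borel_measurable_continuous_onI)
  have "integrable lborel (\<lambda>z. (indicator K z * k z) * H z)"
  proof (rule Bochner_Integration.integrable_bound)
    show "integrable lborel (\<lambda>z. B * (indicator K z * k z))" using k by simp
    show "(\<lambda>z. (indicator K z * k z) * H z) \<in> borel_measurable lborel" using k by measurable
    have "\<bar>(indicator K z * k z) * H z\<bar> \<le> \<bar>B * (indicator K z * k z)\<bar>" for z
      using mult_left_mono[OF B(2)[of z], of "\<bar>indicator K z * k z\<bar>"] B(1)
      by (simp add: abs_mult mult_ac)
    then show "AE z in lborel. norm ((indicator K z * k z) * H z) \<le> norm (B * (indicator K z * k z))"
      by simp
  qed
  moreover have "(\<lambda>z. (indicator K z * k z) * H z) = (\<lambda>z. k z * H z)"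
    using H(2) by (auto simp: indicator_def fun_eq_iff)
  ultimately show ?thesis by simp
qed

text \<open>Integrability of \<open>k\<close> is available on \<open>K\<close> only. Since all
  \<open>F n\<close> vanish off \<open>K\<close>, the restriction of \<open>k\<close> may replace
  it, and the error is at most the L1 norm of this restriction times the uniform distance.\<close>

lemma integral_uniform_limit:
  fixes k :: "'b::euclidean_space \<Rightarrow> real"
  assumes K: "compact K" and k: "integrable lborel (\<lambda>z. indicator K z * k z)"
    and F: "\<And>n. continuous_on UNIV (F n)" "\<And>n z. z \<notin> K \<Longrightarrow> F n z = 0"
    and lim: "uniform_limit UNIV F G sequentially"
  shows "(\<lambda>n. LINT z|lborel. k z * F n z) \<longlonglongrightarrow> (LINT z|lborel. k z * G z)"
proof -
  define k' where "k' z = indicator K z * k z" for z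
  have k': "integrable lborel k'" using k by (simp add: k'_def[abs_def])
  have G: "continuous_on UNIV G"
    by (rule uniform_limit_theorem[OF _ lim]) (use F(1) in auto)
  have pt: "(\<lambda>n. F n z) \<longlonglongrightarrow> G z" for z using lim by (rule tendsto_uniform_limitI) simp
  have G0: "G z = 0" if "z \<notin> K" for z
    using pt[of z] F(2)[OF that] LIMSEQ_unique[of "\<lambda>_. 0" 0 "G z"] by simp
  have eq: "k z * F n z = k' z * F n z" "k z * G z = k' z * G z" for n z
    using F(2)[of z n] G0[of z] by (auto simp: k'_def indicator_def)
  have int: "integrable lborel (\<lambda>z. k' z * H z)"
    if H: "continuous_on UNIV H" "\<And>z. z \<notin> K \<Longrightarrow> H z = 0" for H
  proof -
    have "(\<lambda>z. k' z * H z) = (\<lambda>z. k z * H z)"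
      using H(2) by (auto simp: k'_def indicator_def fun_eq_iff)
    then show ?thesis using integrable_mult_compact_support[OF K k H] by simp
  qed
  note iF = int[OF F] and iG = int[OF G G0]
  define C where "C = (LINT z|lborel. \<bar>k' z\<bar>)"
  have C: "C \<ge> 0" unfolding C_def by (rule integral_nonneg_AE) auto
  show ?thesis unfolding eq
  proof (rule tendstoI)
    fix e :: real assume "e > 0"
    have "e / (C + 1) > 0" using \<open>e > 0\<close> C by simp
    from uniform_limitD[OF lim this] show "\<forall>\<^sub>F n in sequentially.
      dist (LINT z|lborel. k' z * F n z) (LINT z|lborel. k' z * G z) < e"
    proof eventually_elim
      case (elim n)
      have "\<bar>(LINT z|lborel. k' z * F n z) - (LINT z|lborel. k' z * G z)\<bar>
          = \<bar>LINT z|lborel. k' z * (F n z - G z)\<bar>"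
        using iF iG by (simp add: right_diff_distrib)
      also have "\<dots> \<le> (LINT z|lborel. \<bar>k' z\<bar> * (e / (C + 1)))"
      proof (rule integral_abs_bound[THEN order_trans], rule integral_mono)
        show "integrable lborel (\<lambda>z. \<bar>k' z * (F n z - G z)\<bar>)"
          using iF iG by (simp add: right_diff_distrib)
        show "integrable lborel (\<lambda>z. \<bar>k' z\<bar> * (e / (C + 1)))" using k' by simp
        show "\<bar>k' z * (F n z - G z)\<bar> \<le> \<bar>k' z\<bar> * (e / (C + 1))" for z
          unfolding abs_mult using elim[rule_format, of z]
          by (intro mult_left_mono) (auto simp: dist_real_def)
      qed
      also have "\<dots> = C * (e / (C + 1))" by (simp add: C_def)
      also have "\<dots> < e" using \<open>e > 0\<close> C by (simp add: field_simps)
      finally show ?case by (simp add: dist_real_def)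
    qed
  qed
qed

lemma test_functionD:
  assumes "test_function U \<phi>"
  obtains K where "compact K" "K \<subseteq> U" "\<And>z. z \<notin> K \<Longrightarrow> \<phi> z = 0"
proof
  show "compact (closure {z. \<phi> z \<noteq> 0})" "closure {z. \<phi> z \<noteq> 0} \<subseteq> U"
    using assms by (auto simp: test_function_def)
  show "\<phi> z = 0" if "z \<notin> closure {z. \<phi> z \<noteq> 0}" for z
    using that closure_subset[of "{z. \<phi> z \<noteq> 0}"] by blast
qed

lemma C_k_directional:
  fixes \<phi> :: "'b::euclidean_space \<Rightarrow> real"
  assumes "C_k 1 \<phi>"
  shows "((\<lambda>s. \<phi> (z + s *\<^sub>R b)) has_real_derivative frechet_derivative \<phi> (at z) b) (at 0)"
proof -
  have D: "(\<phi> has_derivative frechet_derivative \<phi> (at z)) (at z)"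
    using assms by (simp add: frechet_derivative_works)
  have "((\<lambda>s. \<phi> (z + s *\<^sub>R b)) has_derivative (\<lambda>s. frechet_derivative \<phi> (at z) (s *\<^sub>R b))) (at 0)"
    by (rule has_derivative_compose[where f="\<lambda>s. z + s *\<^sub>R b" and s=UNIV, simplified])
       (auto intro!: derivative_eq_intros D)
  then show ?thesis
    by (rule has_derivative_imp_has_field_derivative)
       (simp add: linear_cmul[OF has_derivative_linear[OF D]])
qed

lemma frechet_derivative_zero_outside:
  fixes \<phi> :: "'b::euclidean_space \<Rightarrow> real"
  assumes "C_k 1 \<phi>" "closed K" "\<And>z. z \<notin> K \<Longrightarrow> \<phi> z = 0" "z \<notin> K"
  shows "frechet_derivative \<phi> (at z) b = 0"
  by (rule directional_derivative_zero_outside[OF assms(2,3) C_k_directional[OF assms(1)] assms(4)])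

lemma test_function_deriv:
  assumes "test_function U \<phi>" "b \<in> Basis"
  shows "test_function U (\<lambda>z. frechet_derivative \<phi> (at z) b)"
proof -
  have C: "C_k k \<phi>" for k using assms by (simp add: test_function_def)
  have "C_k k (\<lambda>z. frechet_derivative \<phi> (at z) b)" for k
    using C[of "Suc k"] assms(2) by simp
  moreover have sub: "closure {z. frechet_derivative \<phi> (at z) b \<noteq> 0} \<subseteq> closure {z. \<phi> z \<noteq> 0}"
  proof (rule closure_minimal)
    show "{z. frechet_derivative \<phi> (at z) b \<noteq> 0} \<subseteq> closure {z. \<phi> z \<noteq> 0}"
      using frechet_derivative_zero_outside[OF C closed_closure, of "{z. \<phi> z \<noteq> 0}"]
        closure_subset[of "{z. \<phi> z \<noteq> 0}"] by blast
  qed simp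
  moreover have "compact (closure {z. frechet_derivative \<phi> (at z) b \<noteq> 0})"
    using compact_Int_closed[of "closure {z. \<phi> z \<noteq> 0}", OF _ closed_closure,
        of "{z. frechet_derivative \<phi> (at z) b \<noteq> 0}"] sub assms(1)
    by (simp add: Int_absorb1 test_function_def)
  ultimately show ?thesis
    using assms(1) unfolding test_function_def by blast
qed

text \<open>Here \<open>g\<close> is the spatial gradient up to the thin space, \<open>w\<close> the weak time derivative, and \<open>R\<close> bounds
  the spatial support. The equation is kept in the form in which it has been integrated by parts once
  in space, because only first derivatives of \<open>u\<close> occur in the proof.\<close>

locale signorini =
  fixes u :: "'a::euclidean_space spacetime \<Rightarrow> real" and g :: "'a spacetime \<Rightarrow> 'a \<times> real"
    and w f :: "'a spacetime \<Rightarrow> real" and R M l :: real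
  assumes cont_u: "continuous_on space_cyl u" and cont_g: "continuous_on space_cyl g"
    and deriv_u: "\<And>z. z \<in> space_cyl \<Longrightarrow>
      ((\<lambda>y. u (y, snd z)) has_derivative (\<lambda>v. g z \<bullet> v)) (at (fst z) within closed_half_space)"
    and R_pos: "R > 0"
    and supp: "\<And>z. z \<in> space_cyl \<Longrightarrow> R < norm (fst z) \<Longrightarrow> u z = 0 \<and> g z = 0"
    and thin: "\<And>z. z \<in> space_cyl \<Longrightarrow> snd (fst z) = 0 \<Longrightarrow> 0 \<le> u z \<and> snd (g z) \<le> 0 \<and> u z * snd (g z) = 0"
    and w_meas [measurable]: "w \<in> borel_measurable borel"
    and f_meas [measurable]: "f \<in> borel_measurable borel"
    and w_out: "\<And>z. z \<notin> open_cyl \<Longrightarrow> w z = 0" and f_out: "\<And>z. z \<notin> open_cyl \<Longrightarrow> f z = 0"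
    and w_L2: "integrable lborel (\<lambda>z. (w z)\<^sup>2)"
    and f_bound: "AE z in lborel. (f z)\<^sup>2 \<le> M\<^sup>2 * ((norm (fst z))\<^sup>2 + \<bar>snd z\<bar>) powr (l - 2)"
    and l_ge: "l \<ge> 2"
    and weak_t_test: "\<And>\<phi>. test_function open_cyl \<phi> \<Longrightarrow>
      (LINT z|lborel. u z * frechet_derivative \<phi> (at z) (0, 1)) = - (LINT z|lborel. w z * \<phi> z)"
    and weak_x_test: "\<And>\<phi>. test_function open_cyl \<phi> \<Longrightarrow>
      (\<Sum>b\<in>Basis. LINT z|lborel. (g z \<bullet> b) * frechet_derivative \<phi> (at z) (b, 0))
        = - (LINT z|lborel. (w z + f z) * \<phi> z)"
begin

lemma integrable_w_compact:
  assumes "compact K" shows "integrable lborel (\<lambda>z. indicator K z * w z)"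
proof (rule Bochner_Integration.integrable_bound)
  have [measurable]: "K \<in> sets borel" using assms by (simp add: borel_compact)
  have "integrable lborel (\<lambda>z. indicator K z *\<^sub>R (1::real))"
    using assms by (intro borel_integrable_compact) auto
  then show "integrable lborel (\<lambda>z. indicator K z + (w z)\<^sup>2)" using w_L2 by simp
  show "(\<lambda>z. indicator K z * w z) \<in> borel_measurable lborel" by measurable
  have "\<bar>w z\<bar> \<le> 1 + (w z)\<^sup>2" for z
    using sum_power2_ge_zero[of "\<bar>w z\<bar> - 1" 0] by (simp add: power2_diff)
  then show "AE z in lborel. norm (indicator K z * w z) \<le> norm (indicator K z + (w z)\<^sup>2)"
    by (auto simp: indicator_def)
qed

lemma integrable_f_compact:
  assumes "compact K" shows "integrable lborel (\<lambda>z. indicator K z * (f z)\<^sup>2)"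
    and "integrable lborel (\<lambda>z. indicator K z * f z)"
proof -
  have [measurable]: "K \<in> sets borel" using assms by (simp add: borel_compact)
  \<comment> \<open>The summand 1 keeps the base of \<open>powr\<close> away from 0, where
    \<open>0 powr 0 = 0\<close> would break continuity in the case l = 2. The bound only grows, as l
    \<ge> 2.\<close>
  have c: "continuous_on K (\<lambda>z::'a spacetime. M\<^sup>2 * (1 + ((norm (fst z))\<^sup>2 + \<bar>snd z\<bar>)) powr (l - 2))"
    by (intro continuous_intros) (auto simp: add_nonneg_eq_0_iff)
  have i: "integrable lborel (\<lambda>z. indicator K z *\<^sub>R (M\<^sup>2 * (1 + ((norm (fst z))\<^sup>2 + \<bar>snd z\<bar>)) powr (l - 2)))"
    by (rule borel_integrable_compact[OF assms c])
  have AE: "AE z in lborel. (f z)\<^sup>2 \<le> M\<^sup>2 * (1 + ((norm (fst z))\<^sup>2 + \<bar>snd z\<bar>)) powr (l - 2)"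
    using f_bound
  proof eventually_elim
    case (elim z)
    also have "M\<^sup>2 * ((norm (fst z))\<^sup>2 + \<bar>snd z\<bar>) powr (l - 2)
        \<le> M\<^sup>2 * (1 + ((norm (fst z))\<^sup>2 + \<bar>snd z\<bar>)) powr (l - 2)"
      using l_ge by (intro mult_left_mono powr_mono2) auto
    finally show ?case .
  qed
  show sq: "integrable lborel (\<lambda>z. indicator K z * (f z)\<^sup>2)"
    by (rule Bochner_Integration.integrable_bound[OF i]) (use AE in \<open>auto simp: indicator_def\<close>)
  have "integrable lborel (\<lambda>z. indicator K z *\<^sub>R (1::real))"
    using assms by (intro borel_integrable_compact) auto
  then have i2: "integrable lborel (\<lambda>z. indicator K z + indicator K z * (f z)\<^sup>2)" using sq by simp
  have "\<bar>f z\<bar> \<le> 1 + (f z)\<^sup>2" for z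
    using sum_power2_ge_zero[of "\<bar>f z\<bar> - 1" 0] by (simp add: power2_diff)
  then show "integrable lborel (\<lambda>z. indicator K z * f z)"
    by (intro Bochner_Integration.integrable_bound[OF i2]) (auto simp: indicator_def)
qed

text \<open>\<open>u\<close> is continuous on the cylinder and \<open>w\<close> is integrable on
  compact sets, so both sides survive the uniform limits supplied by \<open>smooth_approx\<close>.
  The tests to come are time averages of continuous functions, differentiable in time only.\<close>

lemma weak_t:
  assumes \<phi>: "continuous_on UNIV \<phi>" "compact K" "K \<subseteq> open_cyl" "\<And>z. z \<notin> K \<Longrightarrow> \<phi> z = 0"
    and d\<phi>: "continuous_on UNIV d\<phi>"
      "\<And>z. ((\<lambda>s. \<phi> (z + s *\<^sub>R (0, 1))) has_real_derivative d\<phi> z) (at 0)"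
  shows "(LINT z|lborel. u z * d\<phi> z) = - (LINT z|lborel. w z * \<phi> z)"
proof (rule smooth_approx[OF \<phi>(1,2,4) open_open_cyl \<phi>(3)])
  fix \<Phi> K'
  assume K': "compact K'" "K' \<subseteq> open_cyl" and test: "\<And>n. test_function open_cyl (\<Phi> n)"
    and out: "\<And>n z. z \<notin> K' \<Longrightarrow> \<Phi> n z = 0" and lim: "uniform_limit UNIV \<Phi> \<phi> sequentially"
    and dlim: "\<And>b d\<phi>. b \<in> Basis \<Longrightarrow> continuous_on UNIV d\<phi> \<Longrightarrow>
       (\<And>z. ((\<lambda>s. \<phi> (z + s *\<^sub>R b)) has_real_derivative d\<phi> z) (at 0)) \<Longrightarrow>
       uniform_limit UNIV (\<lambda>n z. frechet_derivative (\<Phi> n) (at z) b) d\<phi> sequentially"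
  have B: "(0, 1) \<in> (Basis :: 'a spacetime set)" by (simp add: Basis_prod_def)
  have C: "C_k k (\<Phi> n)" for k n using test by (simp add: test_function_def)
  have l1: "(\<lambda>n. LINT z|lborel. u z * frechet_derivative (\<Phi> n) (at z) (0, 1)) \<longlonglongrightarrow> (LINT z|lborel. u z * d\<phi> z)"
  proof (rule integral_uniform_limit[OF K'(1)])
    show "integrable lborel (\<lambda>z. indicator K' z * u z)"
      using borel_integrable_compact[OF K'(1), of u] K'(2) open_cyl_subset
      by (auto intro: continuous_on_subset[OF cont_u])
    show "uniform_limit UNIV (\<lambda>n z. frechet_derivative (\<Phi> n) (at z) (0, 1)) d\<phi> sequentially"
      by (rule dlim[OF B d\<phi>])
    show "continuous_on UNIV (\<lambda>z. frechet_derivative (\<Phi> n) (at z) (0, 1))" for n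
      using C[of 1 n] B by simp
    show "frechet_derivative (\<Phi> n) (at z) (0, 1) = 0" if "z \<notin> K'" for n z
      by (rule frechet_derivative_zero_outside[OF C compact_imp_closed[OF K'(1)] out that])
  qed
  have l2: "(\<lambda>n. - (LINT z|lborel. w z * \<Phi> n z)) \<longlonglongrightarrow> - (LINT z|lborel. w z * \<phi> z)"
    by (intro tendsto_minus integral_uniform_limit[OF K'(1) integrable_w_compact[OF K'(1)]
          C_k_imp_continuous[OF C] out lim])
  show ?thesis using LIMSEQ_unique[OF l1] l2 by (simp add: weak_t_test[OF test])
qed

text \<open>The same limit for the equation. The tests to come are products of a function p with the
  heat kernel and cutoffs; they have continuous derivatives in space and are merely continuous in
  time.\<close>

lemma weak_x:
  assumes \<phi>: "continuous_on UNIV \<phi>" "compact K" "K \<subseteq> open_cyl" "\<And>z. z \<notin> K \<Longrightarrow> \<phi> z = 0"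
    and d\<phi>: "\<And>b. b \<in> Basis \<Longrightarrow> continuous_on UNIV (d\<phi> b)"
      "\<And>b z. b \<in> Basis \<Longrightarrow> ((\<lambda>s. \<phi> (z + s *\<^sub>R (b, 0))) has_real_derivative d\<phi> b z) (at 0)"
  shows "(\<Sum>b\<in>Basis. LINT z|lborel. (g z \<bullet> b) * d\<phi> b z) = - (LINT z|lborel. (w z + f z) * \<phi> z)"
proof (rule smooth_approx[OF \<phi>(1,2,4) open_open_cyl \<phi>(3)])
  fix \<Phi> K'
  assume K': "compact K'" "K' \<subseteq> open_cyl" and test: "\<And>n. test_function open_cyl (\<Phi> n)"
    and out: "\<And>n z. z \<notin> K' \<Longrightarrow> \<Phi> n z = 0" and lim: "uniform_limit UNIV \<Phi> \<phi> sequentially"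
    and dlim: "\<And>b d\<phi>. b \<in> Basis \<Longrightarrow> continuous_on UNIV d\<phi> \<Longrightarrow>
       (\<And>z. ((\<lambda>s. \<phi> (z + s *\<^sub>R b)) has_real_derivative d\<phi> z) (at 0)) \<Longrightarrow>
       uniform_limit UNIV (\<lambda>n z. frechet_derivative (\<Phi> n) (at z) b) d\<phi> sequentially"
  have B: "(b, 0) \<in> (Basis :: 'a spacetime set)" if "b \<in> Basis" for b
    using that by (subst Basis_prod_def) auto
  have C: "C_k k (\<Phi> n)" for k n using test by (simp add: test_function_def)
  have l1: "(\<lambda>n. \<Sum>b\<in>Basis. LINT z|lborel. (g z \<bullet> b) * frechet_derivative (\<Phi> n) (at z) (b, 0))
     \<longlonglongrightarrow> (\<Sum>b\<in>Basis. LINT z|lborel. (g z \<bullet> b) * d\<phi> b z)"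
  proof (rule tendsto_sum, rule integral_uniform_limit[OF K'(1)])
    fix b :: "'a \<times> real" assume b: "b \<in> Basis"
    have "continuous_on K' (\<lambda>z. g z \<bullet> b)"
      using K'(2) open_cyl_subset by (intro continuous_intros continuous_on_subset[OF cont_g]) auto
    from borel_integrable_compact[OF K'(1) this]
    show "integrable lborel (\<lambda>z. indicator K' z * (g z \<bullet> b))" by simp
    show "uniform_limit UNIV (\<lambda>n z. frechet_derivative (\<Phi> n) (at z) (b, 0)) (d\<phi> b) sequentially"
      by (rule dlim[OF B[OF b] d\<phi>[OF b]])
    show "continuous_on UNIV (\<lambda>z. frechet_derivative (\<Phi> n) (at z) (b, 0))" for n
      using C[of 1 n] B[OF b] by simp
    show "frechet_derivative (\<Phi> n) (at z) (b, 0) = 0" if "z \<notin> K'" for n z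
      by (rule frechet_derivative_zero_outside[OF C compact_imp_closed[OF K'(1)] out that])
  qed
  have i: "integrable lborel (\<lambda>z. indicator K' z * (w z + f z))"
    using integrable_w_compact[OF K'(1)] integrable_f_compact(2)[OF K'(1)] by (simp add: distrib_left)
  have l2: "(\<lambda>n. - (LINT z|lborel. (w z + f z) * \<Phi> n z)) \<longlonglongrightarrow> - (LINT z|lborel. (w z + f z) * \<phi> z)"
    by (intro tendsto_minus integral_uniform_limit[OF K'(1) i C_k_imp_continuous[OF C] out lim])
  show ?thesis using LIMSEQ_unique[OF l1] l2 by (simp add: weak_x_test[OF test])
qed

end

section \<open>Testing with the heat kernel up to the thin space\<close>

lemma positive_part_square_derivative:
  "((\<lambda>s::real. (max 0 s)\<^sup>2) has_real_derivative 2 * max 0 s) (at s)"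
proof -
  consider "s > 0" | "s < 0" | "s = 0" by linarith
  then show ?thesis
  proof cases
    case 1
    have "((\<lambda>s::real. s\<^sup>2) has_real_derivative 2 * max 0 s) (at s)"
      using 1 by (auto intro!: derivative_eq_intros)
    then show ?thesis
      by (rule has_field_derivative_transform_within_open[where S="{0<..}"]) (use 1 in auto)
  next
    case 2
    have "((\<lambda>s::real. 0) has_real_derivative 2 * max 0 s) (at s)"
      using 2 by (auto intro!: derivative_eq_intros)
    then show ?thesis
      by (rule has_field_derivative_transform_within_open[where S="{..<0}"]) (use 2 in auto)
  next
    case 3
    have "((\<lambda>h::real. (max 0 h)\<^sup>2 / h) \<longlongrightarrow> 0) (at 0)"
    proof (rule Lim_null_comparison)
      show "((\<lambda>h. \<bar>h\<bar>) \<longlongrightarrow> 0) (at (0::real))" by (auto intro!: tendsto_eq_intros)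
      show "\<forall>\<^sub>F h in at (0::real). norm ((max 0 h)\<^sup>2 / h) \<le> \<bar>h\<bar>"
        by (auto simp: eventually_at_filter max_def power2_eq_square)
    qed
    then show ?thesis using 3 by (simp add: has_field_derivative_iff)
  qed
qed

text \<open>A C^1 transition from 0 to 1 on [1, 2]; its derivative is the tent of height 2 with peak
  at 3/2. After rescaling by \<open>Suc n\<close>, this height becomes the factor 2 in the estimate
  of the boundary layer.\<close>

definition ramp :: "real \<Rightarrow> real" where
  "ramp s = 2 * (max 0 (s - 1))\<^sup>2 - 4 * (max 0 (s - 3/2))\<^sup>2 + 2 * (max 0 (s - 2))\<^sup>2"

definition ramp' :: "real \<Rightarrow> real" where
  "ramp' s = 4 * max 0 (s - 1) - 8 * max 0 (s - 3/2) + 4 * max 0 (s - 2)"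

lemma ramp_derivative: "(ramp has_real_derivative ramp' s) (at s)"
proof -
  have d: "((\<lambda>s. (max 0 (s - c))\<^sup>2) has_real_derivative 2 * max 0 (s - c)) (at s)" for c :: real
  proof -
    have "((\<lambda>s. s - c) has_real_derivative 1) (at s)" by (auto intro!: derivative_eq_intros)
    from DERIV_chain2[OF positive_part_square_derivative this] show ?thesis by simp
  qed
  show ?thesis
    unfolding ramp_def[abs_def] ramp'_def
    by (rule derivative_eq_intros d refl)+ simp
qed

lemma ramp_0: "s \<le> 1 \<Longrightarrow> ramp s = 0" and ramp_1: "2 \<le> s \<Longrightarrow> ramp s = 1"
  by (simp_all add: ramp_def max_def power2_eq_square algebra_simps)

lemma ramp'_0: "s \<le> 1 \<Longrightarrow> ramp' s = 0" "2 \<le> s \<Longrightarrow> ramp' s = 0"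
  and ramp'_bounds: "0 \<le> ramp' s" "ramp' s \<le> 2"
  by (auto simp: ramp'_def max_def)

lemma continuous_on_ramp: "continuous_on UNIV ramp" and continuous_on_ramp': "continuous_on UNIV ramp'"
  unfolding ramp_def[abs_def] ramp'_def[abs_def] by (auto intro!: continuous_intros)

lemma ramp_bounds: "0 \<le> ramp s" "ramp s \<le> 1"
proof -
  have mono: "ramp x \<le> ramp y" if "x \<le> y" for x y
    using that by (rule DERIV_nonneg_imp_nondecreasing) (use ramp_derivative ramp'_bounds in blast)
  show "0 \<le> ramp s" using mono[of "min s 1" s] ramp_0[of "min s 1"] by simp
  show "ramp s \<le> 1" using mono[of s "max s 2"] ramp_1[of "max s 2"] by simp
qed

text \<open>Open in time, so that for \<open>s2 \<le> 0\<close> the heat kernel is continuous on it,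
  but containing the thin space, so that functions continuous on it are controlled up to x_n =
  0.\<close>

definition cyl_slab :: "real \<Rightarrow> real \<Rightarrow> 'a::euclidean_space spacetime set" where
  "cyl_slab s1 s2 = {z. 0 \<le> snd (fst z) \<and> s1 < snd z \<and> snd z < s2}"

definition cyl_box :: "real \<Rightarrow> real \<Rightarrow> real \<Rightarrow> real \<Rightarrow> 'a::euclidean_space spacetime set" where
  "cyl_box r R a b = {z. r \<le> snd (fst z) \<and> norm (fst z) \<le> R \<and> a \<le> snd z \<and> snd z \<le> b}"

lemma compact_cyl_box: "compact (cyl_box r R a b)"
proof -
  have "closed (cyl_box r R a b)"
    unfolding cyl_box_def by (intro closed_Collect_conj closed_Collect_le continuous_intros)
  moreover have "cyl_box r R a b \<subseteq> cball 0 R \<times> {a..b}" by (auto simp: cyl_box_def)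
  then have "bounded (cyl_box r R a b)"
    by (rule bounded_subset[rotated]) (intro bounded_Times bounded_cball bounded_closed_interval)
  ultimately show ?thesis by (simp add: compact_eq_bounded_closed)
qed

text \<open>Each factor removes one obstacle: the support of \<open>c\<close> bounds x,
  \<open>\<theta>\<close> keeps away from the ends of the time interval, and \<open>\<eta>\<close>
  keeps away from the thin space. The product therefore extends by 0 to a continuous function with
  compact support.\<close>

lemma cutoff_continuous:
  fixes c :: "'a::euclidean_space spacetime \<Rightarrow> real"
  assumes c: "continuous_on (cyl_slab s1 s2) c"
    "\<And>z. z \<in> cyl_slab s1 s2 \<Longrightarrow> R < norm (fst z) \<Longrightarrow> c z = 0"
    and \<theta>: "continuous_on UNIV \<theta>" "\<And>t. t \<notin> {a..b} \<Longrightarrow> \<theta> t = 0" "s1 < a" "b < s2"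
    and \<eta>: "continuous_on UNIV \<eta>" "\<And>s. s \<le> r \<Longrightarrow> \<eta> s = 0" "r > 0"
  defines "F \<equiv> \<lambda>z. c z * \<theta> (snd z) * \<eta> (snd (fst z))"
  shows "continuous_on UNIV F" "\<And>z. z \<notin> cyl_box r R a b \<Longrightarrow> F z = 0" "integrable lborel F"
proof -
  show out: "F z = 0" if "z \<notin> cyl_box r R a b" for z
  proof -
    have "snd (fst z) < r \<or> snd z \<notin> {a..b} \<or> (z \<in> cyl_slab s1 s2 \<and> R < norm (fst z))"
      using that \<theta>(3,4) \<eta>(3) by (auto simp: cyl_box_def cyl_slab_def)
    then show ?thesis using c(2)[of z] \<theta>(2)[of "snd z"] \<eta>(2)[of "snd (fst z)"] by (auto simp: F_def)
  qed
  define U where "U = {z :: 'a spacetime. 0 < snd (fst z) \<and> s1 < snd z \<and> snd z < s2}"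
  have U: "open U" unfolding U_def by (intro open_Collect_conj open_Collect_less continuous_intros)
  show cont: "continuous_on UNIV F"
  proof (rule continuous_on_extend_zero[OF U])
    show "closed (cyl_box r R a b)" by (intro compact_imp_closed compact_cyl_box)
    show "cyl_box r R a b \<subseteq> U" using \<theta>(3,4) \<eta>(3) by (auto simp: cyl_box_def U_def)
    have "continuous_on U c" by (rule continuous_on_subset[OF c(1)]) (auto simp: U_def cyl_slab_def)
    then show "continuous_on U F" unfolding F_def
      by (intro continuous_intros continuous_on_compose2[OF \<theta>(1)] continuous_on_compose2[OF \<eta>(1)]) auto
  qed (rule out)
  show "integrable lborel F" by (rule integrable_compact_support[OF cont compact_cyl_box out])
qed

section \<open>The heat kernel for negative times\<close>

lemma continuous_on_heat_kernel: "continuous_on {z. snd z < 0} heat_kernel"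
proof -
  have "continuous_on {z :: 'a::euclidean_space spacetime. snd z < 0} (\<lambda>z. (- 4 * pi * snd z) powr (- real DIM('a \<times> real) / 2)
      * exp ((norm (fst z))\<^sup>2 / (4 * snd z)))"
    by (intro continuous_intros) auto
  then show ?thesis
    by (rule continuous_on_cong[THEN iffD1, OF refl, rotated]) (auto simp: heat_kernel_def case_prod_unfold)
qed

lemma heat_kernel_nonneg: "0 \<le> heat_kernel z"
  by (auto simp: heat_kernel_def case_prod_unfold)

text \<open>This is grad G = x G / (2t), the source of the drift term with (x . g) / (2t) in the
  weighted identities.\<close>

lemma heat_kernel_derivative:
  fixes x :: "'a::euclidean_space \<times> real"
  assumes "t < 0"
  shows "((\<lambda>s. heat_kernel (x + s *\<^sub>R b, t)) has_real_derivative heat_kernel (x, t) * ((x \<bullet> b) / (2 * t))) (at 0)"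
proof -
  have n: "(norm y)\<^sup>2 = y \<bullet> y" for y :: "'a \<times> real" by (simp add: power2_norm_eq_inner)
  have "((\<lambda>s. (norm (x + s *\<^sub>R b))\<^sup>2) has_real_derivative 2 * (x \<bullet> b)) (at 0)"
  proof -
    have "((\<lambda>s. x \<bullet> x + 2 * s * (x \<bullet> b) + s\<^sup>2 * (b \<bullet> b)) has_real_derivative 2 * (x \<bullet> b)) (at 0)"
      by (auto intro!: derivative_eq_intros)
    moreover have "(\<lambda>s. (norm (x + s *\<^sub>R b))\<^sup>2) = (\<lambda>s. x \<bullet> x + 2 * s * (x \<bullet> b) + s\<^sup>2 * (b \<bullet> b))"
      by (simp only: n) (simp add: inner_add inner_commute algebra_simps power2_eq_square)
    ultimately show ?thesis by simp
  qed
  from DERIV_cmult[OF DERIV_fun_exp[OF DERIV_cdivide[OF this, of "4 * t"]], of "(- 4 * pi * t) powr (- real DIM('a \<times> real) / 2)"]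
  have "((\<lambda>s. (- 4 * pi * t) powr (- real DIM('a \<times> real) / 2) * exp ((norm (x + s *\<^sub>R b))\<^sup>2 / (4 * t)))
     has_real_derivative heat_kernel (x, t) * ((x \<bullet> b) / (2 * t))) (at 0)"
    using assms by (simp add: heat_kernel_def mult.assoc)
  then show ?thesis using assms by (simp add: heat_kernel_def)
qed

context signorini
begin

lemma cyl_slab_subset: "- 1 \<le> s1 \<Longrightarrow> s2 \<le> 0 \<Longrightarrow> cyl_slab s1 s2 \<subseteq> space_cyl"
  by (auto simp: cyl_slab_def space_cyl_def)

lemma cont_kernel_slab: "s2 \<le> 0 \<Longrightarrow> continuous_on (cyl_slab s1 s2) heat_kernel"
  by (rule continuous_on_subset[OF continuous_on_heat_kernel]) (auto simp: cyl_slab_def)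

text \<open>The equation is tested with p G \<theta> \<eta>. The product rule yields the gradient of
  p, the drift from the heat kernel, and the derivative of the cutoff \<open>\<eta>\<close>. The
  last one is kept as a separate integral because it turns into the boundary term on the thin
  space.\<close>

lemma weighted_identity:
  assumes s: "- 1 \<le> s1" "s2 \<le> 0"
    and p: "continuous_on (cyl_slab s1 s2) p" "continuous_on (cyl_slab s1 s2) gp"
    and dp: "\<And>z. z \<in> cyl_slab s1 s2 \<Longrightarrow> 0 < snd (fst z) \<Longrightarrow>
        ((\<lambda>y. p (y, snd z)) has_derivative (\<lambda>v. gp z \<bullet> v)) (at (fst z))"
    and ps: "\<And>z. z \<in> cyl_slab s1 s2 \<Longrightarrow> R < norm (fst z) \<Longrightarrow> p z = 0 \<and> gp z = 0"
    and \<theta>: "continuous_on UNIV \<theta>" "\<And>t. t \<notin> {a..b} \<Longrightarrow> \<theta> t = 0" "s1 < a" "b < s2"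
    and \<eta>: "\<And>s. (\<eta> has_real_derivative \<eta>' s) (at s)" "continuous_on UNIV \<eta>'"
      "\<And>s. s \<le> r \<Longrightarrow> \<eta> s = 0" "\<And>s. s \<le> r \<Longrightarrow> \<eta>' s = 0" "r > 0"
  shows "(LINT z|lborel. (g z \<bullet> gp z + p z * (fst z \<bullet> g z) / (2 * snd z)) * heat_kernel z * \<theta> (snd z) * \<eta> (snd (fst z)))
      + (LINT z|lborel. p z * snd (g z) * heat_kernel z * \<theta> (snd z) * \<eta>' (snd (fst z)))
      = - (LINT z|lborel. (w z + f z) * (p z * heat_kernel z * \<theta> (snd z) * \<eta> (snd (fst z))))"
proof -
  define \<phi> where "\<phi> z = p z * heat_kernel z * \<theta> (snd z) * \<eta> (snd (fst z))" for z
  define X where "X b z = (gp z \<bullet> b + p z * (fst z \<bullet> b) / (2 * snd z)) * heat_kernel z * \<theta> (snd z) * \<eta> (snd (fst z))" for b z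
  define Y where "Y b z = p z * ((0, 1) \<bullet> b) * heat_kernel z * \<theta> (snd z) * \<eta>' (snd (fst z))" for b :: "'a \<times> real" and z
  have c\<eta>: "continuous_on UNIV \<eta>" using \<eta>(1) by (meson DERIV_continuous_on has_field_derivative_at_within)
  note contG = cont_kernel_slab[OF s(2)]
  have tneg: "z \<in> cyl_slab s1 s2 \<Longrightarrow> snd z \<noteq> 0" for z :: "'a spacetime" using s by (auto simp: cyl_slab_def)
  have contX: "continuous_on (cyl_slab s1 s2) (\<lambda>z. (gp z \<bullet> b + p z * (fst z \<bullet> b) / (2 * snd z)) * heat_kernel z)" for b
    by (intro continuous_intros p contG) (auto dest: tneg)
  have contY: "continuous_on (cyl_slab s1 s2) (\<lambda>z. p z * ((0, 1) \<bullet> b) * heat_kernel z)" for b :: "'a \<times> real"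
    by (intro continuous_intros p contG)
  have \<phi>: "continuous_on UNIV \<phi>" "\<And>z. z \<notin> cyl_box r R a b \<Longrightarrow> \<phi> z = 0"
    unfolding \<phi>_def[abs_def]
    using cutoff_continuous(1,2)[OF continuous_on_mult[OF p(1) contG] _ \<theta> c\<eta> \<eta>(3,5), of R] ps by auto
  have contXb: "continuous_on UNIV (X c)" "continuous_on UNIV (Y c)" for c
    unfolding X_def[abs_def] Y_def[abs_def]
    using cutoff_continuous(1)[OF contX _ \<theta> c\<eta> \<eta>(3,5), of R c]
      cutoff_continuous(1)[OF contY _ \<theta> \<eta>(2,4,5), of R c] ps by auto
  have XY0: "X c z = 0 \<and> Y c z = 0" if "z \<notin> cyl_box r R a b" for c z
    unfolding X_def Y_def
    using cutoff_continuous(2)[OF contX _ \<theta> c\<eta> \<eta>(3,5) that, of c]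
      cutoff_continuous(2)[OF contY _ \<theta> \<eta>(2,4,5) that, of c] ps by auto
  have K: "compact (cyl_box r R a b :: 'a spacetime set)" by (rule compact_cyl_box)
  have Ksub: "cyl_box r R a b \<subseteq> cyl_slab s1 s2" "cyl_box r R a b \<subseteq> open_cyl"
    using \<theta>(3,4) \<eta>(5) s by (auto simp: cyl_box_def cyl_slab_def open_cyl_def)
  have main: "(\<Sum>c\<in>Basis. LINT z|lborel. (g z \<bullet> c) * (X c z + Y c z)) = - (LINT z|lborel. (w z + f z) * \<phi> z)"
  proof (rule weak_x[OF \<phi>(1) K Ksub(2) \<phi>(2)])
    fix c :: "'a \<times> real"
    show "continuous_on UNIV (\<lambda>z. X c z + Y c z)" by (intro continuous_intros contXb)
    fix z :: "'a spacetime"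
    show "((\<lambda>s. \<phi> (z + s *\<^sub>R (c, 0))) has_real_derivative X c z + Y c z) (at 0)"
    proof (cases "z \<in> cyl_box r R a b")
      case True
      obtain x t where z: "z = (x, t)" by fastforce
      have xt: "0 < snd x" "t < 0" "z \<in> cyl_slab s1 s2"
        using True Ksub s by (auto simp: z open_cyl_def cyl_slab_def)
      have "((\<lambda>s. p (x + s *\<^sub>R c, t)) has_derivative (\<lambda>s. gp z \<bullet> (s *\<^sub>R c))) (at 0)"
        by (rule has_derivative_compose[where f="\<lambda>s. x + s *\<^sub>R c" and s=UNIV and g="\<lambda>y. p (y, t)", simplified])
           (use dp[OF xt(3)] xt in \<open>auto intro!: derivative_eq_intros simp: z\<close>)
      then have d1: "((\<lambda>s. p (x + s *\<^sub>R c, t)) has_real_derivative gp z \<bullet> c) (at 0)"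
        by (rule has_derivative_imp_has_field_derivative) simp
      have d2: "((\<lambda>s. heat_kernel (x + s *\<^sub>R c, t)) has_real_derivative heat_kernel z * ((x \<bullet> c) / (2 * t))) (at 0)"
        using heat_kernel_derivative[OF xt(2)] by (simp add: z)
      have d3: "((\<lambda>s. \<eta> (snd x + s * snd c)) has_real_derivative \<eta>' (snd x) * snd c) (at 0)"
        by (rule DERIV_chain2[where f=\<eta> and g="\<lambda>s. snd x + s * snd c"])
           (auto intro!: derivative_eq_intros \<eta>(1))
      have sc: "snd c = (0, 1) \<bullet> c" by (cases c) simp
      have "((\<lambda>s. p (x + s *\<^sub>R c, t) * heat_kernel (x + s *\<^sub>R c, t) * \<theta> t * \<eta> (snd x + s * snd c))
        has_real_derivative X c z + Y c z) (at 0)"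
        by (rule derivative_eq_intros d1 d2 d3 refl)+
           (simp add: X_def Y_def z sc algebra_simps)
      then show ?thesis by (simp add: \<phi>_def z)
    next
      case False
      have o: "open ((\<lambda>s. z + s *\<^sub>R (c, 0)) -` (- cyl_box r R a b))"
        using compact_imp_closed[OF K] by (intro open_vimage continuous_intros) auto
      have "((\<lambda>s::real. 0::real) has_real_derivative 0) (at 0)" by simp
      then have "((\<lambda>s. \<phi> (z + s *\<^sub>R (c, 0))) has_real_derivative 0) (at 0)"
        by (rule has_field_derivative_transform_within_open[OF _ o]) (use False \<phi>(2) in \<open>auto simp: zero_prod_def[symmetric]\<close>)
      then show ?thesis using XY0[OF False] by simp
    qed
  qed
  have gK: "continuous_on UNIV (\<lambda>z. (g z \<bullet> c) * F z) \<and> integrable lborel (\<lambda>z. (g z \<bullet> c) * F z)"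
    if F: "continuous_on UNIV F" "\<And>z. z \<notin> cyl_box r R a b \<Longrightarrow> F z = 0" for c F
  proof -
    have "continuous_on open_cyl (\<lambda>z. (g z \<bullet> c) * F z)"
      by (intro continuous_intros continuous_on_subset[OF cont_g open_cyl_subset] continuous_on_subset[OF F(1)]) auto
    then have 1: "continuous_on UNIV (\<lambda>z. (g z \<bullet> c) * F z)"
      by (rule continuous_on_extend_zero[OF open_open_cyl compact_imp_closed[OF K] Ksub(2)]) (simp add: F(2))
    then show ?thesis using integrable_compact_support[OF 1 K] F(2) by simp
  qed
  have iX: "integrable lborel (\<lambda>z. (g z \<bullet> c) * X c z)" and iY: "integrable lborel (\<lambda>z. (g z \<bullet> c) * Y c z)" for c
    using gK[of "X c" c] gK[of "Y c" c] contXb XY0 by auto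
  have "(\<Sum>c\<in>Basis. LINT z|lborel. (g z \<bullet> c) * (X c z + Y c z))
     = (LINT z|lborel. (\<Sum>c\<in>Basis. (g z \<bullet> c) * X c z)) + (LINT z|lborel. (\<Sum>c\<in>Basis. (g z \<bullet> c) * Y c z))"
    using iX iY by (simp add: distrib_left sum.distrib)
  moreover have "(\<Sum>c\<in>Basis. (g z \<bullet> c) * X c z)
     = (g z \<bullet> gp z + p z * (fst z \<bullet> g z) / (2 * snd z)) * heat_kernel z * \<theta> (snd z) * \<eta> (snd (fst z))" for z
  proof -
    have "(\<Sum>c\<in>Basis. (g z \<bullet> c) * X c z) = (\<Sum>c\<in>Basis. (g z \<bullet> c) * (gp z \<bullet> c) + p z / (2 * snd z) * ((fst z \<bullet> c) * (g z \<bullet> c)))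
        * heat_kernel z * \<theta> (snd z) * \<eta> (snd (fst z))"
      unfolding X_def sum_distrib_right by (intro sum.cong) (auto simp: algebra_simps)
    also have "(\<Sum>c\<in>Basis. (g z \<bullet> c) * (gp z \<bullet> c) + p z / (2 * snd z) * ((fst z \<bullet> c) * (g z \<bullet> c)))
      = g z \<bullet> gp z + p z * (fst z \<bullet> g z) / (2 * snd z)"
      by (simp add: sum.distrib euclidean_inner[of "g z" "gp z"] euclidean_inner[of "fst z" "g z"] sum_distrib_left
            sum_divide_distrib)
    finally show ?thesis .
  qed
  moreover have "(\<Sum>c\<in>Basis. (g z \<bullet> c) * Y c z)
     = p z * snd (g z) * heat_kernel z * \<theta> (snd z) * \<eta>' (snd (fst z))" for z
  proof -
    have "(\<Sum>c\<in>Basis. (g z \<bullet> c) * Y c z) = p z * (\<Sum>c\<in>Basis. (g z \<bullet> c) * ((0, 1) \<bullet> c)) * heat_kernel z * \<theta> (snd z) * \<eta>' (snd (fst z))"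
      unfolding Y_def sum_distrib_left sum_distrib_right by (intro sum.cong) (auto simp: algebra_simps)
    also have "(\<Sum>c\<in>Basis. (g z \<bullet> c) * ((0, 1) \<bullet> c)) = g z \<bullet> (0, 1)" by (rule euclidean_inner[symmetric])
    also have "\<dots> = snd (g z)" by (cases "g z") simp
    finally show ?thesis .
  qed
  ultimately show ?thesis using main by (simp add: \<phi>_def)
qed

end

text \<open>For \<open>\<delta> > 0\<close> these piecewise linear functions equal 1 on [a, b] and
  approximate its indicator from above, so the limit is the indicator of the closed interval. All of
  them vanish outside the same interval [a - \<delta>, b + \<delta>].\<close>

definition trapezoid :: "real \<Rightarrow> real \<Rightarrow> real \<Rightarrow> nat \<Rightarrow> real \<Rightarrow> real" where
  "trapezoid \<delta> a b n t = max 0 (1 - real (Suc n) / \<delta> * max 0 (max (a - t) (t - b)))"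

lemma trapezoid_bounds: "0 \<le> trapezoid \<delta> a b n t" "\<delta> > 0 \<Longrightarrow> trapezoid \<delta> a b n t \<le> 1"
  by (auto simp: trapezoid_def)

lemma continuous_on_trapezoid: "continuous_on UNIV (trapezoid \<delta> a b n)"
  unfolding trapezoid_def[abs_def] by (intro continuous_intros)

lemma trapezoid_zero:
  assumes "\<delta> > 0" "t \<notin> {a - \<delta>..b + \<delta>}"
  shows "trapezoid \<delta> a b n t = 0"
proof -
  have "\<delta> \<le> max 0 (max (a - t) (t - b))" using assms by auto
  then have "real (Suc n) / \<delta> * \<delta> \<le> real (Suc n) / \<delta> * max 0 (max (a - t) (t - b))"
    using assms by (intro mult_left_mono) auto
  then show ?thesis using assms(1) by (simp add: trapezoid_def)
qed

lemma trapezoid_tendsto: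
  assumes "\<delta> > 0"
  shows "(\<lambda>n. trapezoid \<delta> a b n t) \<longlonglongrightarrow> indicator {a..b} t"
proof (cases "t \<in> {a..b}")
  case True
  then have "trapezoid \<delta> a b n t = 1" for n by (auto simp: trapezoid_def)
  then show ?thesis using True by simp
next
  case False
  define c where "c = max 0 (max (a - t) (t - b))"
  have c: "c > 0" using False by (auto simp: c_def)
  obtain N where N: "real N > \<delta> / c" using reals_Archimedean2 by blast
  have "trapezoid \<delta> a b n t = 0" if "n \<ge> N" for n
  proof -
    have "\<delta> / c \<le> real (Suc n)" using N that by linarith
    then have "1 \<le> real (Suc n) / \<delta> * c" using c assms by (simp add: field_simps)
    then show ?thesis by (simp add: trapezoid_def c_def)
  qed
  then have "\<forall>\<^sub>F n in sequentially. trapezoid \<delta> a b n t = 0" by (auto simp: eventually_sequentially)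
  then show ?thesis using False by (simp add: tendsto_eventually)
qed

context signorini
begin

text \<open>The gradient \<open>\<eta>'\<close> of the cutoff near the thin space is nonnegative, so in the limit the boundary term
  contributes only through the sign of \<open>p z * snd (g z)\<close>.\<close>

lemma weighted_inequality:
  assumes s: "- 1 \<le> s1" "s2 \<le> 0"
    and p: "continuous_on (cyl_slab s1 s2) p" "continuous_on (cyl_slab s1 s2) gp"
    and dp: "\<And>z. z \<in> cyl_slab s1 s2 \<Longrightarrow> 0 < snd (fst z) \<Longrightarrow>
        ((\<lambda>y. p (y, snd z)) has_derivative (\<lambda>v. gp z \<bullet> v)) (at (fst z))"
    and ps: "\<And>z. z \<in> cyl_slab s1 s2 \<Longrightarrow> R < norm (fst z) \<Longrightarrow> p z = 0 \<and> gp z = 0"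
    and bdry: "\<And>z. z \<in> cyl_slab s1 s2 \<Longrightarrow> snd (fst z) = 0 \<Longrightarrow> p z * snd (g z) \<le> 0"
    and \<omega>: "continuous_on UNIV \<omega>" "\<And>t. 0 \<le> \<omega> t" and ab: "s1 < a" "a \<le> b" "b < s2"
  defines "Q \<equiv> \<lambda>z. indicator {z. 0 < snd (fst z) \<and> a \<le> snd z \<and> snd z \<le> b} z *
      (\<omega> (snd z) * heat_kernel z * (g z \<bullet> gp z + p z * (fst z \<bullet> g z) / (2 * snd z) + (w z + f z) * p z))"
  shows "integrable lborel Q" "0 \<le> integral\<^sup>L lborel Q"
proof -
  define \<delta> where "\<delta> = min (a - s1) (s2 - b) / 2"
  have \<delta>: "\<delta> > 0" using ab by (auto simp: \<delta>_def)
  define a' b' where "a' = a - \<delta>" and "b' = b + \<delta>"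
  have ab': "s1 < a'" "b' < s2" "a' \<le> b'" using ab by (auto simp: a'_def b'_def \<delta>_def min_def field_simps)
  define A where "A z = g z \<bullet> gp z + p z * (fst z \<bullet> g z) / (2 * snd z)" for z
  define \<theta> where "\<theta> n t = \<omega> t * trapezoid \<delta> a b n t" for n t
  define \<eta> where "\<eta> n s = ramp (s * real (Suc n))" for n s
  define \<eta>' where "\<eta>' n s = ramp' (s * real (Suc n)) * real (Suc n)" for n s
  define r where "r n = 1 / real (Suc n)" for n
  have r: "r n > 0" for n by (simp add: r_def)
  have rs: "s * real (Suc n) \<le> 1" if "s \<le> r n" for s n
    using that by (simp add: r_def pos_le_divide_eq)
  have \<theta>c: "continuous_on UNIV (\<theta> n)" for n unfolding \<theta>_def
    by (intro continuous_intros \<omega> continuous_on_trapezoid)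
  have \<theta>0: "\<theta> n t = 0" if "t \<notin> {a'..b'}" for n t
    using trapezoid_zero[OF \<delta>] that by (simp add: \<theta>_def a'_def b'_def)
  have \<eta>d: "(\<eta> n has_real_derivative \<eta>' n s) (at s)" for n s
    unfolding \<eta>_def[abs_def] \<eta>'_def
    by (rule DERIV_chain2[OF ramp_derivative]) (auto intro!: derivative_eq_intros)
  have \<eta>c: "continuous_on UNIV (\<eta> n)" "continuous_on UNIV (\<eta>' n)" for n
    unfolding \<eta>_def[abs_def] \<eta>'_def[abs_def]
    by (intro continuous_intros continuous_on_compose2[OF continuous_on_ramp] continuous_on_compose2[OF continuous_on_ramp']; auto)+
  have \<eta>0: "\<eta> n s = 0" "\<eta>' n s = 0" if "s \<le> r n" for n s
    using ramp_0[OF rs[OF that]] ramp'_0(1)[OF rs[OF that]] by (simp_all add: \<eta>_def \<eta>'_def)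
  note contG = cont_kernel_slab[OF s(2)]
  have contg: "continuous_on (cyl_slab s1 s2) g"
    by (rule continuous_on_subset[OF cont_g cyl_slab_subset[OF s]])
  have tneg: "z \<in> cyl_slab s1 s2 \<Longrightarrow> snd z \<noteq> 0" for z :: "'a spacetime" using s by (auto simp: cyl_slab_def)
  have contA: "continuous_on (cyl_slab s1 s2) A"
    unfolding A_def by (intro continuous_intros p contg) (auto dest: tneg)
  have A0: "A z = 0" if "z \<in> cyl_slab s1 s2" "R < norm (fst z)" for z
    using ps[OF that] by (simp add: A_def)
  have c\<omega>: "continuous_on S (\<lambda>z. \<omega> (snd z))" for S :: "'a spacetime set"
    by (intro continuous_on_compose2[OF \<omega>(1)] continuous_intros) auto
  define X where "X n z = A z * heat_kernel z * \<theta> n (snd z) * \<eta> n (snd (fst z))" for n z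
  define P where "P n z = p z * heat_kernel z * \<theta> n (snd z) * \<eta> n (snd (fst z))" for n z
  define Z where "Z n z = p z * snd (g z) * heat_kernel z * \<theta> n (snd z) * \<eta>' n (snd (fst z))" for n z
  have X: "continuous_on UNIV (X n)" "integrable lborel (X n)" for n
    unfolding X_def[abs_def]
    using cutoff_continuous(1,3)[OF continuous_on_mult[OF contA contG] _ \<theta>c \<theta>0 ab'(1,2) \<eta>c(1) \<eta>0(1) r, of R] A0 by auto
  have P: "continuous_on UNIV (P n)" "\<And>z. z \<notin> cyl_box (r n) R a' b' \<Longrightarrow> P n z = 0" for n
    unfolding P_def[abs_def]
    using cutoff_continuous(1,2)[OF continuous_on_mult[OF p(1) contG] _ \<theta>c \<theta>0 ab'(1,2) \<eta>c(1) \<eta>0(1) r, of R] ps by auto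
  have contZ: "continuous_on (cyl_slab s1 s2) (\<lambda>z. p z * snd (g z) * heat_kernel z)"
    by (intro continuous_intros p contg contG)
  have Z: "integrable lborel (Z n)" for n
    unfolding Z_def[abs_def]
    using cutoff_continuous(3)[OF contZ _ \<theta>c \<theta>0 ab'(1,2) \<eta>c(2) \<eta>0(2) r, of R] ps by auto
  have Kb: "compact (cyl_box q R a' b' :: 'a spacetime set)" for q by (rule compact_cyl_box)
  have Kbsub: "cyl_box 0 R a' b' \<subseteq> cyl_slab s1 s2" using ab' by (auto simp: cyl_box_def cyl_slab_def)
  have iwf: "integrable lborel (\<lambda>z. indicator (cyl_box q R a' b') z * (w z + f z))" for q
    using integrable_w_compact[OF Kb] integrable_f_compact(2)[OF Kb] by (simp add: distrib_left)
  have iP: "integrable lborel (\<lambda>z. (w z + f z) * P n z)" for n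
    by (rule integrable_mult_compact_support[OF Kb iwf P])
  define T where "T n z = X n z + (w z + f z) * P n z" for n z
  have iT: "integrable lborel (T n)" for n unfolding T_def[abs_def] using X iP by simp
  have TZ: "integral\<^sup>L lborel (T n) = - integral\<^sup>L lborel (Z n)" for n
  proof -
    have "(LINT z|lborel. X n z) + (LINT z|lborel. Z n z) = - (LINT z|lborel. (w z + f z) * P n z)"
      unfolding X_def Z_def P_def A_def
      by (rule weighted_identity[OF s p dp ps \<theta>c \<theta>0 ab'(1,2) \<eta>d \<eta>c(2) \<eta>0 r])
    then show ?thesis unfolding T_def using X iP by simp
  qed
  \<comment> \<open>Up to cutoffs with values in [0, 1], \<open>T n\<close> is the fixed function
    \<open>q\<close>; this yields both the pointwise limit and a bound independent of
    \<open>n\<close>.\<close>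
  define q where "q z = \<omega> (snd z) * heat_kernel z * (A z + (w z + f z) * p z)" for z
  define ct where "ct n z = trapezoid \<delta> a b n (snd z) * \<eta> n (snd (fst z))" for n and z :: "'a spacetime"
  have T_eq: "T n z = q z * ct n z" for n z
    by (simp add: T_def X_def P_def q_def ct_def \<theta>_def algebra_simps)
  have ctb: "0 \<le> ct n z" "ct n z \<le> 1" for n z
    using trapezoid_bounds[of \<delta> a b n "snd z"] \<delta> ramp_bounds[of "snd (fst z) * real (Suc n)"]
    by (auto simp: ct_def \<eta>_def mult_le_one)
  have ctlim: "(\<lambda>n. ct n z) \<longlonglongrightarrow> indicator {z. 0 < snd (fst z) \<and> a \<le> snd z \<and> snd z \<le> b} z" for z
  proof -
    have "(\<lambda>n. \<eta> n (snd (fst z))) \<longlonglongrightarrow> indicator {0<..} (snd (fst z))"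
    proof (cases "0 < snd (fst z)")
      case True
      obtain N where N: "real N > 2 / snd (fst z)" using reals_Archimedean2 by blast
      have "\<eta> n (snd (fst z)) = 1" if "n \<ge> N" for n
      proof -
        have "2 / snd (fst z) \<le> real (Suc n)" using N that by linarith
        then have "2 \<le> snd (fst z) * real (Suc n)" using True by (simp add: field_simps)
        then show ?thesis by (simp add: \<eta>_def ramp_1)
      qed
      then have "\<forall>\<^sub>F n in sequentially. \<eta> n (snd (fst z)) = 1" by (auto simp: eventually_sequentially)
      then show ?thesis using True by (simp add: tendsto_eventually)
    next
      case False
      then have "\<eta> n (snd (fst z)) = 0" for n using \<eta>0(1) r[of n] by force
      then show ?thesis using False by simp
    qed
    from tendsto_mult[OF trapezoid_tendsto[OF \<delta>] this]
    have "(\<lambda>n. ct n z) \<longlonglongrightarrow> indicator {a..b} (snd z) * indicator {0<..} (snd (fst z))"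
      by (simp add: ct_def)
    also have "indicator {a..b} (snd z) * indicator {0<..} (snd (fst z))
      = (indicator {z. 0 < snd (fst z) \<and> a \<le> snd z \<and> snd z \<le> b} z :: real)"
      by (auto simp: indicator_def)
    finally show ?thesis .
  qed
  have Q_eq: "Q z = q z * indicator {z. 0 < snd (fst z) \<and> a \<le> snd z \<and> snd z \<le> b} z" for z
    by (simp add: Q_def q_def A_def algebra_simps)
  have Tlim: "(\<lambda>n. T n z) \<longlonglongrightarrow> Q z" for z
    unfolding T_eq Q_eq by (intro tendsto_intros ctlim)
  have "\<exists>B>0. \<forall>z\<in>cyl_box 0 R a' b'. \<bar>F z\<bar> \<le> B" if "continuous_on (cyl_slab s1 s2) F" for F :: "'a spacetime \<Rightarrow> real"
  proof -
    have "bounded (F ` cyl_box 0 R a' b')"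
      by (intro compact_imp_bounded compact_continuous_image continuous_on_subset[OF that] Kbsub Kb)
    then show ?thesis unfolding bounded_pos by auto
  qed
  note bdd = this
  obtain B1 where B1: "B1 > 0" "\<And>z. z \<in> cyl_box 0 R a' b' \<Longrightarrow> \<bar>\<omega> (snd z) * heat_kernel z * A z\<bar> \<le> B1"
    using bdd[OF continuous_on_mult[OF continuous_on_mult[OF c\<omega> contG] contA]] by blast
  obtain B2 where B2: "B2 > 0" "\<And>z. z \<in> cyl_box 0 R a' b' \<Longrightarrow> \<bar>\<omega> (snd z) * heat_kernel z * p z\<bar> \<le> B2"
    using bdd[OF continuous_on_mult[OF continuous_on_mult[OF c\<omega> contG] p(1)]] by blast
  define D where "D z = indicator (cyl_box 0 R a' b') z * B1 + B2 * \<bar>indicator (cyl_box 0 R a' b') z * (w z + f z)\<bar>" for z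
  have iD: "integrable lborel D"
  proof -
    have "integrable lborel (\<lambda>z::'a spacetime. indicator (cyl_box 0 R a' b') z *\<^sub>R B1)"
      by (rule borel_integrable_compact[OF Kb]) auto
    then show ?thesis unfolding D_def[abs_def] using iwf[of 0] by simp
  qed
  have TD: "\<bar>T n z\<bar> \<le> D z" for n z
  proof (cases "z \<in> cyl_box 0 R a' b'")
    case True
    have "\<bar>q z\<bar> = \<bar>\<omega> (snd z) * heat_kernel z * A z + (w z + f z) * (\<omega> (snd z) * heat_kernel z * p z)\<bar>"
      by (simp add: q_def algebra_simps)
    also have "\<dots> \<le> \<bar>\<omega> (snd z) * heat_kernel z * A z\<bar> + \<bar>w z + f z\<bar> * \<bar>\<omega> (snd z) * heat_kernel z * p z\<bar>"
      by (metis abs_mult abs_triangle_ineq)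
    also have "\<dots> \<le> B1 + \<bar>w z + f z\<bar> * B2"
      using B1(2)[OF True] B2(2)[OF True] by (intro add_mono mult_left_mono) auto
    also have "\<dots> = D z" using True by (simp add: D_def)
    finally have "\<bar>q z\<bar> \<le> D z" .
    moreover have "\<bar>T n z\<bar> \<le> \<bar>q z\<bar> * 1"
      unfolding T_eq abs_mult using ctb[of n z] by (intro mult_left_mono) auto
    ultimately show ?thesis by simp
  next
    case False
    then have F: "z \<notin> cyl_box (r n) R a' b'" using r[of n] by (auto simp: cyl_box_def)
    have "X n z = 0"
      unfolding X_def
      using cutoff_continuous(2)[OF continuous_on_mult[OF contA contG] _ \<theta>c \<theta>0 ab'(1,2) \<eta>c(1) \<eta>0(1) r F] A0 by auto
    then have "T n z = 0" using P(2)[OF F] by (simp add: T_def)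
    moreover have "D z \<ge> 0" using B1(1) B2(1) by (simp add: D_def)
    ultimately show ?thesis by simp
  qed
  have mT: "T n \<in> borel_measurable lborel" for n using iT by auto
  have mQ: "Q \<in> borel_measurable lborel"
    by (rule borel_measurable_LIMSEQ_real[OF Tlim mT])
  have dom: "AE z in lborel. norm (T n z) \<le> D z" for n using TD by simp
  have lim: "AE z in lborel. (\<lambda>n. T n z) \<longlonglongrightarrow> Q z" using Tlim by simp
  show "integrable lborel Q"
    by (rule integrable_dominated_convergence[OF mQ mT iD lim dom])
  have L: "(\<lambda>n. integral\<^sup>L lborel (T n)) \<longlonglongrightarrow> integral\<^sup>L lborel Q"
    by (rule integral_dominated_convergence[OF mQ mT iD lim dom])

  define c3 where "c3 z = p z * snd (g z) * heat_kernel z * \<omega> (snd z)" for z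
  have c3: "continuous_on (cyl_slab s1 s2) c3"
    unfolding c3_def by (intro continuous_intros p contg contG c\<omega>)
  obtain e where e: "cball (0::'a) R \<subseteq> cbox (-e) e"
    using bounded_subset_cbox_symmetric[OF bounded_cball] by blast
  define C where "C = 2 * measure lborel (cbox (-e) e) * (b' - a')"
  \<comment> \<open>The boundary term lives in the layer where x_n is between \<open>r n\<close> and
    \<open>2 * r n\<close>. Uniform continuity and the sign at x_n = 0 bound its density by
    \<epsilon> there, the slope of the cutoff is at most 2 / \<open>r n\<close>, and the layer has
    volume proportional to \<open>r n\<close>; the product stays below \<epsilon> C.\<close>
  have "- (\<epsilon> * C) \<le> integral\<^sup>L lborel Q" if \<epsilon>: "\<epsilon> > 0" for \<epsilon>
  proof -
    have "uniformly_continuous_on (cyl_box 0 R a' b') c3"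
      by (intro compact_uniformly_continuous continuous_on_subset[OF c3] Kbsub Kb)
    then obtain d where d: "d > 0" "\<And>x y. x \<in> cyl_box 0 R a' b' \<Longrightarrow> y \<in> cyl_box 0 R a' b' \<Longrightarrow> dist x y < d
        \<Longrightarrow> dist (c3 x) (c3 y) < \<epsilon>"
      unfolding uniformly_continuous_on_def using \<epsilon> by metis
    have small: "c3 z \<le> \<epsilon>" if z: "z \<in> cyl_box 0 R a' b'" "snd (fst z) < d" for z
    proof -
      \<comment> \<open>The projection of \<open>z\<close> to the thin space: it stays in the same
        box, and its distance to \<open>z\<close> is the normal coordinate.\<close>
      define z0 where "z0 = ((fst (fst z), 0::real), snd z)"
      have "norm (fst z0) \<le> norm (fst z)"
        by (simp add: z0_def norm_prod_def real_le_rsqrt)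
      then have z0: "z0 \<in> cyl_box 0 R a' b'" using z by (simp add: cyl_box_def z0_def)
      have "dist z z0 < d"
        using z by (simp add: z0_def dist_prod_def dist_real_def cyl_box_def)
      then have "\<bar>c3 z - c3 z0\<bar> < \<epsilon>" using d(2)[OF z(1) z0] by (simp add: dist_real_def)
      moreover have "c3 z0 \<le> 0"
      proof -
        have "p z0 * snd (g z0) \<le> 0" using bdry[of z0] z0 Kbsub by (auto simp: z0_def)
        then have "(p z0 * snd (g z0)) * (heat_kernel z0 * \<omega> (snd z0)) \<le> 0"
          using heat_kernel_nonneg[of z0] \<omega>(2)[of "snd z0"]
          by (intro mult_nonpos_nonneg[of "p z0 * snd (g z0)"] mult_nonneg_nonneg)
        then show ?thesis by (simp add: c3_def mult.assoc)
      qed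
      ultimately show ?thesis by simp
    qed
    have "(\<lambda>n. 2 * r n) \<longlonglongrightarrow> 0"
      unfolding r_def using tendsto_mult_right_zero[OF lim_1_over_n[THEN LIMSEQ_Suc], of 2] by simp
    then have "\<forall>\<^sub>F n in sequentially. 2 * r n < d" by (rule order_tendstoD(2)[OF _ d(1)])
    then have "\<forall>\<^sub>F n in sequentially. - (\<epsilon> * C) \<le> integral\<^sup>L lborel (T n)"
    proof eventually_elim
      case (elim n)
      define Bx where "Bx = cbox ((-e, r n), a') ((e, 2 * r n), b')"
      have content: "measure lborel Bx = measure lborel (cbox (-e) e) * r n * (b' - a')"
        using ab'(3) r[of n] by (simp add: Bx_def content_Pair content_real)
      have Zle: "Z n z \<le> indicator Bx z *\<^sub>R (\<epsilon> * (2 * real (Suc n)))" for z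
      proof (cases "z \<in> Bx")
        case True
        show ?thesis
        proof (cases "norm (fst z) \<le> R \<and> snd (fst z) < 2 * r n")
          case T: True
          have zb: "z \<in> cyl_box 0 R a' b'" "snd (fst z) < d"
            using True T r[of n] elim by (cases z; auto simp: Bx_def cyl_box_def)+
          have "Z n z = c3 z * (trapezoid \<delta> a b n (snd z) * \<eta>' n (snd (fst z)))"
            by (simp add: Z_def c3_def \<theta>_def mult_ac)
          also have "\<dots> \<le> \<epsilon> * (1 * (2 * real (Suc n)))"
          proof (rule mult_mono)
            show "c3 z \<le> \<epsilon>" by (rule small[OF zb])
            have "\<eta>' n (snd (fst z)) \<le> 2 * real (Suc n)"
              unfolding \<eta>'_def by (intro mult_right_mono ramp'_bounds) auto
            then show "trapezoid \<delta> a b n (snd z) * \<eta>' n (snd (fst z)) \<le> 1 * (2 * real (Suc n))"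
              using trapezoid_bounds[of \<delta> a b n "snd z"] \<delta> ramp'_bounds
              by (intro mult_mono) (auto simp: \<eta>'_def)
            show "0 \<le> trapezoid \<delta> a b n (snd z) * \<eta>' n (snd (fst z))"
              using trapezoid_bounds[of \<delta> a b n "snd z"] ramp'_bounds by (simp add: \<eta>'_def)
          qed (use \<epsilon> in simp)
          finally show ?thesis using True by simp
        next
          case F: False
          have "Z n z = 0"
          proof (cases "norm (fst z) \<le> R")
            case True
            then have "2 \<le> snd (fst z) * real (Suc n)" using F by (simp add: r_def not_less pos_divide_le_eq)
            then show ?thesis by (simp add: Z_def \<eta>'_def ramp'_0)
          next
            case nR: False
            have "z \<in> cyl_slab s1 s2" using True ab' r[of n] by (cases z) (auto simp: Bx_def cyl_slab_def)
            then show ?thesis using ps nR by (simp add: Z_def)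
          qed
          then show ?thesis using True \<epsilon> by simp
        qed
      next
        case False
        have "Z n z = 0"
        proof (rule ccontr)
          assume nz: "Z n z \<noteq> 0"
          have 1: "a' \<le> snd z" "snd z \<le> b'" using \<theta>0[of "snd z" n] nz by (auto simp: Z_def)
          have 2: "r n \<le> snd (fst z)" using \<eta>0(2)[of "snd (fst z)" n] nz by (force simp: Z_def)
          have 3: "snd (fst z) \<le> 2 * r n"
          proof (rule ccontr)
            assume "\<not> snd (fst z) \<le> 2 * r n"
            then have "2 \<le> snd (fst z) * real (Suc n)" by (simp add: r_def field_simps)
            then show False using nz by (simp add: Z_def \<eta>'_def ramp'_0)
          qed
          have "z \<in> cyl_slab s1 s2" using 1 2 ab' r[of n] by (auto simp: cyl_slab_def)
          then have "norm (fst z) \<le> R" using ps[of z] nz by (force simp: Z_def)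
          then have "norm (fst (fst z)) \<le> R" using norm_fst_le[of "fst (fst z)" "snd (fst z)"] by simp
          then have "fst (fst z) \<in> cbox (-e) e" using e by auto
          then have "z \<in> Bx" using 1 2 3 by (cases z) (auto simp: Bx_def)
          then show False using False by simp
        qed
        then show ?thesis using False by simp
      qed
      have "integral\<^sup>L lborel (Z n) \<le> (LINT z|lborel. indicator Bx z *\<^sub>R (\<epsilon> * (2 * real (Suc n))))"
      proof (rule integral_mono[OF Z _ Zle])
        show "integrable lborel (\<lambda>z. indicator Bx z *\<^sub>R (\<epsilon> * (2 * real (Suc n))))"
          unfolding Bx_def by (rule borel_integrable_compact) auto
      qed
      also have "\<dots> = measure lborel Bx * (\<epsilon> * (2 * real (Suc n)))"
        by (simp add: Bx_def)
      also have "\<dots> = \<epsilon> * C * (r n * real (Suc n))" unfolding content C_def by (simp only: mult_ac)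
      also have "r n * real (Suc n) = 1" by (simp add: r_def)
      finally show ?case using TZ[of n] by simp
    qed
    then show ?thesis using tendsto_lowerbound[OF L] by simp
  qed
  note lower = this
  show "0 \<le> integral\<^sup>L lborel Q"
  proof (rule field_le_epsilon)
    fix \<epsilon> :: real assume "\<epsilon> > 0"
    have C: "C \<ge> 0" using ab'(3) by (simp add: C_def)
    have "- (\<epsilon> / (C + 1) * C) \<le> integral\<^sup>L lborel Q" using lower[of "\<epsilon> / (C + 1)"] \<open>\<epsilon> > 0\<close> C by simp
    moreover have "\<epsilon> / (C + 1) * C \<le> \<epsilon>" using \<open>\<epsilon> > 0\<close> C by (simp add: field_simps)
    ultimately show "0 \<le> integral\<^sup>L lborel Q + \<epsilon>" by simp
  qed
qed

end

section \<open>Weak convergence of time difference quotients\<close>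

lemma integrable_sq_diff:
  fixes f g :: "'b \<Rightarrow> real"
  assumes [measurable]: "f \<in> borel_measurable M" "g \<in> borel_measurable M"
    and "integrable M (\<lambda>z. (f z)\<^sup>2)" "integrable M (\<lambda>z. (g z)\<^sup>2)"
  shows "integrable M (\<lambda>z. (f z - g z)\<^sup>2)" "integrable M (\<lambda>z. f z * g z)"
proof -
  have i: "integrable M (\<lambda>z. 2 * (f z)\<^sup>2 + 2 * (g z)\<^sup>2)" using assms by simp
  have "(x - y)\<^sup>2 \<le> 2 * x\<^sup>2 + 2 * y\<^sup>2" for x y :: real
    using zero_le_power2[of "x + y"] by (simp add: power2_eq_square algebra_simps)
  then show "integrable M (\<lambda>z. (f z - g z)\<^sup>2)"
    by (intro Bochner_Integration.integrable_bound[OF i]) auto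
  have "\<bar>x * y\<bar> \<le> 2 * x\<^sup>2 + 2 * y\<^sup>2" for x y :: real
    using zero_le_power2[of "x + y"] zero_le_power2[of "x - y"] zero_le_power2[of x] zero_le_power2[of y]
    by (simp add: power2_eq_square algebra_simps abs_le_iff)
  then show "integrable M (\<lambda>z. f z * g z)"
    by (intro Bochner_Integration.integrable_bound[OF i]) (auto simp: abs_mult)
qed

text \<open>Young's inequality with a free weight \<open>s\<close> stands in for Cauchy-Schwarz; the
  choice of \<open>s\<close> is left to the applications.\<close>

lemma integral_mult_le:
  fixes f g :: "'b \<Rightarrow> real"
  assumes [measurable]: "f \<in> borel_measurable M" "g \<in> borel_measurable M"
    and i: "integrable M (\<lambda>z. (f z)\<^sup>2)" "integrable M (\<lambda>z. (g z)\<^sup>2)" and "s > 0"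
  shows "\<bar>LINT z|M. f z * g z\<bar> \<le> (s * (LINT z|M. (f z)\<^sup>2) + (LINT z|M. (g z)\<^sup>2) / s) / 2"
proof -
  have pt: "\<bar>x * y\<bar> \<le> s / 2 * x\<^sup>2 + 1 / (2 * s) * y\<^sup>2" for x y :: real
  proof -
    have "0 \<le> (s * \<bar>x\<bar> - \<bar>y\<bar>)\<^sup>2" by simp
    then have "2 * s * \<bar>x * y\<bar> \<le> s\<^sup>2 * x\<^sup>2 + y\<^sup>2" by (simp add: power2_diff power_mult_distrib abs_mult mult_ac)
    then have "(2 * s * \<bar>x * y\<bar>) / (2 * s) \<le> (s\<^sup>2 * x\<^sup>2 + y\<^sup>2) / (2 * s)"
      using \<open>s > 0\<close> by (intro divide_right_mono) auto
    then show ?thesis using \<open>s > 0\<close> by (simp add: add_divide_distrib power2_eq_square)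
  qed
  have "\<bar>LINT z|M. f z * g z\<bar> \<le> (LINT z|M. s / 2 * (f z)\<^sup>2 + 1 / (2 * s) * (g z)\<^sup>2)"
    by (rule integral_abs_bound[THEN order_trans], rule integral_mono)
       (use i pt in \<open>auto intro!: integrable_abs integrable_sq_diff(2)\<close>)
  then show ?thesis using i \<open>s > 0\<close> by (simp add: field_simps)
qed

text \<open>Urysohn's lemma separates each set of a compact exhaustion from the complement of the
  interior of the next one.\<close>

lemma compact_cutoff_exhaustion:
  fixes U :: "'b::euclidean_space set"
  assumes "open U"
  obtains c :: "nat \<Rightarrow> 'b \<Rightarrow> real" and K where "\<And>n. continuous_on UNIV (c n)" "\<And>n z. 0 \<le> c n z \<and> c n z \<le> 1"
    "\<And>n. compact (K n)" "\<And>n. K n \<subseteq> U" "\<And>n z. z \<notin> K n \<Longrightarrow> c n z = 0"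
    "\<And>z. (\<lambda>n. c n z) \<longlonglongrightarrow> indicator U z"
proof -
  obtain C where C: "\<And>n. compact (C n)" "\<And>n. C n \<subseteq> U" "\<And>n. C n \<subseteq> interior (C (Suc n))" "\<Union>(range C) = U"
      "\<And>K. \<lbrakk>compact K; K \<subseteq> U\<rbrakk> \<Longrightarrow> \<exists>N. \<forall>n\<ge>N. K \<subseteq> (C n)"
    using open_Union_compact_subsets[OF assms] by metis
  have "\<exists>c::'b \<Rightarrow> real. continuous_on UNIV c \<and> (\<forall>z. 0 \<le> c z \<and> c z \<le> 1) \<and> (\<forall>z\<in>C n. c z = 1)
      \<and> (\<forall>z. z \<notin> C (Suc n) \<longrightarrow> c z = 0)" for n
  proof -
    have disj: "C n \<inter> (- interior (C (Suc n))) = {}" using C(3) by blast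
    have cl: "closed (C n)" "closed (- interior (C (Suc n)))" using C(1) compact_imp_closed by auto
    obtain c :: "'b \<Rightarrow> real" where c: "continuous_on UNIV c" "\<And>x. c x \<in> closed_segment 1 0"
        "\<And>x. x \<in> C n \<Longrightarrow> c x = 1" "\<And>x. x \<in> - interior (C (Suc n)) \<Longrightarrow> c x = 0"
      using Urysohn[OF cl disj, of "1::real" 0] by metis
    have "0 \<le> c z \<and> c z \<le> 1" for z using c(2)[of z] by (auto simp: closed_segment_eq_real_ivl)
    then show ?thesis using c interior_subset[of "C (Suc n)"] by (intro exI[of _ c]) blast
  qed
  then obtain c :: "nat \<Rightarrow> 'b \<Rightarrow> real" where c: "\<And>n. continuous_on UNIV (c n)" "\<And>n z. 0 \<le> c n z \<and> c n z \<le> 1"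
      "\<And>n z. z \<in> C n \<Longrightarrow> c n z = 1" "\<And>n z. z \<notin> C (Suc n) \<Longrightarrow> c n z = 0"
    by metis
  have lim: "(\<lambda>n. c n z) \<longlonglongrightarrow> indicator U z" for z
  proof (cases "z \<in> U")
    case True
    then obtain N where "\<forall>n\<ge>N. {z} \<subseteq> C n" using C(5)[of "{z}"] by auto
    then have "\<forall>\<^sub>F n in sequentially. c n z = 1" using c(3) by (auto simp: eventually_sequentially)
    then show ?thesis using True by (simp add: tendsto_eventually)
  next
    case False
    then have "c n z = 0" for n using c(4) C(2) by blast
    then show ?thesis using False by simp
  qed
  show thesis
    by (rule that[of c "\<lambda>n. C (Suc n)"]) (use c C(1,2) lim in blast)+
qed

text \<open>Two approximations, each with squared error below e/4: truncation of \<open>k\<close> in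
  value and in space, by dominated convergence, and then replacement of \<open>k\<close> by a
  continuous function under the same truncation. Estimating the square of the sum costs a factor 2,
  which gives e.\<close>

lemma L2_dense:
  fixes k :: "'b::euclidean_space \<Rightarrow> real"
  assumes [measurable]: "k \<in> borel_measurable borel" and k2: "integrable lborel (\<lambda>z. (k z)\<^sup>2)"
    and U: "open U" "\<And>z. z \<notin> U \<Longrightarrow> k z = 0" and "e > 0"
  obtains \<phi> K where "continuous_on UNIV \<phi>" "compact K" "K \<subseteq> U" "\<And>z. z \<notin> K \<Longrightarrow> \<phi> z = 0"
    "integrable lborel (\<lambda>z. (k z - \<phi> z)\<^sup>2)" "(LINT z|lborel. (k z - \<phi> z)\<^sup>2) < e"
proof (rule compact_cutoff_exhaustion[OF U(1)])
  fix c :: "nat \<Rightarrow> 'b \<Rightarrow> real" and K assume c: "\<And>n. continuous_on UNIV (c n)" "\<And>n z. 0 \<le> c n z \<and> c n z \<le> 1"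
    "\<And>n. compact (K n)" "\<And>n. K n \<subseteq> U" "\<And>n z. z \<notin> K n \<Longrightarrow> c n z = 0"
    "\<And>z. (\<lambda>n. c n z) \<longlonglongrightarrow> indicator U z"
  have [measurable]: "c n \<in> borel_measurable borel" for n
    using c(1) by (rule borel_measurable_continuous_onI)
  define clip where "clip n y = max (- real n) (min (real n) y)" for n y
  have clip: "\<bar>clip n y\<bar> \<le> \<bar>y\<bar>" "\<bar>clip n y\<bar> \<le> real n" for n y by (auto simp: clip_def)
  have clip_cont: "continuous_on UNIV (clip n)" for n unfolding clip_def by (intro continuous_intros)
  have [measurable]: "clip n \<in> borel_measurable borel" for n
    using clip_cont by (rule borel_measurable_continuous_onI)
  have clip_lim: "(\<lambda>n. clip n y) \<longlonglongrightarrow> y" for y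
  proof -
    obtain N where "real N > \<bar>y\<bar>" using reals_Archimedean2 by blast
    then have "\<forall>\<^sub>F n in sequentially. clip n y = y"
      unfolding eventually_sequentially by (intro exI[of _ N]) (auto simp: clip_def)
    then show ?thesis by (simp add: tendsto_eventually)
  qed
  define k1 where "k1 n z = c n z * clip n (k z)" for n z
  have [measurable]: "k1 n \<in> borel_measurable borel" for n unfolding k1_def by measurable
  have k1_le: "\<bar>k1 n z\<bar> \<le> \<bar>k z\<bar>" for n z
    using mult_mono[of "\<bar>c n z\<bar>" 1 "\<bar>clip n (k z)\<bar>" "\<bar>k z\<bar>"] c(2)[of n z] clip(1)[of n "k z"]
    by (simp add: k1_def abs_mult)
  have sq: "(x - y)\<^sup>2 \<le> 4 * x\<^sup>2" if "\<bar>y\<bar> \<le> \<bar>x\<bar>" for x y :: real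
  proof -
    have "\<bar>x - y\<bar> \<le> 2 * \<bar>x\<bar>" using that by linarith
    then have "\<bar>x - y\<bar>\<^sup>2 \<le> (2 * \<bar>x\<bar>)\<^sup>2" by (intro power_mono) auto
    then show ?thesis by (simp add: power_mult_distrib)
  qed
  have "(\<lambda>n. LINT z|lborel. (k z - k1 n z)\<^sup>2) \<longlonglongrightarrow> (LINT z::'b|lborel. (0::real))"
  proof (rule integral_dominated_convergence)
    show "integrable lborel (\<lambda>z. 4 * (k z)\<^sup>2)" using k2 by simp
    have "(\<lambda>n. (k z - k1 n z)\<^sup>2) \<longlonglongrightarrow> (k z - indicator U z * k z)\<^sup>2" for z
      unfolding k1_def by (intro tendsto_intros c(6) clip_lim)
    moreover have "(k z - indicator U z * k z)\<^sup>2 = 0" for z using U(2) by (auto simp: indicator_def)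
    ultimately show "AE z in lborel. (\<lambda>n. (k z - k1 n z)\<^sup>2) \<longlonglongrightarrow> 0" by simp
    show "AE z in lborel. norm ((k z - k1 n z)\<^sup>2) \<le> 4 * (k z)\<^sup>2" for n
      using sq[OF k1_le] by simp
  qed measurable
  then have "\<forall>\<^sub>F n in sequentially. (LINT z|lborel. (k z - k1 n z)\<^sup>2) < e / 4"
    using \<open>e > 0\<close> by (intro order_tendstoD(2)) auto
  then obtain n where n: "(LINT z|lborel. (k z - k1 n z)\<^sup>2) < e / 4"
    by (auto simp: eventually_sequentially)
  have k1_sq: "integrable lborel (\<lambda>z. (k1 n z)\<^sup>2)"
    by (rule Bochner_Integration.integrable_bound[OF k2]) (use k1_le in \<open>auto simp: abs_le_square_iff\<close>)
  have i1: "integrable lborel (\<lambda>z. (k z - k1 n z)\<^sup>2)"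
    by (rule integrable_sq_diff[OF _ _ k2 k1_sq]) auto
  \<comment> \<open>A measurable function is almost everywhere a limit of continuous ones; clipping
    these and multiplying by the cutoff keeps the sequence dominated.\<close>
  have "k \<in> borel_measurable lebesgue" by (auto intro: measurable_completion)
  then have "k measurable_on UNIV"
    by (intro lebesgue_measurable_imp_measurable_on) auto
  then obtain N G where N: "negligible N" and G: "\<And>m. continuous_on UNIV (G m)"
      "\<And>x. x \<notin> N \<Longrightarrow> (\<lambda>m. G m x) \<longlonglongrightarrow> k x"
    unfolding measurable_on_def by auto
  have AEN: "AE z in lborel. z \<notin> N"
  proof -
    have "N \<in> null_sets lebesgue" using N by (simp add: negligible_iff_null_sets)
    then have "AE z in lebesgue. z \<notin> N" by (rule AE_not_in)
    then show ?thesis by (simp add: AE_completion_iff)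
  qed
  define k2' where "k2' m z = c n z * clip n (G m z)" for m z
  have cont2: "continuous_on UNIV (k2' m)" for m
    unfolding k2'_def by (intro continuous_intros c(1) continuous_on_compose2[OF clip_cont] G(1)) auto
  have [measurable]: "k2' m \<in> borel_measurable borel" for m
    using cont2 by (rule borel_measurable_continuous_onI)
  have out2: "k2' m z = 0" if "z \<notin> K n" for m z using c(5) that by (simp add: k2'_def)
  have "(\<lambda>m. LINT z|lborel. (k1 n z - k2' m z)\<^sup>2) \<longlonglongrightarrow> (LINT z::'b|lborel. (0::real))"
  proof (rule integral_dominated_convergence)
    show "integrable lborel (\<lambda>z. indicator (K n) z *\<^sub>R ((2 * real n)\<^sup>2))"
      by (rule borel_integrable_compact[OF c(3)]) auto
    show "AE z in lborel. (\<lambda>m. (k1 n z - k2' m z)\<^sup>2) \<longlonglongrightarrow> 0"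
      using AEN
    proof eventually_elim
      case (elim z)
      have "isCont (clip n) (k z)" using clip_cont by (simp add: continuous_on_eq_continuous_at)
      then have "(\<lambda>m. clip n (G m z)) \<longlonglongrightarrow> clip n (k z)"
        by (rule isCont_tendsto_compose[OF _ G(2)[OF elim]])
      then have "(\<lambda>m. (k1 n z - k2' m z)\<^sup>2) \<longlonglongrightarrow> (k1 n z - c n z * clip n (k z))\<^sup>2"
        unfolding k2'_def by (intro tendsto_intros)
      then show ?case by (simp add: k1_def)
    qed
    have "(k1 n z - k2' m z)\<^sup>2 \<le> indicator (K n) z *\<^sub>R ((2 * real n)\<^sup>2)" for m z
    proof (cases "z \<in> K n")
      case True
      have "k1 n z - k2' m z = c n z * (clip n (k z) - clip n (G m z))"
        by (simp add: k1_def k2'_def algebra_simps)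
      then have "\<bar>k1 n z - k2' m z\<bar> = c n z * \<bar>clip n (k z) - clip n (G m z)\<bar>"
        using c(2)[of n z] by (simp add: abs_mult)
      also have "\<dots> \<le> 1 * (2 * real n)"
        using c(2)[of n z] clip(2)[of n "k z"] clip(2)[of n "G m z"] by (intro mult_mono) auto
      finally have "\<bar>k1 n z - k2' m z\<bar>\<^sup>2 \<le> (2 * real n)\<^sup>2" by (intro power_mono) auto
      then show ?thesis using True by simp
    qed (simp add: out2 k1_def c(5))
    then show "AE z in lborel. norm ((k1 n z - k2' m z)\<^sup>2) \<le> indicator (K n) z *\<^sub>R ((2 * real n)\<^sup>2)" for m
      by simp
  qed measurable
  then have "\<forall>\<^sub>F m in sequentially. (LINT z|lborel. (k1 n z - k2' m z)\<^sup>2) < e / 4"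
    using \<open>e > 0\<close> by (intro order_tendstoD(2)) auto
  then obtain m where m: "(LINT z|lborel. (k1 n z - k2' m z)\<^sup>2) < e / 4"
    by (auto simp: eventually_sequentially)
  have k2_sq: "integrable lborel (\<lambda>z. (k2' m z)\<^sup>2)"
    by (rule integrable_compact_support[OF _ c(3)[of n]]) (auto intro!: continuous_intros cont2 simp: out2)
  have i2: "integrable lborel (\<lambda>z. (k1 n z - k2' m z)\<^sup>2)"
    by (rule integrable_sq_diff[OF _ _ k1_sq k2_sq]) auto
  have i3: "integrable lborel (\<lambda>z. (k z - k2' m z)\<^sup>2)"
    by (rule integrable_sq_diff[OF _ _ k2 k2_sq]) auto
  have "(LINT z|lborel. (k z - k2' m z)\<^sup>2) \<le> (LINT z|lborel. 2 * (k z - k1 n z)\<^sup>2 + 2 * (k1 n z - k2' m z)\<^sup>2)"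
  proof (rule integral_mono[OF i3])
    show "integrable lborel (\<lambda>z. 2 * (k z - k1 n z)\<^sup>2 + 2 * (k1 n z - k2' m z)\<^sup>2)" using i1 i2 by simp
    have "(x - y)\<^sup>2 \<le> 2 * (x - z)\<^sup>2 + 2 * (z - y)\<^sup>2" for x y z :: real
      using zero_le_power2[of "(x - z) - (z - y)"] by (simp add: power2_eq_square algebra_simps)
    then show "(k z - k2' m z)\<^sup>2 \<le> 2 * (k z - k1 n z)\<^sup>2 + 2 * (k1 n z - k2' m z)\<^sup>2" for z .
  qed
  also have "\<dots> < e" using n m i1 i2 by simp
  finally show thesis
    using that[OF cont2 c(3) c(4) out2 i3] by blast
qed

text \<open>Bounded L2 norms reduce convergence against L2 functions to convergence against the
  dense class of continuous functions with compact support in \<open>U\<close>.\<close>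

lemma weak_convergence_extend:
  fixes q :: "nat \<Rightarrow> 'b::euclidean_space \<Rightarrow> real" and W k :: "'b \<Rightarrow> real"
  assumes U: "open U"
    and q: "\<And>n. q n \<in> borel_measurable borel" "\<And>n. integrable lborel (\<lambda>z. (q n z)\<^sup>2)"
      "\<And>n. (LINT z|lborel. (q n z)\<^sup>2) \<le> C"
    and W: "W \<in> borel_measurable borel" "integrable lborel (\<lambda>z. (W z)\<^sup>2)"
    and test: "\<And>\<phi> K. continuous_on UNIV \<phi> \<Longrightarrow> compact K \<Longrightarrow> K \<subseteq> U \<Longrightarrow> (\<And>z. z \<notin> K \<Longrightarrow> \<phi> z = 0) \<Longrightarrow>
      (\<lambda>n. LINT z|lborel. q n z * \<phi> z) \<longlonglongrightarrow> (LINT z|lborel. W z * \<phi> z)"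
    and k: "k \<in> borel_measurable borel" "integrable lborel (\<lambda>z. (k z)\<^sup>2)" "\<And>z. z \<notin> U \<Longrightarrow> k z = 0"
  shows "(\<lambda>n. LINT z|lborel. q n z * k z) \<longlonglongrightarrow> (LINT z|lborel. W z * k z)"
proof (rule tendstoI)
  fix e :: real assume "e > 0"
  define D where "D = max C (LINT z|lborel. (W z)\<^sup>2) + 1"
  have D: "D > 0" "\<And>n. (LINT z|lborel. (q n z)\<^sup>2) \<le> D" "(LINT z|lborel. (W z)\<^sup>2) \<le> D"
  proof -
    have "0 \<le> (LINT z|lborel. (W z)\<^sup>2)" by simp
    then show "D > 0" "(LINT z|lborel. (W z)\<^sup>2) \<le> D" unfolding D_def by linarith+
    show "(LINT z|lborel. (q n z)\<^sup>2) \<le> D" for n using q(3)[of n] unfolding D_def by linarith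
  qed
  \<comment> \<open>\<open>s\<close> and \<open>e'\<close> are chosen such that s D = e/4 and e'/s =
    e/4. Replacing \<open>k\<close> by \<open>\<phi>\<close> then costs at most e/4, both for the
    sequence and for its limit.\<close>
  define s where "s = e / (4 * D)"
  have s: "s > 0" using \<open>e > 0\<close> D by (simp add: s_def)
  define e' where "e' = s * e / 4"
  have e': "e' > 0" using s \<open>e > 0\<close> by (simp add: e'_def)
  show "\<forall>\<^sub>F n in sequentially. dist (LINT z|lborel. q n z * k z) (LINT z|lborel. W z * k z) < e"
  proof (rule L2_dense[OF k(1,2) U k(3) e'])
    fix \<phi> K assume \<phi>: "continuous_on UNIV \<phi>" "compact K" "K \<subseteq> U" "\<And>z. z \<notin> K \<Longrightarrow> \<phi> z = 0"
      and i: "integrable lborel (\<lambda>z. (k z - \<phi> z)\<^sup>2)" and less: "(LINT z|lborel. (k z - \<phi> z)\<^sup>2) < e'"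
    have m: "\<phi> \<in> borel_measurable borel" using \<phi>(1) by (rule borel_measurable_continuous_onI)
    have \<phi>2: "integrable lborel (\<lambda>z. (\<phi> z)\<^sup>2)"
      by (rule integrable_compact_support[OF _ \<phi>(2)]) (auto intro!: continuous_intros \<phi>(1) simp: \<phi>(4))
    have close: "\<bar>(LINT z|lborel. F z * k z) - (LINT z|lborel. F z * \<phi> z)\<bar> \<le> e / 4"
      if F: "F \<in> borel_measurable borel" "integrable lborel (\<lambda>z. (F z)\<^sup>2)" "(LINT z|lborel. (F z)\<^sup>2) \<le> D" for F
    proof -
      have "integrable lborel (\<lambda>z. F z * k z)" "integrable lborel (\<lambda>z. F z * \<phi> z)"
        using integrable_sq_diff(2)[OF _ _ F(2) k(2)] integrable_sq_diff(2)[OF _ _ F(2) \<phi>2] F(1) k(1) m by auto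
      then have "(LINT z|lborel. F z * k z) - (LINT z|lborel. F z * \<phi> z) = (LINT z|lborel. F z * (k z - \<phi> z))"
        by (simp add: right_diff_distrib)
      also have "\<bar>\<dots>\<bar> \<le> (s * (LINT z|lborel. (F z)\<^sup>2) + (LINT z|lborel. (k z - \<phi> z)\<^sup>2) / s) / 2"
        using F(1) k(1) m by (intro integral_mult_le F(2) i s) auto
      also have "\<dots> \<le> (s * D + e' / s) / 2"
        using F(3) less s by (intro divide_right_mono add_mono mult_left_mono) auto
      also have "\<dots> = e / 4" using s D by (simp add: e'_def s_def)
      finally show ?thesis .
    qed
    have "\<forall>\<^sub>F n in sequentially. dist (LINT z|lborel. q n z * \<phi> z) (LINT z|lborel. W z * \<phi> z) < e / 4"
      using test[OF \<phi>] \<open>e > 0\<close> by (intro tendstoD) auto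
    then show "\<forall>\<^sub>F n in sequentially. dist (LINT z|lborel. q n z * k z) (LINT z|lborel. W z * k z) < e"
    proof eventually_elim
      case (elim n)
      show ?case using close[OF q(1,2) D(2), of n] close[OF W D(3)] elim \<open>e > 0\<close>
        unfolding dist_real_def by linarith
    qed
  qed
qed

text \<open>The Steklov average over the forward interval. Its time derivative is the forward
  difference quotient of \<open>\<phi>\<close>, so using it as a test function produces, after a
  translation, the backward quotient of \<open>u\<close>.\<close>

definition time_average :: "real \<Rightarrow> ('b::euclidean_space \<times> real \<Rightarrow> real) \<Rightarrow> 'b \<times> real \<Rightarrow> real" where
  "time_average h \<phi> z = integral {0..h} (\<lambda>\<theta>. \<phi> (z + \<theta> *\<^sub>R (0, 1))) / h"

text \<open>The average at a point looks forward in time, so its support arises from that of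
  \<open>\<phi>\<close> by going backward.\<close>

definition time_shadow :: "real \<Rightarrow> ('b::euclidean_space \<times> real) set \<Rightarrow> ('b \<times> real) set" where
  "time_shadow h K = {z. \<exists>\<theta>\<in>{0..h}. z + \<theta> *\<^sub>R (0, 1) \<in> K}"

lemma compact_time_shadow: "compact K \<Longrightarrow> compact (time_shadow h K)"
proof -
  assume "compact K"
  then have "compact ((\<lambda>(z, \<theta>). z - \<theta> *\<^sub>R (0, 1)) ` (K \<times> {0..h}))"
    by (intro compact_continuous_image compact_Times) (auto intro!: continuous_intros simp: case_prod_unfold)
  moreover have "(\<lambda>(z, \<theta>). z - \<theta> *\<^sub>R (0, 1)) ` (K \<times> {0..h}) = time_shadow h K"
  proof (intro set_eqI iffI)
    fix z assume "z \<in> time_shadow h K"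
    then obtain \<theta> where "\<theta> \<in> {0..h}" "z + \<theta> *\<^sub>R (0, 1) \<in> K" by (auto simp: time_shadow_def)
    then show "z \<in> (\<lambda>(z, \<theta>). z - \<theta> *\<^sub>R (0, 1)) ` (K \<times> {0..h})"
      by (intro image_eqI[of _ _ "(z + \<theta> *\<^sub>R (0, 1), \<theta>)"]) (auto simp: algebra_simps)
  qed (force simp: time_shadow_def)
  ultimately show ?thesis by simp
qed

lemma continuous_time_slice:
  fixes \<phi> :: "'b::euclidean_space \<times> real \<Rightarrow> real"
  assumes "continuous_on UNIV \<phi>"
  shows "continuous_on S (\<lambda>\<theta>. \<phi> (z + \<theta> *\<^sub>R (0, 1)))"
  by (rule continuous_on_compose2[OF assms]) (auto intro!: continuous_intros)

lemma continuous_time_average: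
  fixes \<phi> :: "'b::euclidean_space \<times> real \<Rightarrow> real"
  assumes "continuous_on UNIV \<phi>"
  shows "continuous_on UNIV (time_average h \<phi>)"
proof -
  have "continuous_on (UNIV \<times> cbox 0 h) (\<lambda>(z, \<theta>). \<phi> (z + \<theta> *\<^sub>R (0, 1)))"
    unfolding case_prod_unfold by (rule continuous_on_compose2[OF assms]) (auto intro!: continuous_intros)
  from integral_continuous_on_param[OF this] show ?thesis
    unfolding time_average_def[abs_def] divide_inverse by (intro continuous_on_mult_right) simp
qed

lemma time_average_zero:
  assumes "\<And>z. z \<notin> K \<Longrightarrow> \<phi> z = 0" "z \<notin> time_shadow h K"
  shows "time_average h \<phi> z = 0"
proof -
  have "integral {0..h} (\<lambda>\<theta>. \<phi> (z + \<theta> *\<^sub>R (0, 1))) = integral {0..h} (\<lambda>_. 0)"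
    using assms by (intro integral_cong) (auto simp: time_shadow_def)
  then show ?thesis by (simp add: time_average_def)
qed

lemma time_average_derivative:
  fixes \<phi> :: "'b::euclidean_space \<times> real \<Rightarrow> real"
  assumes \<phi>: "continuous_on UNIV \<phi>" and h: "h > 0"
  shows "((\<lambda>s. time_average h \<phi> (z + s *\<^sub>R (0, 1))) has_real_derivative (\<phi> (z + h *\<^sub>R (0, 1)) - \<phi> z) / h) (at 0)"
proof -
  define f where "f \<theta> = \<phi> (z + \<theta> *\<^sub>R (0, 1))" for \<theta>
  have cf: "continuous_on S f" for S unfolding f_def by (rule continuous_time_slice[OF \<phi>])
  have int: "f integrable_on {c..d}" for c d by (rule integrable_continuous_real[OF cf])
  \<comment> \<open>The base point -1 is an arbitrary number below 0; it makes both 0 and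
    \<open>h\<close> points at which \<open>F\<close> has a two-sided derivative.\<close>
  define F where "F s = integral {- 1..s} f" for s
  have F': "(F has_real_derivative f s) (at s)" if "- 1 < s" for s
  proof -
    have "(F has_real_derivative f s) (at s within {- 1..s + 1})"
      unfolding F_def using that by (intro integral_has_real_derivative cf) auto
    then show ?thesis using that by (simp add: at_within_Icc_at)
  qed
  have d: "((\<lambda>s. (F (s + h) - F s) / h) has_real_derivative (f h - f 0) / h) (at 0)"
  proof -
    have "((\<lambda>s. F (s + h)) has_real_derivative f h) (at 0)"
      using F'[of h] h DERIV_shift[of F "f h" 0 h] by simp
    then show ?thesis using F'[of 0] h by (auto intro!: derivative_eq_intros)
  qed
  have eq: "(F (s + h) - F s) / h = time_average h \<phi> (z + s *\<^sub>R (0, 1))" if "s \<in> {- 1<..}" for s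
  proof -
    have "F (s + h) - F s = integral {s..s + h} f"
      unfolding F_def using that h Henstock_Kurzweil_Integration.integral_combine[of "-1" s "s + h" f] int by auto
    also have "\<dots> = integral {0..h} (\<lambda>\<theta>. f (\<theta> + s))"
      using integral_shift_Icc_real[of 0 h f s] by (simp add: o_def add.commute)
    also have "\<dots> = integral {0..h} (\<lambda>\<theta>. \<phi> (z + s *\<^sub>R (0, 1) + \<theta> *\<^sub>R (0, 1)))"
      by (simp add: f_def algebra_simps)
    finally show ?thesis by (simp add: time_average_def)
  qed
  have "((\<lambda>s. time_average h \<phi> (z + s *\<^sub>R (0, 1))) has_real_derivative (f h - f 0) / h) (at 0)"
    by (rule has_field_derivative_transform_within_open[OF d, of "{- 1<..}"]) (use eq in auto)
  then show ?thesis by (simp add: f_def zero_prod_def[symmetric])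
qed

lemma time_average_close:
  fixes \<phi> :: "'b::euclidean_space \<times> real \<Rightarrow> real"
  assumes \<phi>: "continuous_on UNIV \<phi>" and h: "h > 0" and e: "\<And>\<theta>. \<theta> \<in> {0..h} \<Longrightarrow> \<bar>\<phi> (z + \<theta> *\<^sub>R (0, 1)) - \<phi> z\<bar> \<le> e"
  shows "\<bar>time_average h \<phi> z - \<phi> z\<bar> \<le> e"
proof -
  have i: "(\<lambda>\<theta>. \<phi> (z + \<theta> *\<^sub>R (0, 1))) integrable_on {0..h}"
    by (rule integrable_continuous_real[OF continuous_time_slice[OF \<phi>]])
  have "integral {0..h} (\<lambda>\<theta>. \<phi> (z + \<theta> *\<^sub>R (0, 1)) - \<phi> z) = h * (time_average h \<phi> z - \<phi> z)"
    using i h by (subst Henstock_Kurzweil_Integration.integral_diff) (auto simp: time_average_def algebra_simps)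
  moreover have "norm (integral {0..h} (\<lambda>\<theta>. \<phi> (z + \<theta> *\<^sub>R (0, 1)) - \<phi> z)) \<le> e * (h - 0)"
    using h e by (intro integral_bound continuous_on_diff[OF continuous_time_slice[OF \<phi>] continuous_on_const]) auto
  ultimately have "h * \<bar>time_average h \<phi> z - \<phi> z\<bar> \<le> h * e" using h by (simp add: abs_mult mult.commute)
  then show ?thesis using h by simp
qed

text \<open>Jensen's inequality bounds the square of an average by the average of the square; Fubini
  and translation invariance then integrate the latter.\<close>

lemma time_average_L2:
  fixes \<phi> :: "'b::euclidean_space \<times> real \<Rightarrow> real"
  assumes \<phi>: "continuous_on UNIV \<phi>" "compact K" "\<And>z. z \<notin> K \<Longrightarrow> \<phi> z = 0" and h: "h > 0"
  shows "(LINT z|lborel. (time_average h \<phi> z)\<^sup>2) \<le> (LINT z|lborel. (\<phi> z)\<^sup>2)"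
proof -
  define f where "f z \<theta> = indicator {0..h} \<theta> * (\<phi> (z + \<theta> *\<^sub>R (0, 1)))\<^sup>2" for z and \<theta> :: real
  have [measurable]: "\<phi> \<in> borel_measurable borel" using \<phi>(1) by (rule borel_measurable_continuous_onI)
  have int: "integrable (lborel \<Otimes>\<^sub>M lborel) (case_prod f)"
  proof -
    have "integrable lborel (\<lambda>x. indicator (time_shadow h K \<times> {0..h}) x *\<^sub>R (\<phi> (fst x + snd x *\<^sub>R (0, 1)))\<^sup>2)"
      by (intro borel_integrable_compact compact_Times compact_time_shadow \<phi>(2) continuous_intros
            continuous_on_compose2[OF \<phi>(1)]) auto
    also have "(\<lambda>x. indicator (time_shadow h K \<times> {0..h}) x *\<^sub>R (\<phi> (fst x + snd x *\<^sub>R (0, 1)))\<^sup>2) = case_prod f"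
      using \<phi>(3) by (auto simp: f_def fun_eq_iff indicator_def time_shadow_def)
    finally show ?thesis by (simp add: lborel_prod)
  qed
  have Jensen: "(time_average h \<phi> z)\<^sup>2 \<le> (LINT \<theta>|lborel. f z \<theta>) / h" for z
  proof -
    define m where "m = time_average h \<phi> z"
    define p where "p \<theta> = \<phi> (z + \<theta> *\<^sub>R (0, 1))" for \<theta>
    have cp: "continuous_on S p" for S unfolding p_def by (rule continuous_time_slice[OF \<phi>(1)])
    have ip: "p integrable_on {0..h}" "(\<lambda>\<theta>. (p \<theta>)\<^sup>2) integrable_on {0..h}"
      by (intro integrable_continuous_real continuous_intros cp)+
    have m: "integral {0..h} p = h * m" using h by (simp add: m_def time_average_def p_def[abs_def])
    \<comment> \<open>Jensen's inequality, in the form that the variance about the mean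
      \<open>m\<close> is nonnegative.\<close>
    have "0 \<le> integral {0..h} (\<lambda>\<theta>. (p \<theta> - m)\<^sup>2)"
      by (intro Henstock_Kurzweil_Integration.integral_nonneg integrable_continuous_real continuous_intros cp) auto
    also have "(\<lambda>\<theta>. (p \<theta> - m)\<^sup>2) = (\<lambda>\<theta>. (p \<theta>)\<^sup>2 - 2 * m * p \<theta> + m\<^sup>2)"
      by (simp add: power2_diff fun_eq_iff mult_ac)
    also have "integral {0..h} \<dots> = integral {0..h} (\<lambda>\<theta>. (p \<theta>)\<^sup>2) - 2 * m * integral {0..h} p + h * m\<^sup>2"
    proof -
      have "((\<lambda>\<theta>. (p \<theta>)\<^sup>2 - 2 * m * p \<theta> + m\<^sup>2) has_integral
          integral {0..h} (\<lambda>\<theta>. (p \<theta>)\<^sup>2) - 2 * m * integral {0..h} p + (h - 0) *\<^sub>R m\<^sup>2) {0..h}"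
        using h has_integral_const_real[of "m\<^sup>2" 0 h]
        by (intro has_integral_add has_integral_diff has_integral_mult_right integrable_integral ip) simp
      then show ?thesis by (simp add: integral_unique)
    qed
    finally have "h * m\<^sup>2 \<le> integral {0..h} (\<lambda>\<theta>. (p \<theta>)\<^sup>2)" by (simp add: m power2_eq_square algebra_simps)
    also have "\<dots> = (LINT \<theta>:{0..h}|lborel. (p \<theta>)\<^sup>2)"
      by (intro set_borel_integral_eq_integral(2)[symmetric] borel_integrable_atLeastAtMost' continuous_intros cp)
    also have "\<dots> = (LINT \<theta>|lborel. f z \<theta>)" by (simp add: f_def p_def set_lebesgue_integral_def)
    finally show ?thesis using h by (simp add: m_def field_simps)
  qed
  have int1: "integrable lborel (\<lambda>z. (LINT \<theta>|lborel. f z \<theta>) / h)"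
    using lborel_pair.integrable_fst[OF int] by simp
  have "(LINT z|lborel. (time_average h \<phi> z)\<^sup>2) \<le> (LINT z|lborel. (LINT \<theta>|lborel. f z \<theta>) / h)"
  proof (rule integral_mono[OF _ int1 Jensen])
    show "integrable lborel (\<lambda>z. (time_average h \<phi> z)\<^sup>2)"
      by (rule integrable_compact_support[OF _ compact_time_shadow[OF \<phi>(2)], of _ h])
         (auto intro!: continuous_intros continuous_time_average \<phi>(1) time_average_zero \<phi>(3))
  qed
  also have "\<dots> = (LINT z|lborel. (LINT \<theta>|lborel. f z \<theta>)) / h" by simp
  also have "(LINT z|lborel. (LINT \<theta>|lborel. f z \<theta>)) = (LINT \<theta>|lborel. (LINT z|lborel. f z \<theta>))"
    using lborel_pair.Fubini_integral[OF int] by simp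
  also have "\<dots> = (LINT \<theta>|lborel. indicator {0..h} \<theta> * (LINT z|lborel. (\<phi> z)\<^sup>2))"
  proof (rule Bochner_Integration.integral_cong[OF refl])
    fix \<theta> :: real
    have "(LINT z|lborel. (\<phi> (\<theta> *\<^sub>R (0, 1) + z))\<^sup>2) = (LINT z|lborel. (\<phi> z)\<^sup>2)"
      by (rule lborel_integral_translate[of "\<lambda>z. (\<phi> z)\<^sup>2"]) measurable
    then show "(LINT z|lborel. f z \<theta>) = indicator {0..h} \<theta> * (LINT z|lborel. (\<phi> z)\<^sup>2)"
      by (simp add: f_def add.commute)
  qed
  also have "\<dots> = h * (LINT z|lborel. (\<phi> z)\<^sup>2)" using h by simp
  finally show ?thesis using h by simp
qed

section \<open>Backward time quotients of the solution\<close>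

definition open_slab :: "real \<Rightarrow> real \<Rightarrow> 'a::euclidean_space spacetime set" where
  "open_slab a b = {z. 0 < snd (fst z) \<and> a < snd z \<and> snd z < b}"

lemma open_open_slab: "open (open_slab a b)"
  unfolding open_slab_def by (intro open_Collect_conj open_Collect_less continuous_intros)

lemma open_slab_borel [measurable]: "open_slab a b \<in> sets borel"
  by (intro borel_open open_open_slab)

context signorini
begin

text \<open>The argument is shifted backward while the divisor is \<open>h\<close>, so these
  quotients approximate the negative of the time derivative; hence the limit \<open>- w\<close>
  below.\<close>

definition time_quotient :: "real \<Rightarrow> 'a spacetime \<Rightarrow> real" where
  "time_quotient h z = (u (fst z, snd z - h) - u z) / h"

lemma continuous_time_quotient:
  assumes "h > 0" "S \<subseteq> {z. 0 \<le> snd (fst z) \<and> - 1 + h < snd z \<and> snd z \<le> 0}"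
  shows "continuous_on S (time_quotient h)"
  unfolding time_quotient_def[abs_def] using assms
  by (intro continuous_intros continuous_on_compose2[OF cont_u, of S "\<lambda>z. (fst z, snd z - h)"]
        continuous_on_subset[OF cont_u]) (auto simp: space_cyl_def)

text \<open>Discrete integration by parts: translating the shifted \<open>u\<close> moves the
  quotient onto the test function, where it is the time derivative of the Steklov average. The
  condition \<open>- 1 + h \<le> a\<close> keeps the shadow of the support inside the
  cylinder.\<close>

lemma time_quotient_test:
  assumes \<phi>: "continuous_on UNIV \<phi>" "compact K" "K \<subseteq> open_slab a b" "\<And>z. z \<notin> K \<Longrightarrow> \<phi> z = 0"
    and h: "0 < h" "- 1 + h \<le> a" "b \<le> 0"
  shows "(LINT z|lborel. time_quotient h z * \<phi> z) = - (LINT z|lborel. w z * time_average h \<phi> z)"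
proof -
  define e where "e = (0 :: 'a \<times> real, 1 :: real)"
  define F where "F z = u z * \<phi> (z + h *\<^sub>R e)" for z
  have K': "compact (time_shadow h K)" by (rule compact_time_shadow[OF \<phi>(2)])
  have K'U: "time_shadow h K \<subseteq> open_cyl"
    using \<phi>(3) h by (force simp: time_shadow_def open_slab_def open_cyl_def subset_eq)
  have KU: "K \<subseteq> open_cyl" using \<phi>(3) h by (force simp: open_slab_def open_cyl_def)
  have c1: "continuous_on UNIV (\<lambda>z. u z * \<phi> z)"
    by (rule continuous_on_extend_zero[OF open_open_cyl compact_imp_closed[OF \<phi>(2)] KU])
       (auto intro!: continuous_intros continuous_on_subset[OF cont_u open_cyl_subset]
          continuous_on_subset[OF \<phi>(1)] simp: \<phi>(4))
  have i1: "integrable lborel (\<lambda>z. u z * \<phi> z)"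
    by (rule integrable_compact_support[OF c1 \<phi>(2)]) (simp add: \<phi>(4))
  have F0: "F z = 0" if "z \<notin> time_shadow h K" for z
    using that \<phi>(4)[of "z + h *\<^sub>R e"] h by (force simp: F_def time_shadow_def e_def)
  have cF: "continuous_on UNIV F"
  proof (rule continuous_on_extend_zero[OF open_open_cyl compact_imp_closed[OF K'] K'U _ F0])
    show "continuous_on open_cyl F" unfolding F_def
      by (intro continuous_intros continuous_on_subset[OF cont_u open_cyl_subset] continuous_on_compose2[OF \<phi>(1)]) auto
  qed
  have iF: "integrable lborel F" by (rule integrable_compact_support[OF cF K' F0])
  have mF: "F \<in> borel_measurable borel" using cF by (rule borel_measurable_continuous_onI)
  have shift: "(LINT z|lborel. u (fst z, snd z - h) * \<phi> z) = integral\<^sup>L lborel F"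
  proof -
    have "(LINT z|lborel. F ((- h) *\<^sub>R e + z)) = integral\<^sup>L lborel F"
      by (rule lborel_integral_translate[OF mF])
    moreover have "F ((- h) *\<^sub>R e + z) = u (fst z, snd z - h) * \<phi> z" for z
      by (cases z) (simp add: F_def e_def)
    ultimately show ?thesis by simp
  qed
  have i2: "integrable lborel (\<lambda>z. u (fst z, snd z - h) * \<phi> z)"
  proof -
    have "integrable lborel (\<lambda>z. F ((- h) *\<^sub>R e + 1 *\<^sub>R z))" by (rule lborel_integrable_affine[OF iF]) simp
    moreover have "F ((- h) *\<^sub>R e + 1 *\<^sub>R z) = u (fst z, snd z - h) * \<phi> z" for z
      by (cases z) (simp add: F_def e_def)
    ultimately show ?thesis by simp
  qed
  have "(LINT z|lborel. u z * ((\<phi> (z + h *\<^sub>R e) - \<phi> z) / h)) = - (LINT z|lborel. w z * time_average h \<phi> z)"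
  proof (rule weak_t[OF _ K' K'U])
    show "continuous_on UNIV (time_average h \<phi>)" by (rule continuous_time_average[OF \<phi>(1)])
    show "time_average h \<phi> z = 0" if "z \<notin> time_shadow h K" for z
      by (rule time_average_zero[OF \<phi>(4) that])
    show "continuous_on UNIV (\<lambda>z. (\<phi> (z + h *\<^sub>R e) - \<phi> z) / h)"
      using h by (intro continuous_intros \<phi>(1) continuous_on_compose2[OF \<phi>(1)]) auto
    show "((\<lambda>s. time_average h \<phi> (z + s *\<^sub>R (0, 1))) has_real_derivative (\<phi> (z + h *\<^sub>R e) - \<phi> z) / h) (at 0)" for z
      unfolding e_def by (rule time_average_derivative[OF \<phi>(1) h(1)])
  qed
  also have "(\<lambda>z. u z * ((\<phi> (z + h *\<^sub>R e) - \<phi> z) / h)) = (\<lambda>z. (F z - u z * \<phi> z) / h)"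
    by (simp add: F_def fun_eq_iff algebra_simps)
  also have "integral\<^sup>L lborel \<dots> = (integral\<^sup>L lborel F - (LINT z|lborel. u z * \<phi> z)) / h"
    using iF i1 by simp
  also have "\<dots> = (LINT z|lborel. (u (fst z, snd z - h) * \<phi> z - u z * \<phi> z) / h)"
    using i1 i2 by (simp add: shift)
  also have "\<dots> = (LINT z|lborel. time_quotient h z * \<phi> z)"
    by (simp add: time_quotient_def left_diff_distrib)
  finally show ?thesis .
qed

lemma time_quotient_bounded:
  assumes h: "0 < h" "- 1 + h < a" "b \<le> 0"
  obtains B where "B > 0" "\<And>z. \<bar>indicator (open_slab a b) z * time_quotient h z\<bar> \<le> indicator (cyl_box 0 R a b) z *\<^sub>R B"
proof -
  have "bounded (time_quotient h ` cyl_box 0 R a b)"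
    using h by (intro compact_imp_bounded compact_continuous_image compact_cyl_box continuous_time_quotient)
      (auto simp: cyl_box_def)
  then obtain B where B: "B > 0" "\<And>z. z \<in> cyl_box 0 R a b \<Longrightarrow> \<bar>time_quotient h z\<bar> \<le> B"
    unfolding bounded_pos by auto
  have "\<bar>indicator (open_slab a b) z * time_quotient h z\<bar> \<le> indicator (cyl_box 0 R a b) z *\<^sub>R B" for z
  proof (cases "z \<in> open_slab a b \<and> norm (fst z) \<le> R")
    case True
    then have "z \<in> cyl_box 0 R a b" by (auto simp: open_slab_def cyl_box_def)
    then show ?thesis using B(2) True by simp
  next
    case False
    have "time_quotient h z = 0" if "z \<in> open_slab a b"
    proof -
      have "z \<in> space_cyl" "(fst z, snd z - h) \<in> space_cyl"
        using that h by (auto simp: open_slab_def space_cyl_def)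
      then show ?thesis using supp[of z] supp[of "(fst z, snd z - h)"] False that by (simp add: time_quotient_def)
    qed
    then show ?thesis using B(1) by (cases "z \<in> open_slab a b") auto
  qed
  then show thesis using that B(1) by blast
qed

text \<open>Duality with the contraction property of time averages. Testing with the quotient itself
  gives X \<le> (W + A) / 2 for its squared norm X, that of \<open>w\<close>, W, and that of the
  averaged test, A; as A \<le> X, this yields X \<le> W. The cutoffs \<open>c n\<close> make the
  quotient an admissible test and are removed by dominated convergence.\<close>

lemma time_quotient_L2:
  assumes h: "0 < h" "- 1 + h < a" "b \<le> 0"
  defines "q \<equiv> \<lambda>z. indicator (open_slab a b) z * time_quotient h z"
  shows "q \<in> borel_measurable borel" "integrable lborel (\<lambda>z. (q z)\<^sup>2)"
    "(LINT z|lborel. (q z)\<^sup>2) \<le> (LINT z|lborel. (w z)\<^sup>2)"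
proof -
  have cq: "continuous_on (open_slab a b) (time_quotient h)"
    using h by (intro continuous_time_quotient) (auto simp: open_slab_def)
  have "(\<lambda>z. indicator (open_slab a b) z *\<^sub>R time_quotient h z) \<in> borel_measurable borel"
    by (rule borel_measurable_continuous_on_indicator[OF _ cq]) simp
  then show m [measurable]: "q \<in> borel_measurable borel" by (simp add: q_def)
  obtain B where B: "B > 0" "\<And>z. \<bar>q z\<bar> \<le> indicator (cyl_box 0 R a b) z *\<^sub>R B"
    unfolding q_def using time_quotient_bounded[OF h] by blast
  have iB: "integrable lborel (\<lambda>z::'a spacetime. indicator (cyl_box 0 R a b) z *\<^sub>R (B\<^sup>2))"
    by (rule borel_integrable_compact[OF compact_cyl_box]) auto
  have "(q z)\<^sup>2 \<le> indicator (cyl_box 0 R a b) z *\<^sub>R (B\<^sup>2)" for z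
    using power_mono[OF B(2)[of z], of 2] by (auto simp: indicator_def split: if_splits)
  then show i: "integrable lborel (\<lambda>z. (q z)\<^sup>2)"
    by (intro Bochner_Integration.integrable_bound[OF iB]) auto
  show "(LINT z|lborel. (q z)\<^sup>2) \<le> (LINT z|lborel. (w z)\<^sup>2)"
  proof (rule compact_cutoff_exhaustion[OF open_open_slab])
    fix c :: "nat \<Rightarrow> 'a spacetime \<Rightarrow> real" and K
    assume c: "\<And>n. continuous_on UNIV (c n)" "\<And>n z. 0 \<le> c n z \<and> c n z \<le> 1"
      "\<And>n. compact (K n)" "\<And>n. K n \<subseteq> open_slab a b" "\<And>n z. z \<notin> K n \<Longrightarrow> c n z = 0"
      "\<And>z. (\<lambda>n. c n z) \<longlonglongrightarrow> indicator (open_slab a b) z"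
    have [measurable]: "c n \<in> borel_measurable borel" for n
      using c(1) by (rule borel_measurable_continuous_onI)
    have c0: "c n z = 0" if "z \<notin> open_slab a b" for n z using c(4,5) that by blast
    have eq: "(q z)\<^sup>2 * c n z = time_quotient h z * (time_quotient h z * c n z)" for n z
      using c0[of z n] by (auto simp: q_def indicator_def power2_eq_square)
    have le: "(LINT z|lborel. (q z)\<^sup>2 * c n z) \<le> (LINT z|lborel. (w z)\<^sup>2)" for n
    proof -
      define \<phi> where "\<phi> z = time_quotient h z * c n z" for z
      have \<phi>: "continuous_on UNIV \<phi>" "\<And>z. z \<notin> K n \<Longrightarrow> \<phi> z = 0"
      proof -
        show 0: "\<phi> z = 0" if "z \<notin> K n" for z using c(5)[OF that] by (simp add: \<phi>_def)
        show "continuous_on UNIV \<phi>"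
          by (rule continuous_on_extend_zero[OF open_open_slab compact_imp_closed[OF c(3)] c(4) _ 0])
             (auto simp: \<phi>_def intro!: continuous_intros cq continuous_on_subset[OF c(1)])
      qed
      have \<phi>2: "integrable lborel (\<lambda>z. (\<phi> z)\<^sup>2)"
        by (rule integrable_compact_support[OF _ c(3)[of n]]) (auto intro!: continuous_intros \<phi>)
      have a2: "integrable lborel (\<lambda>z. (time_average h \<phi> z)\<^sup>2)"
        by (rule integrable_compact_support[OF _ compact_time_shadow[OF c(3)[of n]], of _ h])
           (auto intro!: continuous_intros continuous_time_average \<phi> time_average_zero)
      have ma: "time_average h \<phi> \<in> borel_measurable borel"
        by (rule borel_measurable_continuous_onI[OF continuous_time_average[OF \<phi>(1)]])
      have ic: "integrable lborel (\<lambda>z. (q z)\<^sup>2 * c n z)"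
        by (rule Bochner_Integration.integrable_bound[OF i])
           (use c(2) in \<open>auto simp: abs_mult mult_left_le\<close>)
      have "(LINT z|lborel. (q z)\<^sup>2 * c n z) = (LINT z|lborel. time_quotient h z * \<phi> z)"
        by (simp add: eq \<phi>_def)
      also have "\<dots> = - (LINT z|lborel. w z * time_average h \<phi> z)"
        by (rule time_quotient_test[OF \<phi>(1) c(3) c(4) \<phi>(2)]) (use h in auto)
      also have "\<dots> \<le> (1 * (LINT z|lborel. (w z)\<^sup>2) + (LINT z|lborel. (time_average h \<phi> z)\<^sup>2) / 1) / 2"
        using integral_mult_le[OF _ _ w_L2 a2, of 1] ma by auto
      finally have 1: "(LINT z|lborel. (q z)\<^sup>2 * c n z)
          \<le> ((LINT z|lborel. (w z)\<^sup>2) + (LINT z|lborel. (time_average h \<phi> z)\<^sup>2)) / 2" by simp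
      have 2: "(LINT z|lborel. (time_average h \<phi> z)\<^sup>2) \<le> (LINT z|lborel. (\<phi> z)\<^sup>2)"
        by (rule time_average_L2[OF \<phi>(1) c(3) \<phi>(2) h(1)])
      have 3: "(LINT z|lborel. (\<phi> z)\<^sup>2) \<le> (LINT z|lborel. (q z)\<^sup>2 * c n z)"
      proof (rule integral_mono[OF \<phi>2 ic])
        fix z
        have "(\<phi> z)\<^sup>2 = ((q z)\<^sup>2 * c n z) * c n z"
          unfolding eq by (simp add: \<phi>_def power2_eq_square)
        also have "\<dots> \<le> (q z)\<^sup>2 * c n z" using c(2)[of n z] by (intro mult_left_le) auto
        finally show "(\<phi> z)\<^sup>2 \<le> (q z)\<^sup>2 * c n z" .
      qed
      have "\<And>X A P W :: real. X \<le> (W + A) / 2 \<Longrightarrow> A \<le> P \<Longrightarrow> P \<le> X \<Longrightarrow> X \<le> W" by simp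
      from this[OF 1 2 3] show ?thesis .
    qed
    have "(\<lambda>n. LINT z|lborel. (q z)\<^sup>2 * c n z) \<longlonglongrightarrow> (LINT z|lborel. (q z)\<^sup>2)"
    proof (rule integral_dominated_convergence[OF _ _ i])
      have "(\<lambda>n. (q z)\<^sup>2 * c n z) \<longlonglongrightarrow> (q z)\<^sup>2 * indicator (open_slab a b) z" for z
        by (intro tendsto_intros c(6))
      moreover have "(q z)\<^sup>2 * indicator (open_slab a b) z = (q z)\<^sup>2" for z by (auto simp: q_def indicator_def)
      ultimately show "AE z in lborel. (\<lambda>n. (q z)\<^sup>2 * c n z) \<longlonglongrightarrow> (q z)\<^sup>2" by simp
      show "AE z in lborel. norm ((q z)\<^sup>2 * c n z) \<le> (q z)\<^sup>2" for n
        using c(2) by (auto simp: abs_mult mult_left_le)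
    qed measurable
    then show ?thesis by (rule LIMSEQ_le_const2) (use le in auto)
  qed
qed

text \<open>For continuous test functions with compact support the time averages converge uniformly;
  the L2 bound by the norm of \<open>w\<close> carries the limit over to \<open>k\<close> in L2.
  That generality is used for a \<open>k\<close> that contains \<open>w\<close> and
  \<open>f\<close>.\<close>

lemma time_quotient_weak:
  assumes h: "0 < h0" "- 1 + h0 < a" "b \<le> 0" "\<And>n. 0 < h n" "\<And>n. h n \<le> h0" "h \<longlonglongrightarrow> 0"
    and k: "k \<in> borel_measurable borel" "integrable lborel (\<lambda>z. (k z)\<^sup>2)" "\<And>z. z \<notin> open_slab a b \<Longrightarrow> k z = 0"
  shows "(\<lambda>n. LINT z|lborel. indicator (open_slab a b) z * time_quotient (h n) z * k z)
    \<longlonglongrightarrow> (LINT z|lborel. - w z * k z)"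
proof (rule weak_convergence_extend[OF open_open_slab _ _ _ _ _ _ k])
  have hn: "- 1 + h n < a" for n using h(2) h(5)[of n] by simp
  note L2 = time_quotient_L2[OF h(4) hn h(3)]
  show "(\<lambda>z. indicator (open_slab a b) z * time_quotient (h n) z) \<in> borel_measurable borel" for n by (rule L2)
  show "integrable lborel (\<lambda>z. (indicator (open_slab a b) z * time_quotient (h n) z)\<^sup>2)" for n by (rule L2)
  show "(LINT z|lborel. (indicator (open_slab a b) z * time_quotient (h n) z)\<^sup>2) \<le> (LINT z|lborel. (w z)\<^sup>2)" for n
    by (rule L2)
  show "(\<lambda>z. - w z) \<in> borel_measurable borel" by measurable
  show "integrable lborel (\<lambda>z. (- w z)\<^sup>2)" using w_L2 by simp
  fix \<phi> :: "'a spacetime \<Rightarrow> real" and K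
  assume \<phi>: "continuous_on UNIV \<phi>" "compact K" "K \<subseteq> open_slab a b" "\<And>z. z \<notin> K \<Longrightarrow> \<phi> z = 0"
  have sub: "time_shadow (h n) K \<subseteq> time_shadow h0 K" for n
    using h(5)[of n] by (force simp: time_shadow_def)
  have KS: "compact (time_shadow h0 K)" by (rule compact_time_shadow[OF \<phi>(2)])
  have "(\<lambda>n. LINT z|lborel. w z * time_average (h n) \<phi> z) \<longlonglongrightarrow> (LINT z|lborel. w z * \<phi> z)"
  proof (rule integral_uniform_limit[OF KS integrable_w_compact[OF KS]])
    show "continuous_on UNIV (time_average (h n) \<phi>)" for n by (rule continuous_time_average[OF \<phi>(1)])
    show "time_average (h n) \<phi> z = 0" if "z \<notin> time_shadow h0 K" for n z
      using that sub by (intro time_average_zero[OF \<phi>(4)]) auto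
    show "uniform_limit UNIV (\<lambda>n. time_average (h n) \<phi>) \<phi> sequentially"
    proof (rule uniform_limitI)
      fix e :: real assume "e > 0"
      then have e2: "e / 2 > 0" by simp
      show "\<forall>\<^sub>F n in sequentially. \<forall>z\<in>UNIV. dist (time_average (h n) \<phi> z) (\<phi> z) < e"
      proof (rule compact_support_uniformly_continuous[OF \<phi>(1,2,4) e2])
        fix d assume d: "d > 0" "\<And>x y. dist x y < d \<Longrightarrow> \<bar>\<phi> x - \<phi> y\<bar> < e / 2"
        have "\<forall>\<^sub>F n in sequentially. h n < d" using order_tendstoD(2)[OF h(6) d(1)] .
        then show ?thesis
        proof eventually_elim
          case (elim n)
          have "\<bar>time_average (h n) \<phi> z - \<phi> z\<bar> \<le> e / 2" for z
          proof (rule time_average_close[OF \<phi>(1) h(4)])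
            fix \<theta> :: real assume "\<theta> \<in> {0..h n}"
            then have "dist (z + \<theta> *\<^sub>R (0, 1)) z < d"
              using elim by (simp add: dist_norm)
            from d(2)[OF this] show "\<bar>\<phi> (z + \<theta> *\<^sub>R (0, 1)) - \<phi> z\<bar> \<le> e / 2" by simp
          qed
          from le_less_trans[OF this] show ?case using \<open>e > 0\<close> by (simp add: dist_real_def)
        qed
      qed
    qed
  qed
  moreover have "(LINT z|lborel. indicator (open_slab a b) z * time_quotient (h n) z * \<phi> z)
     = - (LINT z|lborel. w z * time_average (h n) \<phi> z)" for n
  proof -
    have eq: "indicator (open_slab a b) z * time_quotient (h n) z * \<phi> z = time_quotient (h n) z * \<phi> z" for z
      using \<phi>(3) \<phi>(4)[of z] by (cases "z \<in> open_slab a b") auto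
    show ?thesis unfolding eq by (rule time_quotient_test[OF \<phi> h(4) less_imp_le[OF hn] h(3)])
  qed
  ultimately show "(\<lambda>n. LINT z|lborel. indicator (open_slab a b) z * time_quotient (h n) z * \<phi> z)
      \<longlonglongrightarrow> (LINT z|lborel. - w z * \<phi> z)"
    by (simp add: tendsto_minus)
qed

end

section \<open>The rescaled time shift\<close>

lemma lborel_Fubini_time:
  fixes F :: "'b::euclidean_space \<times> real \<Rightarrow> real"
  assumes "integrable lborel F"
  shows "integrable lborel (\<lambda>t. LINT x|lborel. F (x, t))"
    "integral\<^sup>L lborel F = (LINT t|lborel. LINT x|lborel. F (x, t))"
proof -
  have "integrable (lborel \<Otimes>\<^sub>M lborel) (case_prod (\<lambda>x t. F (x, t)))"
    using assms by (simp add: lborel_prod)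
  from lborel_pair.integrable_snd[OF this] lborel_pair.integral_snd[OF this]
  show "integrable lborel (\<lambda>t. LINT x|lborel. F (x, t))"
    "integral\<^sup>L lborel F = (LINT t|lborel. LINT x|lborel. F (x, t))"
    by (simp_all add: lborel_prod)
qed

definition closed_slab :: "real \<Rightarrow> real \<Rightarrow> 'a::euclidean_space spacetime set" where
  "closed_slab a b = {z. 0 < snd (fst z) \<and> a \<le> snd z \<and> snd z \<le> b}"

lemma closed_slab_borel [measurable]: "closed_slab a b \<in> sets (borel :: 'a::euclidean_space spacetime measure)"
proof -
  have "(closed_slab a b :: 'a spacetime set) = {z. 0 < snd (fst z)} \<inter> {z. a \<le> snd z \<and> snd z \<le> b}"
    by (auto simp: closed_slab_def)
  moreover have "open {z::'a spacetime. 0 < snd (fst z)}"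
    by (intro open_Collect_less continuous_intros)
  moreover have "closed {z::'a spacetime. a \<le> snd z \<and> snd z \<le> b}"
    by (intro closed_Collect_conj closed_Collect_le continuous_intros)
  ultimately show ?thesis by auto
qed

lemma half_space_borel [measurable]: "{x::'a::euclidean_space \<times> real. 0 < snd x} \<in> sets borel"
  by (intro borel_open open_Collect_less continuous_intros)

text \<open>The map \<open>(x, t) \<mapsto> (dilation h t *\<^sub>R x, t - h)\<close> preserves \<open>|x|\<^sup>2 / t\<close>, hence the heat kernel up to a
  Jacobian factor.\<close>

definition dilation :: "real \<Rightarrow> real \<Rightarrow> real" where
  "dilation h t = sqrt ((t - h) / t)"

lemma dilation_ge_1: "t < 0 \<Longrightarrow> 0 \<le> h \<Longrightarrow> 1 \<le> dilation h t"
  by (simp add: dilation_def le_divide_eq)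

lemma dilation_sq: "t < 0 \<Longrightarrow> 0 \<le> h \<Longrightarrow> (dilation h t)\<^sup>2 = (t - h) / t"
  by (simp add: dilation_def divide_nonpos_neg)

lemma continuous_dilation:
  assumes "\<And>z. z \<in> S \<Longrightarrow> snd z < 0"
  shows "continuous_on S (\<lambda>z::'b::euclidean_space \<times> real. dilation h (snd z))"
  unfolding dilation_def using assms by (intro continuous_intros) force

lemma heat_kernel_dilation:
  fixes x :: "'a::euclidean_space \<times> real"
  assumes "t < 0" "0 \<le> h"
  shows "heat_kernel (x, t) = dilation h t ^ DIM('a \<times> real) * heat_kernel (dilation h t *\<^sub>R x, t - h)"
proof -
  define dl N where "dl = dilation h t" and "N = real DIM('a \<times> real)"
  have dl: "dl > 0" "dl\<^sup>2 = (t - h) / t"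
    using dilation_ge_1[OF assms] dilation_sq[OF assms] by (auto simp: dl_def)
  have th: "t - h = dl\<^sup>2 * t" using dl(2) assms by simp
  have e: "(norm (dl *\<^sub>R x))\<^sup>2 / (4 * (t - h)) = (norm x)\<^sup>2 / (4 * t)"
    using dl(1) assms by (simp add: th power_mult_distrib)
  have "(- 4 * pi * (t - h)) powr (- N / 2) = (dl\<^sup>2 * (- 4 * pi * t)) powr (- N / 2)"
    by (simp add: th mult_ac)
  also have "\<dots> = (dl\<^sup>2) powr (- N / 2) * (- 4 * pi * t) powr (- N / 2)"
    using assms dl by (intro powr_mult)
  also have "(dl\<^sup>2) powr (- N / 2) = dl powr (- N)"
    using dl(1) by (simp add: powr_powr flip: powr_numeral)
  also have "dl powr (- N) = 1 / dl ^ DIM('a \<times> real)"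
    using dl(1) by (simp only: N_def powr_minus powr_realpow inverse_eq_divide)
  finally have p: "(- 4 * pi * (t - h)) powr (- N / 2) = (- 4 * pi * t) powr (- N / 2) / dl ^ DIM('a \<times> real)" by simp
  have "heat_kernel (dl *\<^sub>R x, t - h) = (- 4 * pi * (t - h)) powr (- N / 2) * exp ((norm (dl *\<^sub>R x))\<^sup>2 / (4 * (t - h)))"
    using assms by (simp add: heat_kernel_def N_def)
  also have "\<dots> = (- 4 * pi * t) powr (- N / 2) / dl ^ DIM('a \<times> real) * exp ((norm x)\<^sup>2 / (4 * t))"
    unfolding e p ..
  finally show ?thesis
    using assms dl(1) by (simp add: heat_kernel_def N_def dl_def)
qed

context signorini
begin

lemma slab_integrable:
  fixes F :: "'a spacetime \<Rightarrow> real"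
  assumes F: "continuous_on (cyl_slab s1 s2) F" "\<And>z. z \<in> cyl_slab s1 s2 \<Longrightarrow> R < norm (fst z) \<Longrightarrow> F z = 0"
    and ab: "s1 < a" "b < s2"
  shows "integrable lborel (\<lambda>z. indicator (closed_slab a b) z * F z)"
    "integrable lborel (\<lambda>z. (indicator (closed_slab a b) z * F z)\<^sup>2)"
proof -
  have *: "integrable lborel (\<lambda>z. indicator (closed_slab a b) z * H z)"
    if H: "continuous_on (cyl_slab s1 s2) H" "\<And>z. z \<in> cyl_slab s1 s2 \<Longrightarrow> R < norm (fst z) \<Longrightarrow> H z = 0"
    for H :: "'a spacetime \<Rightarrow> real"
  proof -
    have "integrable lborel (\<lambda>z. indicator (cyl_box 0 R a b) z *\<^sub>R H z)"
      using ab by (intro borel_integrable_compact compact_cyl_box continuous_on_subset[OF H(1)])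
        (auto simp: cyl_box_def cyl_slab_def)
    from integrable_mult_indicator[OF _ this, of "closed_slab a b"]
    have "integrable lborel (\<lambda>z. indicator (closed_slab a b) z *\<^sub>R indicator (cyl_box 0 R a b) z *\<^sub>R H z)"
      by simp
    moreover have "indicator (closed_slab a b) z *\<^sub>R indicator (cyl_box 0 R a b) z *\<^sub>R H z
        = indicator (closed_slab a b) z * H z" for z
    proof (cases "z \<in> closed_slab a b \<and> z \<notin> cyl_box 0 R a b")
      case True
      then have "z \<in> cyl_slab s1 s2" "R < norm (fst z)"
        using ab by (auto simp: closed_slab_def cyl_box_def cyl_slab_def)
      then show ?thesis using H(2) by simp
    qed (auto simp: indicator_def)
    ultimately show ?thesis by (simp only:)
  qed
  show "integrable lborel (\<lambda>z. indicator (closed_slab a b) z * F z)" by (rule *[OF F])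
  have "integrable lborel (\<lambda>z. indicator (closed_slab a b) z * (F z)\<^sup>2)"
    by (rule *) (auto intro!: continuous_intros F(1) simp: F(2))
  moreover have "(indicator (closed_slab a b) z * F z)\<^sup>2 = indicator (closed_slab a b) z * (F z)\<^sup>2" for z
    by (auto simp: indicator_def)
  ultimately show "integrable lborel (\<lambda>z. (indicator (closed_slab a b) z * F z)\<^sup>2)" by simp
qed

text \<open>\<open>f\<close> is known to be square integrable on compact sets; the support of
  \<open>F\<close> allows restricting it to a box before the product of two L2 functions is
  formed.\<close>

lemma slab_integrable_wf:
  fixes F :: "'a spacetime \<Rightarrow> real"
  assumes F: "continuous_on (cyl_slab s1 s2) F" "\<And>z. z \<in> cyl_slab s1 s2 \<Longrightarrow> R < norm (fst z) \<Longrightarrow> F z = 0"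
    and ab: "s1 < a" "b < s2"
  shows "integrable lborel (\<lambda>z. w z * (indicator (closed_slab a b) z * F z))"
    "integrable lborel (\<lambda>z. f z * (indicator (closed_slab a b) z * F z))"
proof -
  have m [measurable]: "(\<lambda>z. indicator (closed_slab a b) z * F z) \<in> borel_measurable borel"
    using slab_integrable(1)[OF assms] by (simp add: borel_measurable_integrable)
  show "integrable lborel (\<lambda>z. w z * (indicator (closed_slab a b) z * F z))"
    by (rule integrable_sq_diff(2)[OF _ _ w_L2 slab_integrable(2)[OF assms]]) auto
  define k where "k z = indicator (cyl_box 0 R a b) z * f z" for z
  have [measurable]: "cyl_box 0 R a b \<in> sets (borel :: 'a spacetime measure)"
    by (intro borel_compact compact_cyl_box)
  have "integrable lborel (\<lambda>z. (k z)\<^sup>2)"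
  proof -
    have "(k z)\<^sup>2 = indicator (cyl_box 0 R a b) z * (f z)\<^sup>2" for z by (auto simp: k_def indicator_def)
    then show ?thesis using integrable_f_compact(1)[OF compact_cyl_box, of 0 R a b] by simp
  qed
  from integrable_sq_diff(2)[OF _ _ this slab_integrable(2)[OF assms]]
  have "integrable lborel (\<lambda>z. k z * (indicator (closed_slab a b) z * F z))" unfolding k_def by simp
  moreover have "k z * (indicator (closed_slab a b) z * F z) = f z * (indicator (closed_slab a b) z * F z)" for z
  proof (cases "z \<in> closed_slab a b \<and> z \<notin> cyl_box 0 R a b")
    case True
    then have "z \<in> cyl_slab s1 s2" "R < norm (fst z)"
      using ab by (auto simp: closed_slab_def cyl_box_def cyl_slab_def)
    then show ?thesis using F(2) by simp
  qed (auto simp: indicator_def k_def)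
  ultimately show "integrable lborel (\<lambda>z. f z * (indicator (closed_slab a b) z * F z))" by (simp only:)
qed

section \<open>Slice energies and the rescaled competitor\<close>

definition energy_density :: "real \<Rightarrow> 'a spacetime \<Rightarrow> real" where
  "energy_density \<kappa> z = (\<bar>snd z\<bar> * (norm (g z))\<^sup>2 - \<kappa> / 2 * (u z)\<^sup>2) * heat_kernel z"

definition slice_energy :: "real \<Rightarrow> real \<Rightarrow> real" where
  "slice_energy \<kappa> t = (LINT x|lborel. indicator {x. 0 < snd x} x * energy_density \<kappa> (x, t))"

text \<open>The function E of the overview. The power of \<open>- t\<close> is the one that makes it
  constant in time when \<open>u\<close> is parabolically homogeneous of degree \<kappa>.\<close>

definition scaled_energy :: "real \<Rightarrow> real \<Rightarrow> real" where
  "scaled_energy \<kappa> t = (- t) powr (- \<kappa>) * slice_energy \<kappa> t"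

definition u_dil :: "real \<Rightarrow> real \<Rightarrow> 'a spacetime \<Rightarrow> real" where
  "u_dil \<kappa> h z = dilation h (snd z) powr (- \<kappa>) * u (dilation h (snd z) *\<^sub>R fst z, snd z - h)"

text \<open>The spatial gradient of \<open>u_dil\<close>: differentiating the dilated argument
  raises the exponent - \<kappa> by 1.\<close>

definition g_dil :: "real \<Rightarrow> real \<Rightarrow> 'a spacetime \<Rightarrow> 'a \<times> real" where
  "g_dil \<kappa> h z = dilation h (snd z) powr (1 - \<kappa>) *\<^sub>R g (dilation h (snd z) *\<^sub>R fst z, snd z - h)"

lemma deriv_u_interior:
  assumes "z \<in> space_cyl" "0 < snd (fst z)"
  shows "((\<lambda>y. u (y, snd z)) has_derivative (\<lambda>v. g z \<bullet> v)) (at (fst z))"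
proof -
  have "open {x::'a \<times> real. 0 < snd x}" by (intro open_Collect_less continuous_intros)
  moreover have "{x::'a \<times> real. 0 < snd x} \<subseteq> closed_half_space" by (auto simp: closed_half_space_def)
  ultimately have "{x::'a \<times> real. 0 < snd x} \<subseteq> interior closed_half_space" by (intro interior_maximal)
  then have "fst z \<in> interior closed_half_space" by (rule subsetD) (simp add: assms(2))
  from deriv_u[OF assms(1)] show ?thesis by (simp only: at_within_interior[OF \<open>fst z \<in> _\<close>])
qed

lemma dil_in_space_cyl:
  assumes "0 \<le> h" "z \<in> cyl_slab (- 1 + h) 0"
  shows "(dilation h (snd z) *\<^sub>R fst z, snd z - h) \<in> space_cyl" "1 \<le> dilation h (snd z)"
    "0 \<le> snd (fst z)" "snd z < 0" "z \<in> space_cyl"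
proof -
  have z: "0 \<le> snd (fst z)" "- 1 + h < snd z" "snd z < 0" using assms(2) by (auto simp: cyl_slab_def)
  then show 1: "1 \<le> dilation h (snd z)" "0 \<le> snd (fst z)" "snd z < 0"
    using dilation_ge_1[of "snd z" h] assms(1) by auto
  show "z \<in> space_cyl" using z assms(1) by (simp add: space_cyl_def)
  have "0 \<le> dilation h (snd z) * snd (fst z)" using 1 by simp
  then show "(dilation h (snd z) *\<^sub>R fst z, snd z - h) \<in> space_cyl"
    using z assms(1) by (simp add: space_cyl_def)
qed

lemma continuous_dil:
  assumes h: "0 \<le> h"
  shows "continuous_on (cyl_slab (- 1 + h) 0) (u_dil \<kappa> h)" "continuous_on (cyl_slab (- 1 + h) 0) (g_dil \<kappa> h)"
proof -
  let ?S = "cyl_slab (- 1 + h) 0 :: 'a spacetime set"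
  have c: "continuous_on ?S (\<lambda>z. dilation h (snd z))"
    by (rule continuous_dilation) (auto simp: cyl_slab_def)
  have ne: "dilation h (snd z) \<noteq> 0" if "z \<in> ?S" for z using dil_in_space_cyl(2)[OF h that] by simp
  have m: "continuous_on ?S (\<lambda>z. (dilation h (snd z) *\<^sub>R fst z, snd z - h))"
    by (intro continuous_intros c)
  have "continuous_on ?S (\<lambda>z. u (dilation h (snd z) *\<^sub>R fst z, snd z - h))"
    "continuous_on ?S (\<lambda>z. g (dilation h (snd z) *\<^sub>R fst z, snd z - h))"
    by (rule continuous_on_compose2[OF cont_u m] continuous_on_compose2[OF cont_g m];
        use dil_in_space_cyl(1)[OF h] in blast)+
  then show "continuous_on ?S (u_dil \<kappa> h)" "continuous_on ?S (g_dil \<kappa> h)"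
    unfolding u_dil_def[abs_def] g_dil_def[abs_def] using ne
    by (intro continuous_intros c; simp)+
qed

lemma u_dil_derivative:
  assumes h: "0 \<le> h" and z: "z \<in> cyl_slab (- 1 + h) 0" "0 < snd (fst z)"
  shows "((\<lambda>y. u_dil \<kappa> h (y, snd z)) has_derivative (\<lambda>v. g_dil \<kappa> h z \<bullet> v)) (at (fst z))"
proof -
  define dl where "dl = dilation h (snd z)"
  have dl: "dl \<ge> 1" using dil_in_space_cyl(2)[OF h z(1)] by (simp add: dl_def)
  define z' where "z' = (dl *\<^sub>R fst z, snd z - h)"
  have z': "z' \<in> space_cyl" "0 < snd (fst z')"
    using dil_in_space_cyl(1)[OF h z(1)] dl z(2) by (auto simp: z'_def dl_def)
  have "((\<lambda>y. u (dl *\<^sub>R y, snd z - h)) has_derivative (\<lambda>v. g z' \<bullet> (dl *\<^sub>R v))) (at (fst z))"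
    by (rule has_derivative_compose[where f="\<lambda>y. dl *\<^sub>R y" and g="\<lambda>y. u (y, snd z - h)"])
       (use deriv_u_interior[OF z'] in \<open>auto intro!: derivative_eq_intros simp: z'_def\<close>)
  then have "((\<lambda>y. dl powr (- \<kappa>) * u (dl *\<^sub>R y, snd z - h)) has_derivative (\<lambda>v. dl powr (- \<kappa>) * (g z' \<bullet> (dl *\<^sub>R v)))) (at (fst z))"
    by (rule has_derivative_mult_right)
  moreover have "dl powr (- \<kappa>) * (g z' \<bullet> (dl *\<^sub>R v)) = g_dil \<kappa> h z \<bullet> v" for v
    using dl powr_mult_base[of dl "- \<kappa>"] by (simp add: g_dil_def z'_def dl_def[symmetric] mult_ac)
  ultimately show ?thesis by (simp add: u_dil_def dl_def[symmetric])
qed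

text \<open>Backward shifts have \<lambda> \<ge> 1, so the dilated point lies at least as far out as
  \<open>z\<close>, where \<open>u\<close> and its gradient vanish at all times.\<close>

lemma dil_support:
  assumes h: "0 \<le> h" and z: "z \<in> cyl_slab (- 1 + h) 0" "R < norm (fst z)"
  shows "u_dil \<kappa> h z = 0" "g_dil \<kappa> h z = 0" "u z = 0" "g z = 0"
proof -
  note d = dil_in_space_cyl[OF h z(1)]
  have "norm (fst z) \<le> norm (dilation h (snd z) *\<^sub>R fst z)"
    using d(2) mult_right_mono[of 1 "dilation h (snd z)" "norm (fst z)"] by simp
  then have "u (dilation h (snd z) *\<^sub>R fst z, snd z - h) = 0 \<and> g (dilation h (snd z) *\<^sub>R fst z, snd z - h) = 0"
    using supp[OF d(1)] z(2) by simp
  then show "u_dil \<kappa> h z = 0" "g_dil \<kappa> h z = 0" by (simp_all add: u_dil_def g_dil_def)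
  show "u z = 0" "g z = 0" using supp[OF d(5)] z(2) by auto
qed

text \<open>The dilation maps the thin space into itself, so the competitor inherits nonnegativity
  there; the part with \<open>u\<close> itself drops out by complementarity.\<close>

lemma dil_boundary:
  assumes h: "0 \<le> h" and z: "z \<in> cyl_slab (- 1 + h) 0" "snd (fst z) = 0"
  shows "(u_dil \<kappa> h z - u z) * snd (g z) \<le> 0"
proof -
  note d = dil_in_space_cyl[OF h z(1)]
  have "0 \<le> u (dilation h (snd z) *\<^sub>R fst z, snd z - h)" using thin[OF d(1)] z(2) by simp
  then have "0 \<le> u_dil \<kappa> h z" by (simp add: u_dil_def)
  moreover have "snd (g z) \<le> 0" "u z * snd (g z) = 0" using thin[OF d(5) z(2)] by auto
  ultimately show ?thesis
    using mult_nonneg_nonpos[of "u_dil \<kappa> h z" "snd (g z)"]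
    unfolding left_diff_distrib[of "u_dil \<kappa> h z"] by linarith
qed

text \<open>Under the substitution y = \<lambda> x the factor \<lambda>^n of the kernel is the
  Jacobian, and |t| \<lambda>^2 = |t - h| gives the gradient term the same factor \<lambda>^(-2
  \<kappa>) as the term in u^2.\<close>

lemma slice_energy_dil:
  assumes h: "0 \<le> h" "- 1 + h < t" "t < 0"
  shows "(LINT x|lborel. indicator {x. 0 < snd x} x *
      ((\<bar>t\<bar> * (norm (g_dil \<kappa> h (x, t)))\<^sup>2 - \<kappa> / 2 * (u_dil \<kappa> h (x, t))\<^sup>2) * heat_kernel (x, t)))
    = dilation h t powr (- 2 * \<kappa>) * slice_energy \<kappa> (t - h)"
proof -
  define dl where "dl = dilation h t"
  have dl: "dl \<ge> 1" "dl\<^sup>2 = (t - h) / t" using dilation_ge_1[of t h] dilation_sq[of t h] h by (auto simp: dl_def)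
  define F where "F x = indicator {x. 0 < snd x} x * energy_density \<kappa> (x, t - h)" for x :: "'a \<times> real"
  have mF: "F \<in> borel_measurable borel"
  proof -
    have "continuous_on {x::'a \<times> real. 0 < snd x} (\<lambda>x. energy_density \<kappa> (x, t - h))"
      unfolding energy_density_def using h
      by (intro continuous_intros continuous_on_compose2[OF cont_u] continuous_on_compose2[OF cont_g]
            continuous_on_compose2[OF continuous_on_heat_kernel]) (auto simp: space_cyl_def)
    from borel_measurable_continuous_on_indicator[OF _ this] show ?thesis by (simp add: F_def[abs_def])
  qed
  have pt: "indicator {x. 0 < snd x} x *
      ((\<bar>t\<bar> * (norm (g_dil \<kappa> h (x, t)))\<^sup>2 - \<kappa> / 2 * (u_dil \<kappa> h (x, t))\<^sup>2) * heat_kernel (x, t))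
      = dl powr (- 2 * \<kappa>) * (dl ^ DIM('a \<times> real) * F (dl *\<^sub>R x))" for x :: "'a \<times> real"
  proof -
    define x' where "x' = (dl *\<^sub>R x, t - h)"
    have g': "\<bar>t\<bar> * (norm (g_dil \<kappa> h (x, t)))\<^sup>2 = dl powr (- 2 * \<kappa>) * (\<bar>t - h\<bar> * (norm (g x'))\<^sup>2)"
    proof -
      have "\<bar>t\<bar> * dl\<^sup>2 = \<bar>t - h\<bar>" 
      proof -
        have "dl\<^sup>2 * t = t - h" using dl(2) h by simp
        then show ?thesis using h by (simp add: abs_of_neg mult.commute)
      qed
      moreover have "(dl powr (1 - \<kappa>))\<^sup>2 = dl powr (- 2 * \<kappa>) * dl\<^sup>2"
        using dl(1) by (simp add: powr_add[symmetric] power2_eq_square powr_mult_base algebra_simps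
            flip: powr_realpow)
      ultimately show ?thesis
        by (simp add: g_dil_def x'_def dl_def[symmetric] power_mult_distrib mult_ac)
    qed
    have u': "(u_dil \<kappa> h (x, t))\<^sup>2 = dl powr (- 2 * \<kappa>) * (u x')\<^sup>2"
      using dl(1) by (simp add: u_dil_def x'_def dl_def[symmetric] power_mult_distrib powr_add[symmetric] power2_eq_square)
    have i: "(indicator {x. 0 < snd x} (dl *\<^sub>R x) :: real) = indicator {x. 0 < snd x} x"
      using dl(1) by (auto simp: indicator_def zero_less_mult_iff)
    have G: "heat_kernel (x, t) = dl ^ DIM('a \<times> real) * heat_kernel x'"
      unfolding x'_def dl_def using h by (intro heat_kernel_dilation) auto
    show ?thesis
      unfolding g' u' G F_def i energy_density_def x'_def[symmetric]
      by (simp add: x'_def algebra_simps)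
  qed
  have "integral\<^sup>L lborel F = \<bar>dl\<bar> ^ DIM('a \<times> real) * (LINT x|lborel. F (0 + dl *\<^sub>R x))"
    using mF dl(1) by (intro lborel_integral_affine) auto
  then have "integral\<^sup>L lborel F = dl ^ DIM('a \<times> real) * (LINT x|lborel. F (dl *\<^sub>R x))"
    using dl(1) by simp
  then show ?thesis
    unfolding pt slice_energy_def by (simp add: F_def[abs_def] dl_def)
qed

lemma scaled_energy_dil:
  assumes h: "0 \<le> h" "- 1 + h < t" "t < 0"
  shows "(- t) powr (- \<kappa>) * (dilation h t powr (- 2 * \<kappa>) * slice_energy \<kappa> (t - h)) = scaled_energy \<kappa> (t - h)"
proof -
  have dl: "dilation h t \<ge> 1" "(dilation h t)\<^sup>2 = (t - h) / t" using dilation_ge_1[of t h] dilation_sq[of t h] h by auto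
  have "dilation h t powr (- 2 * \<kappa>) = ((dilation h t)\<^sup>2) powr (- \<kappa>)"
    using dl(1) by (simp add: powr_powr flip: powr_numeral)
  then have "(- t) powr (- \<kappa>) * dilation h t powr (- 2 * \<kappa>) = ((- t) * ((t - h) / t)) powr (- \<kappa>)"
    using h unfolding dl(2) by (subst powr_mult) (auto simp: divide_nonpos_neg)
  also have "(- t) * ((t - h) / t) = - (t - h)" using h by simp
  finally show ?thesis by (simp add: scaled_energy_def mult.assoc[symmetric])
qed

text \<open>Away from t = 0 the densities are bounded and supported in one ball, so dominated
  convergence applies to the slices. Continuity is what later allows values at single times to be
  extracted from time integrals.\<close>

lemma continuous_scaled_energy:
  assumes cd: "- 1 < c" "d < 0"
  shows "continuous_on {c..d} (scaled_energy \<kappa>)"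
proof -
  have ce: "continuous_on {z. 0 \<le> snd (fst z) \<and> - 1 < snd z \<and> snd z < 0} (energy_density \<kappa>)"
    unfolding energy_density_def
    by (intro continuous_intros continuous_on_subset[OF cont_u] continuous_on_subset[OF cont_g]
          continuous_on_subset[OF continuous_on_heat_kernel]) (auto simp: space_cyl_def)
  have "bounded (energy_density \<kappa> ` cyl_box 0 R c d)"
    using cd by (intro compact_imp_bounded compact_continuous_image compact_cyl_box continuous_on_subset[OF ce])
       (auto simp: cyl_box_def)
  then obtain B where B: "B > 0" "\<And>z. z \<in> cyl_box 0 R c d \<Longrightarrow> \<bar>energy_density \<kappa> z\<bar> \<le> B"
    unfolding bounded_pos by auto
  define F where "F t x = indicator {x. 0 < snd x} x * energy_density \<kappa> (x, t)" for t and x :: "'a \<times> real"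
  have F_bound: "\<bar>F t x\<bar> \<le> indicator (cball 0 R) x *\<^sub>R B" if t: "t \<in> {c..d}" for t x
  proof (cases "0 < snd x")
    case True
    show ?thesis
    proof (cases "norm x \<le> R")
      case n: True
      then have "(x, t) \<in> cyl_box 0 R c d" using True t by (simp add: cyl_box_def)
      then show ?thesis using True n B(2) by (simp add: F_def)
    next
      case n: False
      have "(x, t) \<in> space_cyl" using True t cd by (simp add: space_cyl_def)
      then show ?thesis using supp[of "(x, t)"] n by (simp add: F_def energy_density_def)
    qed
  qed (use B(1) in \<open>simp add: F_def\<close>)
  have "continuous_on {c..d} (\<lambda>t. integral\<^sup>L lborel (F t))"
  proof (rule continuous_on_sequentiallyI)
    fix s t assume st: "\<forall>n. s n \<in> {c..d}" "t \<in> {c..d}" "s \<longlonglongrightarrow> t"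
    have mF: "F r \<in> borel_measurable lborel" if "r \<in> {c..d}" for r
    proof -
      have "continuous_on {x::'a \<times> real. 0 < snd x} (\<lambda>x. energy_density \<kappa> (x, r))"
        using that cd by (intro continuous_on_compose2[OF ce] continuous_intros) auto
      from borel_measurable_continuous_on_indicator[OF _ this] show ?thesis by (simp add: F_def[abs_def])
    qed
    show "(\<lambda>n. integral\<^sup>L lborel (F (s n))) \<longlonglongrightarrow> integral\<^sup>L lborel (F t)"
    proof (rule integral_dominated_convergence)
      show "integrable lborel (\<lambda>x::'a \<times> real. indicator (cball 0 R) x *\<^sub>R B)"
        by (rule borel_integrable_compact) auto
      show "AE x in lborel. norm (F (s n) x) \<le> indicator (cball 0 R) x *\<^sub>R B" for n
        using F_bound[of "s n"] st(1) by simp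
      have "(\<lambda>n. F (s n) x) \<longlonglongrightarrow> F t x" for x
      proof (cases "0 < snd x")
        case True
        have "continuous_on {c..d} (\<lambda>r. energy_density \<kappa> (x, r))"
          using True cd by (intro continuous_on_compose2[OF ce] continuous_intros) auto
        then have "(\<lambda>n. energy_density \<kappa> (x, s n)) \<longlonglongrightarrow> energy_density \<kappa> (x, t)"
          using st unfolding continuous_on_sequentially comp_def by blast
        then show ?thesis unfolding F_def by (intro tendsto_intros)
      qed (simp add: F_def)
      then show "AE x in lborel. (\<lambda>n. F (s n) x) \<longlonglongrightarrow> F t x" by simp
    qed (use mF st in auto)
  qed
  then have "continuous_on {c..d} (slice_energy \<kappa>)" by (simp add: slice_energy_def[abs_def] F_def[abs_def])
  then show ?thesis unfolding scaled_energy_def[abs_def] using cd by (intro continuous_intros) auto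
qed

text \<open>In the expansion of |g + gp|^2 the cross term is the one that the weighted inequality
  controls, while (- t) |gp|^2 is nonnegative and is dropped. Hence J + Q is at most the difference
  of the two energy densities, and the integral of Q is nonnegative.\<close>

lemma energy_difference_lower_bound:
  assumes \<kappa>: "0 < \<kappa>" and h: "0 < h" "- 1 + h < a" "a \<le> b" "b < 0"
  defines "p \<equiv> \<lambda>z. u_dil \<kappa> h z - u z"
  defines "J \<equiv> \<lambda>z. indicator (closed_slab a b) z * ((- snd z) powr (- \<kappa>) * heat_kernel z *
      (p z * (fst z \<bullet> g z + 2 * snd z * w z - \<kappa> * u z + 2 * snd z * f z) - \<kappa> / 2 * (p z)\<^sup>2))"
  shows "integrable lborel J"
    "integral\<^sup>L lborel J \<le> (LINT t:{a..b}|lborel. scaled_energy \<kappa> (t - h) - scaled_energy \<kappa> t)"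
proof -
  let ?S = "cyl_slab (- 1 + h) 0 :: 'a spacetime set"
  have h0: "0 \<le> h" "- 1 \<le> - 1 + h" using h by auto
  define gp where "gp z = g_dil \<kappa> h z - g z" for z
  have sub: "?S \<subseteq> space_cyl" using dil_in_space_cyl(5)[OF h0(1)] by blast
  note cu = continuous_on_subset[OF cont_u sub] and cg = continuous_on_subset[OF cont_g sub]
  note cd = continuous_dil[OF h0(1), of \<kappa>]
  have cp: "continuous_on ?S p" "continuous_on ?S gp"
    unfolding p_def gp_def by (intro continuous_intros cd cu cg)+
  have cG: "continuous_on ?S heat_kernel" by (rule cont_kernel_slab) simp
  have ct: "continuous_on ?S (\<lambda>z. (- snd z) powr c)" for c
    by (intro continuous_intros) (auto simp: cyl_slab_def)
  have ps: "p z = 0 \<and> gp z = 0" if "z \<in> ?S" "R < norm (fst z)" for z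
    using dil_support[OF h0(1) that] by (simp add: p_def gp_def)
  have dp: "((\<lambda>y. p (y, snd z)) has_derivative (\<lambda>v. gp z \<bullet> v)) (at (fst z))" if "z \<in> ?S" "0 < snd (fst z)" for z
    unfolding p_def gp_def inner_diff_left
    by (intro has_derivative_diff u_dil_derivative[OF h0(1)] deriv_u_interior that)
       (use dil_in_space_cyl(5)[OF h0(1) that(1)] that in simp_all)
  have bdry: "p z * snd (g z) \<le> 0" if "z \<in> ?S" "snd (fst z) = 0" for z
    unfolding p_def by (rule dil_boundary[OF h0(1) that])
  \<comment> \<open>On the slab t \<le> b, so the maximum equals - t there; taking it makes the
    weight continuous on the whole line. The factor 2 matches the cross term, and the exponent 1 -
    \<kappa> combines the factor |t| of the gradient term with the scaling factor of E.\<close>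
  define \<omega> where "\<omega> t = 2 * (max (- t) (- b)) powr (1 - \<kappa>)" for t
  have \<omega>: "continuous_on UNIV \<omega>" "\<And>t. 0 \<le> \<omega> t"
    unfolding \<omega>_def using h(4) by (auto intro!: continuous_intros)
  define Q where "Q z = indicator {z. 0 < snd (fst z) \<and> a \<le> snd z \<and> snd z \<le> b} z *
      (\<omega> (snd z) * heat_kernel z * (g z \<bullet> gp z + p z * (fst z \<bullet> g z) / (2 * snd z) + (w z + f z) * p z))" for z
  have Q: "integrable lborel Q" "0 \<le> integral\<^sup>L lborel Q"
    unfolding Q_def[abs_def]
    by (rule weighted_inequality[OF h0(2) _ cp dp ps bdry \<omega> h(2,3,4)]; simp)+
  define A where "A z = (- snd z) powr (- \<kappa>) * heat_kernel z *
      (p z * (fst z \<bullet> g z - \<kappa> * u z) - \<kappa> / 2 * (p z)\<^sup>2)" for z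
  define B where "B z = (- snd z) powr (- \<kappa>) * heat_kernel z * (2 * snd z * p z)" for z
  have cA: "continuous_on ?S A" and cB: "continuous_on ?S B"
    unfolding A_def B_def by (intro continuous_intros ct cG cp cu cg)+
  have A0: "A z = 0" and B0: "B z = 0" if "z \<in> ?S" "R < norm (fst z)" for z
    using ps[OF that] by (simp_all add: A_def B_def)
  have iA: "integrable lborel (\<lambda>z. indicator (closed_slab a b) z * A z)"
    by (rule slab_integrable(1)[OF cA A0 h(2,4)])
  note iB = slab_integrable_wf(1)[OF cB B0 h(2,4)] slab_integrable_wf(2)[OF cB B0 h(2,4)]
  have J_eq: "J z = indicator (closed_slab a b) z * A z + w z * (indicator (closed_slab a b) z * B z)
      + f z * (indicator (closed_slab a b) z * B z)" for z
    by (simp add: J_def A_def B_def algebra_simps)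
  show iJ: "integrable lborel J" unfolding J_eq[abs_def] by (intro Bochner_Integration.integrable_add iA iB)
  define V where "V z = (- snd z) powr (- \<kappa>) * ((\<bar>snd z\<bar> * (norm (g_dil \<kappa> h z))\<^sup>2 - \<kappa> / 2 * (u_dil \<kappa> h z)\<^sup>2) * heat_kernel z)" for z
  define W where "W z = (- snd z) powr (- \<kappa>) * energy_density \<kappa> z" for z
  have cV: "continuous_on ?S V" and cW: "continuous_on ?S W"
    unfolding V_def W_def energy_density_def by (intro continuous_intros ct cG cd cu cg)+
  have V0: "V z = 0" and W0: "W z = 0" if "z \<in> ?S" "R < norm (fst z)" for z
    using dil_support[OF h0(1) that] by (simp_all add: V_def W_def energy_density_def)
  note iV = slab_integrable(1)[OF cV V0 h(2,4)] and iW = slab_integrable(1)[OF cW W0 h(2,4)]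
  have alg1: "c * (2 * (- t)) * (A + P / (2 * t) + F * q) = c * (2 * (- t) * A - P - 2 * t * F * q)"
    if "t < 0" for c t A P F q :: real using that by (simp add: field_simps)
  have alg2: "c * (q * (X + 2 * t * w1 - \<kappa> * u1 + 2 * t * f1) - \<kappa> / 2 * q\<^sup>2)
      + c * (2 * (- t) * A - q * X - 2 * t * (w1 + f1) * q) = c * (2 * (- t) * A - \<kappa> * u1 * q - \<kappa> / 2 * q\<^sup>2)"
    for c t A X q w1 f1 u1 :: real by algebra
  have alg3: "2 * (- t) * A - \<kappa> * u1 * q - \<kappa> / 2 * q\<^sup>2
      \<le> ((- t) * (n + 2 * A + m) - \<kappa> / 2 * (u1 + q)\<^sup>2) - ((- t) * n - \<kappa> / 2 * u1\<^sup>2)"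
    if "0 \<le> (- t) * m" for t A u1 q n m :: real
  proof -
    have "((- t) * (n + 2 * A + m) - \<kappa> / 2 * (u1 + q)\<^sup>2) - ((- t) * n - \<kappa> / 2 * u1\<^sup>2)
      = 2 * (- t) * A - \<kappa> * u1 * q - \<kappa> / 2 * q\<^sup>2 + (- t) * m" by algebra
    then show ?thesis using that by linarith
  qed
  have alg4: "c1 * G * (a1 - b1) = c1 * (a1 * G) - c1 * (b1 * G)" for c1 G a1 b1 :: real
    by (simp add: algebra_simps)
  have pt: "J z + Q z \<le> indicator (closed_slab a b) z * V z - indicator (closed_slab a b) z * W z" for z
  proof (cases "z \<in> closed_slab a b")
    case True
    define t x where "t = snd z" and "x = fst z"
    have t: "t < 0" "max (- t) (- b) = - t" using True h by (auto simp: closed_slab_def t_def)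
    define c where "c = (- t) powr (- \<kappa>) * heat_kernel z"
    have c: "c \<ge> 0" by (simp add: c_def heat_kernel_nonneg)
    have w: "\<omega> t * heat_kernel z = c * (2 * (- t))"
    proof -
      have "(- t) powr (1 - \<kappa>) = (- t) * (- t) powr (- \<kappa>)" using t powr_mult_base[of "- t" "- \<kappa>"] by simp
      then show ?thesis unfolding \<omega>_def t(2) c_def by (simp only: mult_ac)
    qed
    have "z \<in> {z. 0 < snd (fst z) \<and> a \<le> snd z \<and> snd z \<le> b}" using True by (simp add: closed_slab_def)
    then have "Q z = \<omega> t * heat_kernel z * (g z \<bullet> gp z + p z * (x \<bullet> g z) / (2 * t) + (w z + f z) * p z)"
      unfolding Q_def t_def x_def by simp
    also have "\<dots> = c * (2 * (- t) * (g z \<bullet> gp z) - p z * (x \<bullet> g z) - 2 * t * (w z + f z) * p z)"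
      unfolding w by (rule alg1[OF t(1)])
    finally have Qz: "Q z = c * (2 * (- t) * (g z \<bullet> gp z) - p z * (x \<bullet> g z) - 2 * t * (w z + f z) * p z)" .
    have "J z = c * (p z * (x \<bullet> g z + 2 * t * w z - \<kappa> * u z + 2 * t * f z) - \<kappa> / 2 * (p z)\<^sup>2)"
      unfolding J_def c_def t_def x_def using True by (simp only: indicator_simps mult_1_left)
    then have "J z + Q z = c * (2 * (- t) * (g z \<bullet> gp z) - \<kappa> * u z * p z - \<kappa> / 2 * (p z)\<^sup>2)"
      unfolding Qz by (simp only: alg2)
    also have "\<dots> \<le> c * ((\<bar>t\<bar> * (norm (g z + gp z))\<^sup>2 - \<kappa> / 2 * (u z + p z)\<^sup>2) - (\<bar>t\<bar> * (norm (g z))\<^sup>2 - \<kappa> / 2 * (u z)\<^sup>2))"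
    proof (rule mult_left_mono[OF _ c])
      have "(norm (g z + gp z))\<^sup>2 = (norm (g z))\<^sup>2 + 2 * (g z \<bullet> gp z) + (norm (gp z))\<^sup>2"
        by (simp add: power2_norm_eq_inner inner_add inner_commute)
      moreover have "0 \<le> (- t) * (norm (gp z))\<^sup>2" using t by (intro mult_nonneg_nonneg) auto
      ultimately show "2 * (- t) * (g z \<bullet> gp z) - \<kappa> * u z * p z - \<kappa> / 2 * (p z)\<^sup>2
        \<le> (\<bar>t\<bar> * (norm (g z + gp z))\<^sup>2 - \<kappa> / 2 * (u z + p z)\<^sup>2) - (\<bar>t\<bar> * (norm (g z))\<^sup>2 - \<kappa> / 2 * (u z)\<^sup>2)"
        using alg3[of t "(norm (gp z))\<^sup>2" "g z \<bullet> gp z" "u z" "p z" "(norm (g z))\<^sup>2"] abs_of_neg[OF t(1)]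
        by (simp only:)
    qed
    also have "\<dots> = V z - W z"
    proof -
      have 1: "g z + gp z = g_dil \<kappa> h z" and 2: "u z + p z = u_dil \<kappa> h z" by (simp_all add: gp_def p_def)
      show ?thesis
        unfolding 1 2 V_def W_def energy_density_def c_def t_def by (rule alg4)
    qed
    finally show ?thesis by (simp only: indicator_simps(1)[OF True] mult_1_left)
  next
    case False
    then have "J z = 0" by (simp add: J_def)
    moreover have "Q z = 0" using False by (simp add: Q_def closed_slab_def)
    ultimately show ?thesis using False by simp
  qed
  have "integral\<^sup>L lborel J \<le> integral\<^sup>L lborel J + integral\<^sup>L lborel Q" using Q(2) by simp
  also have "\<dots> = (LINT z|lborel. J z + Q z)" using iJ Q(1) by simp
  also have "\<dots> \<le> (LINT z|lborel. indicator (closed_slab a b) z * V z - indicator (closed_slab a b) z * W z)"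
    using iJ Q(1) iV iW pt by (intro integral_mono) auto
  also have "\<dots> = (LINT t|lborel. (LINT x|lborel. indicator (closed_slab a b) (x, t) * V (x, t))
        - (LINT x|lborel. indicator (closed_slab a b) (x, t) * W (x, t)))"
    using iV iW lborel_Fubini_time[OF iV] lborel_Fubini_time[OF iW] by simp
  also have "\<dots> = (LINT t:{a..b}|lborel. scaled_energy \<kappa> (t - h) - scaled_energy \<kappa> t)"
    unfolding set_lebesgue_integral_def
  proof (rule Bochner_Integration.integral_cong[OF refl])
    fix t :: real
    have i: "indicator (closed_slab a b) (x, t) = (indicator {a..b} t * indicator {x. 0 < snd x} x :: real)"
      for x :: "'a \<times> real" by (auto simp: closed_slab_def indicator_def)
    have I: "(LINT x|lborel. c1 * ind x * (c2 * E x)) = c1 * (c2 * (LINT x|lborel. ind x * E x))"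
      for c1 c2 :: real and ind E :: "'a \<times> real \<Rightarrow> real"
    proof -
      have "c1 * ind x * (c2 * E x) = (c1 * c2) * (ind x * E x)" for x by (simp only: mult_ac)
      then show ?thesis by (simp only: integral_mult_right_zero mult.assoc)
    qed
    have v: "(LINT x|lborel. indicator (closed_slab a b) (x, t) * V (x, t))
      = indicator {a..b} t * ((- t) powr (- \<kappa>) * (LINT x|lborel. indicator {x. 0 < snd x} x *
      ((\<bar>t\<bar> * (norm (g_dil \<kappa> h (x, t)))\<^sup>2 - \<kappa> / 2 * (u_dil \<kappa> h (x, t))\<^sup>2) * heat_kernel (x, t))))"
      unfolding i V_def fst_conv snd_conv by (rule I)
    have w: "(LINT x|lborel. indicator (closed_slab a b) (x, t) * W (x, t))
      = indicator {a..b} t * ((- t) powr (- \<kappa>) * slice_energy \<kappa> t)"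
      unfolding i W_def slice_energy_def fst_conv snd_conv by (rule I)
    show "(LINT x|lborel. indicator (closed_slab a b) (x, t) * V (x, t)) - (LINT x|lborel. indicator (closed_slab a b) (x, t) * W (x, t))
      = indicator {a..b} t *\<^sub>R (scaled_energy \<kappa> (t - h) - scaled_energy \<kappa> t)"
    proof (cases "t \<in> {a..b}")
      case True
      have s: "(LINT x|lborel. indicator {x. 0 < snd x} x *
        ((\<bar>t\<bar> * (norm (g_dil \<kappa> h (x, t)))\<^sup>2 - \<kappa> / 2 * (u_dil \<kappa> h (x, t))\<^sup>2) * heat_kernel (x, t)))
        = dilation h t powr (- 2 * \<kappa>) * slice_energy \<kappa> (t - h)"
        by (rule slice_energy_dil) (use True h in auto)
      have "(- t) powr (- \<kappa>) * (dilation h t powr (- 2 * \<kappa>) * slice_energy \<kappa> (t - h)) = scaled_energy \<kappa> (t - h)"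
        by (rule scaled_energy_dil) (use True h in auto)
      then show ?thesis unfolding v w s using True by (simp add: scaled_energy_def)
    qed (simp add: v w)
  qed
  finally show "integral\<^sup>L lborel J \<le> (LINT t:{a..b}|lborel. scaled_energy \<kappa> (t - h) - scaled_energy \<kappa> t)" .
qed

end

section \<open>Monotonicity of the slice energy\<close>

text \<open>The approach is from the left because the point may be the right end of the
  interval.\<close>

lemma difference_quotient_left:
  fixes F :: "real \<Rightarrow> real"
  assumes F: "(F has_real_derivative D) (at x within {c..d})" and x: "c < x" "x \<le> d"
    and h: "\<And>n. 0 < h n" "\<And>n. h n \<le> x - c" "h \<longlonglongrightarrow> 0"
  shows "(\<lambda>n. (F (x - h n) - F x) / h n) \<longlonglongrightarrow> - D"
proof -
  have lim: "((\<lambda>y. (F y - F x) / (y - x)) \<longlongrightarrow> D) (at x within {c..d})"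
    using F by (simp add: has_field_derivative_iff)
  have "(\<lambda>n. x - h n) \<longlonglongrightarrow> x" using tendsto_diff[OF tendsto_const h(3), of x] by simp
  moreover have "x - h n \<in> {c..d} \<and> x - h n \<noteq> x" for n using h(1,2)[of n] x by auto
  ultimately have "filterlim (\<lambda>n. x - h n) (at x within {c..d}) sequentially"
    by (simp add: filterlim_at)
  from tendsto_minus[OF filterlim_compose[OF lim this]]
  have "(\<lambda>n. - ((F (x - h n) - F x) / (- h n))) \<longlonglongrightarrow> - D" by simp
  then show ?thesis by simp
qed

text \<open>Shifting the variable leaves only the integrals of \<open>E\<close> over [a - h, a] and,
  with a minus sign, over [b - h, b]; divided by h they tend to the values of \<open>E\<close> at
  the end points.\<close>

lemma integral_increment_limit:
  fixes E :: "real \<Rightarrow> real"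
  assumes E: "continuous_on {c..b} E" and ab: "c < a" "a \<le> b"
    and h: "\<And>n. 0 < h n" "\<And>n. h n \<le> a - c" "h \<longlonglongrightarrow> 0"
  shows "(\<lambda>n. (LINT t:{a..b}|lborel. E (t - h n) - E t) / h n) \<longlonglongrightarrow> E a - E b"
proof -
  define F where "F s = integral {c..s} E" for s
  have int: "E integrable_on {x..y}" if "c \<le> x" "y \<le> b" for x y
    using that by (intro integrable_continuous_real continuous_on_subset[OF E]) auto
  have F': "(F has_real_derivative E s) (at s within {c..b})" if "s \<in> {c..b}" for s
    unfolding F_def using that by (intro integral_has_real_derivative E)
  have eq: "(LINT t:{a..b}|lborel. E (t - h n) - E t) = (F (b - h n) - F b) - (F (a - h n) - F a)" for n
  proof -
    have c1: "continuous_on {a..b} (\<lambda>t. E (t - h n))"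
      by (rule continuous_on_compose2[OF E]) (use ab h(1,2)[of n] in \<open>auto intro!: continuous_intros\<close>)
    have c2: "continuous_on {a..b} E" by (rule continuous_on_subset[OF E]) (use ab in auto)
    have "(LINT t:{a..b}|lborel. E (t - h n) - E t) = integral {a..b} (\<lambda>t. E (t - h n) - E t)"
      by (intro set_borel_integral_eq_integral borel_integrable_atLeastAtMost' continuous_intros c1 c2)
    also have "\<dots> = integral {a..b} (\<lambda>t. E (t - h n)) - integral {a..b} E"
      by (intro Henstock_Kurzweil_Integration.integral_diff integrable_continuous_real c1 c2)
    also have "integral {a..b} (\<lambda>t. E (t - h n)) = integral {a - h n..b - h n} E"
      using integral_shift_Icc_real[of a b E "- h n"] by (simp add: o_def)
    also have "\<dots> = F (b - h n) - F (a - h n)"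
      using Henstock_Kurzweil_Integration.integral_combine[of c "a - h n" "b - h n" E] ab h(1,2)[of n] int
      by (simp add: F_def algebra_simps)
    also have "integral {a..b} E = F b - F a"
      using Henstock_Kurzweil_Integration.integral_combine[of c a b E] ab int by (simp add: F_def algebra_simps)
    finally show ?thesis by simp
  qed
  have hb: "h n \<le> b - c" for n using h(2)[of n] ab by simp
  have "(\<lambda>n. (F (b - h n) - F b) / h n - (F (a - h n) - F a) / h n) \<longlonglongrightarrow> - E b - (- E a)"
    using ab by (intro tendsto_diff difference_quotient_left[OF F' _ _ h(1) _ h(3)] h(2) hb) auto
  then show ?thesis by (simp add: eq diff_divide_distrib)
qed

text \<open>This is \<lambda>^2 - 1 = h / (- t), factored. As \<lambda> tends to 1 the quotient
  tends to 1 / (- 2t), which is the origin of this factor in the limit.\<close>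

lemma dilation_increment:
  assumes "t < 0" "0 < h"
  shows "(dilation h t - 1) / h = 1 / (- t * (dilation h t + 1))" "1 < dilation h t"
proof -
  have sq: "(dilation h t)\<^sup>2 = 1 + h / (- t)" using dilation_sq[of t h] assms by (simp add: diff_divide_distrib)
  have ge: "1 \<le> dilation h t" using dilation_ge_1[of t h] assms by simp
  have "dilation h t \<noteq> 1" using sq assms by auto
  then show "1 < dilation h t" using ge by simp
  have "(dilation h t - 1) * (dilation h t + 1) = h / (- t)"
    using sq by (simp add: algebra_simps power2_eq_square)
  then have "(dilation h t - 1) * (- t * (dilation h t + 1)) = h"
    using assms by (simp add: field_simps)
  moreover have "- t * (dilation h t + 1) \<noteq> 0" using ge assms by simp
  ultimately show "(dilation h t - 1) / h = 1 / (- t * (dilation h t + 1))"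
    using assms by (simp add: field_simps)
qed

section \<open>Splitting the quotient into dilation and time shift\<close>

context signorini
begin

text \<open>Compares the competitor with \<open>u\<close> shifted in time alone. This part of (v -
  u) / h is governed by the classical spatial gradient; what remains is
  \<open>time_quotient\<close>.\<close>

definition space_quotient :: "real \<Rightarrow> real \<Rightarrow> 'a spacetime \<Rightarrow> real" where
  "space_quotient \<kappa> h z = (u_dil \<kappa> h z - u (fst z, snd z - h)) / h"

lemma dil_quotient_split:
  "(u_dil \<kappa> h z - u z) / h = space_quotient \<kappa> h z + time_quotient h z"
  by (simp add: space_quotient_def time_quotient_def add_divide_distrib[symmetric])

text \<open>The mean value theorem in the dilation parameter m between 1 and \<lambda>, applied to
  m^(- \<kappa>) u(m x, t - h); the increment of m, divided by h, is rewritten by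
  \<open>dilation_increment\<close>.\<close>

lemma space_quotient_mean_value:
  assumes h: "0 < h" and z: "z \<in> cyl_slab (- 1 + h) 0" "0 < snd (fst z)"
  shows "\<exists>m. 1 < m \<and> m < dilation h (snd z) \<and> space_quotient \<kappa> h z =
    (m powr (- \<kappa>) * (g (m *\<^sub>R fst z, snd z - h) \<bullet> fst z) - \<kappa> * m powr (- \<kappa> - 1) * u (m *\<^sub>R fst z, snd z - h))
      * (1 / (- snd z * (dilation h (snd z) + 1)))"
proof -
  define x t where "x = fst z" and "t = snd z - h"
  have t: "snd z < 0" "- 1 < t" "t \<le> 0" using z h by (auto simp: t_def cyl_slab_def)
  define \<psi> where "\<psi> m = m powr (- \<kappa>) * u (m *\<^sub>R x, t)" for m
  define \<psi>' where "\<psi>' m = m powr (- \<kappa>) * (g (m *\<^sub>R x, t) \<bullet> x) - \<kappa> * m powr (- \<kappa> - 1) * u (m *\<^sub>R x, t)" for m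
  note d = dilation_increment[OF t(1) h]
  have "(\<psi> has_real_derivative \<psi>' m) (at m)" if "1 \<le> m" for m
  proof -
    have in_cyl: "(m *\<^sub>R x, t) \<in> space_cyl" "0 < snd (fst (m *\<^sub>R x, t))"
      using that t z(2) by (auto simp: space_cyl_def x_def)
    have "((\<lambda>m. u (m *\<^sub>R x, t)) has_derivative (\<lambda>s. g (m *\<^sub>R x, t) \<bullet> (s *\<^sub>R x))) (at m)"
      by (rule has_derivative_compose[where f="\<lambda>m. m *\<^sub>R x" and g="\<lambda>y. u (y, t)"])
         (use deriv_u_interior[OF in_cyl] in \<open>auto intro!: derivative_eq_intros\<close>)
    then have 1: "((\<lambda>m. u (m *\<^sub>R x, t)) has_real_derivative g (m *\<^sub>R x, t) \<bullet> x) (at m)"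
      by (rule has_derivative_imp_has_field_derivative) simp
    have 2: "((\<lambda>m. m powr (- \<kappa>)) has_real_derivative (- \<kappa>) * m powr (- \<kappa> - 1)) (at m)"
      using that by (intro has_real_derivative_powr) auto
    from DERIV_mult[OF 2 1] show ?thesis
      by (simp add: \<psi>_def[abs_def] \<psi>'_def mult_ac)
  qed
  then obtain m where m: "1 < m" "m < dilation h (snd z)"
      "\<psi> (dilation h (snd z)) - \<psi> 1 = (dilation h (snd z) - 1) * \<psi>' m"
    using MVT2[OF d(2), of \<psi> \<psi>'] by auto
  have "space_quotient \<kappa> h z = (\<psi> (dilation h (snd z)) - \<psi> 1) / h"
    by (simp add: space_quotient_def u_dil_def \<psi>_def x_def t_def)
  also have "\<dots> = \<psi>' m * ((dilation h (snd z) - 1) / h)" unfolding m(3) by simp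
  finally have "space_quotient \<kappa> h z = \<psi>' m * (1 / (- snd z * (dilation h (snd z) + 1)))"
    unfolding d(1) .
  then show ?thesis using m(1,2) unfolding \<psi>'_def x_def t_def by blast
qed

lemma bounded_on_box:
  fixes F :: "'a spacetime \<Rightarrow> 'c::real_normed_vector"
  assumes "continuous_on {z. 0 \<le> snd (fst z) \<and> - 1 < snd z \<and> snd z < 0} F" "- 1 < a" "b < 0"
  obtains B where "B > 0" "\<And>z. z \<in> cyl_box 0 R a b \<Longrightarrow> norm (F z) \<le> B"
proof -
  have "bounded (F ` cyl_box 0 R a b)"
    using assms(2,3) by (intro compact_imp_bounded compact_continuous_image compact_cyl_box continuous_on_subset[OF assms(1)])
       (auto simp: cyl_box_def)
  then show thesis using that unfolding bounded_pos by auto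
qed

text \<open>The points of the mean value theorem lie in one fixed box or outside the support, which
  makes the bound uniform in \<open>h\<close>. It serves for dominated convergence and for the L2
  bound of the quadratic remainder.\<close>

lemma space_quotient_bounded:
  assumes \<kappa>: "0 < \<kappa>" and ab: "- 1 < a - h0" "b < 0"
  obtains B where "B > 0" "\<And>h z. 0 < h \<Longrightarrow> h \<le> h0 \<Longrightarrow> z \<in> closed_slab a b \<Longrightarrow> \<bar>space_quotient \<kappa> h z\<bar> \<le> B"
    "\<And>h z. 0 < h \<Longrightarrow> h \<le> h0 \<Longrightarrow> z \<in> closed_slab a b \<Longrightarrow> R < norm (fst z) \<Longrightarrow> space_quotient \<kappa> h z = 0"
proof -
  have c: "continuous_on {z. 0 \<le> snd (fst z) \<and> - 1 < snd z \<and> snd z < 0} u"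
    "continuous_on {z. 0 \<le> snd (fst z) \<and> - 1 < snd z \<and> snd z < 0} g"
    by (auto intro!: continuous_on_subset[OF cont_u] continuous_on_subset[OF cont_g] simp: space_cyl_def)
  obtain Bu where Bu: "Bu > 0" "\<And>z. z \<in> cyl_box 0 R (a - h0) b \<Longrightarrow> norm (u z) \<le> Bu"
    using bounded_on_box[OF c(1) ab] by blast
  obtain Bg where Bg: "Bg > 0" "\<And>z. z \<in> cyl_box 0 R (a - h0) b \<Longrightarrow> norm (g z) \<le> Bg"
    using bounded_on_box[OF c(2) ab] by blast
  define B where "B = (Bg * R + \<kappa> * Bu) * (1 / (- b))"
  have B: "B > 0" unfolding B_def using Bu(1) Bg(1) R_pos \<kappa> ab
    by (intro mult_pos_pos add_pos_pos divide_pos_pos) auto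
  have slab: "z \<in> cyl_slab (- 1 + h) 0" "0 < snd (fst z)" if "0 < h" "h \<le> h0" "z \<in> closed_slab a b"
    for h and z :: "'a spacetime"
    using that ab by (auto simp: closed_slab_def cyl_slab_def)
  show thesis
  proof
    show "B > 0" by fact
    fix h and z :: "'a spacetime" assume h: "0 < h" "h \<le> h0" and z: "z \<in> closed_slab a b"
    show zero: "space_quotient \<kappa> h z = 0" if "R < norm (fst z)"
    proof -
      have "u_dil \<kappa> h z = 0" using dil_support(1)[OF less_imp_le[OF h(1)] slab(1)[OF h z] that] .
      moreover have "(fst z, snd z - h) \<in> space_cyl"
        using h z ab by (auto simp: closed_slab_def space_cyl_def)
      then have "u (fst z, snd z - h) = 0" using supp that by simp
      ultimately show ?thesis by (simp add: space_quotient_def)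
    qed
    show "\<bar>space_quotient \<kappa> h z\<bar> \<le> B"
    proof (cases "norm (fst z) \<le> R")
      case False
      then show ?thesis using zero B by simp
    next
      case True
      obtain m where m: "1 < m" "space_quotient \<kappa> h z =
          (m powr (- \<kappa>) * (g (m *\<^sub>R fst z, snd z - h) \<bullet> fst z) - \<kappa> * m powr (- \<kappa> - 1) * u (m *\<^sub>R fst z, snd z - h))
          * (1 / (- snd z * (dilation h (snd z) + 1)))"
        using space_quotient_mean_value[OF h(1) slab[OF h z]] by blast
      define z' where "z' = (m *\<^sub>R fst z, snd z - h)"
      have z': "z' \<in> space_cyl" using m(1) slab[OF h z] h z ab by (auto simp: z'_def space_cyl_def closed_slab_def)
      have ug: "norm (u z') \<le> Bu" "norm (g z') \<le> Bg"
      proof -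
        have "norm (u z') \<le> Bu \<and> norm (g z') \<le> Bg"
        proof (cases "norm (fst z') \<le> R")
          case True
          then have "z' \<in> cyl_box 0 R (a - h0) b"
            using z' h z by (auto simp: z'_def cyl_box_def space_cyl_def closed_slab_def)
          then show ?thesis using Bu(2) Bg(2) by blast
        next
          case False
          then show ?thesis using supp[OF z'] Bu(1) Bg(1) by simp
        qed
        then show "norm (u z') \<le> Bu" "norm (g z') \<le> Bg" by auto
      qed
      have pw: "m powr (- \<kappa>) \<le> 1" "m powr (- \<kappa> - 1) \<le> 1"
        using m(1) \<kappa> powr_mono[of "- \<kappa>" 0 m] powr_mono[of "- \<kappa> - 1" 0 m] by auto
      have "\<bar>g z' \<bullet> fst z\<bar> \<le> Bg * R"
        using Cauchy_Schwarz_ineq2[of "g z'" "fst z"] mult_mono[OF ug(2) True] Bg(1) by simp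
      then have 1: "\<bar>m powr (- \<kappa>) * (g z' \<bullet> fst z)\<bar> \<le> 1 * (Bg * R)"
        unfolding abs_mult using pw by (intro mult_mono) auto
      have 2: "\<bar>\<kappa> * m powr (- \<kappa> - 1) * u z'\<bar> \<le> \<kappa> * 1 * Bu"
        unfolding abs_mult using pw \<kappa> ug(1) by (intro mult_mono) auto
      have 3: "\<bar>m powr (- \<kappa>) * (g z' \<bullet> fst z) - \<kappa> * m powr (- \<kappa> - 1) * u z'\<bar> \<le> Bg * R + \<kappa> * Bu"
        using 1 2 by linarith
      have 4: "\<bar>1 / (- snd z * (dilation h (snd z) + 1))\<bar> \<le> 1 / (- b)"
      proof -
        have d: "dilation h (snd z) \<ge> 1" "snd z < 0"
          using dil_in_space_cyl(2,4)[OF less_imp_le[OF h(1)] slab(1)[OF h z]] by auto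
        have "- b \<le> - snd z * 1" using z by (simp add: closed_slab_def)
        also have "\<dots> \<le> - snd z * (dilation h (snd z) + 1)" using d by (intro mult_left_mono) auto
        finally have le: "- b \<le> - snd z * (dilation h (snd z) + 1)" .
        then have "0 < - snd z * (dilation h (snd z) + 1)" using ab(2) by linarith
        then have "\<bar>1 / (- snd z * (dilation h (snd z) + 1))\<bar> = 1 / (- snd z * (dilation h (snd z) + 1))"
          by (simp only: abs_div_pos abs_of_pos abs_one abs_divide)
        also have "\<dots> \<le> 1 / (- b)" using le ab(2) by (intro frac_le) auto
        finally show ?thesis .
      qed
      show ?thesis
        unfolding m(2) z'_def[symmetric] B_def abs_mult[of "_ - _"] using 3 4 by (intro mult_mono) auto
    qed
  qed
qed

text \<open>The intermediate parameters are squeezed between 1 and \<lambda>, so the points tend to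
  \<open>z\<close> and the continuity of \<open>u\<close> and \<open>g\<close> gives the
  limit.\<close>

lemma space_quotient_tendsto:
  assumes ab: "- 1 < a - h0" "b < 0" and z: "z \<in> closed_slab a b"
    and h: "\<And>n. 0 < h n" "\<And>n. h n \<le> h0" "h \<longlonglongrightarrow> 0"
  shows "(\<lambda>n. space_quotient \<kappa> (h n) z) \<longlonglongrightarrow> (fst z \<bullet> g z - \<kappa> * u z) / (- 2 * snd z)"
proof -
  define x t where "x = fst z" and "t = snd z"
  have t: "t < 0" "- 1 < t - h0" using ab z by (auto simp: t_def closed_slab_def)
  have slab: "z \<in> cyl_slab (- 1 + h n) 0" "0 < snd (fst z)" for n
    using z ab h(2)[of n] by (auto simp: closed_slab_def cyl_slab_def)
  have "\<forall>n. \<exists>m. 1 < m \<and> m < dilation (h n) t \<and> space_quotient \<kappa> (h n) z =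
    (m powr (- \<kappa>) * (g (m *\<^sub>R x, t - h n) \<bullet> x) - \<kappa> * m powr (- \<kappa> - 1) * u (m *\<^sub>R x, t - h n))
      * (1 / (- t * (dilation (h n) t + 1)))"
    using space_quotient_mean_value[OF h(1) slab] unfolding x_def t_def by blast
  then obtain m where m: "\<And>n. 1 < m n" "\<And>n. m n < dilation (h n) t" "\<And>n. space_quotient \<kappa> (h n) z =
    (m n powr (- \<kappa>) * (g (m n *\<^sub>R x, t - h n) \<bullet> x) - \<kappa> * m n powr (- \<kappa> - 1) * u (m n *\<^sub>R x, t - h n))
      * (1 / (- t * (dilation (h n) t + 1)))"
    using choice by metis
  have dl: "(\<lambda>n. dilation (h n) t) \<longlonglongrightarrow> 1"
  proof -
    have "(\<lambda>n. sqrt ((t - h n) / t)) \<longlonglongrightarrow> sqrt ((t - 0) / t)"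
      using t by (intro tendsto_intros h(3)) auto
    then show ?thesis using t by (simp add: dilation_def)
  qed
  have ml: "m \<longlonglongrightarrow> 1"
    by (rule tendsto_sandwich[OF _ _ tendsto_const dl]) (auto intro!: always_eventually less_imp_le m(1,2))
  have zl: "(\<lambda>n. (m n *\<^sub>R x, t - h n)) \<longlonglongrightarrow> (1 *\<^sub>R x, t - 0)"
    by (intro tendsto_intros ml h(3))
  have inc: "(m n *\<^sub>R x, t - h n) \<in> space_cyl" for n
  proof -
    have "0 \<le> m n * snd x" using m(1)[of n] slab(2) by (simp add: x_def)
    then show ?thesis using h(1,2)[of n] t by (simp add: space_cyl_def)
  qed
  have zc: "(1 *\<^sub>R x, t - 0) \<in> space_cyl"
    using z ab h(1,2)[of 0] by (auto simp: x_def t_def space_cyl_def closed_slab_def)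
  have ul: "(\<lambda>n. u (m n *\<^sub>R x, t - h n)) \<longlonglongrightarrow> u z"
    using continuous_on_tendsto_compose[OF cont_u zl zc] inc by (simp add: x_def t_def)
  have gl: "(\<lambda>n. g (m n *\<^sub>R x, t - h n)) \<longlonglongrightarrow> g z"
    using continuous_on_tendsto_compose[OF cont_g zl zc] inc by (simp add: x_def t_def)
  have "(\<lambda>n. space_quotient \<kappa> (h n) z) \<longlonglongrightarrow>
    (1 powr (- \<kappa>) * (g z \<bullet> x) - \<kappa> * 1 powr (- \<kappa> - 1) * u z) * (1 / (- t * (1 + 1)))"
    unfolding m(3) using t by (intro tendsto_intros ul gl ml dl) auto
  then show ?thesis by (simp add: x_def t_def inner_commute mult.commute)
qed

end

lemma AE_closed_open_slab:
  "AE z in lborel. z \<in> closed_slab a b \<longleftrightarrow> z \<in> (open_slab a b :: 'a::euclidean_space spacetime set)"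
proof -
  have B: "(0, 1) \<in> (Basis :: 'a spacetime set)" by (simp add: Basis_prod_def)
  have "AE z in lebesgue. z \<notin> {z :: 'a spacetime. z \<bullet> (0, 1) = c}" for c
    using negligible_standard_hyperplane[OF B, of c] by (intro AE_not_in) (simp add: negligible_iff_null_sets)
  then have "AE z in lborel. z \<notin> {z :: 'a spacetime. z \<bullet> (0, 1) = c}" for c
    by (simp add: AE_completion_iff)
  from this[of a] this[of b] show ?thesis
    by eventually_elim (auto simp: closed_slab_def open_slab_def)
qed

context signorini
begin

text \<open>The bound of \<open>energy_difference_lower_bound\<close> is divided by h, and h tends
  to 0: the part linear in the quotient converges, the quadratic part vanishes, and the right-hand
  side tends to the difference of E at the end points.\<close>

lemma scaled_energy_increment:
  assumes \<kappa>: "0 < \<kappa>" and ab: "- 1 < a" "a \<le> b" "b < 0"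
  defines "E \<equiv> \<lambda>z. indicator (open_slab a b) z * ((- snd z) powr (1 - \<kappa>) * heat_kernel z * (f z)\<^sup>2)"
  assumes iE: "integrable lborel E"
  shows "- (integral\<^sup>L lborel E) / 2 \<le> scaled_energy \<kappa> a - scaled_energy \<kappa> b"
proof -
  \<comment> \<open>Half the distance from \<open>a\<close> to -1, so that shifts up to
    \<open>h0\<close> stay inside the cylinder.\<close>
  define h0 where "h0 = (a + 1) / 2"
  have h0: "0 < h0" "- 1 < a - h0" "- 1 + h0 < a" using ab by (auto simp: h0_def field_simps)
  define h where "h n = h0 / real (Suc n)" for n
  have h: "0 < h n" "h n \<le> h0" for n using h0(1) by (auto simp: h_def field_simps)
  have h_lim: "h \<longlonglongrightarrow> 0"
    unfolding h_def using tendsto_mult_right_zero[OF lim_1_over_n[THEN LIMSEQ_Suc], of h0] by simp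
  have ha: "- 1 + h n < a" for n using h(2)[of n] h0 by simp

  let ?V = "open_slab a b :: 'a spacetime set" and ?K = "cyl_box 0 R a b :: 'a spacetime set"
  let ?T = "{z :: 'a spacetime. 0 \<le> snd (fst z) \<and> - 1 < snd z \<and> snd z < 0}"
  have cu: "continuous_on ?T u" and cg: "continuous_on ?T g" and cG: "continuous_on ?T heat_kernel"
    by (auto intro!: continuous_on_subset[OF cont_u] continuous_on_subset[OF cont_g]
        continuous_on_subset[OF continuous_on_heat_kernel] simp: space_cyl_def)
  define c where "c z = (- snd z) powr (- \<kappa>) * heat_kernel z" for z :: "'a spacetime"
  have cc: "continuous_on ?T c" unfolding c_def by (intro continuous_intros cG) auto
  have c_nn: "0 \<le> c z" for z by (simp add: c_def heat_kernel_nonneg)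
  have cF: "continuous_on ?T (\<lambda>z. c z * (fst z \<bullet> g z - \<kappa> * u z))"
    by (intro continuous_intros cc cg cu)
  have cH: "continuous_on ?T (\<lambda>z. c z * (2 * snd z))"
    by (intro continuous_intros cc)
  obtain C1 where C1: "C1 > 0" "\<And>z. z \<in> ?K \<Longrightarrow> norm (c z * (fst z \<bullet> g z - \<kappa> * u z)) \<le> C1"
    using bounded_on_box[OF cF ab(1,3)] by blast
  obtain C2 where C2: "C2 > 0" "\<And>z. z \<in> ?K \<Longrightarrow> norm (c z * (2 * snd z)) \<le> C2"
    using bounded_on_box[OF cH ab(1,3)] by blast
  obtain C3 where C3: "C3 > 0" "\<And>z. z \<in> ?K \<Longrightarrow> norm (c z) \<le> C3"
    using bounded_on_box[OF cc ab(1,3)] by blast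
  obtain Bs where Bs: "Bs > 0" "\<And>h z. 0 < h \<Longrightarrow> h \<le> h0 \<Longrightarrow> z \<in> closed_slab a b \<Longrightarrow> \<bar>space_quotient \<kappa> h z\<bar> \<le> Bs"
    "\<And>h z. 0 < h \<Longrightarrow> h \<le> h0 \<Longrightarrow> z \<in> closed_slab a b \<Longrightarrow> R < norm (fst z) \<Longrightarrow> space_quotient \<kappa> h z = 0"
    using space_quotient_bounded[OF \<kappa> h0(2) ab(3)] by metis
  have VT: "?V \<subseteq> ?T" and Vcl: "?V \<subseteq> closed_slab a b" using ab by (auto simp: open_slab_def closed_slab_def)
  have Kb [measurable]: "?K \<in> sets borel" by (intro borel_compact compact_cyl_box)
  have iK: "integrable lborel (\<lambda>z. indicator ?K z * C)" for C :: real
    using borel_integrable_compact[OF compact_cyl_box, of 0 R a b "\<lambda>_. C"] by simp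

  \<comment> \<open>The factor of the quotient in the linear part, c (Z + 2t f) with Z as in the
    overview. The box makes it square integrable, \<open>f\<close> being controlled on compact sets;
    outside the box v - u vanishes, so nothing is lost.\<close>
  define K where "K z = indicator (?V \<inter> ?K) z * (c z * (fst z \<bullet> g z + 2 * snd z * w z - \<kappa> * u z + 2 * snd z * f z))" for z
  have mV: "(\<lambda>z. indicator ?V z * F z) \<in> borel_measurable borel" if "continuous_on ?T F" for F :: "'a spacetime \<Rightarrow> real"
  proof -
    from borel_measurable_continuous_on_indicator[OF _ continuous_on_subset[OF that VT]] show ?thesis by simp
  qed
  have K_eq: "K z = indicator ?K z * (indicator ?V z * (c z * (fst z \<bullet> g z - \<kappa> * u z)))
      + indicator ?K z * (indicator ?V z * (c z * (2 * snd z))) * (w z + f z)" for z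
    by (simp add: K_def algebra_simps indicator_inter_arith)
  have mK: "K \<in> borel_measurable borel"
    unfolding K_eq[abs_def] using mV[OF cF] mV[OF cH] by measurable
  have K_le: "\<bar>K z\<bar> \<le> indicator ?K z * C1 + C2 * \<bar>w z\<bar> + C2 * \<bar>indicator ?K z * f z\<bar>" for z
  proof (cases "z \<in> ?V \<inter> ?K")
    case True
    have "K z = c z * (fst z \<bullet> g z - \<kappa> * u z) + c z * (2 * snd z) * w z + c z * (2 * snd z) * f z"
      using True by (simp add: K_def algebra_simps)
    also have "\<bar>\<dots>\<bar> \<le> \<bar>c z * (fst z \<bullet> g z - \<kappa> * u z)\<bar> + \<bar>c z * (2 * snd z)\<bar> * \<bar>w z\<bar> + \<bar>c z * (2 * snd z)\<bar> * \<bar>f z\<bar>"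
      unfolding abs_mult[symmetric] by linarith
    also have "\<dots> \<le> C1 + C2 * \<bar>w z\<bar> + C2 * \<bar>f z\<bar>"
      using C1(2)[of z] C2(2)[of z] True by (intro add_mono mult_right_mono) auto
    finally show ?thesis using True by simp
  next
    case False
    then have "K z = 0" by (simp add: K_def)
    then show ?thesis using C1(1) C2(1) by simp
  qed
  have if2: "integrable lborel (\<lambda>z. indicator ?K z * (f z)\<^sup>2)" by (rule integrable_f_compact(1)[OF compact_cyl_box])
  have iK2: "integrable lborel (\<lambda>z. (K z)\<^sup>2)"
  proof (rule Bochner_Integration.integrable_bound)
    show "integrable lborel (\<lambda>z. 3 * (indicator ?K z * C1\<^sup>2) + 3 * (C2\<^sup>2 * (w z)\<^sup>2) + 3 * (C2\<^sup>2 * (indicator ?K z * (f z)\<^sup>2)))"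
      by (intro Bochner_Integration.integrable_add integrable_mult_right iK w_L2 if2)
    show "(\<lambda>z. (K z)\<^sup>2) \<in> borel_measurable lborel" using mK by simp
    have sq3: "(x + y + v)\<^sup>2 \<le> 3 * x\<^sup>2 + 3 * y\<^sup>2 + 3 * v\<^sup>2" for x y v :: real
    proof -
      have "3 * x\<^sup>2 + 3 * y\<^sup>2 + 3 * v\<^sup>2 - (x + y + v)\<^sup>2 = (x - y)\<^sup>2 + (y - v)\<^sup>2 + (x - v)\<^sup>2" by algebra
      then show ?thesis by (smt (verit) zero_le_power2)
    qed
    have "(K z)\<^sup>2 \<le> 3 * (indicator ?K z * C1\<^sup>2) + 3 * (C2\<^sup>2 * (w z)\<^sup>2) + 3 * (C2\<^sup>2 * (indicator ?K z * (f z)\<^sup>2))" for z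
    proof -
      have "(K z)\<^sup>2 \<le> (indicator ?K z * C1 + C2 * \<bar>w z\<bar> + C2 * \<bar>indicator ?K z * f z\<bar>)\<^sup>2"
        using power_mono[OF K_le[of z] abs_ge_zero, of 2] by simp
      also have "\<dots> \<le> 3 * (indicator ?K z * C1)\<^sup>2 + 3 * (C2 * \<bar>w z\<bar>)\<^sup>2 + 3 * (C2 * \<bar>indicator ?K z * f z\<bar>)\<^sup>2"
        by (rule sq3)
      also have "\<dots> = 3 * (indicator ?K z * C1\<^sup>2) + 3 * (C2\<^sup>2 * (w z)\<^sup>2) + 3 * (C2\<^sup>2 * (indicator ?K z * (f z)\<^sup>2))"
        by (simp add: power_mult_distrib indicator_def)
      finally show ?thesis .
    qed
    then show "AE z in lborel. norm ((K z)\<^sup>2) \<le> norm (3 * (indicator ?K z * C1\<^sup>2) + 3 * (C2\<^sup>2 * (w z)\<^sup>2) + 3 * (C2\<^sup>2 * (indicator ?K z * (f z)\<^sup>2)))"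
      by (auto intro!: always_eventually intro: order_trans[OF _ abs_ge_self])
  qed
  have iK1: "integrable lborel (\<lambda>z. \<bar>K z\<bar>)"
  proof -
    have "\<bar>x\<bar> \<le> 1 + x\<^sup>2" for x :: real
      using sum_power2_ge_zero[of "\<bar>x\<bar> - 1" 0] by (simp add: power2_diff)
    then have le: "\<bar>K z\<bar> \<le> indicator ?K z * 1 + (K z)\<^sup>2" for z
      by (cases "z \<in> ?K") (auto simp: K_def)
    have "integrable lborel (\<lambda>z. indicator ?K z * 1 + (K z)\<^sup>2)"
      by (intro Bochner_Integration.integrable_add iK iK2)
    then show ?thesis
      by (rule Bochner_Integration.integrable_bound)
         (use mK le in \<open>auto intro!: always_eventually intro: order_trans[OF _ abs_ge_self]\<close>)
  qed
  have K0: "K z = 0" if "z \<notin> ?V" for z using that by (simp add: K_def)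

  \<comment> \<open>On the slab (v - u) / h is \<open>s n + q n\<close>. Tested with
    \<open>K\<close>, the time part \<open>q n\<close> converges weakly and the dilation part
    \<open>s n\<close> by dominated convergence.\<close>
  define q where "q n z = indicator ?V z * time_quotient (h n) z" for n z
  define s where "s n z = indicator ?V z * space_quotient \<kappa> (h n) z" for n z
  note q = time_quotient_L2[OF h(1) ha less_imp_le[OF ab(3)], folded q_def]
  have ms: "s n \<in> borel_measurable borel" for n
  proof -
    have "continuous_on ?V (space_quotient \<kappa> (h n))"
    proof -
      have Vs: "?V \<subseteq> cyl_slab (- 1 + h n) 0" using ab ha[of n] by (auto simp: open_slab_def cyl_slab_def)
      have "continuous_on ?V (\<lambda>z. u (fst z, snd z - h n))"
        by (rule continuous_on_compose2[OF cont_u])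
           (use ab ha[of n] h(1)[of n] in \<open>auto intro!: continuous_intros simp: open_slab_def space_cyl_def\<close>)
      then show ?thesis unfolding space_quotient_def[abs_def] using h(1)[of n]
        by (intro continuous_intros continuous_on_subset[OF continuous_dil(1)[OF less_imp_le[OF h(1)]] Vs]) auto
    qed
    from borel_measurable_continuous_on_indicator[OF _ this] show ?thesis by (simp add: s_def[abs_def])
  qed
  have s_le: "\<bar>s n z\<bar> \<le> indicator ?K z * Bs" for n z
  proof (cases "z \<in> ?V")
    case True
    then have cl: "z \<in> closed_slab a b" using Vcl by blast
    show ?thesis
    proof (cases "norm (fst z) \<le> R")
      case n: True
      then have "z \<in> ?K" using cl by (auto simp: closed_slab_def cyl_box_def)
      then show ?thesis using Bs(2)[OF h cl] True by (simp add: s_def)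
    next
      case n: False
      then have "space_quotient \<kappa> (h n) z = 0" using Bs(3)[OF h cl] by simp
      then show ?thesis using Bs(1) by (simp add: s_def)
    qed
  qed (use Bs(1) in \<open>simp add: s_def\<close>)
  have is2: "integrable lborel (\<lambda>z. (s n z)\<^sup>2)" and s2_le: "(LINT z|lborel. (s n z)\<^sup>2) \<le> (LINT z|lborel. indicator ?K z * Bs\<^sup>2)" for n
  proof -
    have le: "(s n z)\<^sup>2 \<le> indicator ?K z * Bs\<^sup>2" for z
      using power_mono[OF s_le[of n z], of 2] by (auto simp: indicator_def split: if_splits)
    show i: "integrable lborel (\<lambda>z. (s n z)\<^sup>2)"
      by (rule Bochner_Integration.integrable_bound[OF iK[of "Bs\<^sup>2"]]) (use le ms in auto)
    show "(LINT z|lborel. (s n z)\<^sup>2) \<le> (LINT z|lborel. indicator ?K z * Bs\<^sup>2)"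
      by (rule integral_mono[OF i iK le])
  qed
  define S0 where "S0 z = (fst z \<bullet> g z - \<kappa> * u z) / (- 2 * snd z)" for z

  have L1: "(\<lambda>n. LINT z|lborel. q n z * K z) \<longlonglongrightarrow> (LINT z|lborel. - w z * K z)"
    unfolding q_def
    by (rule time_quotient_weak[OF h0(1,3) less_imp_le[OF ab(3)] h h_lim mK iK2 K0])
  have L2: "(\<lambda>n. LINT z|lborel. s n z * K z) \<longlonglongrightarrow> (LINT z|lborel. S0 z * K z)"
    and iS0: "integrable lborel (\<lambda>z. S0 z * K z)"
  proof -
    have lim: "(\<lambda>n. s n z * K z) \<longlonglongrightarrow> S0 z * K z" for z
    proof (cases "z \<in> ?V")
      case True
      then have "(\<lambda>n. space_quotient \<kappa> (h n) z * K z) \<longlonglongrightarrow> S0 z * K z"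
        unfolding S0_def using Vcl
        by (intro tendsto_intros space_quotient_tendsto[OF h0(2) ab(3) _ h h_lim]) auto
      then show ?thesis using True by (simp add: s_def)
    qed (simp add: K0)
    have m: "(\<lambda>z. s n z * K z) \<in> borel_measurable lborel" for n using ms mK by simp
    have m0: "(\<lambda>z. S0 z * K z) \<in> borel_measurable lborel"
      by (rule borel_measurable_LIMSEQ_real[OF lim m])
    have D: "integrable lborel (\<lambda>z. Bs * \<bar>K z\<bar>)" using iK1 by simp
    have dom: "AE z in lborel. norm (s n z * K z) \<le> Bs * \<bar>K z\<bar>" for n
    proof -
      have "\<bar>s n z\<bar> \<le> Bs" for z using s_le[of n z] Bs(1) by (cases "z \<in> ?K") auto
      then show ?thesis by (auto simp: abs_mult intro!: mult_right_mono)
    qed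
    have AEl: "AE z in lborel. (\<lambda>n. s n z * K z) \<longlonglongrightarrow> S0 z * K z" using lim by simp
    show "(\<lambda>n. LINT z|lborel. s n z * K z) \<longlonglongrightarrow> (LINT z|lborel. S0 z * K z)"
      by (rule integral_dominated_convergence[OF m0 m D AEl dom])
    show "integrable lborel (\<lambda>z. S0 z * K z)"
      by (rule integrable_dominated_convergence[OF m0 m D AEl dom])
  qed
  \<comment> \<open>Since v - u is h times \<open>s n + q n\<close>, the quadratic remainder is of
    order h^2. After division by h there remains h times the integral of \<open>r n\<close>, which
    is bounded by \<open>Cr\<close>.\<close>
  define r where "r n z = indicator ?V z * indicator ?K z * c z * (s n z + q n z)\<^sup>2" for n z
  define Cr where "Cr = 2 * C3 * ((LINT z|lborel. indicator ?K z * Bs\<^sup>2) + (LINT z|lborel. (w z)\<^sup>2))"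
  have ir: "integrable lborel (r n)" and r_le: "integral\<^sup>L lborel (r n) \<le> Cr" and r_nn: "0 \<le> integral\<^sup>L lborel (r n)" for n
  proof -
    have le: "r n z \<le> 2 * C3 * ((s n z)\<^sup>2 + (q n z)\<^sup>2)" and nn: "0 \<le> r n z" for z
    proof -
      show "0 \<le> r n z" by (simp add: r_def c_nn)
      have "(s n z + q n z)\<^sup>2 \<le> 2 * ((s n z)\<^sup>2 + (q n z)\<^sup>2)"
        using zero_le_power2[of "s n z - q n z"] by (simp add: power2_eq_square algebra_simps)
      then have "c z * (s n z + q n z)\<^sup>2 \<le> C3 * (2 * ((s n z)\<^sup>2 + (q n z)\<^sup>2))" if "z \<in> ?K"
        using C3(1) C3(2)[OF that] c_nn[of z] by (intro mult_mono) auto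
      moreover have "0 \<le> 2 * C3 * ((s n z)\<^sup>2 + (q n z)\<^sup>2)" using C3(1) by simp
      ultimately show "r n z \<le> 2 * C3 * ((s n z)\<^sup>2 + (q n z)\<^sup>2)"
        by (auto simp: r_def indicator_def algebra_simps)
    qed
    have i: "integrable lborel (\<lambda>z. 2 * C3 * ((s n z)\<^sup>2 + (q n z)\<^sup>2))" using is2 q(2) by simp
    have mr: "r n \<in> borel_measurable borel"
    proof -
      have "r n z = indicator ?K z * (indicator ?V z * c z) * (s n z + q n z)\<^sup>2" for z by (simp add: r_def)
      then have "r n = (\<lambda>z. indicator ?K z * (indicator ?V z * c z) * (s n z + q n z)\<^sup>2)" by blast
      then show ?thesis using mV[OF cc] ms q(1) by simp
    qed
    show ir: "integrable lborel (r n)"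
      by (rule Bochner_Integration.integrable_bound[OF i]) (use mr le nn in \<open>auto intro!: always_eventually intro: order_trans[OF _ abs_ge_self]\<close>)
    have "integral\<^sup>L lborel (r n) \<le> (LINT z|lborel. 2 * C3 * ((s n z)\<^sup>2 + (q n z)\<^sup>2))"
      by (rule integral_mono[OF ir i le])
    also have "\<dots> = 2 * C3 * ((LINT z|lborel. (s n z)\<^sup>2) + (LINT z|lborel. (q n z)\<^sup>2))"
      using is2 q(2) by simp
    also have "\<dots> \<le> Cr"
      unfolding Cr_def using s2_le[of n] q(3)[of n] C3(1) by (intro mult_left_mono add_mono) auto
    finally show "integral\<^sup>L lborel (r n) \<le> Cr" .
    show "0 \<le> integral\<^sup>L lborel (r n)" by (rule integral_nonneg_AE) (use nn in simp)
  qed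
  have L3: "(\<lambda>n. h n * integral\<^sup>L lborel (r n)) \<longlonglongrightarrow> 0"
  proof (rule Lim_null_comparison)
    show "\<forall>\<^sub>F n in sequentially. norm (h n * integral\<^sup>L lborel (r n)) \<le> h n * Cr"
      using h(1) r_le r_nn by (auto intro!: always_eventually mult_left_mono simp: abs_mult less_imp_le)
    show "(\<lambda>n. h n * Cr) \<longlonglongrightarrow> 0" by (rule tendsto_mult_left_zero[OF h_lim])
  qed
  have step: "(LINT z|lborel. s n z * K z) + (LINT z|lborel. q n z * K z) - \<kappa> / 2 * (h n * integral\<^sup>L lborel (r n))
      \<le> (LINT t:{a..b}|lborel. scaled_energy \<kappa> (t - h n) - scaled_energy \<kappa> t) / h n" for n
  proof -
    define J where "J z = indicator (closed_slab a b) z * ((- snd z) powr (- \<kappa>) * heat_kernel z *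
      ((u_dil \<kappa> (h n) z - u z) * (fst z \<bullet> g z + 2 * snd z * w z - \<kappa> * u z + 2 * snd z * f z)
        - \<kappa> / 2 * (u_dil \<kappa> (h n) z - u z)\<^sup>2))" for z
    have J: "integrable lborel J"
      "integral\<^sup>L lborel J \<le> (LINT t:{a..b}|lborel. scaled_energy \<kappa> (t - h n) - scaled_energy \<kappa> t)"
      unfolding J_def[abs_def] using energy_difference_lower_bound[OF \<kappa> h(1) ha ab(2,3), of n] by simp_all
    have isK: "integrable lborel (\<lambda>z. s n z * K z)" and iqK: "integrable lborel (\<lambda>z. q n z * K z)"
      using integrable_sq_diff(2)[OF _ _ is2 iK2] integrable_sq_diff(2)[OF _ _ q(2) iK2] ms q(1) mK by auto
    have J_eq: "J z = h n * (s n z * K z + q n z * K z - \<kappa> / 2 * (h n * r n z))"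
      if eq: "z \<in> closed_slab a b \<longleftrightarrow> z \<in> ?V" for z
    proof (cases "z \<in> ?V")
      case True
      define p where "p = u_dil \<kappa> (h n) z - u z"
      have p: "p = h n * (s n z + q n z)"
        using dil_quotient_split[of \<kappa> "h n" z] h(1)[of n] True by (simp add: p_def s_def q_def field_simps)
      show ?thesis
      proof (cases "z \<in> ?K")
        case K: True
        define kt where "kt = fst z \<bullet> g z + 2 * snd z * w z - \<kappa> * u z + 2 * snd z * f z"
        have J': "J z = c z * (p * kt - \<kappa> / 2 * p\<^sup>2)"
          using True eq by (simp add: J_def c_def p_def kt_def)
        have K': "K z = c z * kt" using True K by (simp add: K_def kt_def)
        have r': "r n z = c z * (s n z + q n z)\<^sup>2" using True K by (simp add: r_def)
        show ?thesis unfolding J' K' r' p by algebra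
      next
        case nK: False
        have "z \<in> cyl_slab (- 1 + h n) 0" using True ab ha[of n] by (auto simp: open_slab_def cyl_slab_def)
        moreover have "R < norm (fst z)" using True nK by (auto simp: open_slab_def cyl_box_def)
        ultimately have "p = 0" using dil_support[OF less_imp_le[OF h(1)]] by (simp add: p_def)
        then have "J z = 0" by (simp add: J_def p_def[symmetric])
        moreover have "K z = 0" "r n z = 0" using nK by (simp_all add: K_def r_def)
        ultimately show ?thesis by simp
      qed
    next
      case False
      then show ?thesis using eq by (simp add: J_def K0 r_def)
    qed
    have "integral\<^sup>L lborel J = (LINT z|lborel. h n * (s n z * K z + q n z * K z - \<kappa> / 2 * (h n * r n z)))"
    proof (rule integral_cong_AE)
      show "J \<in> borel_measurable lborel" using J(1) by (rule borel_measurable_integrable)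
      show "(\<lambda>z. h n * (s n z * K z + q n z * K z - \<kappa> / 2 * (h n * r n z))) \<in> borel_measurable lborel"
        using isK iqK ir[of n] by (intro borel_measurable_integrable) simp
      show "AE z in lborel. J z = h n * (s n z * K z + q n z * K z - \<kappa> / 2 * (h n * r n z))"
        using AE_closed_open_slab[of a b] by eventually_elim (rule J_eq)
    qed
    also have "\<dots> = h n * ((LINT z|lborel. s n z * K z) + (LINT z|lborel. q n z * K z) - \<kappa> / 2 * (h n * integral\<^sup>L lborel (r n)))"
      using isK iqK ir[of n] by simp
    finally show ?thesis using J(2) h(1)[of n] by (simp add: pos_le_divide_eq mult.commute)
  qed
  have lhs: "(\<lambda>n. (LINT z|lborel. s n z * K z) + (LINT z|lborel. q n z * K z) - \<kappa> / 2 * (h n * integral\<^sup>L lborel (r n)))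
    \<longlonglongrightarrow> (LINT z|lborel. S0 z * K z) + (LINT z|lborel. - w z * K z) - \<kappa> / 2 * 0"
    by (intro tendsto_intros L1 L2 L3)
  have rhs: "(\<lambda>n. (LINT t:{a..b}|lborel. scaled_energy \<kappa> (t - h n) - scaled_energy \<kappa> t) / h n)
    \<longlonglongrightarrow> scaled_energy \<kappa> a - scaled_energy \<kappa> b"
    by (rule integral_increment_limit[where c="a - h0"])
       (use continuous_scaled_energy[OF h0(2) ab(3)] h0(1) ab(2) h h_lim in auto)
  have key: "(LINT z|lborel. S0 z * K z) + (LINT z|lborel. - w z * K z) \<le> scaled_energy \<kappa> a - scaled_energy \<kappa> b"
    using LIMSEQ_le[OF lhs rhs] step by auto
  have iwK: "integrable lborel (\<lambda>z. - w z * K z)"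
    using integrable_sq_diff(2)[OF _ _ w_L2 iK2] mK by simp
  \<comment> \<open>Completing the square: G (G + 2t f) / (- 2t) = (G + t f)^2 / (- 2t) + t f^2 / 2.
    Here \<open>G\<close> is the Z of the overview, and the limit \<open>S0 - w\<close> of the
    quotients equals G / (- 2t).\<close>
  have pt: "- (1 / 2) * E z \<le> S0 z * K z + - w z * K z" for z
  proof (cases "z \<in> ?V \<inter> ?K")
    case True
    define t G where "t = snd z" and "G = fst z \<bullet> g z - \<kappa> * u z + 2 * snd z * w z"
    have t: "t < 0" using True ab by (auto simp: t_def open_slab_def)
    have d: "S0 z - w z = G / (- 2 * t)"
      using t by (simp add: S0_def G_def t_def field_simps)
    have k: "K z = c z * (G + 2 * t * f z)" using True by (simp add: K_def G_def t_def algebra_simps)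
    have "S0 z * K z + - w z * K z = (S0 z - w z) * K z" by (simp add: algebra_simps)
    then have 1: "S0 z * K z + - w z * K z = c z * (G / (- 2 * t) * (G + 2 * t * f z))"
      unfolding d by (simp only: k mult_ac)
    have 2: "G / (- 2 * t) * (G + 2 * t * f z) - t * (f z)\<^sup>2 / 2 = (G + t * f z)\<^sup>2 / (- 2 * t)"
      using t by (simp add: field_simps power2_eq_square)
    have "0 \<le> (G + t * f z)\<^sup>2 / (- 2 * t)" using t by (intro divide_nonneg_nonneg) auto
    then have "t * (f z)\<^sup>2 / 2 \<le> G / (- 2 * t) * (G + 2 * t * f z)" using 2 by linarith
    then have "c z * (t * (f z)\<^sup>2 / 2) \<le> S0 z * K z + - w z * K z"
      unfolding 1 by (intro mult_left_mono c_nn)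
    moreover have "- (1 / 2) * E z = c z * (t * (f z)\<^sup>2 / 2)"
    proof -
      have "(- t) powr (1 - \<kappa>) = (- t) * (- t) powr (- \<kappa>)" using t powr_mult_base[of "- t" "- \<kappa>"] by simp
      then show ?thesis using True by (simp add: E_def c_def t_def)
    qed
    ultimately show ?thesis by simp
  next
    case False
    then have "K z = 0" by (auto simp: K_def)
    moreover have "E z \<ge> 0" by (simp add: E_def heat_kernel_nonneg)
    ultimately show ?thesis by simp
  qed
  have "- (integral\<^sup>L lborel E) / 2 = (LINT z|lborel. - (1 / 2) * E z)" by simp
  also have "\<dots> \<le> (LINT z|lborel. S0 z * K z + - w z * K z)"
    using iE iS0 iwK pt by (intro integral_mono Bochner_Integration.integrable_add) auto
  also have "\<dots> = (LINT z|lborel. S0 z * K z) + (LINT z|lborel. - w z * K z)"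
    by (rule Bochner_Integration.integral_add[OF iS0 iwK])
  finally show ?thesis using key by simp
qed

end

section \<open>Gaussian moments\<close>

text \<open>A product of one-dimensional normal densities with standard deviation 2, up to
  constants. The exponent is half of that of the heat kernel at time -1; the other half will absorb
  the polynomial factor.\<close>

lemma gaussian_integrable:
  "integrable lborel (\<lambda>x::'b::euclidean_space. exp (- ((norm x)\<^sup>2 / 8)))"
proof -
  define G where "G s = exp (- (s\<^sup>2 / 8))" for s :: real
  have 1: "integrable lborel G"
  proof -
    have "integrable lborel (\<lambda>s. normal_density 0 2 s * sqrt (2 * pi * 2\<^sup>2))"
      by (intro integrable_mult_left integrable_normal_density) simp
    then show ?thesis by (simp add: normal_density_def G_def[abs_def])
  qed
  have eq: "exp (- ((norm x)\<^sup>2 / 8)) = (\<Prod>b\<in>Basis. G (x \<bullet> b))" for x :: 'b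
  proof -
    have "(norm x)\<^sup>2 = (\<Sum>b\<in>Basis. (x \<bullet> b)\<^sup>2)"
      unfolding power2_norm_eq_inner by (subst euclidean_inner) (simp add: power2_eq_square)
    then have "- ((norm x)\<^sup>2 / 8) = (\<Sum>b\<in>Basis. - ((x \<bullet> b)\<^sup>2 / 8))"
      by (simp add: sum_divide_distrib sum_negf)
    then show ?thesis by (simp add: exp_sum G_def)
  qed
  have "(\<integral>\<^sup>+x. ennreal (\<Prod>b\<in>Basis. G (x \<bullet> b)) \<partial>(lborel :: 'b measure)) = (\<Prod>b\<in>(Basis::'b set). \<integral>\<^sup>+s. ennreal (G s) \<partial>lborel)"
    using nn_integral_lborel_prod[of "\<lambda>b s. ennreal (G s)"] 1 by (simp add: prod_ennreal G_def)
  also have "\<dots> < \<infinity>"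
  proof -
    have "(\<integral>\<^sup>+s. ennreal (G s) \<partial>lborel) < \<infinity>"
      using 1 by (simp add: integrable_iff_bounded G_def)
    then show ?thesis by (simp add: power_less_top_ennreal)
  qed
  finally have fin: "(\<integral>\<^sup>+x. ennreal (exp (- ((norm x)\<^sup>2 / 8))) \<partial>(lborel :: 'b measure)) < \<infinity>" by (simp add: eq)
  show ?thesis
    by (rule integrableI_bounded) (use fin in auto)
qed

lemma borel_measurable_heat_kernel [measurable]: "heat_kernel \<in> borel_measurable borel"
proof -
  have eq: "heat_kernel z = indicator {z. snd z < 0} z *\<^sub>R heat_kernel z" for z :: "'a spacetime"
    by (auto simp: heat_kernel_def indicator_def case_prod_unfold)
  have "open {z :: 'a spacetime. snd z < 0}" by (intro open_Collect_less continuous_intros)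
  then have "(\<lambda>z :: 'a spacetime. indicator {z. snd z < 0} z *\<^sub>R heat_kernel z) \<in> borel_measurable borel"
    by (intro borel_measurable_continuous_on_indicator continuous_on_heat_kernel) auto
  then show ?thesis unfolding eq[symmetric] .
qed

text \<open>Up to the factor M^2, this is the bound for f^2 G at time - \<tau>: squaring the power l
  - 2 of the parabolic norm gives the power l - 2 of |x|^2 + \<tau>.\<close>

definition moment_density :: "real \<Rightarrow> 'a::euclidean_space \<times> real \<Rightarrow> real \<Rightarrow> real" where
  "moment_density l x \<tau> = ((norm x)\<^sup>2 + \<tau>) powr (l - 2) * heat_kernel (x, - \<tau>)"

lemma moment_density_nonneg: "0 \<le> moment_density l x \<tau>"
  by (simp add: moment_density_def heat_kernel_nonneg)

lemma moment_integrable_1: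
  assumes "l \<ge> 2"
  shows "integrable lborel (\<lambda>x::'a::euclidean_space \<times> real. moment_density l x 1)"
proof -
  \<comment> \<open>The exponent l - 2 is raised by 1 so that division by \<open>q\<close> is
    possible also for l = 2; this only enlarges the power, because the base s + 1 is at least
    1.\<close>
  define q where "q = l - 1"
  have q: "q \<ge> 1" using assms by (simp add: q_def)
  define C where "C = (4 * pi) powr (- real DIM('a \<times> real) / 2) * (8 * q) powr q"
  have bound: "moment_density l x 1 \<le> C * exp (- ((norm x)\<^sup>2 / 8))" for x :: "'a \<times> real"
  proof -
    define s where "s = (norm x)\<^sup>2"
    have s: "s \<ge> 0" by (simp add: s_def)
    have "1 + s / (8 * q) \<le> exp (s / (8 * q))" by (rule exp_ge_add_one_self)
    then have "8 * q * (1 + s / (8 * q)) \<le> 8 * q * exp (s / (8 * q))" using q by (intro mult_left_mono) auto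
    moreover have "8 * q * (1 + s / (8 * q)) = 8 * q + s" using q by (simp add: field_simps)
    ultimately have le: "s + 1 \<le> 8 * q * exp (s / (8 * q))" using q by linarith
    have "(s + 1) powr (l - 2) \<le> (s + 1) powr q"
      using s by (intro powr_mono) (auto simp: q_def)
    also have "\<dots> \<le> (8 * q * exp (s / (8 * q))) powr q"
      using le s q by (intro powr_mono2) auto
    also have "\<dots> = (8 * q) powr q * exp (s / 8)"
      using q by (simp add: powr_mult exp_powr_real)
    finally have 1: "(s + 1) powr (l - 2) \<le> (8 * q) powr q * exp (s / 8)" .
    have "moment_density l x 1 = (4 * pi) powr (- real DIM('a \<times> real) / 2) * ((s + 1) powr (l - 2) * exp (- (s / 4)))"
      by (simp add: moment_density_def heat_kernel_def s_def)
    also have "\<dots> \<le> (4 * pi) powr (- real DIM('a \<times> real) / 2) * ((8 * q) powr q * exp (s / 8) * exp (- (s / 4)))"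
      using 1 by (intro mult_left_mono mult_right_mono) auto
    also have "\<dots> = C * (exp (s / 8) * exp (- (s / 4)))" by (simp only: C_def mult.assoc)
    also have "exp (s / 8) * exp (- (s / 4)) = exp (- (s / 8))" by (simp flip: exp_add)
    finally show ?thesis by (simp only: s_def)
  qed
  show ?thesis
  proof (rule Bochner_Integration.integrable_bound)
    show "integrable lborel (\<lambda>x::'a \<times> real. C * exp (- ((norm x)\<^sup>2 / 8)))"
      by (intro integrable_mult_right gaussian_integrable)
    show "(\<lambda>x::'a \<times> real. moment_density l x 1) \<in> borel_measurable lborel"
      unfolding moment_density_def by measurable
    have "norm (moment_density l x 1) \<le> norm (C * exp (- ((norm x)\<^sup>2 / 8)))" for x :: "'a \<times> real"
      using order_trans[OF bound[of x] abs_ge_self] moment_density_nonneg[of l x 1] by simp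
    then show "AE x::'a \<times> real in lborel. norm (moment_density l x 1) \<le> norm (C * exp (- ((norm x)\<^sup>2 / 8)))"
      by (rule AE_I2)
  qed
qed

text \<open>The dilation with \<lambda>^2 = 1 / \<tau> carries time - \<tau> to time -1, so the
  scaling of the kernel already proved for the competitor reduces every moment to the one at time
  -1.\<close>

lemma moment_scaling:
  fixes l \<tau> :: real
  assumes l: "l \<ge> 2" and \<tau>: "0 < \<tau>" "\<tau> \<le> 1"
  shows "integrable lborel (\<lambda>x::'a::euclidean_space \<times> real. moment_density l x \<tau>)"
    "(LINT x::'a \<times> real|lborel. moment_density l x \<tau>) = \<tau> powr (l - 2) * (LINT x::'a \<times> real|lborel. moment_density l x 1)"
proof -
  define d where "d = dilation (1 - \<tau>) (- \<tau>)"
  have d: "d > 0" "d\<^sup>2 = 1 / \<tau>"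
    using dilation_ge_1[of "- \<tau>" "1 - \<tau>"] dilation_sq[of "- \<tau>" "1 - \<tau>"] \<tau> by (auto simp: d_def)
  have eq: "moment_density l x \<tau> = \<tau> powr (l - 2) * (d ^ DIM('a \<times> real) * moment_density l (0 + d *\<^sub>R x) 1)"
    for x :: "'a \<times> real"
  proof -
    have "heat_kernel (x, - \<tau>) = d ^ DIM('a \<times> real) * heat_kernel (d *\<^sub>R x, - \<tau> - (1 - \<tau>))"
      unfolding d_def using \<tau> by (intro heat_kernel_dilation) auto
    then have G: "heat_kernel (x, - \<tau>) = d ^ DIM('a \<times> real) * heat_kernel (d *\<^sub>R x, - 1)" by simp
    have "(norm x)\<^sup>2 + \<tau> = \<tau> * ((norm (d *\<^sub>R x))\<^sup>2 + 1)"
      using \<tau> d by (simp add: power_mult_distrib algebra_simps)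
    then have "((norm x)\<^sup>2 + \<tau>) powr (l - 2) = \<tau> powr (l - 2) * ((norm (d *\<^sub>R x))\<^sup>2 + 1) powr (l - 2)"
      using \<tau> by (simp add: powr_mult)
    then show ?thesis by (simp add: moment_density_def G mult_ac)
  qed
  note i = moment_integrable_1[OF l, where 'a='a]
  show "integrable lborel (\<lambda>x::'a \<times> real. moment_density l x \<tau>)"
    unfolding eq using d(1) by (intro integrable_mult_right lborel_integrable_affine i) auto
  have "(LINT x::'a \<times> real|lborel. moment_density l x 1)
    = \<bar>d\<bar> ^ DIM('a \<times> real) * (LINT x::'a \<times> real|lborel. moment_density l (0 + d *\<^sub>R x) 1)"
    using d(1) borel_measurable_integrable[OF i] by (intro lborel_integral_affine) auto
  then show "(LINT x::'a \<times> real|lborel. moment_density l x \<tau>) = \<tau> powr (l - 2) * (LINT x::'a \<times> real|lborel. moment_density l x 1)"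
    unfolding eq using d(1) by simp
qed

text \<open>By Tonelli, nonnegativity turns integrability on slices and an integrable bound in
  \<open>t\<close> into integrability in space-time.\<close>

lemma iterated_integrable:
  fixes F :: "'b::euclidean_space \<times> real \<Rightarrow> real"
  assumes m [measurable]: "F \<in> borel_measurable borel" and nn: "\<And>z. 0 \<le> F z"
    and i: "\<And>t. integrable lborel (\<lambda>x. F (x, t))" and le: "\<And>t. (LINT x|lborel. F (x, t)) \<le> B t"
    and B: "integrable lborel B"
  shows "integrable lborel F" "integral\<^sup>L lborel F \<le> integral\<^sup>L lborel B"
proof -
  have B_nn: "0 \<le> B t" for t
  proof -
    have "0 \<le> (LINT x|lborel. F (x, t))" by (rule integral_nonneg_AE) (simp add: nn)
    then show ?thesis using le[of t] by linarith
  qed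
  have "(\<integral>\<^sup>+z. ennreal (F z) \<partial>lborel) = (\<integral>\<^sup>+t. (\<integral>\<^sup>+x. ennreal (F (x, t)) \<partial>lborel) \<partial>lborel)"
    using lborel_pair.nn_integral_snd[of "\<lambda>z. ennreal (F z)"] by (simp add: lborel_prod)
  also have "\<dots> = (\<integral>\<^sup>+t. ennreal (LINT x|lborel. F (x, t)) \<partial>lborel)"
    by (simp add: nn_integral_eq_integral[OF i] nn)
  also have "\<dots> \<le> (\<integral>\<^sup>+t. ennreal (B t) \<partial>lborel)"
    by (intro nn_integral_mono ennreal_leI le)
  also have "\<dots> = ennreal (integral\<^sup>L lborel B)"
    by (rule nn_integral_eq_integral[OF B]) (simp add: B_nn)
  finally have fin: "(\<integral>\<^sup>+z. ennreal (F z) \<partial>lborel) \<le> ennreal (integral\<^sup>L lborel B)" .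
  show iF: "integrable lborel F"
  proof (rule integrableI_bounded)
    have "(\<integral>\<^sup>+z. ennreal (norm (F z)) \<partial>lborel) = (\<integral>\<^sup>+z. ennreal (F z) \<partial>lborel)" using nn by simp
    also have "\<dots> < \<infinity>" by (rule order_le_less_trans[OF fin]) simp
    finally show "(\<integral>\<^sup>+z. ennreal (norm (F z)) \<partial>lborel) < \<infinity>" .
  qed simp
  have "ennreal (integral\<^sup>L lborel F) \<le> ennreal (integral\<^sup>L lborel B)"
    using fin nn_integral_eq_integral[OF iF] nn by simp
  then show "integral\<^sup>L lborel F \<le> integral\<^sup>L lborel B"
    using B_nn by (subst (asm) ennreal_le_iff) (auto intro!: integral_nonneg_AE)
qed

lemma powr_integral:
  fixes a b \<sigma> :: real
  assumes \<sigma>: "\<sigma> > 0" and ab: "a \<le> b" "b < 0"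
  shows "integrable lborel (\<lambda>t. indicator {a..b} t * (- t) powr (\<sigma> - 1))"
    "(LINT t|lborel. indicator {a..b} t * (- t) powr (\<sigma> - 1)) = ((- a) powr \<sigma> - (- b) powr \<sigma>) / \<sigma>"
proof -
  have c: "continuous_on {a..b} (\<lambda>t. (- t) powr (\<sigma> - 1))"
    using ab by (intro continuous_intros) auto
  note si = borel_integrable_atLeastAtMost'[OF c]
  then show "integrable lborel (\<lambda>t. indicator {a..b} t * (- t) powr (\<sigma> - 1))"
    by (simp add: set_integrable_def)
  have d: "((\<lambda>t. - ((- t) powr \<sigma>) / \<sigma>) has_vector_derivative (- t) powr (\<sigma> - 1)) (at t within {a..b})"
    if "a \<le> t" "t \<le> b" for t
  proof -
    have "0 < - t" using that ab by simp
    moreover have "((\<lambda>t. - t) has_real_derivative - 1) (at t)" by (auto intro!: derivative_eq_intros)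
    ultimately have "((\<lambda>t. (- t) powr \<sigma>) has_real_derivative \<sigma> * (- t) powr (\<sigma> - of_nat 1) * - 1) (at t)"
      by (intro DERIV_fun_powr)
    note D = DERIV_cdivide[OF DERIV_minus[OF this], of \<sigma>]
    have "- (\<sigma> * (- t) powr (\<sigma> - of_nat 1) * - 1) / \<sigma> = (- t) powr (\<sigma> - 1)" using \<sigma> by simp
    from D[unfolded this] have "((\<lambda>t. - ((- t) powr \<sigma>) / \<sigma>) has_vector_derivative (- t) powr (\<sigma> - 1)) (at t)"
      by (rule has_real_derivative_iff_has_vector_derivative[THEN iffD1])
    then show ?thesis by (rule has_vector_derivative_at_within)
  qed
  have "((\<lambda>t. (- t) powr (\<sigma> - 1)) has_integral (- ((- b) powr \<sigma>) / \<sigma> - - ((- a) powr \<sigma>) / \<sigma>)) {a..b}"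
    by (rule fundamental_theorem_of_calculus[OF ab(1) d]) auto
  then have 1: "integral {a..b} (\<lambda>t. (- t) powr (\<sigma> - 1)) = - ((- b) powr \<sigma>) / \<sigma> - - ((- a) powr \<sigma>) / \<sigma>"
    by (rule integral_unique)
  have "(LINT t|lborel. indicator {a..b} t * (- t) powr (\<sigma> - 1)) = (LINT t:{a..b}|lborel. (- t) powr (\<sigma> - 1))"
    by (simp add: set_lebesgue_integral_def)
  also have "\<dots> = integral {a..b} (\<lambda>t. (- t) powr (\<sigma> - 1))"
    by (rule set_borel_integral_eq_integral(2)[OF si])
  also have "\<dots> = ((- a) powr \<sigma> - (- b) powr \<sigma>) / \<sigma>"
    unfolding 1 by (simp only: diff_divide_distrib minus_divide_left[symmetric] diff_minus_eq_add add.commute[of _ "(- a) powr \<sigma> / \<sigma>"] add_uminus_conv_diff)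
  finally show "(LINT t|lborel. indicator {a..b} t * (- t) powr (\<sigma> - 1)) = ((- a) powr \<sigma> - (- b) powr \<sigma>) / \<sigma>" .
qed

context signorini
begin

text \<open>By moment scaling a slice contributes at most M^2 m (- t)^(l - 1 - \<kappa>), hence at
  most M^2 m (- t)^(\<sigma> - 1), because 0 < - t \<le> 1 and \<sigma> < l - \<kappa>. Integration
  in time gives the 1/\<sigma> of the constant, and the completed square its 1/2.\<close>

lemma scaled_energy_almost_decreasing:
  assumes \<kappa>: "0 < \<kappa>" and \<sigma>: "0 < \<sigma>" "\<sigma> < l - \<kappa>" and ab: "- 1 < a" "a \<le> b" "b < 0"
  defines "m \<equiv> (LINT x::'a \<times> real|lborel. moment_density l x 1)"
  shows "scaled_energy \<kappa> b + M\<^sup>2 * m / (2 * \<sigma>) * (- b) powr \<sigma> \<le> scaled_energy \<kappa> a + M\<^sup>2 * m / (2 * \<sigma>) * (- a) powr \<sigma>"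
proof -
  have m0: "0 \<le> m" unfolding m_def by (rule integral_nonneg_AE) (simp add: moment_density_nonneg)
  define P where "P z = indicator (open_slab a b) z * ((- snd z) powr (1 - \<kappa>) * (M\<^sup>2 * moment_density l (fst z) (- snd z)))" for z :: "'a spacetime"
  define B where "B t = M\<^sup>2 * m * (indicator {a..b} t * (- t) powr (\<sigma> - 1))" for t
  have B: "integrable lborel B" unfolding B_def by (intro integrable_mult_right powr_integral \<sigma> ab)
  have fs [measurable]: "(\<lambda>z::'a spacetime. (norm (fst z))\<^sup>2 + - snd z) \<in> borel_measurable borel"
    "(\<lambda>z::'a spacetime. - snd z) \<in> borel_measurable borel"
    by (intro borel_measurable_continuous_onI continuous_intros)+
  have mP: "P \<in> borel_measurable borel"
    unfolding P_def[abs_def] moment_density_def minus_minus prod.collapse by measurable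
  have P0: "0 \<le> P z" for z by (simp add: P_def moment_density_nonneg)
  have slice: "integrable lborel (\<lambda>x. P (x, t)) \<and> (LINT x|lborel. P (x, t)) \<le> B t" for t
  proof (cases "t \<in> {a<..<b}")
    case True
    define c where "c = (- t) powr (1 - \<kappa>) * M\<^sup>2"
    have c0: "c \<ge> 0" by (simp add: c_def)
    have t: "0 < - t" "- t \<le> 1" using True ab by auto
    note ms = moment_scaling[OF l_ge t, where 'a='a]
    have icm: "integrable lborel (\<lambda>x::'a \<times> real. c * moment_density l x (- t))" using ms(1) by simp
    have le: "P (x, t) \<le> c * moment_density l x (- t)" for x
      using moment_density_nonneg[of l x "- t"] c0 by (auto simp: P_def c_def indicator_def)
    have mPt: "(\<lambda>x. P (x, t)) \<in> borel_measurable lborel" using mP by simp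
    have i: "integrable lborel (\<lambda>x. P (x, t))"
      by (rule Bochner_Integration.integrable_bound[OF icm mPt])
         (use le P0 in \<open>auto intro!: always_eventually intro: order_trans[OF _ abs_ge_self]\<close>)
    have "(LINT x|lborel. P (x, t)) \<le> (LINT x::'a \<times> real|lborel. c * moment_density l x (- t))"
      by (rule integral_mono[OF i icm le])
    also have "\<dots> = c * ((- t) powr (l - 2) * m)" using ms(2) by (simp add: m_def)
    also have "\<dots> = M\<^sup>2 * m * (- t) powr (l - 1 - \<kappa>)"
    proof -
      have "(- t) powr (1 - \<kappa>) * (- t) powr (l - 2) = (- t) powr (l - 1 - \<kappa>)"
        by (simp add: powr_add[symmetric] algebra_simps)
      then show ?thesis by (simp add: c_def mult_ac)
    qed
    also have "\<dots> \<le> M\<^sup>2 * m * (- t) powr (\<sigma> - 1)"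
      using m0 t \<sigma> by (intro mult_left_mono powr_mono') auto
    also have "\<dots> = B t" using True by (simp add: B_def)
    finally show ?thesis using i by simp
  next
    case False
    then have "P (x, t) = 0" for x by (auto simp: P_def open_slab_def)
    then show ?thesis using m0 by (simp add: B_def)
  qed
  have P: "integrable lborel P" "integral\<^sup>L lborel P \<le> integral\<^sup>L lborel B"
    using iterated_integrable[OF mP P0 _ _ B] slice by auto
  define E where "E z = indicator (open_slab a b) z * ((- snd z) powr (1 - \<kappa>) * heat_kernel z * (f z)\<^sup>2)" for z
  have E_le: "AE z in lborel. E z \<le> P z"
    using f_bound
  proof eventually_elim
    case (elim z)
    show ?case
    proof (cases "z \<in> open_slab a b")
      case True
      then have t: "snd z < 0" using ab by (auto simp: open_slab_def)
      have "(- snd z) powr (1 - \<kappa>) * heat_kernel z * (f z)\<^sup>2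
        \<le> (- snd z) powr (1 - \<kappa>) * heat_kernel z * (M\<^sup>2 * ((norm (fst z))\<^sup>2 + \<bar>snd z\<bar>) powr (l - 2))"
        using elim by (intro mult_left_mono) (auto simp: heat_kernel_nonneg)
      then show ?thesis using True t by (simp add: E_def P_def moment_density_def mult_ac)
    qed (simp add: E_def P_def)
  qed
  have E0: "0 \<le> E z" for z by (simp add: E_def heat_kernel_nonneg)
  have mE: "E \<in> borel_measurable borel" unfolding E_def[abs_def] by measurable
  have iE: "integrable lborel E"
    by (rule Bochner_Integration.integrable_bound[OF P(1)]) (use mE E_le E0 in \<open>auto elim!: eventually_mono intro: order_trans[OF _ abs_ge_self]\<close>)
  have "integral\<^sup>L lborel E \<le> integral\<^sup>L lborel P" by (rule integral_mono_AE[OF iE P(1) E_le])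
  also note P(2)
  also have "integral\<^sup>L lborel B = M\<^sup>2 * m * (((- a) powr \<sigma> - (- b) powr \<sigma>) / \<sigma>)"
    unfolding B_def using powr_integral(2)[OF \<sigma>(1) ab(2,3)] by simp
  finally have "- (M\<^sup>2 * m * (((- a) powr \<sigma> - (- b) powr \<sigma>) / \<sigma>)) / 2 \<le> - (integral\<^sup>L lborel E) / 2" by simp
  also have "\<dots> \<le> scaled_energy \<kappa> a - scaled_energy \<kappa> b"
    using scaled_energy_increment[OF \<kappa> ab iE[unfolded E_def[abs_def]]] by (simp add: E_def[abs_def])
  finally have le: "- (M\<^sup>2 * m * (((- a) powr \<sigma> - (- b) powr \<sigma>) / \<sigma>)) / 2 \<le> scaled_energy \<kappa> a - scaled_energy \<kappa> b" .
  have "- (k * ((x - y) / \<sigma>)) / 2 = k / (2 * \<sigma>) * y - k / (2 * \<sigma>) * x" for k x y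
    using \<sigma>(1) by (simp add: field_simps)
  from le[unfolded this] show ?thesis by linarith
qed

end

section \<open>The Weiss energy as an average over time slices\<close>

lemma half_cyl_borel [measurable]: "half_cyl r \<in> sets (borel :: 'a::euclidean_space spacetime measure)"
proof -
  have "(half_cyl r :: 'a spacetime set) = {z. 0 < snd (fst z)} \<inter> {z. - (r\<^sup>2) < snd z} \<inter> {z. snd z \<le> 0}"
    by (auto simp: half_cyl_def)
  moreover have "open {z::'a spacetime. 0 < snd (fst z)}" "open {z::'a spacetime. - (r\<^sup>2) < snd z}"
    by (intro open_Collect_less continuous_intros)+
  moreover have "closed {z::'a spacetime. snd z \<le> 0}" by (intro closed_Collect_le continuous_intros)
  ultimately show ?thesis by auto
qed

lemma indicator_half_cyl:
  "indicator (half_cyl r) (x, t) = (indicator {x. 0 < snd x} x * indicator {- (r\<^sup>2)<..0} t :: real)"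
  by (auto simp: half_cyl_def indicator_def)

text \<open>For l = 2 the moment density is the kernel itself, so by \<open>moment_scaling\<close>
  its mass is the same on all slices with 0 < - t \<le> 1.\<close>

lemma heat_kernel_cyl_integrable:
  assumes r: "0 < r" "r < 1"
  shows "integrable lborel (\<lambda>z::'a::euclidean_space spacetime. indicator (half_cyl r) z * heat_kernel z)"
proof -
  define m where "m = (LINT x::'a \<times> real|lborel. moment_density 2 x 1)"
  have r2: "r\<^sup>2 < 1" using r by (simp add: power_less_one_iff)
  have m0: "0 \<le> m" unfolding m_def by (rule integral_nonneg_AE) (simp add: moment_density_nonneg)
  define B where "B t = indicator {- (r\<^sup>2)..0} t * m" for t :: real
  have slice: "integrable lborel (\<lambda>x::'a \<times> real. indicator (half_cyl r) (x, t) * heat_kernel (x, t)) \<and>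
      (LINT x::'a \<times> real|lborel. indicator (half_cyl r) (x, t) * heat_kernel (x, t)) \<le> B t" for t
  proof (cases "t \<in> {- (r\<^sup>2)<..<0}")
    case True
    then have t: "0 < - t" "- t \<le> 1" using r2 by auto
    have eq: "moment_density 2 x (- t) = heat_kernel (x, t)" for x :: "'a \<times> real"
    proof -
      have "(norm x)\<^sup>2 + - t \<noteq> 0" using t zero_le_power2[of "norm x"] by linarith
      then show ?thesis by (simp add: moment_density_def)
    qed
    note ms = moment_scaling[OF order_refl t, where 'a='a, unfolded eq]
    have le: "indicator (half_cyl r) (x, t) * heat_kernel (x, t) \<le> heat_kernel (x, t)" for x :: "'a \<times> real"
      using heat_kernel_nonneg[of "(x, t)"] by (auto simp: indicator_def)
    have mG: "(\<lambda>z::'a spacetime. indicator (half_cyl r) z * heat_kernel z) \<in> borel_measurable borel" by measurable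
    have i: "integrable lborel (\<lambda>x::'a \<times> real. indicator (half_cyl r) (x, t) * heat_kernel (x, t))"
    proof (rule Bochner_Integration.integrable_bound[OF ms(1)])
      show "(\<lambda>x::'a \<times> real. indicator (half_cyl r) (x, t) * heat_kernel (x, t)) \<in> borel_measurable lborel"
        using measurable_compose[OF _ mG, of "\<lambda>x. (x, t)" lborel] by simp
      show "AE x::'a \<times> real in lborel. norm (indicator (half_cyl r) (x, t) * heat_kernel (x, t)) \<le> norm (heat_kernel (x, t))"
        by (auto simp: indicator_def)
    qed
    have "(LINT x::'a \<times> real|lborel. indicator (half_cyl r) (x, t) * heat_kernel (x, t)) \<le> (LINT x::'a \<times> real|lborel. heat_kernel (x, t))"
      by (rule integral_mono[OF i ms(1) le])
    also have "\<dots> = B t" using ms(2) True t by (simp add: m_def B_def)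
    finally show ?thesis using i by simp
  next
    case False
    then have eq: "indicator (half_cyl r) (x, t) * heat_kernel (x, t) = 0" for x :: "'a \<times> real"
      by (auto simp: half_cyl_def heat_kernel_def indicator_def)
    show ?thesis unfolding eq using m0 by (simp add: B_def)
  qed
  have iB: "integrable lborel B"
    unfolding B_def by (intro integrable_mult_left integrable_real_indicator) auto
  show ?thesis
    by (rule iterated_integrable(1)[OF _ _ _ _ iB]) (use slice in \<open>auto simp: heat_kernel_nonneg\<close>)
qed

context signorini
begin

text \<open>The energies are defined by integrals over \<open>lebesgue\<close>, whereas Fubini and
  the substitutions use \<open>lborel\<close>. This is the passage between them, together with
  integrability up to t = 0, where the kernel is singular but \<open>F\<close> is bounded.\<close>

lemma cyl_kernel_integral:
  fixes F :: "'a spacetime \<Rightarrow> real"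
  assumes F: "continuous_on space_cyl F" "\<And>z. z \<in> space_cyl \<Longrightarrow> R < norm (fst z) \<Longrightarrow> F z = 0"
    and r: "0 < r" "r < 1"
  shows "integrable lborel (\<lambda>z. indicator (half_cyl r) z * (F z * heat_kernel z))"
    "(LINT z:half_cyl r|lebesgue. F z * heat_kernel z) = (LINT z|lborel. indicator (half_cyl r) z * (F z * heat_kernel z))"
    "set_integrable lebesgue (half_cyl r) (\<lambda>z. F z * heat_kernel z)"
proof -
  have r2: "r\<^sup>2 < 1" using r by (simp add: power_less_one_iff)
  have sub: "half_cyl r \<subseteq> (space_cyl :: 'a spacetime set)" using r2 by (auto simp: half_cyl_def space_cyl_def)
  have "(\<lambda>z. indicator (half_cyl r) z *\<^sub>R F z) \<in> borel_measurable borel"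
    by (rule borel_measurable_continuous_on_indicator[OF _ continuous_on_subset[OF F(1) sub]]) simp
  then have mF [measurable]: "(\<lambda>z. indicator (half_cyl r) z * F z) \<in> borel_measurable borel" by simp
  have eq: "indicator (half_cyl r) z * (F z * heat_kernel z) = (indicator (half_cyl r) z * F z) * heat_kernel z" for z
    by simp
  have m: "(\<lambda>z. indicator (half_cyl r) z * (F z * heat_kernel z)) \<in> borel_measurable borel"
    unfolding eq by measurable
  have "bounded (F ` cyl_box 0 R (- (r\<^sup>2)) 0)"
    using r2 by (intro compact_imp_bounded compact_continuous_image compact_cyl_box continuous_on_subset[OF F(1)])
       (auto simp: cyl_box_def space_cyl_def)
  then obtain B where B: "B > 0" "\<And>z. z \<in> cyl_box 0 R (- (r\<^sup>2)) 0 \<Longrightarrow> \<bar>F z\<bar> \<le> B"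
    unfolding bounded_pos by auto
  have le: "\<bar>indicator (half_cyl r) z * (F z * heat_kernel z)\<bar> \<le> B * (indicator (half_cyl r) z * heat_kernel z)" for z
  proof (cases "z \<in> half_cyl r")
    case True
    have "\<bar>F z\<bar> \<le> B"
    proof (cases "norm (fst z) \<le> R")
      case n: True
      then have "z \<in> cyl_box 0 R (- (r\<^sup>2)) 0" using True by (auto simp: cyl_box_def half_cyl_def)
      then show ?thesis by (rule B(2))
    next
      case False
      then show ?thesis using F(2)[of z] True sub B(1) by auto
    qed
    then show ?thesis using True heat_kernel_nonneg[of z] by (simp add: abs_mult mult_right_mono)
  qed simp
  show i: "integrable lborel (\<lambda>z. indicator (half_cyl r) z * (F z * heat_kernel z))"
  proof (rule Bochner_Integration.integrable_bound)
    show "integrable lborel (\<lambda>z::'a spacetime. B * (indicator (half_cyl r) z * heat_kernel z))"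
      by (intro integrable_mult_right heat_kernel_cyl_integrable r)
    show "(\<lambda>z. indicator (half_cyl r) z * (F z * heat_kernel z)) \<in> borel_measurable lborel" using m by simp
    show "AE z in lborel. norm (indicator (half_cyl r) z * (F z * heat_kernel z)) \<le> norm (B * (indicator (half_cyl r) z * heat_kernel z))"
      using le by (auto intro!: always_eventually intro: order_trans[OF _ abs_ge_self])
  qed
  show "(LINT z:half_cyl r|lebesgue. F z * heat_kernel z) = (LINT z|lborel. indicator (half_cyl r) z * (F z * heat_kernel z))"
    unfolding set_lebesgue_integral_def using integral_completion[of "\<lambda>z. indicator (half_cyl r) z * (F z * heat_kernel z)" lborel] m
    by simp
  show "set_integrable lebesgue (half_cyl r) (\<lambda>z. F z * heat_kernel z)"
    unfolding set_integrable_def using integrable_completion[of "\<lambda>z. indicator (half_cyl r) z * (F z * heat_kernel z)" lborel] m i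
    by simp
qed

lemma density_factor:
  "continuous_on space_cyl (\<lambda>z. \<bar>snd z\<bar> * (norm (g z))\<^sup>2 - \<kappa> / 2 * (u z)\<^sup>2)"
  "continuous_on space_cyl (\<lambda>z. \<bar>snd z\<bar> * (norm (g z))\<^sup>2)" "continuous_on space_cyl (\<lambda>z. (u z)\<^sup>2)"
  by (intro continuous_intros cont_u cont_g)+

definition energy :: "real \<Rightarrow> real \<Rightarrow> real" where
  "energy \<kappa> r = 1 / r powr (2 * \<kappa> + 2) *
     (LINT z:half_cyl r|lebesgue. (\<bar>snd z\<bar> * (norm (g z))\<^sup>2 - \<kappa> / 2 * (u z)\<^sup>2) * heat_kernel z)"

lemma energy_split:
  assumes r: "0 < r" "r < 1"
  shows "energy \<kappa> r = 1 / r powr (2 * \<kappa>) *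
     (1 / r\<^sup>2 * (LINT z:half_cyl r|lebesgue. \<bar>snd z\<bar> * (norm (g z))\<^sup>2 * heat_kernel z)
       - \<kappa> / 2 * (1 / r\<^sup>2 * (LINT z:half_cyl r|lebesgue. (u z)\<^sup>2 * heat_kernel z)))"
proof -
  have i: "set_integrable lebesgue (half_cyl r) (\<lambda>z. \<bar>snd z\<bar> * (norm (g z))\<^sup>2 * heat_kernel z)"
    "set_integrable lebesgue (half_cyl r) (\<lambda>z. (u z)\<^sup>2 * heat_kernel z)"
    by (rule cyl_kernel_integral(3)[OF density_factor(2) _ r] cyl_kernel_integral(3)[OF density_factor(3) _ r];
        simp add: supp)+
  have "(LINT z:half_cyl r|lebesgue. (\<bar>snd z\<bar> * (norm (g z))\<^sup>2 - \<kappa> / 2 * (u z)\<^sup>2) * heat_kernel z)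
    = (LINT z:half_cyl r|lebesgue. \<bar>snd z\<bar> * (norm (g z))\<^sup>2 * heat_kernel z - \<kappa> / 2 * ((u z)\<^sup>2 * heat_kernel z))"
    by (simp add: left_diff_distrib mult.assoc)
  also have "\<dots> = (LINT z:half_cyl r|lebesgue. \<bar>snd z\<bar> * (norm (g z))\<^sup>2 * heat_kernel z)
      - (LINT z:half_cyl r|lebesgue. \<kappa> / 2 * ((u z)\<^sup>2 * heat_kernel z))"
    by (rule set_integral_diff(2)[OF i(1)]) (use i(2) in simp)
  also have "(LINT z:half_cyl r|lebesgue. \<kappa> / 2 * ((u z)\<^sup>2 * heat_kernel z))
      = \<kappa> / 2 * (LINT z:half_cyl r|lebesgue. (u z)\<^sup>2 * heat_kernel z)"
    by (rule set_integral_mult_right)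
  finally have "(LINT z:half_cyl r|lebesgue. (\<bar>snd z\<bar> * (norm (g z))\<^sup>2 - \<kappa> / 2 * (u z)\<^sup>2) * heat_kernel z)
    = (LINT z:half_cyl r|lebesgue. \<bar>snd z\<bar> * (norm (g z))\<^sup>2 * heat_kernel z)
      - \<kappa> / 2 * (LINT z:half_cyl r|lebesgue. (u z)\<^sup>2 * heat_kernel z)" .
  moreover have "r powr (2 * \<kappa> + 2) = r powr (2 * \<kappa>) * r\<^sup>2" using r by (simp add: powr_add)
  ultimately show ?thesis using r by (simp add: energy_def field_simps)
qed

lemma energy_slices:
  assumes r: "0 < r" "r < 1"
  shows "integrable lborel (\<lambda>t. indicator {- (r\<^sup>2)<..<0} t * slice_energy \<kappa> t)"
    "energy \<kappa> r = 1 / r powr (2 * \<kappa> + 2) * (LINT t|lborel. indicator {- (r\<^sup>2)<..<0} t * slice_energy \<kappa> t)"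
proof -
  note c = cyl_kernel_integral[OF density_factor(1)[of \<kappa>] _ r]
  have i: "integrable lborel (\<lambda>z. indicator (half_cyl r) z * ((\<bar>snd z\<bar> * (norm (g z))\<^sup>2 - \<kappa> / 2 * (u z)\<^sup>2) * heat_kernel z))"
    by (rule c(1)) (simp add: supp)
  have slice: "(LINT x|lborel. indicator (half_cyl r) (x, t) * ((\<bar>snd (x, t)\<bar> * (norm (g (x, t)))\<^sup>2 - \<kappa> / 2 * (u (x, t))\<^sup>2) * heat_kernel (x, t)))
    = indicator {- (r\<^sup>2)<..<0} t * slice_energy \<kappa> t" for t
  proof -
    have "indicator (half_cyl r) (x, t) * ((\<bar>snd (x, t)\<bar> * (norm (g (x, t)))\<^sup>2 - \<kappa> / 2 * (u (x, t))\<^sup>2) * heat_kernel (x, t))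
      = indicator {- (r\<^sup>2)<..<0} t * (indicator {x. 0 < snd x} x * energy_density \<kappa> (x, t))" for x
    proof (cases "t < 0")
      case True
      then have "(indicator {- (r\<^sup>2)<..0} t :: real) = indicator {- (r\<^sup>2)<..<0} t" by (simp add: indicator_def)
      then show ?thesis unfolding indicator_half_cyl energy_density_def by simp
    next
      \<comment> \<open>The kernel is 0 for t \<ge> 0 by definition, so the top slice contributes
        nothing and the time interval may be taken open at 0.\<close>
      case False
      then show ?thesis by (simp add: heat_kernel_def)
    qed
    then show ?thesis unfolding slice_energy_def by (simp only: integral_mult_right_zero)
  qed
  show "integrable lborel (\<lambda>t. indicator {- (r\<^sup>2)<..<0} t * slice_energy \<kappa> t)"
    using lborel_Fubini_time(1)[OF i] by (simp only: slice)
  have "(LINT z:half_cyl r|lebesgue. (\<bar>snd z\<bar> * (norm (g z))\<^sup>2 - \<kappa> / 2 * (u z)\<^sup>2) * heat_kernel z)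
     = (LINT t|lborel. indicator {- (r\<^sup>2)<..<0} t * slice_energy \<kappa> t)"
    using c(2) lborel_Fubini_time(2)[OF i] supp by (simp only: slice) simp
  then show "energy \<kappa> r = 1 / r powr (2 * \<kappa> + 2) * (LINT t|lborel. indicator {- (r\<^sup>2)<..<0} t * slice_energy \<kappa> t)"
    by (simp add: energy_def)
qed

text \<open>Under t = - r^2 s the Jacobian r^2 and the factor r^(2 \<kappa>) of (- t)^\<kappa>
  cancel the normalisation, so that r enters only through the argument of E.\<close>

lemma energy_rescaled:
  fixes r \<kappa> :: real
  assumes r: "0 < r" "r < 1"
  defines "A \<equiv> \<lambda>s. indicator {0<..<1} s * (s powr \<kappa> * scaled_energy \<kappa> (- (r\<^sup>2 * s)))"
  shows "integrable lborel A" "energy \<kappa> r = integral\<^sup>L lborel A"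
proof -
  define F where "F t = indicator {- (r\<^sup>2)<..<0} t * slice_energy \<kappa> t" for t
  note e = energy_slices[OF r, of \<kappa>, folded F_def]
  have iF: "integrable lborel F" using e(1) by (simp add: F_def[abs_def])
  have r2: "r\<^sup>2 > 0" using r by simp
  have eq: "F (0 + (- (r\<^sup>2)) *\<^sub>R s) = r powr (2 * \<kappa>) * A s" for s
  proof (cases "s \<in> {0<..<1}")
    case True
    then have "- (r\<^sup>2 * s) \<in> {- (r\<^sup>2)<..<0}" using r2 by simp
    moreover have "slice_energy \<kappa> (- (r\<^sup>2 * s)) = (r\<^sup>2 * s) powr \<kappa> * scaled_energy \<kappa> (- (r\<^sup>2 * s))"
    proof -
      have "(r\<^sup>2 * s) powr \<kappa> * (r\<^sup>2 * s) powr (- \<kappa>) = 1"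
        using True r2 r by (simp add: powr_add[symmetric])
      then show ?thesis by (simp add: scaled_energy_def mult.assoc[symmetric])
    qed
    moreover have "(r\<^sup>2 * s) powr \<kappa> = r powr (2 * \<kappa>) * s powr \<kappa>"
      using r True by (simp add: powr_mult powr_powr flip: powr_numeral)
    ultimately show ?thesis using True by (simp add: F_def A_def)
  next
    case False
    then have "- (r\<^sup>2 * s) \<notin> {- (r\<^sup>2)<..<0}"
      using r2 by (auto simp: zero_less_mult_iff)
    then show ?thesis using False by (simp add: F_def A_def)
  qed
  have "integrable lborel (\<lambda>s. F (0 + (- (r\<^sup>2)) *\<^sub>R s))"
    by (rule lborel_integrable_affine[OF iF]) (use r in simp)
  then show "integrable lborel A" unfolding eq using r by simp
  have "integral\<^sup>L lborel F = \<bar>- (r\<^sup>2)\<bar> ^ DIM(real) * (LINT s|lborel. F (0 + (- (r\<^sup>2)) *\<^sub>R s))"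
    by (rule lborel_integral_affine) (use iF r in auto)
  also have "\<dots> = r\<^sup>2 * r powr (2 * \<kappa>) * integral\<^sup>L lborel A" unfolding eq by simp
  also have "r\<^sup>2 * r powr (2 * \<kappa>) = r powr (2 * \<kappa> + 2)" using r by (simp add: powr_add)
  finally show "energy \<kappa> r = integral\<^sup>L lborel A"
    using e(2) r by (simp add: F_def[abs_def])
qed

text \<open>For r \<le> r' the time - r'^2 s is the earlier one, so the inequality between slices
  applies for each s in (0, 1). The errors carry the factor s^\<kappa> s^\<sigma> \<le> 1 and
  integrate to at most \<open>c0 * d\<close>; as \<open>d \<ge> 0\<close>, every larger constant
  \<open>c\<close> works too.\<close>

lemma energy_almost_increasing:
  assumes \<kappa>: "0 < \<kappa>" and \<sigma>: "0 < \<sigma>" "\<sigma> < l - \<kappa>" and r: "0 < r" "r \<le> r'" "r' < 1"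
    and c: "M\<^sup>2 * (LINT x::'a \<times> real|lborel. moment_density l x 1) / (2 * \<sigma>) \<le> c"
  shows "energy \<kappa> r + c * r powr (2 * \<sigma>) \<le> energy \<kappa> r' + c * r' powr (2 * \<sigma>)"
proof -
  define c0 where "c0 = M\<^sup>2 * (LINT x::'a \<times> real|lborel. moment_density l x 1) / (2 * \<sigma>)"
  have c0: "0 \<le> c0" unfolding c0_def using \<sigma> by (intro divide_nonneg_pos mult_nonneg_nonneg integral_nonneg_AE) (auto simp: moment_density_nonneg)
  define A where "A r s = indicator {0<..<1} s * (s powr \<kappa> * scaled_energy \<kappa> (- (r\<^sup>2 * s)))" for r s :: real
  have e: "integrable lborel (A r)" "energy \<kappa> r = integral\<^sup>L lborel (A r)" if "0 < r" "r < 1" for r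
    using energy_rescaled[OF that, of \<kappa>] by (simp_all add: A_def[abs_def])
  define d where "d = r' powr (2 * \<sigma>) - r powr (2 * \<sigma>)"
  have d: "0 \<le> d" unfolding d_def using r \<sigma> by (simp add: powr_mono2)
  have le: "A r s \<le> A r' s + indicator {0<..<1} s * (c0 * d)" for s
  proof (cases "s \<in> {0<..<1}")
    case True
    have sq: "r\<^sup>2 * s \<le> r'\<^sup>2 * s" "0 < r\<^sup>2 * s" using True r by (auto intro!: mult_right_mono power_mono)
    have lt: "r'\<^sup>2 * s < 1"
    proof -
      have "r'\<^sup>2 < 1" using r by (simp add: power_less_one_iff)
      then have "r'\<^sup>2 * s \<le> r'\<^sup>2 * 1" using True by (intro mult_left_mono) auto
      then show ?thesis using \<open>r'\<^sup>2 < 1\<close> by simp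
    qed
    have "scaled_energy \<kappa> (- (r\<^sup>2 * s)) + c0 * (r\<^sup>2 * s) powr \<sigma> \<le> scaled_energy \<kappa> (- (r'\<^sup>2 * s)) + c0 * (r'\<^sup>2 * s) powr \<sigma>"
      using scaled_energy_almost_decreasing[OF \<kappa> \<sigma>, of "- (r'\<^sup>2 * s)" "- (r\<^sup>2 * s)"] sq lt by (simp add: c0_def)
    moreover have "(q\<^sup>2 * s) powr \<sigma> = q powr (2 * \<sigma>) * s powr \<sigma>" if "q > 0" for q
      using that True by (simp add: powr_mult powr_powr flip: powr_numeral)
    ultimately have "scaled_energy \<kappa> (- (r\<^sup>2 * s)) \<le> scaled_energy \<kappa> (- (r'\<^sup>2 * s)) + c0 * d * s powr \<sigma>"
      using r by (simp add: d_def algebra_simps)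
    then have "s powr \<kappa> * scaled_energy \<kappa> (- (r\<^sup>2 * s)) \<le> s powr \<kappa> * (scaled_energy \<kappa> (- (r'\<^sup>2 * s)) + c0 * d * s powr \<sigma>)"
      by (rule mult_left_mono) simp
    moreover have "c0 * d * (s powr \<kappa> * s powr \<sigma>) \<le> c0 * d * 1"
    proof (rule mult_left_mono)
      have "s powr \<kappa> \<le> 1" "s powr \<sigma> \<le> 1" using True \<kappa> \<sigma> by (auto intro!: powr_le1)
      then show "s powr \<kappa> * s powr \<sigma> \<le> 1" by (intro mult_le_one) auto
    qed (use c0 d in simp)
    ultimately show ?thesis using True by (simp add: A_def algebra_simps)
  qed (simp add: A_def)
  have ii: "integrable lborel (\<lambda>s::real. indicator {0<..<1} s * (c0 * d))"
    by (intro integrable_mult_left integrable_real_indicator) auto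
  have rr: "0 < r'" "r < 1" using r by auto
  have "energy \<kappa> r \<le> (LINT s|lborel. A r' s + indicator {0<..<1} s * (c0 * d))"
    unfolding e(2)[OF r(1) rr(2)]
    by (rule integral_mono[OF e(1)[OF r(1) rr(2)] Bochner_Integration.integrable_add[OF e(1)[OF rr(1) r(3)] ii] le])
  also have "\<dots> = energy \<kappa> r' + c0 * d"
    using e[OF rr(1) r(3)] ii by simp
  also have "\<dots> \<le> energy \<kappa> r' + c * d"
    using c d by (intro add_left_mono mult_right_mono) (simp_all add: c0_def)
  finally show ?thesis by (simp add: d_def algebra_simps)
qed

text \<open>The energy is r^(- (2 \<kappa> + 2)) \<Phi>(r^2), and the fundamental theorem of
  calculus differentiates \<Phi>, because the slice energy is continuous for t < 0.\<close>

lemma energy_differentiable: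
  assumes r: "0 < r" "r < 1"
  shows "\<exists>D. (energy \<kappa> has_real_derivative D) (at r)"
proof -
  define \<Phi> where "\<Phi> y = (LINT t|lborel. indicator {- y<..<0} t * slice_energy \<kappa> t)" for y
  have r2: "0 < r\<^sup>2" "r\<^sup>2 < 1" using r by (auto simp: power_less_one_iff)
  \<comment> \<open>[p, q] is a neighbourhood of r^2 inside (0, 1). The slices near t = 0, where
    continuity has not been established, are collected in the constant
    \<open>\<Phi> p\<close>.\<close>
  define p q where "p = r\<^sup>2 / 2" and "q = (r\<^sup>2 + 1) / 2"
  have pq: "0 < p" "p < r\<^sup>2" "r\<^sup>2 < q" "q < 1" using r2 by (auto simp: p_def q_def)
  have cs: "continuous_on {- q..- p} (slice_energy \<kappa>)"
  proof -
    have "continuous_on {- q..- p} (\<lambda>t. (- t) powr \<kappa> * scaled_energy \<kappa> t)"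
      using pq by (intro continuous_intros continuous_scaled_energy) auto
    moreover have "(- t) powr \<kappa> * scaled_energy \<kappa> t = slice_energy \<kappa> t" if "t \<in> {- q..- p}" for t
    proof -
      have "(- t) powr \<kappa> * (- t) powr (- \<kappa>) = 1" using that pq by (simp add: powr_add[symmetric])
      then show ?thesis by (simp add: scaled_energy_def mult.assoc[symmetric])
    qed
    ultimately show ?thesis
      using continuous_on_cong[OF refl, of "{- q..- p}" "\<lambda>t. (- t) powr \<kappa> * scaled_energy \<kappa> t" "slice_energy \<kappa>"]
      by blast
  qed
  have int: "slice_energy \<kappa> integrable_on {x..y}" if "- q \<le> x" "y \<le> - p" for x y
    using that by (intro integrable_continuous_real continuous_on_subset[OF cs]) auto
  define F where "F s = integral {- q..s} (slice_energy \<kappa>)" for s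
  have F': "(F has_real_derivative slice_energy \<kappa> s) (at s)" if "- q < s" "s < - p" for s
  proof -
    have "(F has_real_derivative slice_energy \<kappa> s) (at s within {- q..- p})"
      unfolding F_def using that by (intro integral_has_real_derivative cs) auto
    then show ?thesis using that by (simp add: at_within_Icc_at)
  qed
  have \<Phi>_eq: "\<Phi> y = \<Phi> p + (F (- p) - F (- y))" if y: "p < y" "y < q" for y
  proof -
    have i: "integrable lborel (\<lambda>t. indicator {- v<..<0} t * slice_energy \<kappa> t)" if "0 < v" "v < 1" for v
      using energy_slices(1)[of "sqrt v" \<kappa>] that by simp
    note ip = i[of p] and iy = i[of y]
    have si: "set_integrable lborel {- y..- p} (slice_energy \<kappa>)"
      using y by (intro borel_integrable_atLeastAtMost' continuous_on_subset[OF cs]) auto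
    have "\<Phi> y = (LINT t|lborel. indicator {- p<..<0} t * slice_energy \<kappa> t + indicator {- y..- p} t *\<^sub>R slice_energy \<kappa> t)"
      unfolding \<Phi>_def
    proof (rule integral_cong_AE)
      show "(\<lambda>t. indicator {- y<..<0} t * slice_energy \<kappa> t) \<in> borel_measurable lborel"
        using iy y pq by (intro borel_measurable_integrable) auto
      show "(\<lambda>t. indicator {- p<..<0} t * slice_energy \<kappa> t + indicator {- y..- p} t *\<^sub>R slice_energy \<kappa> t) \<in> borel_measurable lborel"
        using ip y pq si by (intro borel_measurable_integrable Bochner_Integration.integrable_add) (auto simp: set_integrable_def)
      have "AE t in lborel. t \<noteq> - y" by (rule AE_lborel_singleton)
      then show "AE t in lborel. indicator {- y<..<0} t * slice_energy \<kappa> t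
          = indicator {- p<..<0} t * slice_energy \<kappa> t + indicator {- y..- p} t *\<^sub>R slice_energy \<kappa> t"
        by eventually_elim (use y pq in \<open>auto simp: indicator_def\<close>)
    qed
    also have "\<dots> = \<Phi> p + (LINT t:{- y..- p}|lborel. slice_energy \<kappa> t)"
      unfolding \<Phi>_def set_lebesgue_integral_def
      by (rule Bochner_Integration.integral_add) (use ip y pq si in \<open>auto simp: set_integrable_def\<close>)
    also have "(LINT t:{- y..- p}|lborel. slice_energy \<kappa> t) = integral {- y..- p} (slice_energy \<kappa>)"
      by (rule set_borel_integral_eq_integral(2)[OF si])
    also have "\<dots> = F (- p) - F (- y)"
      using Henstock_Kurzweil_Integration.integral_combine[of "- q" "- y" "- p" "slice_energy \<kappa>"] y int
      by (simp add: F_def algebra_simps)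
    finally show ?thesis .
  qed
  have dF: "((\<lambda>y. F (- y)) has_real_derivative - slice_energy \<kappa> (- (r\<^sup>2))) (at (r\<^sup>2))"
  proof -
    have 1: "(F has_real_derivative slice_energy \<kappa> (- (r\<^sup>2))) (at (- (r\<^sup>2)))" using pq by (intro F') auto
    have 2: "((\<lambda>y. - y) has_real_derivative - 1) (at (r\<^sup>2))" by (auto intro!: derivative_eq_intros)
    from DERIV_chain2[where f=F and g="\<lambda>y. - y", OF 1 2] show ?thesis by simp
  qed
  have "((\<lambda>y. \<Phi> p + (F (- p) - F (- y))) has_real_derivative slice_energy \<kappa> (- (r\<^sup>2))) (at (r\<^sup>2))"
    using dF by (auto intro!: derivative_eq_intros)
  then have "(\<Phi> has_real_derivative slice_energy \<kappa> (- (r\<^sup>2))) (at (r\<^sup>2))"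
    by (rule has_field_derivative_transform_within_open[where S="{p<..<q}"]) (use pq \<Phi>_eq in auto)
  then have "((\<lambda>y. \<Phi> (y\<^sup>2)) has_real_derivative slice_energy \<kappa> (- (r\<^sup>2)) * (2 * r)) (at r)"
    by (rule DERIV_chain2) (auto intro!: derivative_eq_intros)
  moreover have "((\<lambda>y. y powr (- (2 * \<kappa> + 2))) has_real_derivative - (2 * \<kappa> + 2) * r powr (- (2 * \<kappa> + 2) - 1)) (at r)"
    using r by (intro has_real_derivative_powr) auto
  ultimately have "\<exists>D. ((\<lambda>y. y powr (- (2 * \<kappa> + 2)) * \<Phi> (y\<^sup>2)) has_real_derivative D) (at r)"
    using DERIV_mult by blast
  then obtain D where D: "((\<lambda>y. y powr (- (2 * \<kappa> + 2)) * \<Phi> (y\<^sup>2)) has_real_derivative D) (at r)" ..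
  have "y powr (- (2 * \<kappa> + 2)) * \<Phi> (y\<^sup>2) = energy \<kappa> y" if "y \<in> {0<..<1}" for y
    using energy_slices(2)[of y \<kappa>] that by (simp only: \<Phi>_def powr_minus_divide greaterThanLessThan_iff)
  then have "(energy \<kappa> has_real_derivative D) (at r)"
    by (intro has_field_derivative_transform_within_open[OF D, of "{0<..<1}"]) (use r in auto)
  then show ?thesis ..
qed

text \<open>A nondecreasing differentiable function has nonnegative derivative. The constant
  \<open>c\<close> is C / (2 \<sigma>) because differentiating c r^(2 \<sigma>) then produces the
  coefficient C.\<close>

lemma energy_derivative_bound:
  assumes \<kappa>: "0 < \<kappa>" and \<sigma>: "0 < \<sigma>" "\<sigma> < l - \<kappa>" and r: "0 < r" "r < 1"
    and C: "M\<^sup>2 * (LINT x::'a \<times> real|lborel. moment_density l x 1) \<le> C"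
  shows "\<exists>D. (energy \<kappa> has_real_derivative D) (at r) \<and> D \<ge> - C * r powr (2 * \<sigma> - 1)"
proof -
  define c where "c = C / (2 * \<sigma>)"
  have c: "M\<^sup>2 * (LINT x::'a \<times> real|lborel. moment_density l x 1) / (2 * \<sigma>) \<le> c"
    unfolding c_def using C \<sigma> by (intro divide_right_mono) auto
  obtain D where D: "(energy \<kappa> has_real_derivative D) (at r)" using energy_differentiable[OF r] by blast
  have "((\<lambda>r. energy \<kappa> r + c * r powr (2 * \<sigma>)) has_real_derivative D + c * (2 * \<sigma> * r powr (2 * \<sigma> - 1))) (at r)"
    using r by (intro DERIV_add D DERIV_cmult has_real_derivative_powr) auto
  moreover have "mono_on {0<..<1} (\<lambda>r. energy \<kappa> r + c * r powr (2 * \<sigma>))"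
    by (rule mono_onI) (use energy_almost_increasing[OF \<kappa> \<sigma> _ _ _ c] in auto)
  ultimately have "0 \<le> D + c * (2 * \<sigma> * r powr (2 * \<sigma> - 1))"
    by (intro mono_on_imp_deriv_nonneg) (use r in \<open>auto simp: interior_open\<close>)
  also have "c * (2 * \<sigma> * r powr (2 * \<sigma> - 1)) = C * r powr (2 * \<sigma> - 1)" using \<sigma> by (simp add: c_def)
  finally show ?thesis using D by (intro exI[of _ D]) auto
qed

end

section \<open>Solutions of the Signorini class\<close>

text \<open>The class provides functions that are measurable for the completed measure on the half
  cylinder, whereas the locale works with Borel functions on the whole space that vanish off the
  open cylinder. The two agree almost everywhere on the open cylinder.\<close>

lemma borel_representative:
  fixes k :: "'a::euclidean_space spacetime \<Rightarrow> real"
  assumes k: "k \<in> borel_measurable (lebesgue_on (half_cyl 1))"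
  obtains k' where "k' \<in> borel_measurable borel" "\<And>z. z \<notin> open_cyl \<Longrightarrow> k' z = 0"
    "AE z in lebesgue. indicator open_cyl z * k z = k' z"
    "(\<lambda>z. indicator open_cyl z * k z) \<in> borel_measurable lebesgue"
proof -
  have m: "(\<lambda>z. indicator (half_cyl 1) z *\<^sub>R k z) \<in> borel_measurable lebesgue"
    using k half_cyl_lebesgue by (subst (asm) borel_measurable_restrict_space_iff) auto
  then obtain h where h: "h \<in> borel_measurable lborel" "AE z in lborel. indicator (half_cyl 1) z *\<^sub>R k z = h z"
    using completion_ex_borel_measurable_real by blast
  have sub: "z \<in> open_cyl \<Longrightarrow> z \<in> half_cyl 1" for z :: "'a spacetime"
    by (cases z) (auto simp: open_cyl_def half_cyl_def)
  show thesis
  proof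
    show "(\<lambda>z. indicator open_cyl z * h z) \<in> borel_measurable borel" using h(1) by measurable
    show "indicator open_cyl z * h z = 0" if "z \<notin> open_cyl" for z using that by simp
    have "AE z in lborel. indicator open_cyl z * k z = indicator open_cyl z * h z"
      using h(2) by eventually_elim (auto simp: indicator_def sub)
    then show "AE z in lebesgue. indicator open_cyl z * k z = indicator open_cyl z * h z"
      by (rule AE_completion)
    have eq: "indicator open_cyl z * k z = indicator open_cyl z * (indicator (half_cyl 1) z *\<^sub>R k z)" for z :: "'a spacetime"
      by (auto simp: indicator_def sub)
    have "(indicator open_cyl :: 'a spacetime \<Rightarrow> real) \<in> borel_measurable lebesgue"
      by (intro borel_measurable_indicator) (simp add: open_cyl_borel)
    then show "(\<lambda>z. indicator open_cyl z * k z) \<in> borel_measurable lebesgue"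
      unfolding eq using m by (rule borel_measurable_times)
  qed
qed

lemma representative_integral:
  fixes k k' F :: "'a::euclidean_space spacetime \<Rightarrow> real"
  assumes k: "k' \<in> borel_measurable borel" "AE z in lebesgue. indicator open_cyl z * k z = k' z"
      "(\<lambda>z. indicator open_cyl z * k z) \<in> borel_measurable lebesgue"
    and F: "F \<in> borel_measurable borel"
  shows "(LINT z:open_cyl|lebesgue. k z * F z) = (LINT z|lborel. k' z * F z)"
proof -
  have F': "F \<in> borel_measurable lebesgue" using F by (simp add: measurable_completion)
  have k': "k' \<in> borel_measurable lebesgue" using k(1) by (simp add: measurable_completion)
  have eq: "indicator open_cyl z *\<^sub>R (k z * F z) = (indicator open_cyl z * k z) * F z" for z by simp
  have "(LINT z:open_cyl|lebesgue. k z * F z) = (LINT z|lebesgue. k' z * F z)"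
    unfolding set_lebesgue_integral_def eq
  proof (rule integral_cong_AE)
    show "(\<lambda>z. (indicator open_cyl z * k z) * F z) \<in> borel_measurable lebesgue" using k(3) F' by (rule borel_measurable_times)
    show "(\<lambda>z. k' z * F z) \<in> borel_measurable lebesgue" using k' F' by (rule borel_measurable_times)
    show "AE z in lebesgue. (indicator open_cyl z * k z) * F z = k' z * F z"
      using k(2) by eventually_elim simp
  qed
  also have "\<dots> = (LINT z|lborel. k' z * F z)" using k(1) F by (intro integral_completion) simp
  finally show ?thesis .
qed

lemma continuous_test_functions:
  assumes "test_function U \<phi>"
  shows "continuous_on UNIV \<phi>" "b \<in> Basis \<Longrightarrow> continuous_on UNIV (\<lambda>z. frechet_derivative \<phi> (at z) b)"
proof -
  have C: "C_k k \<phi>" for k using assms by (simp add: test_function_def)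
  show "continuous_on UNIV \<phi>" by (rule C_k_imp_continuous[OF C])
  show "b \<in> Basis \<Longrightarrow> continuous_on UNIV (\<lambda>z. frechet_derivative \<phi> (at z) b)" using C[of 1] by simp
qed

lemma locally_integrable_mult_test:
  fixes k :: "'b::euclidean_space \<Rightarrow> real"
  assumes k: "locally_integrable_on U k" and U: "U \<in> sets lebesgue" and \<phi>: "test_function U \<phi>"
  shows "set_integrable lebesgue U (\<lambda>z. k z * \<phi> z)"
proof (rule test_functionD[OF \<phi>])
  fix K assume K: "compact K" "K \<subseteq> U" "\<And>z. z \<notin> K \<Longrightarrow> \<phi> z = 0"
  note c = continuous_test_functions(1)[OF \<phi>]
  obtain B where B: "B > 0" "\<And>z. \<bar>\<phi> z\<bar> \<le> B" using compact_support_bounded[OF c K(1,3)] by blast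
  have "set_integrable lebesgue K k" using k K by (simp add: locally_integrable_on_def)
  then have i: "integrable lebesgue (\<lambda>z. B * (indicator K z *\<^sub>R k z))" unfolding set_integrable_def by simp
  have m: "\<phi> \<in> borel_measurable lebesgue"
    using borel_measurable_continuous_onI[OF c] by (simp add: measurable_completion)
  have eq: "indicator U z *\<^sub>R (k z * \<phi> z) = (indicator K z *\<^sub>R k z) * \<phi> z" for z
    using K(2) K(3)[of z] by (cases "z \<in> K") (auto simp: subset_eq)
  show "set_integrable lebesgue U (\<lambda>z. k z * \<phi> z)"
    unfolding set_integrable_def eq
  proof (rule Bochner_Integration.integrable_bound[OF i])
    have "(\<lambda>z. indicator K z *\<^sub>R k z) \<in> borel_measurable lebesgue"
      using \<open>set_integrable lebesgue K k\<close> unfolding set_integrable_def by (rule borel_measurable_integrable)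
    then show "(\<lambda>z. (indicator K z *\<^sub>R k z) * \<phi> z) \<in> borel_measurable lebesgue" using m by (rule borel_measurable_times)
    have "norm ((indicator K z *\<^sub>R k z) * \<phi> z) \<le> norm (B * (indicator K z *\<^sub>R k z))" for z
      using mult_left_mono[OF B(2)[of z], of "\<bar>indicator K z *\<^sub>R k z\<bar>"] B(1) by (simp add: abs_mult mult_ac)
    then show "AE z in lebesgue. norm ((indicator K z *\<^sub>R k z) * \<phi> z) \<le> norm (B * (indicator K z *\<^sub>R k z))"
      by (rule AE_I2)
  qed
qed

text \<open>Changing x first and t afterwards passes through a point with the old time and the new
  position, which stays in the cylinder because that is a product set.\<close>

lemma par_holder_continuous:
  assumes "par_holder \<alpha> (space_cyl :: 'a::euclidean_space spacetime set) G" "0 < \<alpha>"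
  shows "continuous_on space_cyl G"
  unfolding continuous_on_def
proof
  fix z0 :: "'a spacetime" assume z0: "z0 \<in> space_cyl"
  obtain K where K: "\<And>x y t. (x, t) \<in> (space_cyl :: 'a spacetime set) \<and> (y, t) \<in> space_cyl \<Longrightarrow> norm (G (x, t) - G (y, t)) \<le> K * norm (x - y) powr \<alpha>"
    "\<And>x s t. (x, s) \<in> (space_cyl :: 'a spacetime set) \<and> (x, t) \<in> space_cyl \<Longrightarrow> norm (G (x, s) - G (x, t)) \<le> K * \<bar>s - t\<bar> powr (\<alpha> / 2)"
    using assms(1) unfolding par_holder_def by blast
  define b where "b z = K * norm (fst z - fst z0) powr \<alpha> + K * \<bar>snd z - snd z0\<bar> powr (\<alpha> / 2)" for z :: "'a spacetime"
  have le: "norm (G z - G z0) \<le> b z" if z: "z \<in> space_cyl" for z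
  proof -
    have m: "(fst z0, snd z) \<in> space_cyl" using z z0 by (simp add: space_cyl_def)
    have "norm (G z - G z0) \<le> norm (G (fst z, snd z) - G (fst z0, snd z)) + norm (G (fst z0, snd z) - G (fst z0, snd z0))"
      using norm_triangle_ineq[of "G z - G (fst z0, snd z)" "G (fst z0, snd z) - G z0"] by simp
    also have "\<dots> \<le> b z" unfolding b_def using z z0 m by (intro add_mono K) auto
    finally show ?thesis .
  qed
  have "((\<lambda>z. norm (fst z - fst z0) powr \<alpha>) \<longlongrightarrow> 0) (at z0 within space_cyl)"
  proof (rule tendsto_zero_powrI[OF _ tendsto_const _ assms(2)])
    have "((\<lambda>z. norm (fst z - fst z0)) \<longlongrightarrow> norm (fst z0 - fst z0)) (at z0 within space_cyl)"
      by (intro tendsto_intros)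
    then show "((\<lambda>z. norm (fst z - fst z0)) \<longlongrightarrow> 0) (at z0 within space_cyl)" by (simp only: diff_self norm_zero)
  qed (rule always_eventually, simp)
  moreover have "((\<lambda>z. \<bar>snd z - snd z0\<bar> powr (\<alpha> / 2)) \<longlongrightarrow> 0) (at z0 within space_cyl)"
  proof (rule tendsto_zero_powrI[OF _ tendsto_const _ half_gt_zero[OF assms(2)]])
    have "((\<lambda>z. \<bar>snd z - snd z0\<bar>) \<longlongrightarrow> \<bar>snd z0 - snd z0\<bar>) (at z0 within space_cyl)"
      by (intro tendsto_intros)
    then show "((\<lambda>z. \<bar>snd z - snd z0\<bar>) \<longlongrightarrow> 0) (at z0 within space_cyl)" by (simp only: diff_self abs_zero)
  qed (rule always_eventually, simp)
  ultimately have "(b \<longlongrightarrow> K * 0 + K * 0) (at z0 within space_cyl)"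
    unfolding b_def by (intro tendsto_intros)
  then have b0: "(b \<longlongrightarrow> 0) (at z0 within space_cyl)" by (simp only: mult_zero_right add_0_right)
  have "\<forall>\<^sub>F z in at z0 within space_cyl. norm (G z - G z0) \<le> b z"
    unfolding eventually_at_filter by (rule always_eventually) (simp add: le)
  then have "((\<lambda>z. G z - G z0) \<longlongrightarrow> 0) (at z0 within space_cyl)"
    by (rule Lim_null_comparison[OF _ b0])
  then show "(G \<longlongrightarrow> G z0) (at z0 within space_cyl)" by (rule LIM_zero_cancel)
qed

lemma grad_x_derivative:
  assumes "(\<lambda>y. u (y, t)) differentiable (at x within closed_half_space)"
  shows "((\<lambda>y. u (y, t)) has_derivative (\<lambda>v. grad_x u (x, t) \<bullet> v)) (at x within closed_half_space)"
proof -
  define D where "D = frechet_derivative (\<lambda>y. u (y, t)) (at x within closed_half_space)"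
  have D: "((\<lambda>y. u (y, t)) has_derivative D) (at x within closed_half_space)"
    using assms unfolding D_def frechet_derivative_works .
  have lin: "linear D" using D by (rule has_derivative_linear)
  have "D v = grad_x u (x, t) \<bullet> v" for v
  proof -
    have "D v = D (\<Sum>b\<in>Basis. (v \<bullet> b) *\<^sub>R b)" by (simp only: euclidean_representation)
    also have "\<dots> = (\<Sum>b\<in>Basis. (v \<bullet> b) * D b)" using lin by (simp add: linear_sum linear_cmul)
    also have "\<dots> = grad_x u (x, t) \<bullet> v"
      unfolding grad_x_def fst_conv snd_conv D_def[symmetric] inner_sum_left inner_scaleR_left
      by (rule sum.cong[OF refl]) (simp only: inner_commute[of v] mult.commute)
    finally show ?thesis .
  qed
  then have eq: "D = (\<lambda>v. grad_x u (x, t) \<bullet> v)" by (rule ext)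
  show ?thesis by (rule D[unfolded eq])
qed

text \<open>Off the thin space \<open>u\<close> vanishes on a whole neighbourhood in x, so its
  derivative is 0. Points of the thin space are approached along the normal direction, and
  continuity of \<open>g\<close> gives the value there.\<close>

lemma gradient_zero_outside_support:
  fixes u :: "'a::euclidean_space spacetime \<Rightarrow> real"
  assumes c: "continuous_on space_cyl g"
    and d: "\<And>z. z \<in> space_cyl \<Longrightarrow> ((\<lambda>y. u (y, snd z)) has_derivative (\<lambda>v. g z \<bullet> v)) (at (fst z) within closed_half_space)"
    and s: "\<And>z. z \<in> space_cyl \<Longrightarrow> R < norm (fst z) \<Longrightarrow> u z = 0"
    and z: "z \<in> space_cyl" "R < norm (fst z)"
  shows "g z = 0"
proof -
  have interior: "g z = 0" if z: "z \<in> space_cyl" "R < norm (fst z)" "0 < snd (fst z)" for z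
  proof -
    define O' where "O' = {x :: 'a \<times> real. 0 < snd x} \<inter> {x. R < norm x}"
    have O': "open O'" unfolding O'_def by (intro open_Int open_Collect_less continuous_intros)
    have zO: "fst z \<in> O'" using z by (simp add: O'_def)
    have "((\<lambda>y. u (y, snd z)) has_derivative (\<lambda>v. g z \<bullet> v)) (at (fst z) within O')"
      by (rule has_derivative_subset[OF d[OF z(1)]]) (auto simp: O'_def closed_half_space_def)
    then have 1: "((\<lambda>y. u (y, snd z)) has_derivative (\<lambda>v. g z \<bullet> v)) (at (fst z))"
      by (simp only: at_within_open[OF zO O'])
    have "((\<lambda>y. 0) has_derivative (\<lambda>v. 0)) (at (fst z))" by simp
    then have "((\<lambda>y. u (y, snd z)) has_derivative (\<lambda>v. 0)) (at (fst z))"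
    proof (rule has_derivative_transform_within_open[OF _ O' zO])
      fix y assume "y \<in> O'"
      then have "(y, snd z) \<in> space_cyl" "R < norm (fst (y, snd z))" using z(1) by (auto simp: O'_def space_cyl_def)
      then show "0 = u (y, snd z)" using s by simp
    qed
    from has_derivative_unique[OF 1 this] have "(\<lambda>v. g z \<bullet> v) = (\<lambda>v. 0)" .
    then have "g z \<bullet> g z = 0" by (rule fun_cong)
    then show ?thesis by simp
  qed
  define y where "y n = (fst z + (1 / real (Suc n)) *\<^sub>R (0, 1), snd z)" for n
  have y_lim: "y \<longlonglongrightarrow> z"
  proof -
    have "y \<longlonglongrightarrow> (fst z + 0 *\<^sub>R (0, 1), snd z)"
      unfolding y_def by (intro tendsto_intros lim_1_over_n[THEN LIMSEQ_Suc])
    then show ?thesis by (simp only: scaleR_zero_left add_0_right prod.collapse)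
  qed
  have y_in: "y n \<in> space_cyl" "0 < snd (fst (y n))" for n
    using z(1) by (auto simp: y_def space_cyl_def add_nonneg_pos)
  have "\<forall>\<^sub>F n in sequentially. R < norm (fst (y n))"
    by (rule order_tendstoD(1)[OF _ z(2)]) (intro tendsto_intros y_lim)
  then have "\<forall>\<^sub>F n in sequentially. g (y n) = 0" by eventually_elim (rule interior[OF y_in(1) _ y_in(2)])
  then have "(\<lambda>n. g (y n)) \<longlonglongrightarrow> 0" by (rule tendsto_eventually)
  moreover have "(\<lambda>n. g (y n)) \<longlonglongrightarrow> g z"
    by (rule continuous_on_tendsto_compose[OF c y_lim z(1)]) (simp add: y_in)
  ultimately show ?thesis using LIMSEQ_unique by blast
qed

text \<open>The product u \<psi> has compact support in the open cylinder, so its derivative along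
  \<open>b\<close> integrates to 0. This identifies the weak first derivatives in space with the
  classical gradient.\<close>

lemma classical_integration_by_parts:
  fixes u :: "'a::euclidean_space spacetime \<Rightarrow> real"
  assumes cu: "continuous_on space_cyl u" and cg: "continuous_on space_cyl g"
    and d: "\<And>z. z \<in> space_cyl \<Longrightarrow> ((\<lambda>y. u (y, snd z)) has_derivative (\<lambda>v. g z \<bullet> v)) (at (fst z) within closed_half_space)"
    and \<chi>: "test_function open_cyl \<psi>" and b: "b \<in> Basis"
  shows "(LINT z|lborel. u z * frechet_derivative \<psi> (at z) (b, 0)) = - (LINT z|lborel. (g z \<bullet> b) * \<psi> z)"
proof (rule test_functionD[OF \<chi>])
  fix K :: "'a spacetime set" assume K: "compact K" "K \<subseteq> open_cyl" "\<And>z. z \<notin> K \<Longrightarrow> \<psi> z = 0"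
  have B: "(b, 0) \<in> (Basis :: 'a spacetime set)" using b by (subst Basis_prod_def) auto
  have C1: "C_k 1 \<psi>" using \<chi> unfolding test_function_def by blast
  define D where "D z = frechet_derivative \<psi> (at z) (b, 0)" for z
  have cD: "continuous_on UNIV D" and c\<psi>: "continuous_on UNIV \<psi>"
    using continuous_test_functions[OF \<chi>] B by (auto simp: D_def[abs_def])
  have D0: "D z = 0" if "z \<notin> K" for z
    unfolding D_def by (rule frechet_derivative_zero_outside[OF C1 compact_imp_closed[OF K(1)] K(3) that])
  have cu': "continuous_on open_cyl u" and cg': "continuous_on open_cyl (\<lambda>z. g z \<bullet> b)"
    by (intro continuous_intros continuous_on_subset[OF cu open_cyl_subset] continuous_on_subset[OF cg open_cyl_subset])+
  have ext0: "continuous_on UNIV (\<lambda>z. F z * H z) \<and> integrable lborel (\<lambda>z. F z * H z)"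
    if "continuous_on open_cyl F" "continuous_on UNIV H" "\<And>z. z \<notin> K \<Longrightarrow> H z = 0" for F H :: "'a spacetime \<Rightarrow> real"
  proof -
    have 1: "continuous_on UNIV (\<lambda>z. F z * H z)"
      by (rule continuous_on_extend_zero[OF open_open_cyl compact_imp_closed[OF K(1)] K(2)])
         (auto intro!: continuous_intros that(1) continuous_on_subset[OF that(2)] simp: that(3))
    then show ?thesis using integrable_compact_support[OF 1 K(1)] that(3) by simp
  qed
  note e1 = ext0[OF cu' c\<psi> K(3)] and e2 = ext0[OF cu' cD D0] and e3 = ext0[OF cg' c\<psi> K(3)]
  have "(LINT z|lborel. u z * D z + (g z \<bullet> b) * \<psi> z) = 0"
  proof (rule integral_directional_derivative_zero[where \<Phi>="\<lambda>z. u z * \<psi> z" and b="(b, 0)", OF _ _ K(1)])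
    show "continuous_on UNIV (\<lambda>z. u z * \<psi> z)" using e1 by blast
    show "continuous_on UNIV (\<lambda>z. u z * D z + (g z \<bullet> b) * \<psi> z)" using e2 e3 by (intro continuous_on_add) blast+
    show "u z * \<psi> z = 0" if "z \<notin> K" for z using K(3)[OF that] by simp
    fix z :: "'a spacetime"
    show "((\<lambda>s. u (z + s *\<^sub>R (b, 0)) * \<psi> (z + s *\<^sub>R (b, 0))) has_real_derivative u z * D z + (g z \<bullet> b) * \<psi> z) (at 0)"
    proof (cases "z \<in> K")
      case True
      obtain x t where z: "z = (x, t)" by fastforce
      have zU: "z \<in> open_cyl" using True K(2) by blast
      have zS: "z \<in> space_cyl" using zU open_cyl_subset by blast
      define O' where "O' = {x :: 'a \<times> real. 0 < snd x}"
      have O': "open O'" unfolding O'_def by (intro open_Collect_less continuous_intros)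
      have xO: "x \<in> O'" using zU by (simp add: O'_def z open_cyl_def)
      have "((\<lambda>y. u (y, t)) has_derivative (\<lambda>v. g z \<bullet> v)) (at x within O')"
        by (rule has_derivative_subset[OF d[OF zS, unfolded z fst_conv snd_conv, folded z]])
           (auto simp: O'_def closed_half_space_def)
      then have dx: "((\<lambda>y. u (y, t)) has_derivative (\<lambda>v. g z \<bullet> v)) (at x)"
        by (simp only: at_within_open[OF xO O'])
      have line: "((\<lambda>s. x + s *\<^sub>R b) has_derivative (\<lambda>s. s *\<^sub>R b)) (at (0::real))"
        by (auto intro!: derivative_eq_intros)
      have dx': "((\<lambda>y. u (y, t)) has_derivative (\<lambda>v. g z \<bullet> v)) (at (x + (0::real) *\<^sub>R b))"
        using dx by (simp only: scaleR_zero_left add_0_right)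
      have lin: "(\<lambda>s. g z \<bullet> (s *\<^sub>R b)) = (*) (g z \<bullet> b)"
        by (rule ext) (simp only: inner_scaleR_right mult.commute)
      have shift: "z + s *\<^sub>R (b, 0) = (x + s *\<^sub>R b, t)" for s by (simp add: z)
      have 1: "((\<lambda>s. u (z + s *\<^sub>R (b, 0))) has_real_derivative g z \<bullet> b) (at 0)"
        unfolding has_field_derivative_def shift lin[symmetric] by (rule has_derivative_compose[OF line dx'])
      have z0: "z + (0::real) *\<^sub>R (b, 0) = z" by (simp add: z)
      have eq: "u z * D z + (g z \<bullet> b) * \<psi> z = (g z \<bullet> b) * \<psi> z + D z * u z"
        by (simp add: add.commute mult.commute)
      show ?thesis
        unfolding eq unfolding D_def by (rule DERIV_mult[OF 1 C_k_directional[OF C1, of z "(b, 0)"], unfolded z0])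
    next
      case False
      have o: "open ((\<lambda>s. z + s *\<^sub>R (b, 0)) -` (- K))"
        using compact_imp_closed[OF K(1)] by (intro open_vimage continuous_intros) auto
      have "((\<lambda>s::real. 0::real) has_real_derivative 0) (at 0)" by simp
      then have d0: "((\<lambda>s. u (z + s *\<^sub>R (b, 0)) * \<psi> (z + s *\<^sub>R (b, 0))) has_real_derivative 0) (at 0)"
      proof (rule has_field_derivative_transform_within_open[OF _ o])
        show "(0::real) \<in> (\<lambda>s. z + s *\<^sub>R (b, 0)) -` (- K)" using False by (simp add: zero_prod_def[symmetric])
        show "0 = u (z + s *\<^sub>R (b, 0)) * \<psi> (z + s *\<^sub>R (b, 0))" if "s \<in> (\<lambda>s. z + s *\<^sub>R (b, 0)) -` (- K)" for s
          using K(3)[of "z + s *\<^sub>R (b, 0)"] that by simp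
      qed
      have eq: "u z * D z + (g z \<bullet> b) * \<psi> z = 0" using D0[OF False] K(3)[OF False] by simp
      show ?thesis unfolding eq by (rule d0)
    qed
  qed
  then show ?thesis using e2 e3 by (simp add: D_def)
qed

text \<open>The weak second derivatives are eliminated here: tested with \<phi>, they equal
  \<open>u\<close> tested with a second derivative of \<phi>, and one classical integration by parts
  leaves the gradient. Representatives are changed on null sets only.\<close>

lemma signorini_class_imp_signorini:
  fixes u f :: "'a::euclidean_space spacetime \<Rightarrow> real"
  assumes S: "signorini_class f u" and l: "l \<ge> 2"
    and fb: "AE z in lebesgue_on (half_cyl 1). \<bar>f z\<bar> \<le> M * par_norm z powr (l - 2)"
  shows "\<exists>w f' R. signorini u (grad_x u) w f' R M l"
proof -
  let ?U = "open_cyl :: 'a spacetime set" and ?g = "grad_x u"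
  note S' = S[unfolded signorini_class_def half_thin_eq]
  note class_f = S'[THEN conjunct1] and class_W = S'[THEN conjunct2, THEN conjunct1] and cu = S'[THEN conjunct2, THEN conjunct2, THEN conjunct2, THEN conjunct1]
    and class_d = S'[THEN conjunct2, THEN conjunct2, THEN conjunct2, THEN conjunct2, THEN conjunct1] and class_g = S'[THEN conjunct2, THEN conjunct2, THEN conjunct2, THEN conjunct2, THEN conjunct2, THEN conjunct1]
    and class_b = S'[THEN conjunct2, THEN conjunct2, THEN conjunct2, THEN conjunct2, THEN conjunct2, THEN conjunct2, THEN conjunct1]
    and class_h = S'[THEN conjunct2, THEN conjunct2, THEN conjunct2, THEN conjunct2, THEN conjunct2, THEN conjunct2, THEN conjunct2, THEN conjunct1]
    and class_t = S'[THEN conjunct2, THEN conjunct2, THEN conjunct2, THEN conjunct2, THEN conjunct2, THEN conjunct2, THEN conjunct2, THEN conjunct2, THEN conjunct1]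
  obtain \<alpha> where \<alpha>: "0 < \<alpha>" "par_holder \<alpha> space_cyl ?g"
    using class_g by (elim exE conjE)
  have cg: "continuous_on space_cyl ?g" by (rule par_holder_continuous[OF \<alpha>(2,1)])
  have d: "((\<lambda>y. u (y, snd z)) has_derivative (\<lambda>v. ?g z \<bullet> v)) (at (fst z) within closed_half_space)"
    if "z \<in> space_cyl" for z
  proof -
    from bspec[OF class_d that]
    have "(\<lambda>y. u (y, snd z)) differentiable (at (fst z) within closed_half_space)"
      by (simp only: case_prod_unfold)
    from grad_x_derivative[OF this] show ?thesis unfolding prod.collapse .
  qed
  from class_b obtain R where R0: "R > 0" "Ball {z \<in> space_cyl. u z \<noteq> 0} (\<lambda>z. norm z \<le> R)"
    unfolding bounded_pos by (elim exE conjE)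
  have R: "norm z \<le> R" if "z \<in> space_cyl" "u z \<noteq> 0" for z using bspec[OF R0(2), of z] that by (simp only: mem_Collect_eq simp_thms)
  have su: "u z = 0" if "z \<in> space_cyl" "R < norm (fst z)" for z
  proof (rule ccontr)
    assume "u z \<noteq> 0"
    then have "norm z \<le> R" by (rule R[OF that(1)])
    moreover have "norm (fst z) \<le> norm z" using norm_fst_le[of "fst z" "snd z"] by (simp only: prod.collapse)
    ultimately show False using that(2) by linarith
  qed
  have sg: "?g z = 0" if "z \<in> space_cyl" "R < norm (fst z)" for z
    by (rule gradient_zero_outside_support[OF cg d su that])
  have thin: "0 \<le> u z \<and> snd (?g z) \<le> 0 \<and> u z * snd (?g z) = 0" if "z \<in> space_cyl" "snd (fst z) = 0" for z
  proof -
    have "z \<in> thin_cyl 1" using that by (cases z) (auto simp: thin_cyl_def space_cyl_def)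
    from bspec[OF class_t this] show ?thesis by (simp add: d_n_def)
  qed
  have Ul: "?U \<in> sets lebesgue" using open_cyl_borel by simp

  obtain w0 where w0: "L2_on (half_cyl 1) w0" "weak_deriv ?U (0, 1) u w0"
    using class_W unfolding W21_2_def interior_half_cyl by blast
  have mf: "f \<in> borel_measurable (lebesgue_on (half_cyl 1))" and fi: "\<exists>B. AE z in lebesgue_on (half_cyl 1). \<bar>f z\<bar> \<le> B"
  proof -
    show "f \<in> borel_measurable (lebesgue_on (half_cyl 1))" "\<exists>B. AE z in lebesgue_on (half_cyl 1). \<bar>f z\<bar> \<le> B"
      using class_f by (simp_all only: Linf_on_def)
  qed
  obtain ut d2 where ut: "weak_deriv ?U (0, 1) u ut"
    and d2: "\<And>b. b \<in> Basis \<Longrightarrow> \<exists>v. weak_deriv ?U (b, 0) u v \<and> weak_deriv ?U (b, 0) v (d2 b)"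
    and heat: "AE z in lebesgue_on (half_cyl 1). (\<Sum>b\<in>Basis. d2 b z) - ut z = f z"
    using class_h unfolding heat_equation_on_def interior_half_cyl by blast
  have half_AE: "AE z in lebesgue. z \<in> half_cyl 1 \<longrightarrow> P z" if "AE z in lebesgue_on (half_cyl 1). P z" for P :: "'a spacetime \<Rightarrow> bool"
    using that half_cyl_lebesgue by (subst (asm) AE_restrict_space_iff) auto
  have sub: "z \<in> ?U \<Longrightarrow> z \<in> half_cyl 1" for z by (cases z) (auto simp: open_cyl_def half_cyl_def)

  show ?thesis
  proof (rule borel_representative[OF w0(1)[unfolded L2_on_def, THEN conjunct1]], rule borel_representative[OF mf])
    fix w f'
    assume w: "w \<in> borel_measurable borel" "\<And>z. z \<notin> ?U \<Longrightarrow> w z = 0"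
        "AE z in lebesgue. indicator ?U z * w0 z = w z" "(\<lambda>z. indicator ?U z * w0 z) \<in> borel_measurable lebesgue"
      and f': "f' \<in> borel_measurable borel" "\<And>z. z \<notin> ?U \<Longrightarrow> f' z = 0"
        "AE z in lebesgue. indicator ?U z * f z = f' z" "(\<lambda>z. indicator ?U z * f z) \<in> borel_measurable lebesgue"
    have w2: "integrable lborel (\<lambda>z. (w z)\<^sup>2)"
    proof -
      have mw2: "(\<lambda>z. (w z)\<^sup>2) \<in> borel_measurable lborel"
        using borel_measurable_power[OF w(1), of 2] by simp
      have "integrable (lebesgue_on (half_cyl 1)) (\<lambda>z. (w0 z)\<^sup>2)" using w0(1) by (simp add: L2_on_def)
      then have i: "integrable lebesgue (\<lambda>z. indicator (half_cyl 1) z *\<^sub>R (w0 z)\<^sup>2)"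
        using half_cyl_lebesgue by (subst (asm) integrable_restrict_space) auto
      have "integrable lebesgue (\<lambda>z. (w z)\<^sup>2)"
      proof (rule Bochner_Integration.integrable_bound[OF i])
        show "(\<lambda>z. (w z)\<^sup>2) \<in> borel_measurable lebesgue" by (rule measurable_completion[OF mw2])
        show "AE z in lebesgue. norm ((w z)\<^sup>2) \<le> norm (indicator (half_cyl 1) z *\<^sub>R (w0 z)\<^sup>2)"
          using w(3)
        proof eventually_elim
          case (elim z)
          show ?case
          proof (cases "z \<in> ?U")
            case True
            then show ?thesis using elim sub[OF True] by simp
          qed (simp add: w(2))
        qed
      qed
      then show ?thesis unfolding integrable_completion[OF mw2] .
    qed
    have f2: "AE z in lborel. (f' z)\<^sup>2 \<le> M\<^sup>2 * ((norm (fst z))\<^sup>2 + \<bar>snd z\<bar>) powr (l - 2)"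
    proof -
      have "AE z in lebesgue. (f' z)\<^sup>2 \<le> M\<^sup>2 * ((norm (fst z))\<^sup>2 + \<bar>snd z\<bar>) powr (l - 2)"
        using half_AE[OF fb] f'(3)
      proof eventually_elim
        case (elim z)
        show ?case
        proof (cases "z \<in> ?U")
          case True
          define s where "s = (norm (fst z))\<^sup>2 + \<bar>snd z\<bar>"
          have "\<bar>snd z\<bar> > 0" using True by (auto simp: open_cyl_def)
          then have s: "s > 0" using zero_le_power2[of "norm (fst z)"] unfolding s_def by linarith
          have fz: "f z = f' z" using elim(2) True by simp
          have "par_norm z = s powr (1 / 2)"
            using s unfolding powr_half_sqrt[OF less_imp_le[OF s]] by (simp only: par_norm_def s_def)
          then have "par_norm z powr (l - 2) = s powr ((l - 2) / 2)" by (simp add: powr_powr)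
          then have "\<bar>f' z\<bar> \<le> M * s powr ((l - 2) / 2)" using elim(1) sub[OF True] fz by simp
          then have "\<bar>f' z\<bar>\<^sup>2 \<le> (M * s powr ((l - 2) / 2))\<^sup>2" by (rule power_mono) simp
          also have "\<dots> = M\<^sup>2 * s powr (l - 2)"
          proof -
            have "(s powr ((l - 2) / 2))\<^sup>2 = s powr (l - 2)"
              by (simp only: power2_eq_square powr_add[symmetric] field_sum_of_halves)
            then show ?thesis by (simp only: power_mult_distrib)
          qed
          finally show ?thesis by (simp add: s_def)
        qed (simp add: f'(2))
      qed
      then show ?thesis by (simp add: AE_completion_iff)
    qed
    have fi': "integrable lborel (\<lambda>z. f' z * \<phi> z)" if \<phi>: "test_function ?U \<phi>" for \<phi>
    proof (rule test_functionD[OF \<phi>])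
      fix K :: "'a spacetime set" assume K: "compact K" "K \<subseteq> ?U" "\<And>z. z \<notin> K \<Longrightarrow> \<phi> z = 0"
      note c = continuous_test_functions(1)[OF \<phi>]
      have i: "integrable lborel \<phi>" by (rule integrable_compact_support[OF c K(1,3)])
      obtain B where B: "AE z in lebesgue_on (half_cyl 1). \<bar>f z\<bar> \<le> B" using fi by blast
      have "AE z in lebesgue. \<bar>f' z\<bar> \<le> \<bar>B\<bar>"
        using half_AE[OF B] f'(3)
      proof eventually_elim
        case (elim z)
        show ?case
        proof (cases "z \<in> ?U")
          case True
          then have "f' z = f z" using elim(2) by simp
          moreover have "\<bar>f z\<bar> \<le> B" using elim(1) sub[OF True] by blast
          ultimately show ?thesis by simp
        qed (simp add: f'(2))
      qed
      then have AE: "AE z in lborel. \<bar>f' z\<bar> \<le> \<bar>B\<bar>" by (simp add: AE_completion_iff)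
      show "integrable lborel (\<lambda>z. f' z * \<phi> z)"
      proof (rule Bochner_Integration.integrable_bound)
        show "integrable lborel (\<lambda>z. \<bar>B\<bar> * \<phi> z)" using i by simp
        show "(\<lambda>z. f' z * \<phi> z) \<in> borel_measurable lborel" using f'(1) i by (intro borel_measurable_times) auto
        show "AE z in lborel. norm (f' z * \<phi> z) \<le> norm (\<bar>B\<bar> * \<phi> z)"
          using AE by eventually_elim (simp add: abs_mult mult_right_mono)
      qed
    qed
    have wi: "integrable lborel (\<lambda>z. w z * \<phi> z)" if \<phi>: "test_function ?U \<phi>" for \<phi>
    proof (rule test_functionD[OF \<phi>])
      fix K :: "'a spacetime set" assume K: "compact K" "K \<subseteq> ?U" "\<And>z. z \<notin> K \<Longrightarrow> \<phi> z = 0"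
      note c = continuous_test_functions(1)[OF \<phi>]
      have "integrable lborel (\<lambda>z. (\<phi> z)\<^sup>2)"
        by (rule integrable_compact_support[OF _ K(1)]) (auto intro!: continuous_intros c simp: K(3))
      then show "integrable lborel (\<lambda>z. w z * \<phi> z)"
        using w(1) w2 borel_measurable_continuous_onI[OF c] by (intro integrable_sq_diff(2)) auto
    qed
    have uint: "(LINT z:?U|lebesgue. u z * F z) = (LINT z|lborel. u z * F z)"
      if F: "F \<in> borel_measurable borel" "\<And>z. z \<notin> ?U \<Longrightarrow> F z = 0" for F
    proof -
      have "(\<lambda>z. indicator ?U z *\<^sub>R u z) \<in> borel_measurable borel"
        by (rule borel_measurable_continuous_on_indicator[OF _ continuous_on_subset[OF cu open_cyl_subset]]) simp
      then have m: "(\<lambda>z. indicator ?U z * u z) \<in> borel_measurable borel" by simp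
      have "(LINT z:?U|lebesgue. u z * F z) = (LINT z|lborel. indicator ?U z * u z * F z)"
        by (rule representative_integral[OF m _ _ F(1)]) (use m in \<open>auto simp: measurable_completion\<close>)
      also have "(\<lambda>z. indicator ?U z * u z * F z) = (\<lambda>z. u z * F z)"
        using F(2) by (auto simp: indicator_def fun_eq_iff)
      finally show ?thesis .
    qed
    have deriv_meas: "(\<lambda>z. frechet_derivative \<phi> (at z) c) \<in> borel_measurable borel"
        "\<And>z. z \<notin> ?U \<Longrightarrow> frechet_derivative \<phi> (at z) c = 0"
      if \<phi>: "test_function ?U \<phi>" and c: "c \<in> Basis" for \<phi> c
    proof -
      show "(\<lambda>z. frechet_derivative \<phi> (at z) c) \<in> borel_measurable borel"
        by (rule borel_measurable_continuous_onI[OF continuous_test_functions(2)[OF \<phi> c]])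
      fix z assume "z \<notin> ?U"
      then show "frechet_derivative \<phi> (at z) c = 0"
        using test_functionD[OF test_function_deriv[OF \<phi> c]] by (metis subsetD)
    qed
    have Bt: "(0, 1) \<in> (Basis :: 'a spacetime set)" by (simp add: Basis_prod_def)
    have test_meas: "\<phi> \<in> borel_measurable borel" if "test_function ?U \<phi>" for \<phi>
      by (rule borel_measurable_continuous_onI[OF continuous_test_functions(1)[OF that]])
    have weak_t: "(LINT z|lborel. u z * frechet_derivative \<phi> (at z) (0, 1)) = - (LINT z|lborel. w z * \<phi> z)"
      if \<phi>: "test_function ?U \<phi>" for \<phi>
    proof -
      have "(LINT z:?U|lebesgue. u z * frechet_derivative \<phi> (at z) (0, 1)) = - (LINT z:?U|lebesgue. w0 z * \<phi> z)"
        using w0(2) \<phi> unfolding weak_deriv_def by blast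
      moreover have "(LINT z:?U|lebesgue. u z * frechet_derivative \<phi> (at z) (0, 1))
          = (LINT z|lborel. u z * frechet_derivative \<phi> (at z) (0, 1))"
        by (rule uint[OF deriv_meas[OF \<phi> Bt]])
      ultimately show ?thesis
        by (simp only: representative_integral[OF w(1,3,4) test_meas[OF \<phi>]])
    qed
    have weak_x: "(\<Sum>b\<in>Basis. LINT z|lborel. (?g z \<bullet> b) * frechet_derivative \<phi> (at z) (b, 0))
        = - (LINT z|lborel. (w z + f' z) * \<phi> z)" if \<phi>: "test_function ?U \<phi>" for \<phi>
    proof -
      have d2_eq: "(LINT z:?U|lebesgue. d2 b z * \<phi> z) = - (LINT z|lborel. (?g z \<bullet> b) * frechet_derivative \<phi> (at z) (b, 0))"
        "locally_integrable_on ?U (d2 b)" if b: "b \<in> Basis" for b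
      proof -
        obtain v where v: "weak_deriv ?U (b, 0) u v" "weak_deriv ?U (b, 0) v (d2 b)" using d2[OF b] by blast
        show "locally_integrable_on ?U (d2 b)" using v(2) by (simp add: weak_deriv_def)
        have B: "(b, 0) \<in> (Basis :: 'a spacetime set)" using b by (subst Basis_prod_def) auto
        define \<psi> where "\<psi> z = frechet_derivative \<phi> (at z) (b, 0)" for z
        have \<psi>: "test_function ?U \<psi>" unfolding \<psi>_def by (rule test_function_deriv[OF \<phi> B])
        have 1: "(LINT z:?U|lebesgue. v z * \<psi> z) = - (LINT z:?U|lebesgue. d2 b z * \<phi> z)"
          using v(2) \<phi> unfolding weak_deriv_def \<psi>_def by blast
        have 2: "(LINT z:?U|lebesgue. u z * frechet_derivative \<psi> (at z) (b, 0)) = - (LINT z:?U|lebesgue. v z * \<psi> z)"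
          using v(1) \<psi> unfolding weak_deriv_def by blast
        have 3: "(LINT z:?U|lebesgue. u z * frechet_derivative \<psi> (at z) (b, 0)) = - (LINT z|lborel. (?g z \<bullet> b) * \<psi> z)"
          by (rule trans[OF uint[OF deriv_meas[OF \<psi> B]] classical_integration_by_parts[OF cu cg d \<psi> b]])
        show "(LINT z:?U|lebesgue. d2 b z * \<phi> z) = - (LINT z|lborel. (?g z \<bullet> b) * frechet_derivative \<phi> (at z) (b, 0))"
          using 1 2 3 by (simp add: \<psi>_def)
      qed
      \<comment> \<open>The equation and the Sobolev class each supply a weak time derivative,
        \<open>ut\<close> and \<open>w0\<close>; against \<phi> both give minus the integral of
        \<open>u\<close> with the time derivative of \<phi>, so they agree when tested.\<close>
      have ut_eq: "(LINT z:?U|lebesgue. ut z * \<phi> z) = (LINT z|lborel. w z * \<phi> z)"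
      proof -
        have "(LINT z:?U|lebesgue. u z * frechet_derivative \<phi> (at z) (0, 1)) = - (LINT z:?U|lebesgue. ut z * \<phi> z)"
          using ut \<phi> unfolding weak_deriv_def by blast
        moreover have "(LINT z:?U|lebesgue. u z * frechet_derivative \<phi> (at z) (0, 1))
            = (LINT z|lborel. u z * frechet_derivative \<phi> (at z) (0, 1))"
          by (rule uint[OF deriv_meas[OF \<phi> Bt]])
        ultimately show ?thesis using weak_t[OF \<phi>] by linarith
      qed
      have li: "locally_integrable_on ?U ut" using ut by (simp add: weak_deriv_def)
      note i_ut = locally_integrable_mult_test[OF li Ul \<phi>]
      note i_d2 = locally_integrable_mult_test[OF d2_eq(2) Ul \<phi>]
      have "(LINT z:?U|lebesgue. f z * \<phi> z) = (LINT z|lebesgue. (\<Sum>b\<in>Basis. indicator ?U z *\<^sub>R (d2 b z * \<phi> z)) - indicator ?U z *\<^sub>R (ut z * \<phi> z))"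
        unfolding set_lebesgue_integral_def
      proof (rule integral_cong_AE)
        have "\<phi> \<in> borel_measurable lebesgue" using test_meas[OF \<phi>] by (simp add: measurable_completion)
        with f'(4) have "(\<lambda>z. (indicator ?U z * f z) * \<phi> z) \<in> borel_measurable lebesgue" by (rule borel_measurable_times)
        then show "(\<lambda>z. indicator ?U z *\<^sub>R (f z * \<phi> z)) \<in> borel_measurable lebesgue" by (simp add: mult.assoc)
        show "(\<lambda>z. (\<Sum>b\<in>Basis. indicator ?U z *\<^sub>R (d2 b z * \<phi> z)) - indicator ?U z *\<^sub>R (ut z * \<phi> z)) \<in> borel_measurable lebesgue"
          using i_ut i_d2 unfolding set_integrable_def
          by (intro borel_measurable_integrable Bochner_Integration.integrable_diff Bochner_Integration.integrable_sum)
        show "AE z in lebesgue. indicator ?U z *\<^sub>R (f z * \<phi> z)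
            = (\<Sum>b\<in>Basis. indicator ?U z *\<^sub>R (d2 b z * \<phi> z)) - indicator ?U z *\<^sub>R (ut z * \<phi> z)"
          using half_AE[OF heat]
        proof eventually_elim
          case (elim z)
          show ?case
          proof (cases "z \<in> ?U")
            case True
            then have "f z = (\<Sum>b\<in>Basis. d2 b z) - ut z" using elim sub[OF True] by simp
            then show ?thesis using True by (simp add: left_diff_distrib sum_distrib_right)
          qed simp
        qed
      qed
      also have "\<dots> = (\<Sum>b\<in>Basis. LINT z:?U|lebesgue. d2 b z * \<phi> z) - (LINT z:?U|lebesgue. ut z * \<phi> z)"
        unfolding set_lebesgue_integral_def
        by (subst Bochner_Integration.integral_diff[OF Bochner_Integration.integrable_sum[OF i_d2[unfolded set_integrable_def]]
              i_ut[unfolded set_integrable_def]], assumption)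
           (simp only: Bochner_Integration.integral_sum[OF i_d2[unfolded set_integrable_def]])
      also have "\<dots> = - (\<Sum>b\<in>Basis. LINT z|lborel. (?g z \<bullet> b) * frechet_derivative \<phi> (at z) (b, 0)) - (LINT z|lborel. w z * \<phi> z)"
        by (simp add: d2_eq(1) ut_eq sum_negf)
      finally have eq: "(LINT z|lborel. f' z * \<phi> z)
        = - (\<Sum>b\<in>Basis. LINT z|lborel. (?g z \<bullet> b) * frechet_derivative \<phi> (at z) (b, 0)) - (LINT z|lborel. w z * \<phi> z)"
        by (simp only: representative_integral[OF f'(1,3,4) test_meas[OF \<phi>]])
      have "(LINT z|lborel. (w z + f' z) * \<phi> z) = (LINT z|lborel. w z * \<phi> z) + (LINT z|lborel. f' z * \<phi> z)"
        using wi[OF \<phi>] fi'[OF \<phi>] by (simp add: distrib_right)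
      then show ?thesis using eq by simp
    qed
    have "signorini u ?g w f' R M l"
    proof
      show "continuous_on space_cyl u" by (rule cu)
      show "continuous_on space_cyl ?g" by (rule cg)
      show "((\<lambda>y. u (y, snd z)) has_derivative (\<lambda>v. ?g z \<bullet> v)) (at (fst z) within closed_half_space)"
        if "z \<in> space_cyl" for z by (rule d[OF that])
      show "u z = 0 \<and> ?g z = 0" if "z \<in> space_cyl" "R < norm (fst z)" for z
        by (rule conjI[OF su[OF that] sg[OF that]])
      show "0 \<le> u z \<and> snd (?g z) \<le> 0 \<and> u z * snd (?g z) = 0" if "z \<in> space_cyl" "snd (fst z) = 0" for z
        by (rule thin[OF that])
    qed (fact R0(1) w f' w2 f2 l weak_t weak_x)+
    then show ?thesis by blast
  qed
qed

theorem theorem13p1: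
  fixes \<sigma> l M :: real
  assumes "l \<ge> 2" and "\<sigma> > 0"
  shows "\<exists>C>0. \<forall>(\<kappa>::real) (f :: (real ^ 'm) spacetime \<Rightarrow> real) u.
           0 < \<kappa> \<and> \<kappa> < l \<and> \<sigma> < l - \<kappa> \<and>
           signorini_class f u \<and>
           (AE z in lebesgue_on (half_cyl 1). \<bar>f z\<bar> \<le> M * par_norm z powr (l - 2)) \<longrightarrow>
           (\<forall>r\<in>{0<..<1}. weiss \<kappa> u r = 1 / r powr (2 * \<kappa>) * (I_fun u r - \<kappa> / 2 * H_fun u r)) \<and>
           (AE r in lebesgue_on {0<..<1}. \<exists>D. (weiss \<kappa> u has_real_derivative D) (at r) \<and>
              D \<ge> - C * r powr (2 * \<sigma> - 1)) \<and>
           mono_on {0<..<1} (\<lambda>r. weiss \<kappa> u r + C * r powr (2 * \<sigma>))"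
proof -
  \<comment> \<open>Fixed before \<kappa>, \<open>f\<close> and \<open>u\<close> are introduced: it
    depends on \<open>M\<close>, \<open>l\<close> and the dimension only.\<close>
  define c where "c = M\<^sup>2 * (LINT x::(real ^ 'm) \<times> real|lborel. moment_density l x 1)"
  \<comment> \<open>One constant for both conclusions: the derivative bound asks for C \<ge> c,
    monotonicity for C \<ge> c / (2 \<sigma>), and the 1 keeps C positive when c = 0.\<close>
  define C where "C = c + c / (2 * \<sigma>) + 1"
  have c: "c \<ge> 0"
    unfolding c_def by (intro mult_nonneg_nonneg integral_nonneg_AE) (auto simp: moment_density_nonneg)
  have "0 \<le> c / (2 * \<sigma>)" using c assms(2) by simp
  then have C: "C > 0" "c \<le> C" "c / (2 * \<sigma>) \<le> C" using c by (auto simp: C_def)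
  show ?thesis
  proof (intro exI[of _ C] conjI allI impI C(1))
    fix \<kappa> :: real and f u :: "(real ^ 'm) spacetime \<Rightarrow> real"
    assume A: "0 < \<kappa> \<and> \<kappa> < l \<and> \<sigma> < l - \<kappa> \<and> signorini_class f u \<and>
      (AE z in lebesgue_on (half_cyl 1). \<bar>f z\<bar> \<le> M * par_norm z powr (l - 2))"
    then have \<kappa>: "0 < \<kappa>" "\<sigma> < l - \<kappa>" by auto
    obtain w f' R where "signorini u (grad_x u) w f' R M l"
      using signorini_class_imp_signorini[OF _ assms(1)] A by blast
    then interpret signorini u "grad_x u" w f' R M l .
    have W: "weiss \<kappa> u = energy \<kappa>" by (simp add: weiss_def energy_def fun_eq_iff)
    show "\<forall>r\<in>{0<..<1}. weiss \<kappa> u r = 1 / r powr (2 * \<kappa>) * (I_fun u r - \<kappa> / 2 * H_fun u r)"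
      unfolding W I_fun_def H_fun_def using energy_split by auto
    \<comment> \<open>The derivative exists and obeys the bound at every r in (0, 1), so the
      exceptional set is empty.\<close>
    show "AE r in lebesgue_on {0<..<1}. \<exists>D. (weiss \<kappa> u has_real_derivative D) (at r) \<and> D \<ge> - C * r powr (2 * \<sigma> - 1)"
    proof (rule AE_I2)
      fix r :: real assume "r \<in> space (lebesgue_on {0<..<1})"
      then have "0 < r" "r < 1" by auto
      then show "\<exists>D. (weiss \<kappa> u has_real_derivative D) (at r) \<and> D \<ge> - C * r powr (2 * \<sigma> - 1)"
        unfolding W by (rule energy_derivative_bound[OF \<kappa>(1) assms(2) \<kappa>(2)]) (use C(2) in \<open>simp add: c_def\<close>)
    qed
    show "mono_on {0<..<1} (\<lambda>r. weiss \<kappa> u r + C * r powr (2 * \<sigma>))"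
      unfolding W
      by (rule mono_onI, rule energy_almost_increasing[OF \<kappa>(1) assms(2) \<kappa>(2)]) (use C(3) in \<open>auto simp: c_def\<close>)
  qed
qed

end
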